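(* Let $(X_n)_{n=0}^\infty$ be a sequence of pairwise disjoint compact sets in $\mathbb{C}$ with $\inf\{|z| : z\in X_n\}\to\infty$ as $n\to\infty$, and let $(C_n)_{n=0}^{\infty}$ be a sequence of finite sets $C_n\subseteq X_n$. Let $\varphi$ be a holomorphic function defined on a neighbourhood of $X:=\bigcup_{n=0}^\infty X_n$ such that $\varphi(X_{n-1})\subseteq X_n$ and $\varphi(\partial X_{n-1})\subseteq \partial X_n$ for all $n\geq 1$. Let $(\varepsilon_n)_{n=0}^\infty$ be a sequence of positive numbers. Then there exist a transcendental meromorphic function $f$, a $\mathcal{C}^{\infty}$ diffeomorphism $\theta\colon\mathbb{C}\to\mathbb{C}$ and a sequence $(k_n)_{n=0}^\infty$ of positive integers such that (a) $f^{k_n}\circ\theta=\theta\circ\varphi$ on $X_n$ for all $n\geq 0$; (b) $|\theta(z)-z|\leq\varepsilon_n$ on $X_n$ for all $n\geq 0$; (c) $\partial\theta(X)\subseteq J(f)$; (d) $\theta$ satisfies the Cauchy--Riemann equations on $X$; in particular, it is conformal on $\operatorname{int}(X)$; (e) $\theta(c)=c$ for $c\in\bigcup_{n=0}^\infty C_n$; (f) the set $f(\theta(X))$ is bounded. In particular, $\theta(X)\subseteq BU(f)$ and each $\theta(X_n)$ is a wandering compact set of $f$.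
   Context: Boundaries and closures are taken in $\mathbb{C}$. A transcendental meromorphic function is a meromorphic function $f\colon\mathbb{C}\to\widehat{\mathbb{C}}$ for which $\infty$ is an essential singularity (i.e. which is not rational). The Fatou set $F(f)$ is the set of points having a neighbourhood on which all iterates $f^n$ are defined and form a normal family; the Julia set is $J(f)=\mathbb{C}\setminus F(f)$. The bungee set is $BU(f)=\{z\in\mathbb{C}: \liminf_{n\to\infty}|f^n(z)|<\infty=\limsup_{n\to\infty}|f^n(z)|\}$. A compact set $K\subseteq\mathbb{C}$ is a wandering compact set of $f$ if $\partial K\subseteq J(f)$ and $f^n(K)\cap f^m(K)=\emptyset$ for all $n\neq m$.
   Formalization: Adds the hypothesis that φ is not constant near any non-isolated point of X; without it the claim fails (e.g. X_n disjoint closed discs, φ constant near each X_n with value in ∂X_{n+1}), since (a) would force an iterate of f to be locally constant. *)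

theory Defs
  imports "HOL-Complex_Analysis.Complex_Analysis"
begin

text \<open>
  A meromorphic function from \<open>\<complex>\<close> to the Riemann sphere is represented by a function
  \<open>f :: complex \<Rightarrow> complex\<close> that is nicely meromorphic on the whole plane. Its value in the sphere
  is \<open>\<infinity>\<close> exactly at the points satisfying \<^term>\<open>is_pole f\<close>; there the library convention
  \<open>f z = 0\<close> is a dummy value and must never be read as a value of the meromorphic function.
\<close>

definition rational_function :: "(complex \<Rightarrow> complex) \<Rightarrow> bool" where
  "rational_function f \<longleftrightarrow>
     (\<exists>p q. q \<noteq> 0 \<and> (\<forall>z. poly q z \<noteq> 0 \<longrightarrow> f z = poly p z / poly q z))"

definition transcendental_meromorphic :: "(complex \<Rightarrow> complex) \<Rightarrow> bool" where
  "transcendental_meromorphic f \<longleftrightarrow> f nicely_meromorphic_on UNIV \<and> \<not> rational_function f"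

text \<open>
  The \<open>n\<close>-th iterate takes a finite value at \<open>z\<close> iff none of \<open>z, f z, \<dots>, f\<^bsup>n-1\<^esup> z\<close> is a pole. In
  that case its value is \<^term>\<open>(f ^^ n) z\<close>. As \<open>f\<close> is not defined at \<open>\<infinity>\<close>, all iterates
  are defined at \<open>z\<close> iff all of them are finite there.
\<close>

definition iterate_finite :: "(complex \<Rightarrow> complex) \<Rightarrow> nat \<Rightarrow> complex \<Rightarrow> bool" where
  "iterate_finite f n z \<longleftrightarrow> (\<forall>j<n. \<not> is_pole f ((f ^^ j) z))"

definition all_iterates_defined :: "(complex \<Rightarrow> complex) \<Rightarrow> complex \<Rightarrow> bool" where
  "all_iterates_defined f z \<longleftrightarrow> (\<forall>n. iterate_finite f n z)"

text \<open>
  The inverse stereographic projection onto the unit sphere of \<open>\<complex> \<times> \<real>\<close>, whose north pole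
  \<open>(0, 1)\<close> corresponds to \<open>\<infinity>\<close>. The distance of two projected points is their chordal distance.
\<close>

definition to_sphere :: "complex \<Rightarrow> complex \<times> real" where
  "to_sphere z = ((2 / (1 + (cmod z)\<^sup>2)) *\<^sub>R z, ((cmod z)\<^sup>2 - 1) / ((cmod z)\<^sup>2 + 1))"

text \<open>
  Normality with respect to the spherical metric, for families of functions without poles on the
  open set \<open>U\<close>. The limit \<open>h\<close> automatically takes values in the unit sphere; in particular
  locally uniform convergence to \<open>\<infinity>\<close> is allowed.
\<close>

definition normal_family :: "complex set \<Rightarrow> (complex \<Rightarrow> complex) set \<Rightarrow> bool" where
  "normal_family U F \<longleftrightarrow>
     (\<forall>g :: nat \<Rightarrow> complex \<Rightarrow> complex. range g \<subseteq> F \<longrightarrow>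
        (\<exists>(r :: nat \<Rightarrow> nat) h. strict_mono r \<and>
           (\<forall>K. compact K \<and> K \<subseteq> U \<longrightarrow>
              uniform_limit K (\<lambda>n z. to_sphere (g (r n) z)) h sequentially)))"

definition Fatou_set :: "(complex \<Rightarrow> complex) \<Rightarrow> complex set" where
  "Fatou_set f = {z. \<exists>U. open U \<and> z \<in> U \<and> (\<forall>w\<in>U. all_iterates_defined f w) \<and>
                        normal_family U (range (\<lambda>n. f ^^ n))}"

definition Julia_set :: "(complex \<Rightarrow> complex) \<Rightarrow> complex set" where
  "Julia_set f = - Fatou_set f"

definition bungee_set :: "(complex \<Rightarrow> complex) \<Rightarrow> complex set" where
  "bungee_set f = {z. all_iterates_defined f z \<and>
       liminf (\<lambda>n. ereal (cmod ((f ^^ n) z))) < \<infinity> \<and>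
       limsup (\<lambda>n. ereal (cmod ((f ^^ n) z))) = \<infinity>}"

definition wandering_compact_set :: "(complex \<Rightarrow> complex) \<Rightarrow> complex set \<Rightarrow> bool" where
  "wandering_compact_set f K \<longleftrightarrow>
     compact K \<and> frontier K \<subseteq> Julia_set f \<and>
     (\<forall>z\<in>K. all_iterates_defined f z) \<and>
     (\<forall>n m. n \<noteq> m \<longrightarrow> (f ^^ n) ` K \<inter> (f ^^ m) ` K = {})"

text \<open>Real smoothness: directional derivatives of all orders exist and are continuous.\<close>

primrec C_k :: "nat \<Rightarrow> (complex \<Rightarrow> complex) \<Rightarrow> bool" where
  "C_k 0 g \<longleftrightarrow> continuous_on UNIV g"
| "C_k (Suc k) g \<longleftrightarrow> (\<forall>z. g differentiable at z) \<and>
      (\<forall>v. C_k k (\<lambda>z. frechet_derivative g (at z) v))"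

definition C_infinity :: "(complex \<Rightarrow> complex) \<Rightarrow> bool" where
  "C_infinity g \<longleftrightarrow> (\<forall>k. C_k k g)"

definition smooth_diffeomorphism :: "(complex \<Rightarrow> complex) \<Rightarrow> bool" where
  "smooth_diffeomorphism g \<longleftrightarrow> bij g \<and> C_infinity g \<and> C_infinity (inv g)"

text \<open>
  With \<open>g = u + iv\<close>: \<open>u\<^sub>x = v\<^sub>y\<close> and \<open>u\<^sub>y = - v\<^sub>x\<close>; the vectors \<open>1\<close> and \<open>\<i>\<close> are the
  \<open>x\<close>- and \<open>y\<close>-directions.
\<close>

definition Cauchy_Riemann_at :: "(complex \<Rightarrow> complex) \<Rightarrow> complex \<Rightarrow> bool" where
  "Cauchy_Riemann_at g z \<longleftrightarrow> g differentiable at z \<and>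
     Re (frechet_derivative g (at z) 1) = Im (frechet_derivative g (at z) \<i>) \<and>
     Re (frechet_derivative g (at z) \<i>) = - Im (frechet_derivative g (at z) 1)"

definition conformal_on :: "(complex \<Rightarrow> complex) \<Rightarrow> complex set \<Rightarrow> bool" where
  "conformal_on g S \<longleftrightarrow> g holomorphic_on S \<and> inj_on g S \<and> (\<forall>z\<in>S. deriv g z \<noteq> 0)"

text \<open>
  The holomorphic map \<open>\<phi>\<close> to be realised must be non-constant in the following sense at each
  non-isolated point \<open>x\<close> of \<open>X\<close>. If \<open>\<phi>\<close> were constant near \<open>x\<close>, then
  \<open>f\<^bsup>k\<^esup> \<circ> \<theta> = \<theta> \<circ> \<phi>\<close> would force the meromorphic iterate \<open>f\<^bsup>k\<^esup>\<close> to be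
  constant near \<open>\<theta> x\<close>, which is impossible for transcendental \<open>f\<close>. At isolated points of \<open>X\<close>
  nothing needs to be assumed.
\<close>

definition nonconstant_near :: "(complex \<Rightarrow> complex) \<Rightarrow> complex \<Rightarrow> bool" where
  "nonconstant_near g x \<longleftrightarrow> \<not> (\<forall>\<^sub>F z in nhds x. g z = g x)"

end

theory Submission
  imports Defs
begin

text \<open>
  Each point of \<open>X n\<close> is to reach \<open>X (Suc n)\<close> after three steps: first into a small disc about a pole
  \<open>p\<close>, then by \<open>1 / (z - p)\<close> into a disc about a far away point \<open>e n\<close>, and from there to the position
  prescribed by \<open>\<phi>\<close>. Rational approximation produces maps with this behaviour up to a small error on
  finitely many of the sets. The error is absorbed by moving the points of \<open>X n\<close>, i.e. by a
  holomorphic perturbation of the identity near \<open>X n\<close> that is cut off smoothly. Finding it means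
  solving \<open>\<phi> \<circ> \<xi> = \<psi>\<close> for \<open>\<psi>\<close> close to \<open>\<phi>\<close>, which is possible in the presence of critical points
  of \<open>\<phi>\<close> if the error vanishes there to high order, so the approximation also interpolates. At each
  step a pole is placed on the orbit of a point close to a prescribed boundary point, so that all
  boundary points lie in the Julia set of the limit function.
\<close>

section \<open>Rational approximation with interpolation\<close>

text \<open>Boundedness of \<open>f\<close> on \<theta>(X) forces the detour: the first step must
  bring all \<open>X n\<close> into one bounded region, where their images accumulate, and no
  approximation on a compact set could prescribe the map on all these images. So nothing is
  prescribed in the disc about \<open>p\<close>. There the map stays \<open>1 / (z - p)\<close> plus
  a small holomorphic term, and the first step is an affine contraction to a spot which this map
  already sends close to \<open>e n\<close>. The discs about the \<open>e n\<close> are disjoint and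
  escape to infinity, so the third step can be chosen freely on each: it undoes the first two and
  applies \<phi>. Poles witness the Julia set because all iterates are defined near a point of the
  Fatou set; non-normality never has to be shown directly. A pole must survive all later changes of
  the map, hence the orbit leading to it is frozen: later increments vanish on it. A change at stage
  \<open>N\<close> also disturbs the conjugacy on the earlier sets, so the correction runs backwards
  from \<open>X N\<close> to \<open>X 0\<close>; its size in order \<open>N\<close> is at most
  \<open>(1/2)^N\<close>, which makes the limit smooth.\<close>

definition fin_mero :: "(complex \<Rightarrow> complex) \<Rightarrow> complex set \<Rightarrow> bool" where
  "fin_mero r D \<longleftrightarrow> finite D \<and> r holomorphic_on - D \<and> r meromorphic_on UNIV"

lemma fin_mero_add:
  "fin_mero r D \<Longrightarrow> fin_mero s E \<Longrightarrow> fin_mero (\<lambda>z. r z + s z) (D \<union> E)"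
  unfolding fin_mero_def
  by (auto intro!: holomorphic_intros meromorphic_intros elim: holomorphic_on_subset)

lemma fin_mero_mult:
  "fin_mero r D \<Longrightarrow> fin_mero s E \<Longrightarrow> fin_mero (\<lambda>z. r z * s z) (D \<union> E)"
  unfolding fin_mero_def
  by (auto intro!: holomorphic_intros meromorphic_intros elim: holomorphic_on_subset)

lemma fin_mero_entire: "r holomorphic_on UNIV \<Longrightarrow> fin_mero r {}"
  unfolding fin_mero_def
  by (auto intro!: analytic_on_imp_meromorphic_on simp: analytic_on_open)

lemma fin_mero_const: "fin_mero (\<lambda>z. c) {}"
  by (intro fin_mero_entire) auto

lemma fin_mero_pole: "fin_mero (\<lambda>z. c / (z - a)) {a}"
  unfolding fin_mero_def
  by (auto intro!: holomorphic_intros meromorphic_intros)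

text \<open>Approximation by Riemann sums: on a short piece the integrand is nearly constant in the
  integration variable, uniformly for \<open>z\<close> in \<open>K\<close>, and a frozen integrand
  is a simple pole on the segment.\<close>

lemma segment_approx:
  assumes g: "continuous_on (closed_segment a b) g" and K: "compact K"
    and disj: "closed_segment a b \<inter> K = {}" and e: "\<epsilon> > 0"
  shows "\<exists>r D. fin_mero r D \<and> D \<subseteq> closed_segment a b \<and>
     (\<forall>z\<in>K. norm (contour_integral (linepath a b) (\<lambda>\<zeta>. g \<zeta> / (\<zeta> - z)) - r z) \<le> \<epsilon>)"
proof -
  define \<gamma> where "\<gamma> = linepath a b"
  define F where "F = (\<lambda>t z. g (\<gamma> t) / (\<gamma> t - z) * (b - a))"
  have \<gamma>: "\<gamma> t \<in> closed_segment a b" if "t \<in> {0..1}" for t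
    using that unfolding \<gamma>_def path_image_linepath[symmetric] path_image_def by blast
  have cont\<gamma>: "continuous_on {0..1} \<gamma>" unfolding \<gamma>_def by (rule continuous_on_linepath)
  have contg: "continuous_on {0..1} (g \<circ> \<gamma>)"
    using \<gamma> by (intro continuous_on_compose cont\<gamma> continuous_on_subset[OF g]) auto
  have contF2: "continuous_on ({0..1} \<times> K) (\<lambda>x. F (fst x) (snd x))"
  proof -
    have 1: "continuous_on ({0..1} \<times> K) (\<lambda>x. \<gamma> (fst x))"
      by (rule continuous_on_compose2[OF cont\<gamma>]) (auto intro!: continuous_intros)
    have 2: "continuous_on ({0..1} \<times> K) (\<lambda>x. g (\<gamma> (fst x)))"
      by (rule continuous_on_compose2[OF g 1]) (use \<gamma> in auto)
    show ?thesis unfolding F_def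
      by (intro continuous_intros 1 2) (use \<gamma> disj in \<open>force\<close>)
  qed
  have contF: "continuous_on {0..1} (\<lambda>t. F t z)" if "z \<in> K" for z
    by (rule continuous_on_compose2[OF contF2, of "{0..1}" "\<lambda>t. (t, z)", simplified])
       (use that in \<open>auto intro!: continuous_intros\<close>)
  have uc: "uniformly_continuous_on ({0..1} \<times> K) (\<lambda>x. F (fst x) (snd x))"
    by (intro compact_uniformly_continuous contF2 compact_Times K) auto
  obtain d where d: "d > 0" and
    dF: "\<And>t t' z. t \<in> {0..1} \<Longrightarrow> t' \<in> {0..1} \<Longrightarrow> z \<in> K \<Longrightarrow> \<bar>t - t'\<bar> < d \<Longrightarrow> norm (F t z - F t' z) \<le> \<epsilon>"
  proof -
    obtain d where d: "d > 0" and
      D: "\<And>x x'. x \<in> {0..1} \<times> K \<Longrightarrow> x' \<in> {0..1} \<times> K \<Longrightarrow> dist x' x < d \<Longrightarrow>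
         dist (F (fst x') (snd x')) (F (fst x) (snd x)) < \<epsilon>"
      using uc e unfolding uniformly_continuous_on_def by metis
    show ?thesis
    proof (rule that[OF d])
      fix t t' z assume "t \<in> {0..1}" "t' \<in> {0..1}" "z \<in> K" "\<bar>t - t'\<bar> < d"
      then show "norm (F t z - F t' z) \<le> \<epsilon>"
        using D[of "(t',z)" "(t,z)"] by (auto simp: dist_norm dist_prod_def)
    qed
  qed
  \<comment> \<open>The allowed error is proportional to the length, so it adds up under
    concatenation; \<open>Bolzano\<close> then replaces the choice of a partition of [0, 1].\<close>
  define P where "P = (\<lambda>s t. 0 \<le> s \<and> s \<le> t \<and> t \<le> 1 \<longrightarrow> (\<exists>r D. fin_mero r D \<and> D \<subseteq> closed_segment a b \<and>
     (\<forall>z\<in>K. norm (integral {s..t} (\<lambda>x. F x z) - r z) \<le> \<epsilon> * (t - s))))"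
  have "P 0 1"
  proof (rule Bolzano)
    fix s t u assume P: "P s t" "P t u" and le: "s \<le> t" "t \<le> u"
    show "P s u" unfolding P_def
    proof
      assume su: "0 \<le> s \<and> s \<le> u \<and> u \<le> 1"
      obtain r D where 1: "fin_mero r D" "D \<subseteq> closed_segment a b"
        "\<And>z. z\<in>K \<Longrightarrow> norm (integral {s..t} (\<lambda>x. F x z) - r z) \<le> \<epsilon> * (t - s)"
        using P(1) su le unfolding P_def by fastforce
      obtain r' D' where 2: "fin_mero r' D'" "D' \<subseteq> closed_segment a b"
        "\<And>z. z\<in>K \<Longrightarrow> norm (integral {t..u} (\<lambda>x. F x z) - r' z) \<le> \<epsilon> * (u - t)"
        using P(2) su le unfolding P_def by fastforce
      show "\<exists>r D. fin_mero r D \<and> D \<subseteq> closed_segment a b \<and>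
         (\<forall>z\<in>K. norm (integral {s..u} (\<lambda>x. F x z) - r z) \<le> \<epsilon> * (u - s))"
      proof (intro exI conjI ballI)
        show "fin_mero (\<lambda>z. r z + r' z) (D \<union> D')" using 1 2 by (intro fin_mero_add)
        show "D \<union> D' \<subseteq> closed_segment a b" using 1 2 by auto
        fix z assume z: "z \<in> K"
        have "(\<lambda>x. F x z) integrable_on {s..u}"
          by (intro integrable_continuous_real continuous_on_subset[OF contF[OF z]]) (use su in auto)
        then have eq: "integral {s..u} (\<lambda>x. F x z) = integral {s..t} (\<lambda>x. F x z) + integral {t..u} (\<lambda>x. F x z)"
          using Henstock_Kurzweil_Integration.integral_combine[OF le] by metis
        have "norm (integral {s..u} (\<lambda>x. F x z) - (r z + r' z)) \<le>
          norm (integral {s..t} (\<lambda>x. F x z) - r z) + norm (integral {t..u} (\<lambda>x. F x z) - r' z)"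
          unfolding eq by (metis add_diff_add norm_triangle_ineq)
        then show "norm (integral {s..u} (\<lambda>x. F x z) - (r z + r' z)) \<le> \<epsilon> * (u - s)"
          using 1(3)[OF z] 2(3)[OF z] by (simp add: algebra_simps)
      qed
    qed
  next
    fix x :: real
    show "\<exists>d>0. \<forall>a b. a \<le> x \<and> x \<le> b \<and> b - a < d \<longrightarrow> P a b"
    proof (intro exI conjI allI impI, rule d)
      fix s t assume st: "s \<le> x \<and> x \<le> t \<and> t - s < d"
      show "P s t" unfolding P_def
      proof
        assume su: "0 \<le> s \<and> s \<le> t \<and> t \<le> 1"
        let ?c = "- ((t - s) *\<^sub>R (g (\<gamma> s) * (b - a)))"
        show "\<exists>r D. fin_mero r D \<and> D \<subseteq> closed_segment a b \<and>
         (\<forall>z\<in>K. norm (integral {s..t} (\<lambda>x. F x z) - r z) \<le> \<epsilon> * (t - s))"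
        proof (intro exI conjI ballI)
          show "fin_mero (\<lambda>z. ?c / (z - \<gamma> s)) {\<gamma> s}" by (rule fin_mero_pole)
          show "{\<gamma> s} \<subseteq> closed_segment a b" using \<gamma>[of s] su by auto
          fix z assume z: "z \<in> K"
          have int: "(\<lambda>x. F x z) integrable_on {s..t}"
            by (intro integrable_continuous_real continuous_on_subset[OF contF[OF z]]) (use su in auto)
          have "z \<noteq> \<gamma> s" using \<gamma>[of s] su disj z by auto
          then have "?c / (z - \<gamma> s) = (t - s) *\<^sub>R F s z"
            unfolding F_def by (auto simp: field_simps scaleR_conv_of_real)
          then have "integral {s..t} (\<lambda>x. F x z) - ?c / (z - \<gamma> s) = integral {s..t} (\<lambda>x. F x z - F s z)"
            using int su by (subst Henstock_Kurzweil_Integration.integral_diff) auto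
          moreover have "norm (integral {s..t} (\<lambda>x. F x z - F s z)) \<le> \<epsilon> * (t - s)"
          proof (rule integral_bound)
            show "continuous_on {s..t} (\<lambda>x. F x z - F s z)"
              by (intro continuous_intros continuous_on_subset[OF contF[OF z]]) (use su in auto)
            show "norm (F x z - F s z) \<le> \<epsilon>" if "x \<in> {s..t}" for x
              using dF[of x s z] that su st z by auto
          qed (use su in auto)
          ultimately show "norm (integral {s..t} (\<lambda>x. F x z) - ?c / (z - \<gamma> s)) \<le> \<epsilon> * (t - s)" by simp
        qed
      qed
    qed
  qed auto
  then obtain r D where r: "fin_mero r D" "D \<subseteq> closed_segment a b"
     "\<And>z. z\<in>K \<Longrightarrow> norm (integral {0..1} (\<lambda>x. F x z) - r z) \<le> \<epsilon>"
    unfolding P_def by auto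
  have "contour_integral (linepath a b) (\<lambda>\<zeta>. g \<zeta> / (\<zeta> - z)) = integral {0..1} (\<lambda>x. F x z)" for z
    unfolding contour_integral_integral F_def \<gamma>_def by simp
  with r show ?thesis by auto
qed

section \<open>Cauchy integrals along the edges of a square grid\<close>

definition seg_int :: "(complex \<Rightarrow> complex) \<Rightarrow> complex \<Rightarrow> complex \<Rightarrow> complex \<Rightarrow> complex" where
  "seg_int g a b z = contour_integral (linepath a b) (\<lambda>\<zeta>. g \<zeta> / (\<zeta> - z))"

lemma seg_int_integrable:
  assumes "continuous_on (closed_segment a b) g" "z \<notin> closed_segment a b"
  shows "(\<lambda>\<zeta>. g \<zeta> / (\<zeta> - z)) contour_integrable_on linepath a b"
  by (intro contour_integrable_continuous_linepath continuous_intros assms)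
     (use assms in auto)

text \<open>Grid lines may pass through \<open>K\<close>; continuity off the segment later carries
  the Cauchy formula over to the points of \<open>K\<close> on grid lines.\<close>

lemma seg_int_isCont:
  assumes g: "continuous_on (closed_segment a b) g" and z: "z \<notin> closed_segment a b"
  shows "isCont (seg_int g a b) z"
proof -
  have "(seg_int g a b has_field_derivative (of_nat 1 * contour_integral (linepath a b)
      (\<lambda>u. g u / (u - z) ^ Suc 1))) (at z)"
  proof (rule Cauchy_next_derivative(2)[where S=UNIV and B="norm (b - a)"])
    show "((\<lambda>u. g u / (u - w) ^ 1) has_contour_integral seg_int g a b w) (linepath a b)"
      if "w \<in> UNIV - path_image (linepath a b)" for w
      unfolding seg_int_def using seg_int_integrable[OF g, of w] that
      by (simp add: has_contour_integral_integral)
  qed (use assms in auto)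
  then show ?thesis by (rule DERIV_isCont)
qed

lemma seg_int_swap: "seg_int g b a z = - seg_int g a b z"
  unfolding seg_int_def
  by (cases "(\<lambda>\<zeta>. g \<zeta> / (\<zeta> - z)) contour_integrable_on linepath a b")
     (metis contour_integral_reversepath reversepath_linepath valid_path_linepath)+

text \<open>Both horizontal edges are run from left to right and both vertical ones upwards, so that
  an edge common to two adjacent squares contributes literally the same term twice, with opposite
  signs.\<close>

lemma Cauchy_rectangle:
  assumes g: "g holomorphic_on S" and S: "cbox a c \<subseteq> S" and le: "Re a < Re c" "Im a < Im c"
    and z: "z \<notin> cbox a c - box a c"
  shows "seg_int g a (Complex (Re c) (Im a)) z + seg_int g (Complex (Re c) (Im a)) c z
     - seg_int g (Complex (Re a) (Im c)) c z - seg_int g a (Complex (Re a) (Im c)) z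
     = (if z \<in> box a c then 2 * of_real pi * \<i> * g z else 0)"
proof -
  define b d where "b = Complex (Re c) (Im a)" and "d = Complex (Re a) (Im c)"
  let ?f = "\<lambda>\<zeta>. g \<zeta> / (\<zeta> - z)"
  have hol: "g holomorphic_on cbox a c" using g S holomorphic_on_subset by blast
  have cont: "continuous_on (cbox a c) g" using hol holomorphic_on_imp_continuous_on by blast
  have img: "path_image (rectpath a c) = cbox a c - box a c"
    using le by (simp add: path_image_rectpath_cbox_minus_box)
  have segs: "closed_segment a b \<union> closed_segment b c \<union> closed_segment c d \<union> closed_segment d a \<subseteq> cbox a c - box a c"
    unfolding img[symmetric] rectpath_def Let_def b_def d_def by (auto simp: path_image_join)
  have ig: "?f contour_integrable_on linepath x y" if "closed_segment x y \<subseteq> cbox a c - box a c" for x y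
    by (intro seg_int_integrable continuous_on_subset[OF cont]) (use that z in auto)
  have igs: "?f contour_integrable_on linepath a b" "?f contour_integrable_on linepath b c"
     "?f contour_integrable_on linepath c d" "?f contour_integrable_on linepath d a"
    by (intro ig; use segs in auto)+
  have "contour_integral (rectpath a c) ?f = seg_int g a b z + (seg_int g b c z + (seg_int g c d z + seg_int g d a z))"
    unfolding rectpath_def Let_def b_def[symmetric] d_def[symmetric] seg_int_def
    using igs by simp
  also have "\<dots> = seg_int g a b z + seg_int g b c z - seg_int g d c z - seg_int g a d z"
    by (simp add: seg_int_swap[of g c d] seg_int_swap[of g d a])
  finally have 1: "contour_integral (rectpath a c) ?f = \<dots>" .
  have "contour_integral (rectpath a c) ?f = (if z \<in> box a c then 2 * of_real pi * \<i> * g z else 0)"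
  proof (cases "z \<in> box a c")
    case True
    then have w: "winding_number (rectpath a c) z = 1" by (rule winding_number_rectpath)
    have "(?f has_contour_integral (2 * pi * \<i> * winding_number (rectpath a c) z * g z)) (rectpath a c)"
      by (rule Cauchy_integral_formula_convex_simple[where S="cbox a c"])
         (use hol True img z in auto)
    with True show ?thesis by (simp add: w contour_integral_unique)
  next
    case False
    then have "z \<notin> cbox a c" using z by auto
    then have "(?f has_contour_integral 0) (rectpath a c)"
    proof (intro Cauchy_theorem_convex_simple[where S="cbox a c"])
      show "?f holomorphic_on cbox a c" using \<open>z \<notin> cbox a c\<close> by (intro holomorphic_intros hol) auto
      show "path_image (rectpath a c) \<subseteq> cbox a c" unfolding img by blast
    qed (simp_all)
    with False show ?thesis by (simp add: contour_integral_unique)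
  qed
  with 1 show ?thesis by (simp add: b_def d_def)
qed

text \<open>This is the cancellation of common edges: with \<open>A\<close> and \<open>B\<close>
  indexing lower and upper, or right and left, edges, what survives are the edges that belong to
  only one of the chosen squares.\<close>

lemma sum_diff_sets:
  fixes f :: "'a \<Rightarrow> 'b::ab_group_add"
  assumes "finite A" "finite B"
  shows "sum f A - sum f B = sum f (A - B) - sum f (B - A)"
  using sum.Int_Diff[OF assms(1), of f B] sum.Int_Diff[OF assms(2), of f A]
  by (simp add: Int_commute)

text \<open>The set \<open>S\<close> confines the singularities. The class \<open>fin_mero\<close>
  replaces rational functions: it asks for finitely many singularities and meromorphy in the plane
  and leaves the behaviour at infinity open.\<close>

definition approx_on :: "complex set \<Rightarrow> complex set \<Rightarrow> (complex \<Rightarrow> complex) \<Rightarrow> bool" where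
  "approx_on K S h \<longleftrightarrow> (\<forall>\<epsilon>>0. \<exists>r D. fin_mero r D \<and> D \<subseteq> S \<and> (\<forall>z\<in>K. norm (h z - r z) \<le> \<epsilon>))"

lemma approx_on_add:
  assumes "approx_on K S f" "approx_on K S g"
  shows "approx_on K S (\<lambda>z. f z + g z)"
  unfolding approx_on_def
proof (intro allI impI)
  fix e :: real assume "e > 0"
  then have "e/2 > 0" by simp
  obtain r D where 1: "fin_mero r D" "D \<subseteq> S" "\<And>z. z\<in>K \<Longrightarrow> norm (f z - r z) \<le> e/2"
    using assms(1) \<open>e/2>0\<close> unfolding approx_on_def by blast
  obtain r' D' where 2: "fin_mero r' D'" "D' \<subseteq> S" "\<And>z. z\<in>K \<Longrightarrow> norm (g z - r' z) \<le> e/2"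
    using assms(2) \<open>e/2>0\<close> unfolding approx_on_def by blast
  have "norm (f z + g z - (r z + r' z)) \<le> e" if "z \<in> K" for z
    using 1(3)[OF that] 2(3)[OF that] norm_triangle_ineq[of "f z - r z" "g z - r' z"]
    by (simp add: algebra_simps)
  then show "\<exists>r D. fin_mero r D \<and> D \<subseteq> S \<and> (\<forall>z\<in>K. norm (f z + g z - r z) \<le> e)"
    using fin_mero_add[OF 1(1) 2(1)] 1(2) 2(2)
    by (intro exI[of _ "\<lambda>z. r z + r' z"] exI[of _ "D \<union> D'"]) auto
qed

lemma approx_on_cmult:
  assumes "approx_on K S f"
  shows "approx_on K S (\<lambda>z. c * f z)"
  unfolding approx_on_def
proof (intro allI impI)
  fix e :: real assume "e > 0"
  then have "e/(1 + norm c) > 0" by (simp add: add_pos_nonneg)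
  then obtain r D where 1: "fin_mero r D" "D \<subseteq> S" "\<And>z. z\<in>K \<Longrightarrow> norm (f z - r z) \<le> e/(1 + norm c)"
    using assms(1) unfolding approx_on_def by blast
  have "norm (c * f z - c * r z) \<le> e" if "z \<in> K" for z
  proof -
    have "norm (c * f z - c * r z) = norm c * norm (f z - r z)"
      by (metis norm_mult right_diff_distrib)
    also have "\<dots> \<le> (1 + norm c) * (e / (1 + norm c))"
      using 1(3)[OF that] by (intro mult_mono) auto
    also have "\<dots> = e" by (simp add: add_nonneg_eq_0_iff)
    finally show ?thesis .
  qed
  then show "\<exists>r D. fin_mero r D \<and> D \<subseteq> S \<and> (\<forall>z\<in>K. norm (c * f z - r z) \<le> e)"
    using fin_mero_mult[OF fin_mero_const[of c] 1(1)] 1(2) by auto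
qed

lemma approx_on_0: "approx_on K S (\<lambda>z. 0)"
  unfolding approx_on_def using fin_mero_const[of 0] by force

lemma approx_on_sum:
  "finite I \<Longrightarrow> (\<And>i. i \<in> I \<Longrightarrow> approx_on K S (f i)) \<Longrightarrow> approx_on K S (\<lambda>z. \<Sum>i\<in>I. f i z)"
  by (induction I rule: finite_induct) (auto simp: approx_on_0 intro!: approx_on_add)

lemma approx_on_diff: "approx_on K S f \<Longrightarrow> approx_on K S g \<Longrightarrow> approx_on K S (\<lambda>z. f z - g z)"
  using approx_on_add[of K S f "\<lambda>z. -1 * g z"] approx_on_cmult[of K S g "-1"] by simp

lemma approx_on_seg_int:
  assumes "continuous_on (closed_segment a b) g" "compact K" "closed_segment a b \<inter> K = {}"
    "closed_segment a b \<subseteq> S"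
  shows "approx_on K S (seg_int g a b)"
  unfolding approx_on_def seg_int_def using segment_approx[OF assms(1-3)] assms(4) by (meson order_trans)

text \<open>The poles are not pushed anywhere: they stay on the edges of a grid polygon around
  \<open>K\<close>, hence in \<open>O'\<close>. This localisation is used later, when
  \<open>O'\<close> omits the sets reserved for later stages and the new poles must avoid
  them.\<close>

lemma runge_approx:
  assumes K: "compact K" and O: "open O'" "K \<subseteq> O'" and g: "g holomorphic_on O'"
  shows "approx_on K (O' - K) g"
proof -
  obtain d where d: "d > 0" "\<And>x y. x \<in> K \<Longrightarrow> dist x y < d \<Longrightarrow> y \<in> O'"
    using compact_subset_open_imp_ball_epsilon_subset[OF K O]
    by (metis UN_iff mem_ball subsetD)
  \<comment> \<open>A square of side \<open>d / 4\<close> has diameter below \<open>d\<close>, so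
    every closed square meeting \<open>K\<close> lies in \<open>O'\<close>.\<close>
  define s where "s = d / 4"
  have s: "s > 0" using d by (simp add: s_def)
  define P where "P = (\<lambda>i j. Complex (s * of_int i) (s * of_int j))"
  have PRe[simp]: "Re (P i j) = s * of_int i" "Im (P i j) = s * of_int j" for i j by (auto simp: P_def)
  define Q where "Q = (\<lambda>i j. cbox (P i j) (P (i+1) (j+1)))"
  define I where "I = {(i,j). Q i j \<inter> K \<noteq> {}}"
  have inQ: "z \<in> Q i j \<longleftrightarrow> s * of_int i \<le> Re z \<and> Re z \<le> s * (of_int i + 1) \<and>
         s * of_int j \<le> Im z \<and> Im z \<le> s * (of_int j + 1)" for z i j
    unfolding Q_def in_cbox_complex_iff by auto
  have QO: "Q i j \<subseteq> O'" if "(i,j) \<in> I" for i j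
  proof
    fix y assume y: "y \<in> Q i j"
    from that obtain x where x: "x \<in> Q i j" "x \<in> K" unfolding I_def by auto
    have "\<bar>Re x - Re y\<bar> \<le> s" "\<bar>Im x - Im y\<bar> \<le> s"
      using x(1) y unfolding inQ by (auto simp: algebra_simps)
    then have "dist x y \<le> 2 * s"
      using cmod_le[of "x - y"] by (simp add: dist_norm)
    then show "y \<in> O'" using d(2)[OF x(2), of y] d(1) by (simp add: s_def)
  qed
  have inI: "(i,j) \<in> I \<longleftrightarrow> Q i j \<inter> K \<noteq> {}" for i j by (simp add: I_def)
  have finI: "finite I"
  proof -
    obtain B where B: "\<And>x. x \<in> K \<Longrightarrow> norm x \<le> B" using K compact_imp_bounded bounded_iff by metis
    define N where "N = \<lceil>B / s\<rceil> + 1"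
    have "I \<subseteq> {-N..N} \<times> {-N..N}"
    proof clarify
      fix i j assume "(i,j) \<in> I"
      then obtain x where x: "x \<in> Q i j" "x \<in> K" unfolding I_def by auto
      have "\<bar>Re x\<bar> \<le> B" "\<bar>Im x\<bar> \<le> B" using B[OF x(2)] abs_Re_le_cmod abs_Im_le_cmod order_trans by blast+
      moreover have "of_int i \<le> Re x / s" "Re x / s \<le> of_int i + 1" "of_int j \<le> Im x / s" "Im x / s \<le> of_int j + 1"
        using x(1) s unfolding inQ by (auto simp: field_simps)
      moreover have "\<bar>Re x / s\<bar> \<le> B / s" "\<bar>Im x / s\<bar> \<le> B / s"
        using calculation s by (auto simp: field_simps abs_if divide_simps)
      moreover have "B / s \<le> of_int N - 1" unfolding N_def by simp
      ultimately have "of_int i \<le> (of_int N :: real)" "of_int (-N) \<le> (of_int i :: real)"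
        "of_int j \<le> (of_int N :: real)" "of_int (-N) \<le> (of_int j :: real)" by linarith+
      then show "i \<in> {-N..N} \<and> j \<in> {-N..N}" unfolding of_int_le_iff by auto
    qed
    then show ?thesis by (rule finite_subset) auto
  qed
  have contg: "continuous_on O' g" using g holomorphic_on_imp_continuous_on by blast
  define Hz where "Hz = (\<lambda>z (i,j). seg_int g (P i j) (P (i+1) j) z)"
  define Vt where "Vt = (\<lambda>z (i,j). seg_int g (P i j) (P i (j+1)) z)"
  define hseg where "hseg = (\<lambda>(i,j). closed_segment (P i j) (P (i+1) j))"
  define vseg where "vseg = (\<lambda>(i,j). closed_segment (P i j) (P i (j+1)))"
  have hseg_iff: "z \<in> hseg (i,j) \<longleftrightarrow> Im z = s * of_int j \<and> s * of_int i \<le> Re z \<and> Re z \<le> s * (of_int i + 1)" for z i j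
    unfolding hseg_def using s by (auto simp: closed_segment_same_Im closed_segment_eq_real_ivl)
  have vseg_iff: "z \<in> vseg (i,j) \<longleftrightarrow> Re z = s * of_int i \<and> s * of_int j \<le> Im z \<and> Im z \<le> s * (of_int j + 1)" for z i j
    unfolding vseg_def using s by (auto simp: closed_segment_same_Re closed_segment_eq_real_ivl)
  \<comment> \<open>An edge carries the index of its lower or left end point; \<open>uJ\<close> and
    \<open>uI\<close> send a square to its upper and to its right edge.\<close>
  define uJ where "uJ = (\<lambda>(i::int,j::int). (i,j+1))"
  define uI where "uI = (\<lambda>(i::int,j::int). (i+1,j))"
  have inj: "inj_on uJ I" "inj_on uI I" unfolding uJ_def uI_def by (auto simp: inj_on_def)
  have fin: "finite (uJ ` I)" "finite (uI ` I)" using finI by auto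
  define EH where "EH = (I - uJ ` I) \<union> (uJ ` I - I)"
  define EV where "EV = (I - uI ` I) \<union> (uI ` I - I)"
  \<comment> \<open>Two closed squares share the edge. If it met \<open>K\<close>, both would be
    indexed by \<open>I\<close>, and the edge would not lie in the symmetric difference.\<close>
  have EH: "hseg e \<subseteq> O'" "hseg e \<inter> K = {}" if "e \<in> EH" for e
  proof -
    obtain i j where e: "e = (i,j)" by (cases e)
    have sub: "hseg (i,j) \<subseteq> Q i j" "hseg (i,j) \<subseteq> Q i (j-1)" using s by (auto simp: hseg_iff inQ algebra_simps)
    have im: "(i,j) \<in> uJ ` I \<longleftrightarrow> (i,j-1) \<in> I" unfolding uJ_def by (auto simp: image_iff intro!: bexI[of _ "(i,j-1)"])
    show "hseg e \<subseteq> O'" using that sub QO[of i j] QO[of i "j-1"] unfolding EH_def e im Un_iff Diff_iff by blast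
    show "hseg e \<inter> K = {}" using that sub unfolding EH_def e im Un_iff Diff_iff inI by blast
  qed
  have EV: "vseg e \<subseteq> O'" "vseg e \<inter> K = {}" if "e \<in> EV" for e
  proof -
    obtain i j where e: "e = (i,j)" by (cases e)
    have sub: "vseg (i,j) \<subseteq> Q i j" "vseg (i,j) \<subseteq> Q (i-1) j" using s by (auto simp: vseg_iff inQ algebra_simps)
    have im: "(i,j) \<in> uI ` I \<longleftrightarrow> (i-1,j) \<in> I" unfolding uI_def by (auto simp: image_iff intro!: bexI[of _ "(i-1,j)"])
    show "vseg e \<subseteq> O'" using that sub QO[of i j] QO[of "i-1" j] unfolding EV_def e im Un_iff Diff_iff by blast
    show "vseg e \<inter> K = {}" using that sub unfolding EV_def e im Un_iff Diff_iff inI by blast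
  qed
  have finE: "finite EH" "finite EV" unfolding EH_def EV_def using finI fin by auto
  define FS where "FS = (\<lambda>z. (sum (Hz z) (I - uJ ` I) - sum (Hz z) (uJ ` I - I)) +
     (sum (Vt z) (uI ` I - I) - sum (Vt z) (I - uI ` I)))"
  have approxH: "approx_on K (O' - K) (\<lambda>z. Hz z e)" if "e \<in> EH" for e
  proof -
    obtain i j where e: "e = (i,j)" by (cases e)
    show ?thesis unfolding Hz_def e prod.case
      by (intro approx_on_seg_int continuous_on_subset[OF contg] K)
         (use EH[OF that] in \<open>auto simp: hseg_def e\<close>)
  qed
  have approxV: "approx_on K (O' - K) (\<lambda>z. Vt z e)" if "e \<in> EV" for e
  proof -
    obtain i j where e: "e = (i,j)" by (cases e)
    show ?thesis unfolding Vt_def e prod.case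
      by (intro approx_on_seg_int continuous_on_subset[OF contg] K)
         (use EV[OF that] in \<open>auto simp: vseg_def e\<close>)
  qed
  have "approx_on K (O' - K) FS"
    unfolding FS_def
    by (intro approx_on_add approx_on_diff approx_on_sum approxH approxV)
       (auto simp: EH_def EV_def finI fin)
  then have ap: "approx_on K (O' - K) (\<lambda>z. 1 / (2 * of_real pi * \<i>) * FS z)" by (rule approx_on_cmult)
  have contH: "isCont (\<lambda>z. Hz z e) z" if "e \<in> EH" "z \<in> K" for e z
  proof -
    obtain i j where e: "e = (i,j)" by (cases e)
    show ?thesis unfolding Hz_def e prod.case
      by (intro seg_int_isCont continuous_on_subset[OF contg])
         (use EH[OF that(1)] that(2) in \<open>auto simp: hseg_def e\<close>)
  qed
  have contV: "isCont (\<lambda>z. Vt z e) z" if "e \<in> EV" "z \<in> K" for e z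
  proof -
    obtain i j where e: "e = (i,j)" by (cases e)
    show ?thesis unfolding Vt_def e prod.case
      by (intro seg_int_isCont continuous_on_subset[OF contg])
         (use EV[OF that(1)] that(2) in \<open>auto simp: vseg_def e\<close>)
  qed
  have contFS: "isCont FS z" if "z \<in> K" for z
    unfolding FS_def
    by (intro continuous_intros contH contV) (use that in \<open>auto simp: EH_def EV_def\<close>)
  text \<open>Off the grid lines the sum of the Cauchy integrals over all squares telescopes to \<open>FS\<close>.\<close>
  have FS_eq: "FS z = 2 * of_real pi * \<i> * g z"
    if z: "z \<in> box (P a b) (P (a+1) (b+1))" "(a,b) \<in> I" for z a b
  proof -
    have one: "Hz z (i,j) + Vt z (uI (i,j)) - Hz z (uJ (i,j)) - Vt z (i,j)
        = (if (i,j) = (a,b) then 2 * of_real pi * \<i> * g z else 0)" if ij: "(i,j) \<in> I" for i j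
    proof -
      have zz: "of_int a < Re z / s" "Re z / s < of_int a + 1" "of_int b < Im z / s" "Im z / s < of_int b + 1"
        using z(1) s unfolding in_box_complex_iff by (auto simp: field_simps)
      have box: "z \<in> box (P i j) (P (i+1) (j+1)) \<longleftrightarrow> (i,j) = (a,b)"
      proof
        assume "z \<in> box (P i j) (P (i+1) (j+1))"
        then have "of_int i < Re z / s" "Re z / s < of_int i + 1" "of_int j < Im z / s" "Im z / s < of_int j + 1"
          using s unfolding in_box_complex_iff by (auto simp: field_simps)
        then have "floor (Re z / s) = i" "floor (Im z / s) = j" by linarith+
        moreover have "floor (Re z / s) = a" "floor (Im z / s) = b" using zz by linarith+
        ultimately show "(i,j) = (a,b)" by simp
      qed (use z in auto)
      have nb: "z \<notin> cbox (P i j) (P (i+1) (j+1)) - box (P i j) (P (i+1) (j+1))"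
      proof
        assume as: "z \<in> cbox (P i j) (P (i+1) (j+1)) - box (P i j) (P (i+1) (j+1))"
        then have "z \<in> Q i j" by (simp add: Q_def)
        then have "of_int i \<le> Re z / s" "Re z / s \<le> of_int i + 1" "of_int j \<le> Im z / s" "Im z / s \<le> of_int j + 1"
          using s unfolding inQ by (auto simp: field_simps)
        then have "of_int i < (of_int a :: real) + 1" "of_int a < (of_int i :: real) + 1"
          "of_int j < (of_int b :: real) + 1" "of_int b < (of_int j :: real) + 1" using zz by linarith+
        then have "i = a" "j = b" by linarith+
        with as z show False by auto
      qed
      have corner: "Complex (Re (P (i+1) (j+1))) (Im (P i j)) = P (i+1) j" "Complex (Re (P i j)) (Im (P (i+1) (j+1))) = P i (j+1)"
        by (auto simp: P_def)
      have lt: "Re (P i j) < Re (P (i+1) (j+1))" "Im (P i j) < Im (P (i+1) (j+1))"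
        using s by (auto simp: algebra_simps)
      show ?thesis
        using Cauchy_rectangle[OF g QO[OF ij, unfolded Q_def] lt nb, unfolded corner box]
        unfolding Hz_def Vt_def uI_def uJ_def prod.case by (simp only: algebra_simps)
    qed
    have "(\<Sum>e\<in>I. Hz z e + Vt z (uI e) - Hz z (uJ e) - Vt z e) =
        (\<Sum>e\<in>I. if e = (a,b) then 2 * of_real pi * \<i> * g z else 0)"
    proof (intro sum.cong refl)
      fix e assume "e \<in> I"
      then show "Hz z e + Vt z (uI e) - Hz z (uJ e) - Vt z e =
          (if e = (a,b) then 2 * of_real pi * \<i> * g z else 0)"
        using one by (cases e) (simp only:)
    qed
    also have "\<dots> = 2 * of_real pi * \<i> * g z" using z(2) finI by simp
    finally have "sum (Hz z) I + sum (Vt z) (uI ` I) - sum (Hz z) (uJ ` I) - sum (Vt z) I = 2 * of_real pi * \<i> * g z"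
      by (simp add: sum.distrib sum_subtractf sum.reindex inj)
    then have "2 * of_real pi * \<i> * g z = (sum (Hz z) I - sum (Hz z) (uJ ` I)) + (sum (Vt z) (uI ` I) - sum (Vt z) I)"
      by (simp add: algebra_simps)
    also have "\<dots> = FS z" unfolding FS_def using sum_diff_sets finI fin by metis
    finally show ?thesis by simp
  qed
  have "1 / (2 * of_real pi * \<i>) * FS z = g z" if z: "z \<in> K" for z
  proof -
    \<comment> \<open>As \<open>z\<close> may lie on a grid line, it is approached along the
      diagonal by interior points of a chosen square containing it; both sides of the formula are
      continuous at \<open>z\<close>.\<close>
    define w where "w = (\<lambda>n::nat. z + Complex (s / (real n + 2) ) (s / (real n + 2)))"
    define a where "a = floor (Re z / s)"
    define b where "b = floor (Im z / s)"
    have ab: "of_int a \<le> Re z / s" "Re z / s < of_int a + 1" "of_int b \<le> Im z / s" "Im z / s < of_int b + 1"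
      unfolding a_def b_def by linarith+
    have ab': "s * of_int a \<le> Re z" "Re z < s * (of_int a + 1)" "s * of_int b \<le> Im z" "Im z < s * (of_int b + 1)"
      using ab s by (auto simp: field_simps)
    have "z \<in> Q a b" using ab' by (auto simp: inQ)
    then have abI: "(a,b) \<in> I" using z inI by blast
    have lim0: "(\<lambda>n::nat. s / (real n + 2)) \<longlonglongrightarrow> 0"
      using LIMSEQ_ignore_initial_segment[OF lim_const_over_n[of s], of 2] by (simp add: add.commute)
    have wlim: "w \<longlonglongrightarrow> z"
    proof -
      have "(\<lambda>n. z + Complex (s / (real n + 2) ) (s / (real n + 2))) \<longlonglongrightarrow> z + Complex 0 0"
        by (intro tendsto_intros tendsto_Complex lim0)
      then show ?thesis unfolding w_def by (simp add: Complex_eq_0[symmetric] zero_complex.code[symmetric])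
    qed
    define m where "m = min (s * (of_int a + 1) - Re z) (s * (of_int b + 1) - Im z)"
    have "m > 0" unfolding m_def using ab' by auto
    have ev: "eventually (\<lambda>n. FS (w n) = 2 * of_real pi * \<i> * g (w n)) sequentially"
      using order_tendstoD(2)[OF lim0 \<open>m > 0\<close>]
    proof eventually_elim
      case (elim n)
      have "0 < s / (real n + 2)" using s by simp
      then have "w n \<in> box (P a b) (P (a+1) (b+1))"
        using elim ab' unfolding in_box_complex_iff w_def m_def by (auto simp: algebra_simps)
      from FS_eq[OF this abI] show ?case .
    qed
    have l1: "(\<lambda>n. FS (w n)) \<longlonglongrightarrow> FS z" using contFS[OF z] wlim isCont_tendsto_compose by blast
    have "isCont g z" using contg O z continuous_on_eq_continuous_at by blast
    then have "(\<lambda>n. g (w n)) \<longlonglongrightarrow> g z" using wlim by (rule isCont_tendsto_compose)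
    then have "(\<lambda>n. 2 * of_real pi * \<i> * g (w n)) \<longlonglongrightarrow> 2 * of_real pi * \<i> * g z"
      by (intro tendsto_intros)
    then have "(\<lambda>n. FS (w n)) \<longlonglongrightarrow> 2 * of_real pi * \<i> * g z"
      unfolding tendsto_cong[OF ev] .
    with l1 have "FS z = 2 * of_real pi * \<i> * g z" by (rule LIMSEQ_unique)
    then show ?thesis by simp
  qed
  then show ?thesis using ap unfolding approx_on_def by simp
qed

text \<open>The modulus of the monic polynomial with root list \<open>l\<close>. A list rather than
  a set, so that repeated entries express vanishing of higher order.\<close>

definition wt :: "complex list \<Rightarrow> complex \<Rightarrow> real" where
  "wt l z = (\<Prod>a\<leftarrow>l. cmod (z - a))"

lemma wt_simps [simp]:
  "wt [] z = 1" "wt (a # l) z = cmod (z - a) * wt l z" "wt (l @ l') z = wt l z * wt l' z"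
  by (simp_all add: wt_def)

lemma wt_nonneg [simp]: "0 \<le> wt l z"
  by (induction l) auto

lemma wt_eq_0_iff: "wt l z = 0 \<longleftrightarrow> z \<in> set l"
  by (induction l) auto

lemma continuous_on_wt [continuous_intros]:
  "continuous_on S f \<Longrightarrow> continuous_on S (\<lambda>z. wt l (f z))"
  by (induction l) (auto intro!: continuous_intros)

text \<open>An error bounded by \<^term>\<open>\<epsilon> * wt l z\<close> encodes interpolation at the points of \<open>l\<close>, with
  multiplicity; it is obtained by approximating the divided differences of \<open>g\<close>.\<close>

lemma runge_interpolation:
  assumes K: "compact K" and O: "open O'" "K \<subseteq> O'" and g: "g holomorphic_on O'"
    and l: "set l \<subseteq> K" and e: "\<epsilon> > 0"
  shows "\<exists>r D. fin_mero r D \<and> D \<subseteq> O' - K \<and> (\<forall>z\<in>K. norm (g z - r z) \<le> \<epsilon> * wt l z)"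
  using l g
proof (induction l arbitrary: g)
  case Nil
  then show ?case using runge_approx[OF K O Nil.prems(2)] e unfolding approx_on_def by simp
next
  case (Cons s l)
  define g1 where "g1 = (\<lambda>z. if z = s then deriv g s else (g z - g s) / (z - s))"
  have "g1 holomorphic_on O'" unfolding g1_def
    using Cons.prems O by (intro pole_lemma) (auto simp: interior_open)
  then obtain r D where r: "fin_mero r D" "D \<subseteq> O' - K" "\<And>z. z \<in> K \<Longrightarrow> norm (g1 z - r z) \<le> \<epsilon> * wt l z"
    using Cons.IH[of g1] Cons.prems by auto
  have "fin_mero (\<lambda>z. g s + (z - s) * r z) ({} \<union> ({} \<union> D))"
    by (intro fin_mero_add fin_mero_mult r fin_mero_const fin_mero_entire holomorphic_intros)
  moreover have "norm (g z - (g s + (z - s) * r z)) \<le> \<epsilon> * wt (s # l) z" if "z \<in> K" for z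
  proof -
    have "g z - (g s + (z - s) * r z) = (z - s) * (g1 z - r z)"
    proof (cases "z = s")
      case False
      then have "(z - s) * g1 z = g z - g s" by (simp add: g1_def)
      then show ?thesis by (simp add: right_diff_distrib)
    qed simp
    then have "norm (g z - (g s + (z - s) * r z)) = cmod (z - s) * norm (g1 z - r z)"
      by (simp add: norm_mult)
    also have "\<dots> \<le> cmod (z - s) * (\<epsilon> * wt l z)" by (intro mult_left_mono r that) auto
    finally show ?thesis by (simp add: algebra_simps)
  qed
  ultimately show ?case using r(2)
    by (intro exI[of _ "\<lambda>z. g s + (z - s) * r z"] exI[of _ D]) auto
qed

text \<open>A small multiple of \<open>q z / (z - a)\<close> is added to an interpolating
  approximant, where \<open>q\<close> is the polynomial with root list \<open>l\<close>. This
  respects the weight, and \<open>q a\<close> is nonzero because the nodes lie in \<open>K\<close>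
  and \<open>a\<close> does not.\<close>

lemma runge_interpolation_pole:
  assumes K: "compact K" and O: "open O'" "K \<subseteq> O'" and g: "g holomorphic_on O'"
    and l: "set l \<subseteq> K" and e: "\<epsilon> > 0" and a: "a \<notin> K"
  shows "\<exists>r D. fin_mero r D \<and> D \<subseteq> insert a (O' - K) \<and> is_pole r a \<and>
     (\<forall>z\<in>K. norm (g z - r z) \<le> \<epsilon> * wt l z)"
proof -
  \<comment> \<open>Deleting \<open>a\<close> first keeps the approximant \<open>r\<close>
    holomorphic at \<open>a\<close>, so that it cannot cancel the pole added afterwards.\<close>
  have O2: "open (O' - {a})" "K \<subseteq> O' - {a}" "g holomorphic_on (O' - {a})"
    using O a g by (auto intro: holomorphic_on_subset)
  obtain r D where r: "fin_mero r D" "D \<subseteq> O' - {a} - K"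
    "\<And>z. z \<in> K \<Longrightarrow> norm (g z - r z) \<le> \<epsilon>/2 * wt l z"
    using runge_interpolation[OF K O2 l, of "\<epsilon>/2"] e by auto
  obtain d where d: "d > 0" "\<And>z. z \<in> K \<Longrightarrow> d \<le> dist a z"
    using separate_point_closed[OF compact_imp_closed[OF K] a] by auto
  define q where "q = (\<lambda>z. \<Prod>s\<leftarrow>l. (z - s))"
  have qn: "norm (q z) = wt l z" for z unfolding q_def wt_def by (induction l) (auto simp: norm_mult)
  have qhol: "q holomorphic_on S" for S unfolding q_def by (induction l) (auto intro!: holomorphic_intros)
  have qa: "q a \<noteq> 0" using qn[of a] wt_eq_0_iff[of l a] a l by auto
  \<comment> \<open>As \<open>d\<close> is a lower bound for the distance of \<open>a\<close> from
    \<open>K\<close>, the added term uses up at most half of the allowed error.\<close>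
  define c where "c = complex_of_real (\<epsilon> * d / 2)"
  define R where "R = (\<lambda>z. r z + q z * (c / (z - a)))"
  have "fin_mero R (D \<union> ({} \<union> {a}))" unfolding R_def
    by (intro fin_mero_add fin_mero_mult r fin_mero_pole fin_mero_entire qhol)
  moreover have "norm (g z - R z) \<le> \<epsilon> * wt l z" if z: "z \<in> K" for z
  proof -
    have pos: "cmod (z - a) \<ge> d" using d(2)[OF z] by (simp add: dist_norm norm_minus_commute)
    have "norm (c / (z - a)) \<le> \<epsilon> / 2"
    proof -
      have "\<epsilon> * d / 2 / cmod (z - a) \<le> \<epsilon> * d / 2 / d"
        using pos d e by (intro divide_left_mono mult_pos_pos) auto
      then show ?thesis using d e unfolding c_def norm_divide norm_of_real by (simp add: abs_mult)
    qed
    then have "norm (q z * (c / (z - a))) \<le> wt l z * (\<epsilon> / 2)"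
      unfolding norm_mult qn by (intro mult_left_mono) auto
    moreover have "norm (g z - R z) \<le> norm (g z - r z) + norm (q z * (c / (z - a)))"
      unfolding R_def by (metis diff_diff_eq norm_triangle_ineq4)
    ultimately show ?thesis using r(3)[OF z] by (simp add: algebra_simps)
  qed
  moreover have "is_pole R a"
  proof -
    have fD: "finite D" "r holomorphic_on - D" using r(1) by (auto simp: fin_mero_def)
    have "is_pole (\<lambda>z. ((z - a) * r z + q z * c) / (z - a) ^ 1) a"
    proof (rule is_pole_basic)
      show "(\<lambda>z. (z - a) * r z + q z * c) holomorphic_on - D"
        by (intro holomorphic_intros fD qhol)
      show "open (- D)" using fD by (simp add: finite_imp_closed open_Compl)
      show "a \<in> - D" using r(2) by auto
      show "(a - a) * r a + q a * c \<noteq> 0" using qa d e by (simp add: c_def)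
    qed auto
    moreover have "\<forall>\<^sub>F z in at a. ((z - a) * r z + q z * c) / (z - a) ^ 1 = R z"
      by (rule eventually_at_filter[THEN iffD2]) (auto simp: R_def field_simps intro!: always_eventually)
    ultimately show ?thesis by (subst (asm) is_pole_cong) auto
  qed
  ultimately show ?thesis using r(2) by (intro exI[of _ R] exI[of _ "insert a D"]) auto
qed

section \<open>Lifting by Newton iteration\<close>

lemma compact_fatten:
  fixes K :: "complex set"
  assumes "compact K" "open W" "K \<subseteq> W"
  obtains d K2 where "d > 0" "compact K2" "K2 \<subseteq> W" "\<And>x y. x \<in> K \<Longrightarrow> dist x y \<le> d \<Longrightarrow> y \<in> interior K2"
proof -
  obtain e where e: "e > 0" "\<And>x y. x \<in> K \<Longrightarrow> dist x y < e \<Longrightarrow> y \<in> W"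
    using compact_subset_open_imp_ball_epsilon_subset[OF assms] by (metis UN_iff mem_ball subsetD)
  define K2 where "K2 = {x + y | x y. x \<in> K \<and> y \<in> cball 0 (e/2)}"
  show ?thesis
  proof (rule that)
    show "e/4 > 0" using e by simp
    show "compact K2" unfolding K2_def by (intro compact_sums assms compact_cball)
    show "K2 \<subseteq> W" unfolding K2_def using e by (auto simp: dist_norm)
    fix x y assume xy: "x \<in> K" "dist x y \<le> e/4"
    have "ball x (e/2) \<subseteq> K2"
    proof
      fix z assume "z \<in> ball x (e/2)"
      then show "z \<in> K2" unfolding K2_def using xy
        by (intro CollectI exI[of _ x] exI[of _ "z - x"]) (auto simp: dist_norm norm_minus_commute)
    qed
    then have "ball x (e/2) \<subseteq> interior K2" by (intro interior_maximal) auto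
    then show "y \<in> interior K2" using xy e by auto
  qed
qed

lemma compact_holomorphic_bound:
  assumes "compact K" "f holomorphic_on W" "K \<subseteq> W"
  obtains B where "B \<ge> 1" "\<And>z. z \<in> K \<Longrightarrow> cmod (f z) \<le> B"
proof -
  have "compact (f ` K)"
    using assms by (intro compact_continuous_image holomorphic_on_imp_continuous_on) (auto elim: holomorphic_on_subset)
  then obtain b where "\<And>z. z \<in> K \<Longrightarrow> cmod (f z) \<le> b"
    using compact_imp_bounded bounded_iff by (metis imageI)
  then show ?thesis by (intro that[of "max b 1"]) (auto simp: le_max_iff_disj)
qed

text \<open>Solving \<open>G1 \<circ> \<xi> = H\<close> for \<open>G1, H\<close> close to \<open>G\<close>, by simplified Newton iteration. The error
  weight \<open>w\<close> is dominated by \<open>\<bar>G'\<bar>\<close>, so it vanishes at the critical points of \<open>G\<close>, where the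
  iteration stays put (there the quotient is \<open>x / 0 = 0\<close>).\<close>

lemma newton_lift:
  fixes G :: "complex \<Rightarrow> complex" and w :: "complex \<Rightarrow> real"
  assumes W: "open W" and K: "compact K" "K \<subseteq> W" and G: "G holomorphic_on W"
    and iso: "\<And>z. z \<in> W \<Longrightarrow> \<forall>\<^sub>F y in at z. deriv G y \<noteq> 0"
    and w0: "\<And>z. z \<in> W \<Longrightarrow> 0 \<le> w z" and wC: "\<And>z. z \<in> W \<Longrightarrow> w z \<le> C * cmod (deriv G z)"
  obtains V where "open V" "K \<subseteq> V" "V \<subseteq> W"
    "\<And>\<epsilon>. \<epsilon> > 0 \<Longrightarrow> \<exists>\<kappa>>0. \<forall>G1 H. G1 holomorphic_on W \<longrightarrow> H holomorphic_on W \<longrightarrow>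
       (\<forall>z\<in>W. cmod (G1 z - G z) \<le> \<kappa> * (w z * cmod (deriv G z))) \<longrightarrow>
       (\<forall>z\<in>W. cmod (H z - G z) \<le> \<kappa> * (w z * cmod (deriv G z))) \<longrightarrow>
       (\<exists>\<xi>. \<xi> holomorphic_on V \<and> (\<forall>z\<in>V. \<xi> z \<in> W \<and> G1 (\<xi> z) = H z \<and> cmod (\<xi> z - z) \<le> \<epsilon> * w z))"
proof -
  obtain D K2 where D: "D > 0" "compact K2" "K2 \<subseteq> W" "\<And>x y. x \<in> K \<Longrightarrow> dist x y \<le> D \<Longrightarrow> y \<in> interior K2"
    using compact_fatten[OF K(1) W K(2)] by metis
  define d where "d = D / 2"
  have d: "d > 0" using D by (simp add: d_def)
  define V where "V = (\<Union>x\<in>K. ball x d)"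
  have VK2: "cball z d \<subseteq> K2" if z: "z \<in> V" for z
  proof
    fix y assume "y \<in> cball z d"
    moreover obtain x where "x \<in> K" "dist x z < d" using z by (auto simp: V_def)
    ultimately have "dist x y \<le> D" using dist_triangle[of x y z] by (auto simp: d_def)
    then show "y \<in> K2" using D(4) \<open>x \<in> K\<close> interior_subset by blast
  qed
  have VinK2: "z \<in> K2" if "z \<in> V" for z using VK2[OF that] d by auto
  have VW: "V \<subseteq> W"
  proof
    fix z assume "z \<in> V"
    then have "z \<in> K2" using VK2[of z] d by auto
    then show "z \<in> W" using D by auto
  qed
  have openV: "open V" unfolding V_def by auto
  have KV: "K \<subseteq> V" unfolding V_def using d by force
  have hG': "deriv G holomorphic_on W" by (intro holomorphic_deriv G W)
  have hG'': "deriv (deriv G) holomorphic_on W" by (intro holomorphic_deriv hG' W)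
  obtain B where B: "B \<ge> 1" "\<And>z. z \<in> K2 \<Longrightarrow> cmod (deriv G z) \<le> B"
    using compact_holomorphic_bound[OF D(2) hG' D(3)] by metis
  obtain M where M: "M \<ge> 1" "\<And>z. z \<in> K2 \<Longrightarrow> cmod (deriv (deriv G) z) \<le> M"
    using compact_holomorphic_bound[OF D(2) hG'' D(3)] by metis
  \<comment> \<open>On \<open>cball z (r * cmod (deriv G z))\<close> one stays inside
    \<open>K2\<close>, and \<open>deriv G\<close> varies by at most a quarter of its modulus at
    \<open>z\<close>. The radius has to shrink with the derivative.\<close>
  define r where "r = min (d / B) (1 / (4 * M))"
  have r: "r > 0" "r * B \<le> d" "M * r \<le> 1/4"
    using d B(1) M(1) by (auto simp: r_def min_def field_simps)
  have rgB: "r * cmod (deriv G z) \<le> r * B" if "z \<in> V" for z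
    using B(2)[OF VinK2[OF that]] r(1) by (intro mult_left_mono) auto
  define C1 where "C1 = max C 1"
  have C1: "C1 \<ge> 1" "\<And>z. z \<in> W \<Longrightarrow> w z \<le> C1 * cmod (deriv G z)"
  proof -
    show "C1 \<ge> 1" by (simp add: C1_def)
    fix z assume "z \<in> W"
    then show "w z \<le> C1 * cmod (deriv G z)"
      using wC[of z] mult_right_mono[of C C1 "cmod (deriv G z)"] by (auto simp: C1_def)
  qed
  have main: "\<exists>\<kappa>>0. \<forall>G1 H. G1 holomorphic_on W \<longrightarrow> H holomorphic_on W \<longrightarrow>
       (\<forall>z\<in>W. cmod (G1 z - G z) \<le> \<kappa> * (w z * cmod (deriv G z))) \<longrightarrow>
       (\<forall>z\<in>W. cmod (H z - G z) \<le> \<kappa> * (w z * cmod (deriv G z))) \<longrightarrow>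
       (\<exists>\<xi>. \<xi> holomorphic_on V \<and> (\<forall>z\<in>V. \<xi> z \<in> W \<and> G1 (\<xi> z) = H z \<and> cmod (\<xi> z - z) \<le> \<epsilon> * w z))"
    if eps: "\<epsilon> > 0" for \<epsilon> :: real
  proof -
    \<comment> \<open>The second entry makes the first Newton increment at most an eighth of
      \<open>r * cmod (deriv G z)\<close>; the total displacement, at most twice that, stays inside
      the disc of half the radius on which the iteration contracts.\<close>
    define \<kappa> where "\<kappa> = min (\<epsilon> / 4) (r / (16 * C1))"
    have kap: "\<kappa> > 0" "4 * \<kappa> \<le> \<epsilon>" "\<kappa> * C1 \<le> r / 16"
      using eps r C1(1) by (auto simp: \<kappa>_def min_def field_simps)
    show ?thesis
    proof (rule exI[of _ \<kappa>], intro conjI allI impI)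
      show "\<kappa> > 0" by (fact kap)
      fix G1 H
      assume G1: "G1 holomorphic_on W" and H: "H holomorphic_on W"
        and aG: "\<forall>z\<in>W. cmod (G1 z - G z) \<le> \<kappa> * (w z * cmod (deriv G z))"
        and bG: "\<forall>z\<in>W. cmod (H z - G z) \<le> \<kappa> * (w z * cmod (deriv G z))"
      define xi where "xi = rec_nat (\<lambda>z. z) (\<lambda>_ x z. x z - (G1 (x z) - H z) / deriv G z)"
      have xi0[simp]: "xi 0 z = z" and xiS: "xi (Suc k) z = xi k z - (G1 (xi k z) - H z) / deriv G z" for k z
        by (simp_all add: xi_def)
      define del where "del = (\<lambda>z. cmod ((G1 z - H z) / deriv G z))"
      have del: "del z \<le> 2 * \<kappa> * w z" "del z \<le> r * cmod (deriv G z) / 8" if "z \<in> V" for z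
      proof -
        have zW: "z \<in> W" using that VW by auto
        have "cmod (G1 z - H z) \<le> cmod (G1 z - G z) + cmod (H z - G z)"
          by (metis norm_triangle_ineq4 diff_diff_eq2 diff_add_cancel add_diff_cancel_right')
        also have "\<dots> \<le> 2 * \<kappa> * w z * cmod (deriv G z)" using aG bG zW by force
        finally show *: "del z \<le> 2 * \<kappa> * w z"
          unfolding del_def norm_divide using kap w0[OF zW] by (cases "deriv G z = 0") (auto simp: divide_simps)
        have "\<kappa> * w z \<le> \<kappa> * (C1 * cmod (deriv G z))" using C1(2)[OF zW] kap by (intro mult_left_mono) auto
        also have "\<dots> \<le> r / 16 * cmod (deriv G z)" using kap(3) by (metis mult.assoc mult_right_mono norm_ge_zero)
        finally show "del z \<le> r * cmod (deriv G z) / 8" using * by simp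
      qed
      \<comment> \<open>The derivative of the Newton map is
        \<open>1 - deriv G1 x / deriv G z\<close>; the variation of \<open>deriv G\<close> and the
        derivative of \<open>G1 - G\<close> contribute at most a quarter each.\<close>
      have contr: "cmod ((u - (G1 u - H z) / deriv G z) - (v - (G1 v - H z) / deriv G z)) \<le> 1/2 * cmod (u - v)"
        if z: "z \<in> V" and uv: "u \<in> cball z (r * cmod (deriv G z) / 2)" "v \<in> cball z (r * cmod (deriv G z) / 2)" for z u v
      proof (cases "deriv G z = 0")
        case True then show ?thesis using uv by simp
      next
        case False
        define g where "g = cmod (deriv G z)"
        have g: "g > 0" using False by (simp add: g_def)
        have zW: "z \<in> W" and zK2: "z \<in> K2" using z VW VK2[OF z] d by auto
        have gB: "r * g \<le> d"
        proof -
          have "r * g \<le> r * B" using B(2)[OF zK2] r(1) by (intro mult_left_mono) (auto simp: g_def)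
          then show ?thesis using r by linarith
        qed
        have DK2: "cball z (r * g) \<subseteq> K2" using VK2[OF z] gB by force
        have dG: "cmod (deriv G y - deriv G z) \<le> g / 4" if y: "y \<in> cball z (r * g)" for y
        proof -
          have "cmod (deriv G y - deriv G z) \<le> M * cmod (y - z)"
          proof (rule field_differentiable_bound[where S="cball z (r * g)" and f'="deriv (deriv G)"])
            fix x assume "x \<in> cball z (r * g)"
            then have x: "x \<in> K2" using DK2 by auto
            then show "(deriv G has_field_derivative deriv (deriv G) x) (at x within cball z (r * g))"
              using hG' W D(3) by (meson holomorphic_derivI subsetD has_field_derivative_at_within)
            show "cmod (deriv (deriv G) x) \<le> M" using M x by auto
          qed (use y r g in auto)
          also have "\<dots> \<le> M * (r * g)" using y M by (intro mult_left_mono) (auto simp: dist_norm norm_minus_commute)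
          also have "\<dots> \<le> 1/4 * g" using r(3) g by (metis mult.assoc mult_right_mono less_imp_le)
          finally show ?thesis by simp
        qed
        \<comment> \<open>As \<open>w\<close> is dominated by the derivative, the error is quadratic
          in \<open>g\<close>. Cauchy's estimate with radius \<open>r * g / 2\<close> costs one
          factor \<open>g\<close> and leaves a bound linear in \<open>g\<close>, as required for the
          division by \<open>deriv G z\<close>.\<close>
        have aB: "cmod (G1 y - G y) \<le> \<kappa> * C1 * (25/16 * g^2)" if y: "y \<in> cball z (r * g)" for y
        proof -
          have yW: "y \<in> W" using y DK2 D(3) by auto
          have "cmod (deriv G y) \<le> 5/4 * g" using dG[OF y] norm_triangle_ineq2[of "deriv G y" "deriv G z"] unfolding g_def by linarith
          then have sq: "(cmod (deriv G y))^2 \<le> (5/4 * g)^2" by (intro power_mono) auto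
          have "cmod (G1 y - G y) \<le> \<kappa> * (w y * cmod (deriv G y))" using aG yW by auto
          also have "\<dots> \<le> \<kappa> * ((C1 * cmod (deriv G y)) * cmod (deriv G y))"
            using C1(2)[OF yW] kap by (intro mult_left_mono mult_right_mono) auto
          also have "\<dots> = \<kappa> * C1 * (cmod (deriv G y))^2" by (simp add: power2_eq_square)
          also have "\<dots> \<le> \<kappa> * C1 * (5/4 * g)^2" using sq kap C1(1) by (intro mult_left_mono) auto
          finally show ?thesis by (simp add: power2_eq_square)
        qed
        have hola: "(\<lambda>y. G1 y - G y) holomorphic_on W" by (intro holomorphic_intros G1 G)
        have da: "cmod (deriv (\<lambda>y. G1 y - G y) x) \<le> g / 4" if x: "x \<in> cball z (r * g / 2)" for x
        proof -
          have sub: "cball x (r * g / 2) \<subseteq> cball z (r * g)"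
            using x by (intro subsetI) (smt (verit, best) dist_commute dist_triangle2 field_sum_of_halves mem_cball)
          have subW: "cball x (r * g / 2) \<subseteq> W" using sub DK2 D(3) by auto
          have "cmod ((deriv ^^ 1) (\<lambda>y. G1 y - G y) x) \<le> fact 1 * (\<kappa> * C1 * (25/16 * g^2)) / (r * g / 2) ^ 1"
          proof (rule Cauchy_inequality)
            show "(\<lambda>y. G1 y - G y) holomorphic_on ball x (r * g / 2)"
              using hola holomorphic_on_subset subW ball_subset_cball by (metis order_trans)
            show "continuous_on (cball x (r * g / 2)) (\<lambda>y. G1 y - G y)"
              using hola subW by (meson continuous_on_subset holomorphic_on_imp_continuous_on)
            show "0 < r * g / 2" using r g by simp
            fix y assume "cmod (x - y) = r * g / 2"
            then have "y \<in> cball x (r * g / 2)" by (simp add: dist_norm)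
            then show "cmod (G1 y - G y) \<le> \<kappa> * C1 * (25/16 * g^2)" using aB sub by auto
          qed
          also have "\<dots> = \<kappa> * C1 * (25/8 * g / r)" using r g by (simp add: power2_eq_square field_simps)
          also have "\<dots> \<le> r / 16 * (25/8 * g / r)" using kap(3) r g by (intro mult_right_mono) auto
          also have "\<dots> \<le> g / 4" using r g by simp
          finally show ?thesis by simp
        qed
        have "cmod ((u - (G1 u - H z) / deriv G z) - (v - (G1 v - H z) / deriv G z)) \<le> 1/2 * cmod (u - v)"
        proof (rule field_differentiable_bound[where S="cball z (r * g / 2)" and f'="\<lambda>x. 1 - deriv G1 x / deriv G z"])
          fix x assume x: "x \<in> cball z (r * g / 2)"
          moreover have "r * g > 0" using r g by simp
          ultimately have x2: "x \<in> cball z (r * g)" unfolding mem_cball by linarith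
          have xW: "x \<in> W" using x2 DK2 D(3) by auto
          have d1: "(G1 has_field_derivative deriv G1 x) (at x)" and d2: "(G has_field_derivative deriv G x) (at x)"
            using xW G1 G W holomorphic_derivI by blast+
          show "((\<lambda>y. y - (G1 y - H z) / deriv G z) has_field_derivative 1 - deriv G1 x / deriv G z)
             (at x within cball z (r * g / 2))"
            using False by (auto intro!: derivative_eq_intros has_field_derivative_at_within[OF d1])
          have "deriv (\<lambda>y. G1 y - G y) x = deriv G1 x - deriv G x"
            using DERIV_diff[OF d1 d2] by (rule DERIV_imp_deriv)
          then have "cmod (deriv G1 x - deriv G z) \<le> g / 4 + g / 4"
            using da[OF x] dG[OF x2] norm_triangle_ineq[of "deriv G1 x - deriv G x" "deriv G x - deriv G z"] by simp
          moreover have "1 - deriv G1 x / deriv G z = - ((deriv G1 x - deriv G z) / deriv G z)"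
            using False by (simp add: field_simps)
          then have "cmod (1 - deriv G1 x / deriv G z) = cmod (deriv G1 x - deriv G z) / g"
            by (simp add: norm_divide g_def)
          ultimately show "cmod (1 - deriv G1 x / deriv G z) \<le> 1/2" using g by (simp add: pos_divide_le_eq)
        qed (use uv g_def in auto)
        then show ?thesis .
      qed
      have step: "cmod (xi (Suc k) z - xi k z) \<le> del z / 2 ^ k \<and> cmod (xi k z - z) \<le> 2 * (1 - 1 / 2 ^ k) * del z"
        if z: "z \<in> V" for k z
      proof (induction k)
        case 0
        then show ?case by (simp add: xiS del_def norm_divide norm_minus_commute)
      next
        case (Suc k)
        have d0: "del z \<ge> 0" by (simp add: del_def)
        have e1: "cmod (xi (Suc k) z - z) \<le> 2 * (1 - 1 / 2 ^ Suc k) * del z"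
        proof -
          have "cmod (xi (Suc k) z - z) \<le> cmod (xi (Suc k) z - xi k z) + cmod (xi k z - z)"
            using norm_triangle_ineq[of "xi (Suc k) z - xi k z" "xi k z - z"] by simp
          also have "\<dots> \<le> del z / 2 ^ k + 2 * (1 - 1 / 2 ^ k) * del z" using Suc by auto
          also have "\<dots> = 2 * (1 - 1 / 2 ^ Suc k) * del z" by (simp add: field_simps)
          finally show ?thesis .
        qed
        have inD: "xi j z \<in> cball z (r * cmod (deriv G z) / 2)" if "cmod (xi j z - z) \<le> 2 * (1 - 1 / 2 ^ j) * del z" for j
        proof -
          have "2 * (1 - 1 / 2 ^ j) * del z \<le> 2 * 1 * del z" using d0 by (intro mult_right_mono) auto
          then show ?thesis using del(2)[OF z] that d0 by (simp add: dist_norm norm_minus_commute)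
        qed
        have "cmod (xi (Suc (Suc k)) z - xi (Suc k) z) \<le> 1/2 * cmod (xi (Suc k) z - xi k z)"
          using contr[OF z inD[of "Suc k"] inD[of k]] e1 Suc by (simp add: xiS)
        also have "\<dots> \<le> del z / 2 ^ Suc k" using Suc by simp
        finally show ?case using e1 by simp
      qed
      have xiW: "xi k z \<in> W" if z: "z \<in> V" for k z
      proof -
        have d0: "del z \<ge> 0" by (simp add: del_def)
        have "2 * (1 - 1 / 2 ^ k) * del z \<le> 2 * 1 * del z" using d0 by (intro mult_right_mono) auto
        then have "cmod (xi k z - z) \<le> r * cmod (deriv G z) / 4" using step[OF z, of k] del(2)[OF z] by auto
        also have "\<dots> \<le> r * B / 4" using rgB[OF z] by linarith
        also have "\<dots> \<le> d" using r d by simp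
        finally have "xi k z \<in> cball z d" by (simp add: dist_norm norm_minus_commute)
        then show ?thesis using VK2[OF z] D(3) by blast
      qed
      \<comment> \<open>The iterates contain quotients by \<open>deriv G\<close>, so holomorphy is
        obtained away from the critical points before it is extended over them.\<close>
      define V0 where "V0 = V - {z. deriv G z = 0}"
      have openV0: "open V0"
      proof -
        have "open (W \<inter> deriv G -` (- {0}))"
          using hG' W by (intro continuous_open_preimage holomorphic_on_imp_continuous_on) auto
        moreover have "V0 = V \<inter> (W \<inter> deriv G -` (- {0}))" using VW by (auto simp: V0_def)
        ultimately show ?thesis using openV by auto
      qed
      have xihol: "xi k holomorphic_on V0" for k
      proof (induction k)
        case 0 have "xi 0 = (\<lambda>z. z)" by (rule ext) simp
        then show ?case by simp
      next
        case (Suc k)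
        have h1: "(\<lambda>z. G1 (xi k z)) holomorphic_on V0"
          using holomorphic_on_compose_gen[OF Suc G1] xiW by (auto simp: o_def V0_def)
        have h2: "H holomorphic_on V0" "deriv G holomorphic_on V0"
          using H hG' VW by (auto intro: holomorphic_on_subset simp: V0_def)
        have "(\<lambda>z. xi k z - (G1 (xi k z) - H z) / deriv G z) holomorphic_on V0"
          by (intro holomorphic_on_diff holomorphic_on_divide Suc h1 h2) (auto simp: V0_def)
        moreover have "xi (Suc k) = (\<lambda>z. xi k z - (G1 (xi k z) - H z) / deriv G z)" by (rule ext) (simp add: xiS)
        ultimately show ?case by simp
      qed
      \<comment> \<open>The majorant is independent of \<open>z\<close>, so the convergence is
        uniform across the critical points.\<close>
      have "uniform_limit V (\<lambda>n z. \<Sum>k<n. xi (Suc k) z - xi k z) (\<lambda>z. \<Sum>k. xi (Suc k) z - xi k z) sequentially"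
      proof (rule Weierstrass_m_test)
        show "summable (\<lambda>k. r * B / 8 * (1/2) ^ k)" by (intro summable_mult summable_geometric) auto
        fix k z assume z: "z \<in> V"
        have "del z \<le> r * B / 8" using del(2)[OF z] rgB[OF z] by linarith
        then have "del z / 2 ^ k \<le> r * B / 8 / 2 ^ k" by (intro divide_right_mono) auto
        then have "cmod (xi (Suc k) z - xi k z) \<le> r * B / 8 / 2 ^ k"
          using step[OF z, of k] by linarith
        then show "cmod (xi (Suc k) z - xi k z) \<le> r * B / 8 * (1/2) ^ k"
          by (simp add: power_divide)
      qed
      moreover define \<xi> where "\<xi> = (\<lambda>z. z + (\<Sum>k. xi (Suc k) z - xi k z))"
      ultimately have "uniform_limit V (\<lambda>n z. z + (\<Sum>k<n. xi (Suc k) z - xi k z)) \<xi> sequentially"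
        unfolding \<xi>_def by (intro uniform_limit_intros)
      moreover have "z + (\<Sum>k<n. xi (Suc k) z - xi k z) = xi n z" for n z
        using sum_lessThan_telescope[of "\<lambda>k. xi k z" n] by simp
      ultimately have ul: "uniform_limit V xi \<xi> sequentially" by simp
      have lim: "(\<lambda>n. xi n z) \<longlonglongrightarrow> \<xi> z" if "z \<in> V" for z
        using tendsto_uniform_limitI[OF ul that] .
      have close: "cmod (\<xi> z - z) \<le> 2 * del z" if z: "z \<in> V" for z
      proof (rule LIMSEQ_le_const2)
        show "(\<lambda>n. cmod (xi n z - z)) \<longlonglongrightarrow> cmod (\<xi> z - z)" by (intro tendsto_intros lim z)
        have "cmod (xi n z - z) \<le> 2 * del z" for n
        proof -
          have "2 * (1 - 1 / 2 ^ n) * del z \<le> 2 * 1 * del z" by (intro mult_right_mono) (auto simp: del_def)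
          then show ?thesis using order_trans[OF conjunct2[OF step[OF z]]] by simp
        qed
        then show "\<exists>N. \<forall>n\<ge>N. cmod (xi n z - z) \<le> 2 * del z" by blast
      qed
      have xW: "\<xi> z \<in> W" if z: "z \<in> V" for z
      proof -
        have "cmod (\<xi> z - z) \<le> r * cmod (deriv G z) / 4" using close[OF z] del(2)[OF z] by auto
        also have "\<dots> \<le> r * B / 4" using rgB[OF z] by linarith
        also have "\<dots> \<le> d" using r d by simp
        finally have "\<xi> z \<in> cball z d" by (simp add: dist_norm norm_minus_commute)
        then show ?thesis using VK2[OF z] D(3) by blast
      qed
      have solves: "G1 (\<xi> z) = H z" if z: "z \<in> V" for z
      proof (cases "deriv G z = 0")
        case True
        have zW: "z \<in> W" using z VW by auto
        have "del z = 0" using True by (simp add: del_def)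
        then have "\<xi> z = z" using close[OF z] by simp
        moreover have "G1 z = G z" "H z = G z" using aG bG zW True by auto
        ultimately show ?thesis by simp
      next
        case False
        have "isCont G1 (\<xi> z)" using G1 W xW[OF z] continuous_on_eq_continuous_at holomorphic_on_imp_continuous_on by blast
        then have "(\<lambda>n. xi n z - (G1 (xi n z) - H z) / deriv G z) \<longlonglongrightarrow> \<xi> z - (G1 (\<xi> z) - H z) / deriv G z"
          by (intro tendsto_intros lim z isCont_tendsto_compose[OF _ lim[OF z]]) (use False in auto)
        moreover have "(\<lambda>n. xi (Suc n) z) \<longlonglongrightarrow> \<xi> z" using lim[OF z] by (rule LIMSEQ_Suc)
        ultimately have "\<xi> z - (G1 (\<xi> z) - H z) / deriv G z = \<xi> z" unfolding xiS using LIMSEQ_unique by blast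
        then show ?thesis using False by auto
      qed
      have hol0: "\<xi> holomorphic_on V0"
      proof (rule holomorphic_uniform_sequence[OF openV0 xihol])
        fix z assume "z \<in> V0"
        then obtain e where "e > 0" "cball z e \<subseteq> V0" using openV0 open_contains_cball by blast
        then show "\<exists>d>0. cball z d \<subseteq> V0 \<and> uniform_limit (cball z d) xi \<xi> sequentially"
          using uniform_limit_on_subset[OF ul] by (auto simp: V0_def intro!: exI[of _ e])
      qed
      have "\<xi> holomorphic_on V"
      proof -
        have "\<exists>e>0. \<xi> holomorphic_on ball z e" if z: "z \<in> V" for z
        proof (cases "deriv G z = 0")
          case False
          then have "z \<in> V0" using z by (simp add: V0_def)
          then obtain e where "e > 0" "ball z e \<subseteq> V0" using openV0 open_contains_ball by blast
          then show ?thesis using hol0 holomorphic_on_subset by blast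
        next
          case True
          have zW: "z \<in> W" using z VW by auto
          obtain e1 where e1: "e1 > 0" "\<And>y. y \<noteq> z \<Longrightarrow> dist y z < e1 \<Longrightarrow> deriv G y \<noteq> 0"
            using iso[OF zW] unfolding eventually_at by auto
          obtain e2 where e2: "e2 > 0" "ball z e2 \<subseteq> V" using openV z open_contains_ball by blast
          define e where "e = min e1 e2"
          have e: "e > 0" "ball z e - {z} \<subseteq> V0" "ball z e \<subseteq> V"
            using e1 e2 by (auto simp: e_def V0_def dist_commute)
          have h: "\<xi> holomorphic_on ball z e - {z}" using hol0 e holomorphic_on_subset by blast
          have xz: "\<xi> z = z" using close[OF z] True by (simp add: del_def)
          \<comment> \<open>The displacement is bounded by a multiple of
            \<open>cmod (deriv G y)\<close>, which tends to 0 at a critical point. Hence the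
            isolated singularity of \<open>\<xi>\<close> there is removable.\<close>
          have "isCont \<xi> z"
          proof -
            have cG: "(deriv G \<longlongrightarrow> 0) (at z)"
              using hG' W zW continuous_on_eq_continuous_at holomorphic_on_imp_continuous_on True isContD by metis
            have "((\<lambda>y. \<xi> y - y) \<longlongrightarrow> 0) (at z)"
            proof (rule Lim_null_comparison)
              show "\<forall>\<^sub>F y in at z. norm (\<xi> y - y) \<le> r * cmod (deriv G y) / 4"
                unfolding eventually_at
              proof (intro exI[of _ e] conjI ballI impI e)
                fix y assume "y \<noteq> z \<and> dist y z < e"
                then have "y \<in> V" using e by (auto simp: dist_commute)
                then show "norm (\<xi> y - y) \<le> r * cmod (deriv G y) / 4" using close[of y] del(2)[of y] by auto
              qed
              show "((\<lambda>y. r * cmod (deriv G y) / 4) \<longlongrightarrow> 0) (at z)"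
                by (rule tendsto_eq_intros cG refl | simp)+
            qed
            then have "((\<lambda>y. (\<xi> y - y) + y) \<longlongrightarrow> 0 + z) (at z)" by (intro tendsto_add tendsto_ident_at)
            then show ?thesis using xz by (simp add: isCont_def)
          qed
          moreover have "isCont \<xi> y" if "y \<in> ball z e - {z}" for y
            using h that holomorphic_on_imp_continuous_on[OF h]
            by (metis continuous_on_eq_continuous_at finite.emptyI finite_insert finite_imp_closed open_Diff open_ball)
          ultimately have "continuous_on (ball z e) \<xi>"
            by (metis DiffI continuous_at_imp_continuous_on singletonD)
          then have "\<xi> holomorphic_on ball z e"
            using no_isolated_singularity[of "ball z e" \<xi> "{z}"] h by auto
          then show ?thesis using e by auto
        qed
        then show ?thesis
          by (metis openV centre_in_ball holomorphic_on_open holomorphic_on_def field_differentiable_at_within open_ball at_within_open field_differentiable_def)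
      qed
      moreover have "cmod (\<xi> z - z) \<le> \<epsilon> * w z" if z: "z \<in> V" for z
      proof -
        have "cmod (\<xi> z - z) \<le> 4 * \<kappa> * w z" using close[OF z] del(1)[OF z] by auto
        also have "\<dots> \<le> \<epsilon> * w z" using kap(2) w0[of z] z VW by (intro mult_right_mono) auto
        finally show ?thesis .
      qed
      ultimately show "\<exists>\<xi>. \<xi> holomorphic_on V \<and> (\<forall>z\<in>V. \<xi> z \<in> W \<and> G1 (\<xi> z) = H z \<and> cmod (\<xi> z - z) \<le> \<epsilon> * w z)"
        using xW solves by blast
    qed
  qed
  show ?thesis using that[OF openV KV VW main] by blast
qed

section \<open>Smooth functions of a complex variable\<close>

lemma frechet_derivativeI: "(f has_derivative f') (at x) \<Longrightarrow> frechet_derivative f (at x) v = f' v"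
  using frechet_derivative_at by metis

lemma C_k_Suc_imp: "C_k (Suc k) g \<Longrightarrow> C_k k g"
proof (induction k arbitrary: g)
  case 0
  then show ?case by (auto intro!: continuous_at_imp_continuous_on differentiable_imp_continuous_within)
next
  case (Suc k)
  then show ?case by (metis C_k.simps(2))
qed

lemma C_k_Suc_derivI:
  assumes d: "\<And>z. (g has_derivative g' z) (at z)" and "\<And>v. C_k k (\<lambda>z. g' z v)"
  shows "C_k (Suc k) g"
proof -
  have "frechet_derivative g (at z) v = g' z v" for z v by (rule frechet_derivativeI[OF d])
  then show ?thesis using assms unfolding C_k.simps by (auto simp: differentiable_def)
qed

lemma C_k_linear:
  assumes "bounded_linear L" "C_k k g" shows "C_k k (\<lambda>z. L (g z))"
  using assms(2)
proof (induction k arbitrary: g)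
  case 0
  then show ?case using bounded_linear.continuous_on[OF assms(1)] by auto
next
  case (Suc k)
  have d: "((\<lambda>z. L (g z)) has_derivative (\<lambda>v. L (frechet_derivative g (at z) v))) (at z)" for z
    using Suc.prems by (intro bounded_linear.has_derivative[OF assms(1)]) (simp flip: frechet_derivative_works)
  show ?case by (rule C_k_Suc_derivI[OF d]) (use Suc in auto)
qed

lemma C_k_const: "C_k k (\<lambda>z. c)"
  by (induction k arbitrary: c) auto

lemma C_k_id: "C_k k (\<lambda>z. z)"
proof (cases k)
  case (Suc j)
  then show ?thesis by (auto simp: frechet_derivativeI[OF has_derivative_ident] C_k_const)
qed auto

lemma C_k_add: "C_k k f \<Longrightarrow> C_k k g \<Longrightarrow> C_k k (\<lambda>z. f z + g z)"
proof (induction k arbitrary: f g)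
  case 0 then show ?case by (auto intro!: continuous_intros)
next
  case (Suc k)
  have d: "((\<lambda>z. f z + g z) has_derivative (\<lambda>v. frechet_derivative f (at z) v + frechet_derivative g (at z) v)) (at z)" for z
    using Suc.prems by (intro has_derivative_add) (simp_all flip: frechet_derivative_works)
  show ?case by (rule C_k_Suc_derivI[OF d]) (use Suc in auto)
qed

lemma C_k_mult: "C_k k f \<Longrightarrow> C_k k g \<Longrightarrow> C_k k (\<lambda>z. f z * g z)"
proof (induction k arbitrary: f g)
  case 0 then show ?case by (auto intro!: continuous_intros)
next
  case (Suc k)
  have d: "((\<lambda>z. f z * g z) has_derivative (\<lambda>v. f z * frechet_derivative g (at z) v + frechet_derivative f (at z) v * g z)) (at z)" for z
    using Suc.prems by (intro has_derivative_mult) (simp_all flip: frechet_derivative_works)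
  have "C_k k f" "C_k k g" using Suc.prems C_k_Suc_imp by blast+
  then have "C_k k (\<lambda>z. f z * frechet_derivative g (at z) v + frechet_derivative f (at z) v * g z)" for v
    using Suc by (intro C_k_add Suc.IH) auto
  then show ?case by (rule C_k_Suc_derivI[OF d])
qed

lemma C_k_minus: "C_k k f \<Longrightarrow> C_k k (\<lambda>z. - f z)"
  using C_k_linear[OF bounded_linear_minus[OF bounded_linear_ident]] by auto

lemma C_k_diff: "C_k k f \<Longrightarrow> C_k k g \<Longrightarrow> C_k k (\<lambda>z. f z - g z)"
  using C_k_add[of k f "\<lambda>z. - g z"] C_k_minus[of k g] by simp

text \<open>\<open>C_k\<close> is defined for complex-valued functions only, so real and imaginary
  parts are embedded back into the complex numbers.\<close>

lemma bounded_linear_Re_complex: "bounded_linear (\<lambda>z. complex_of_real (Re z))"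
  using bounded_linear_compose[OF bounded_linear_of_real bounded_linear_Re] .

lemma bounded_linear_Im_complex: "bounded_linear (\<lambda>z. complex_of_real (Im z))"
  using bounded_linear_compose[OF bounded_linear_of_real bounded_linear_Im] .

lemmas C_k_Re = C_k_linear[OF bounded_linear_Re_complex]
lemmas C_k_Im = C_k_linear[OF bounded_linear_Im_complex]
lemmas C_k_cnj = C_k_linear[OF bounded_linear_cnj]

lemma frechet_derivative_components:
  assumes "g differentiable at z"
  shows "frechet_derivative g (at z) v = complex_of_real (Re v) * frechet_derivative g (at z) 1
       + complex_of_real (Im v) * frechet_derivative g (at z) \<i>"
proof -
  have l: "bounded_linear (frechet_derivative g (at z))"
    using assms frechet_derivative_works has_derivative_bounded_linear by blast
  have "frechet_derivative g (at z) (a *\<^sub>R 1 + b *\<^sub>R \<i>)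
      = a *\<^sub>R frechet_derivative g (at z) 1 + b *\<^sub>R frechet_derivative g (at z) \<i>" for a b
    using bounded_linear.linear[OF l] by (simp only: linear_add linear_scale)
  moreover have "Re v *\<^sub>R 1 + Im v *\<^sub>R \<i> = v" by (simp add: complex_eq_iff)
  ultimately have "frechet_derivative g (at z) v = Re v *\<^sub>R frechet_derivative g (at z) 1 + Im v *\<^sub>R frechet_derivative g (at z) \<i>"
    by metis
  then show ?thesis by (simp add: scaleR_conv_of_real)
qed

lemma C_k_SucI:
  assumes "\<And>z. g differentiable at z"
    "C_k k (\<lambda>z. frechet_derivative g (at z) 1)" "C_k k (\<lambda>z. frechet_derivative g (at z) \<i>)"
  shows "C_k (Suc k) g"
proof -
  have "C_k k (\<lambda>z. frechet_derivative g (at z) v)" for v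
    unfolding frechet_derivative_components[OF assms(1), of _ v]
    by (intro C_k_add C_k_mult C_k_const assms)
  then show ?thesis using assms by simp
qed

lemma C_k_compose: "C_k k g \<Longrightarrow> C_k k h \<Longrightarrow> C_k k (\<lambda>z. g (h z))"
proof (induction k arbitrary: g h)
  case 0 then show ?case using continuous_on_compose2 by (metis C_k.simps(1) subset_UNIV)
next
  case (Suc k)
  have dg: "g differentiable at z" and dh: "h differentiable at z" for z using Suc.prems by auto
  have d: "((\<lambda>z. g (h z)) has_derivative (\<lambda>v. frechet_derivative g (at (h z)) (frechet_derivative h (at z) v))) (at z)" for z
    using has_derivative_compose[of h _ z UNIV g] dg dh frechet_derivative_works by blast
  have "C_k k h" using Suc.prems C_k_Suc_imp by blast
  then have "C_k k (\<lambda>z. frechet_derivative g (at (h z)) (frechet_derivative h (at z) v))" for v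
    unfolding frechet_derivative_components[OF dg, of _ "frechet_derivative h (at _) v"]
    using Suc.prems Suc.IH[of "\<lambda>z. frechet_derivative g (at z) 1" h] Suc.IH[of "\<lambda>z. frechet_derivative g (at z) \<i>" h]
    by (intro C_k_add C_k_mult C_k_Re C_k_Im) auto
  then show ?case by (rule C_k_Suc_derivI[OF d])
qed

lemma C_k_inverse:
  assumes "\<And>z. g z \<noteq> 0" shows "C_k k g \<Longrightarrow> C_k k (\<lambda>z. inverse (g z))"
proof (induction k)
  case 0 then show ?case using assms by (auto intro!: continuous_intros)
next
  case (Suc k)
  have d: "((\<lambda>z. inverse (g z)) has_derivative (\<lambda>v. - (inverse (g z) * frechet_derivative g (at z) v * inverse (g z)))) (at z)" for z
    using Suc.prems assms by (intro Deriv.has_derivative_inverse) (simp_all flip: frechet_derivative_works)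
  have "C_k k g" using Suc.prems C_k_Suc_imp by blast
  then have "C_k k (\<lambda>z. - (inverse (g z) * frechet_derivative g (at z) v * inverse (g z)))" for v
    using Suc by (intro C_k_minus C_k_mult Suc.IH) auto
  then show ?case by (rule C_k_Suc_derivI[OF d])
qed

lemma C_k_prod: "finite I \<Longrightarrow> (\<And>i. i \<in> I \<Longrightarrow> C_k k (f i)) \<Longrightarrow> C_k k (\<lambda>z. \<Prod>i\<in>I. f i z)"
  by (induction I rule: finite_induct) (auto intro!: C_k_const C_k_mult)

lemma C_k_sum: "finite I \<Longrightarrow> (\<And>i. i \<in> I \<Longrightarrow> C_k k (f i)) \<Longrightarrow> C_k k (\<lambda>z. \<Sum>i\<in>I. f i z)"
  by (induction I rule: finite_induct) (auto intro!: C_k_const C_k_add)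

section \<open>Smooth cutoff functions\<close>

text \<open>The functions \<open>P(1/t) exp(-1/t)\<close>, extended by 0, are closed under
  differentiation. Carrying the polynomial along turns the smoothness of \<open>exp(-1/t)\<close>
  into a single induction over all \<open>P\<close>.\<close>

definition flat :: "real poly \<Rightarrow> real \<Rightarrow> real" where
  "flat P t = (if t > 0 then poly P (1 / t) * exp (- 1 / t) else 0)"

lemma poly_over_exp: "((\<lambda>x. x ^ k * poly P x / exp x) \<longlongrightarrow> (0::real)) at_top"
proof (induction P arbitrary: k)
  case (pCons a P)
  have "((\<lambda>x. a * (x ^ k / exp x) + x ^ Suc k * poly P x / exp x) \<longlongrightarrow> a * 0 + 0) at_top"
    by (intro tendsto_add tendsto_mult tendsto_const tendsto_power_div_exp_0 pCons)
  then show ?case by (simp add: algebra_simps add_divide_distrib)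
qed auto

lemma flat_DERIV: "(flat P has_real_derivative flat ([:0,0,1:] * (P - pderiv P)) t) (at t)"
proof -
  consider "t > 0" | "t < 0" | "t = 0" by linarith
  then show ?thesis
  proof cases
    case 1
    have "((\<lambda>t. poly P (1 / t) * exp (- 1 / t)) has_real_derivative
       flat ([:0,0,1:] * (P - pderiv P)) t) (at t)"
      using 1 unfolding flat_def
      by (auto intro!: derivative_eq_intros DERIV_chain2[OF poly_DERIV] simp: field_simps power2_eq_square)
    moreover have ev: "\<forall>\<^sub>F x in nhds t. flat P x = poly P (1 / x) * exp (- 1 / x)"
      using eventually_nhds_in_open[of "{0<..}" t] 1 by (auto elim!: eventually_mono simp: flat_def)
    ultimately show ?thesis unfolding DERIV_cong_ev[OF refl ev refl] by simp
  next
    case 2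
    have "((\<lambda>t. 0) has_real_derivative flat ([:0,0,1:] * (P - pderiv P)) t) (at t)"
      using 2 by (simp add: flat_def)
    moreover have ev: "\<forall>\<^sub>F x in nhds t. flat P x = 0"
      using eventually_nhds_in_open[of "{..<0}" t] 2 by (auto elim!: eventually_mono simp: flat_def)
    ultimately show ?thesis unfolding DERIV_cong_ev[OF refl ev refl] by simp
  next
    case 3
    have "((\<lambda>h. flat P h / h) \<longlongrightarrow> 0) (at_right 0)"
    proof -
      have "((\<lambda>x. x ^ 1 * poly P x / exp x) \<longlongrightarrow> (0::real)) at_top" by (rule poly_over_exp)
      then have "((\<lambda>h. inverse h ^ 1 * poly P (inverse h) / exp (inverse h)) \<longlongrightarrow> 0) (at_right 0)"
        by (rule filterlim_compose[OF _ filterlim_inverse_at_top_right])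
      moreover have "\<forall>\<^sub>F h in at_right 0. inverse h ^ 1 * poly P (inverse h) / exp (inverse h) = flat P h / h"
        by (auto simp: eventually_at_filter flat_def exp_minus field_simps)
      ultimately show ?thesis by (rule Lim_transform_eventually)
    qed
    moreover have "((\<lambda>h. flat P h / h) \<longlongrightarrow> 0) (at_left 0)"
      by (rule Lim_transform_eventually[OF tendsto_const]) (auto simp: eventually_at_filter flat_def)
    ultimately have "((\<lambda>h. flat P h / h) \<longlongrightarrow> 0) (at 0)" using filterlim_split_at by blast
    then show ?thesis using 3 by (simp add: DERIV_def flat_def)
  qed
qed

lemma C_k_flat: "C_k k (\<lambda>z. complex_of_real (flat P (Re z)))"
proof (induction k arbitrary: P)
  case 0
  have "isCont (flat P) t" for t using flat_DERIV DERIV_isCont by blast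
  then have "continuous_on UNIV (flat P)" by (simp add: continuous_at_imp_continuous_on)
  then show ?case by (auto intro!: continuous_intros continuous_on_compose2[of UNIV "flat P" UNIV Re])
next
  case (Suc k)
  let ?Q = "[:0,0,1:] * (P - pderiv P)"
  have d: "((\<lambda>z. complex_of_real (flat P (Re z))) has_derivative (\<lambda>v. of_real (Re v) * of_real (flat ?Q (Re z)))) (at z)" for z
  proof -
    have "(flat P has_derivative (\<lambda>h. h * flat ?Q (Re z))) (at (Re z))"
      using flat_DERIV[of P "Re z"] by (simp add: has_field_derivative_def mult_commute_abs)
    then have "((\<lambda>z. flat P (Re z)) has_derivative (\<lambda>v. Re v * flat ?Q (Re z))) (at z)"
      using has_derivative_compose[of Re Re z UNIV "flat P" "\<lambda>h. h * flat ?Q (Re z)"]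
      by (auto intro: bounded_linear_imp_has_derivative bounded_linear_Re)
    then have "((\<lambda>z. complex_of_real (flat P (Re z))) has_derivative (\<lambda>v. of_real (Re v * flat ?Q (Re z)))) (at z)"
      by (rule has_derivative_of_real)
    then show ?thesis by simp
  qed
  show ?case by (rule C_k_Suc_derivI[OF d]) (intro C_k_mult C_k_const Suc)
qed

text \<open>The usual quotient of \<open>exp(-1/t)\<close> by
  \<open>exp(-1/t) + exp(-1/(1-t))\<close> for \<open>t = Re z\<close>, each exponential extended by
  0. The denominator is positive since \<open>t\<close> and \<open>1 - t\<close> are never both
  nonpositive.\<close>

definition smooth_step :: "complex \<Rightarrow> complex" where
  "smooth_step z = complex_of_real (flat 1 (Re z)) *
     inverse (complex_of_real (flat 1 (Re z)) + complex_of_real (flat 1 (Re (1 - z))))"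

lemma C_k_smooth_step: "C_k k smooth_step"
  unfolding smooth_step_def
proof (intro C_k_mult C_k_inverse C_k_add C_k_flat)
  show "C_k k (\<lambda>z. complex_of_real (flat 1 (Re (1 - z))))"
    by (intro C_k_compose[OF C_k_flat] C_k_diff C_k_const C_k_id)
  fix z :: complex
  have "flat 1 (Re z) + flat 1 (Re (1 - z)) > 0"
    by (cases "Re z > 0") (auto simp: flat_def add_pos_nonneg)
  then show "complex_of_real (flat 1 (Re z)) + complex_of_real (flat 1 (Re (1 - z))) \<noteq> 0"
    by (metis of_real_add of_real_eq_0_iff less_irrefl)
qed

lemma smooth_step_0: "Re z \<le> 0 \<Longrightarrow> smooth_step z = 0"
  and smooth_step_1: "Re z \<ge> 1 \<Longrightarrow> smooth_step z = 1"
  by (auto simp: smooth_step_def flat_def)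

text \<open>For finitely many bumps \<open>b x\<close> centred in \<open>K\<close>, the product of
  the factors \<open>1 - b x z\<close> vanishes as soon as one bump is 1, and it equals 1 where all
  bumps are 0.\<close>

lemma smooth_cutoff:
  assumes "compact K" "open V" "K \<subseteq> V"
  obtains cf N L where "C_infinity cf" "open N" "K \<subseteq> N" "N \<subseteq> V" "\<And>z. z \<in> N \<Longrightarrow> cf z = 1"
    "compact L" "L \<subseteq> V" "\<And>z. z \<notin> L \<Longrightarrow> cf z = 0"
proof -
  obtain e where e: "e > 0" "\<And>x y. x \<in> K \<Longrightarrow> dist x y < e \<Longrightarrow> y \<in> V"
    using compact_subset_open_imp_ball_epsilon_subset[OF assms] by (metis UN_iff mem_ball subsetD)
  define R where "R = e / 4"
  have R: "R > 0" using e by (simp add: R_def)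
  obtain F where F: "F \<subseteq> K" "finite F" "K \<subseteq> (\<Union>x\<in>F. ball x R)"
    using compactE_image[OF assms(1), of K "\<lambda>x. ball x R"] R by force
  \<comment> \<open>The argument has real part \<open>2 - (dist x z / R)^2\<close>, which is at
    least 1 up to distance \<open>R\<close> and negative from distance \<open>2 * R\<close> on. The
    squared distance is written with \<open>cnj\<close> so that the closure rules for
    \<open>C_k\<close> apply.\<close>
  define b where "b = (\<lambda>x z. smooth_step (2 - (z - x) * cnj (z - x) * of_real (1 / R^2)))"
  have Reb: "Re (2 - (z - x) * cnj (z - x) * of_real (1 / R^2)) = 2 - (dist x z)^2 / R^2" for x z
    unfolding complex_norm_square[symmetric] dist_norm norm_minus_commute[of x]
    by (simp add: power2_eq_square)
  have b1: "b x z = 1" if "dist x z \<le> R" for x z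
  proof -
    have "(dist x z)^2 \<le> R^2" using that by (intro power_mono) auto
    then show ?thesis unfolding b_def using R by (intro smooth_step_1) (unfold Reb, simp)
  qed
  have b0: "b x z = 0" if "dist x z \<ge> 2 * R" for x z
  proof -
    have "(2*R)^2 \<le> (dist x z)^2" using that R by (intro power_mono) auto
    moreover have "(2*R)^2 = 4 * R^2" by (simp add: power_mult_distrib)
    moreover have "0 \<le> R^2" by simp
    ultimately have "2 * R^2 \<le> (dist x z)^2" by linarith
    then show ?thesis unfolding b_def using R by (intro smooth_step_0) (unfold Reb, simp add: field_simps)
  qed
  define cf where "cf = (\<lambda>z. 1 - (\<Prod>x\<in>F. 1 - b x z))"
  show ?thesis
  proof (rule that)
    show "C_infinity cf" unfolding C_infinity_def cf_def b_def using F
      by (intro allI C_k_diff C_k_const C_k_prod C_k_compose[OF C_k_smooth_step] C_k_mult C_k_cnj C_k_id) auto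
    show "open (\<Union>x\<in>F. ball x R)" by auto
    show "K \<subseteq> (\<Union>x\<in>F. ball x R)" by fact
    show "(\<Union>x\<in>F. ball x R) \<subseteq> V" using e F by (auto simp: R_def)
    show "compact (\<Union>x\<in>F. cball x (2*R))" using F by auto
    show "(\<Union>x\<in>F. cball x (2*R)) \<subseteq> V" using e F by (auto simp: R_def)
    show "cf z = 1" if "z \<in> (\<Union>x\<in>F. ball x R)" for z
    proof -
      from that obtain x where x: "x \<in> F" "dist x z < R" by auto
      then have "b x z = 1" using b1 by auto
      then have "(\<Prod>x\<in>F. 1 - b x z) = 0" using x F by (intro prod_zero) auto
      then show ?thesis by (simp add: cf_def)
    qed
    show "cf z = 0" if "z \<notin> (\<Union>x\<in>F. cball x (2*R))" for z
    proof -
      have "b x z = 0" if "x \<in> F" for x using b0[of x z] \<open>z \<notin> _\<close> that by force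
      then show ?thesis by (simp add: cf_def)
    qed
  qed
qed

section \<open>Quantitative smoothness and smooth series\<close>

text \<open>One bound for all iterated partial derivatives up to order \<open>k\<close>. Only the
  directions 1 and \<open>\<i>\<close> are taken, because a derivative is linear in the direction
  and a bound for all directions would force it to vanish.\<close>

primrec C_k_le :: "nat \<Rightarrow> real \<Rightarrow> (complex \<Rightarrow> complex) \<Rightarrow> bool" where
  "C_k_le 0 c g \<longleftrightarrow> continuous_on UNIV g \<and> (\<forall>z. cmod (g z) \<le> c)"
| "C_k_le (Suc k) c g \<longleftrightarrow> (\<forall>z. g differentiable at z) \<and> (\<forall>z. cmod (g z) \<le> c) \<and>
     C_k_le k c (\<lambda>z. frechet_derivative g (at z) 1) \<and> C_k_le k c (\<lambda>z. frechet_derivative g (at z) \<i>)"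

lemma C_k_le_bound: "C_k_le k c g \<Longrightarrow> cmod (g z) \<le> c"
  by (cases k) auto

lemma C_k_le_imp_C_k: "C_k_le k c g \<Longrightarrow> C_k k g"
proof (induction k arbitrary: g)
  case (Suc k)
  then show ?case by (intro C_k_SucI) (simp_all only: C_k_le.simps)
qed auto

lemma C_k_le_Suc_imp: "C_k_le (Suc k) c g \<Longrightarrow> C_k_le k c g"
proof (induction k arbitrary: g)
  case 0
  then show ?case by (auto intro!: continuous_at_imp_continuous_on differentiable_imp_continuous_within)
next
  case (Suc k)
  then show ?case by (metis C_k_le.simps(2))
qed

lemma C_k_le_mono_k: "C_k_le k c g \<Longrightarrow> j \<le> k \<Longrightarrow> C_k_le j c g"
  by (induction k) (auto simp: le_Suc_eq dest: C_k_le_Suc_imp simp del: C_k_le.simps)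

lemma C_k_le_mono: "C_k_le k c g \<Longrightarrow> c \<le> c' \<Longrightarrow> C_k_le k c' g"
  by (induction k arbitrary: g) (auto intro: order_trans)

lemma C_k_le_SucI:
  assumes d: "\<And>z. (g has_derivative g' z) (at z)" and "\<And>z. cmod (g z) \<le> c"
    and "C_k_le k c (\<lambda>z. g' z 1)" "C_k_le k c (\<lambda>z. g' z \<i>)"
  shows "C_k_le (Suc k) c g"
proof -
  have "frechet_derivative g (at z) v = g' z v" for z v by (rule frechet_derivativeI[OF d])
  then show ?thesis using assms unfolding C_k_le.simps by (auto simp: differentiable_def)
qed

lemma C_k_le_0: "c \<ge> 0 \<Longrightarrow> C_k_le k c (\<lambda>z. 0)"
  by (induction k) auto

lemma C_k_le_add: "C_k_le k c f \<Longrightarrow> C_k_le k d g \<Longrightarrow> C_k_le k (c + d) (\<lambda>z. f z + g z)"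
proof (induction k arbitrary: f g)
  case 0 then show ?case by (auto intro!: continuous_intros norm_triangle_le add_mono)
next
  case (Suc k)
  have d: "((\<lambda>z. f z + g z) has_derivative (\<lambda>v. frechet_derivative f (at z) v + frechet_derivative g (at z) v)) (at z)" for z
    using Suc.prems by (intro has_derivative_add) (simp_all flip: frechet_derivative_works)
  show ?case by (rule C_k_le_SucI[OF d]) (use Suc in \<open>auto intro!: norm_triangle_le add_mono\<close>)
qed

lemma C_k_le_cmult: "C_k_le k c g \<Longrightarrow> C_k_le k (cmod a * c) (\<lambda>z. a * g z)"
proof (induction k arbitrary: g)
  case 0 then show ?case by (auto intro!: continuous_intros mult_left_mono simp: norm_mult)
next
  case (Suc k)
  have d: "((\<lambda>z. a * g z) has_derivative (\<lambda>v. a * frechet_derivative g (at z) v)) (at z)" for z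
    using Suc.prems by (intro has_derivative_mult_right) (simp_all flip: frechet_derivative_works)
  show ?case by (rule C_k_le_SucI[OF d]) (use Suc in \<open>auto intro!: mult_left_mono simp: norm_mult\<close>)
qed

lemma C_k_le_sum:
  "finite I \<Longrightarrow> (\<And>i. i \<in> I \<Longrightarrow> C_k_le k c (f i)) \<Longrightarrow> C_k_le k (of_nat (card I) * c) (\<lambda>z. \<Sum>i\<in>I. f i z)"
proof (induction I rule: finite_induct)
  case (insert i I)
  then have "C_k_le k (c + of_nat (card I) * c) (\<lambda>z. f i z + (\<Sum>i\<in>I. f i z))" by (intro C_k_le_add) auto
  with insert show ?case by (simp add: algebra_simps)
qed (auto simp: C_k_le_0)

lemma deriv_bound:
  assumes "f holomorphic_on W" "cball z r \<subseteq> W" "r > 0" "\<And>y. y \<in> W \<Longrightarrow> cmod (f y) \<le> B"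
  shows "cmod (deriv f z) \<le> B / r"
proof -
  have "cmod ((deriv ^^ 1) f z) \<le> fact 1 * B / r ^ 1"
  proof (rule Cauchy_inequality)
    show "f holomorphic_on ball z r" using assms ball_subset_cball holomorphic_on_subset by (metis order_trans)
    show "continuous_on (cball z r) f" using assms by (meson continuous_on_subset holomorphic_on_imp_continuous_on)
    fix x assume "cmod (z - x) = r"
    then have "x \<in> cball z r" by (simp add: dist_norm)
    then show "cmod (f x) \<le> B" using assms by auto
  qed fact
  then show ?thesis by simp
qed

lemma frechet_derivative_zero_outside:
  assumes "closed L" "\<And>z. z \<notin> L \<Longrightarrow> g z = 0" "z \<notin> L"
  shows "frechet_derivative g (at z) v = 0"
proof -
  have "(g has_derivative (\<lambda>v. 0)) (at z)"
    by (rule has_derivative_transform_within_open[of "\<lambda>z. 0" _ _ UNIV "- L"])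
       (use assms in \<open>auto simp: open_Compl\<close>)
  then show ?thesis by (rule frechet_derivativeI)
qed

lemma C_infinity_deriv: "C_infinity g \<Longrightarrow> C_infinity (\<lambda>z. frechet_derivative g (at z) v)"
  unfolding C_infinity_def by (metis C_k.simps(2))

text \<open>By Cauchy's estimates a sup bound for a holomorphic \<open>u\<close> controls all its
  derivatives on the compact set \<open>L\<close>, so the size of a cut off correction in every
  order is governed by its sup norm. The induction generalises over cutoff, domain and bound because
  the product rule changes all three.\<close>

lemma cutoff_product_C_k_le:
  assumes "C_infinity cf" "compact L" "L \<subseteq> V" "open V" "\<And>z. z \<notin> L \<Longrightarrow> cf z = 0" "c > 0"
  shows "\<exists>\<delta>>0. \<forall>u. u holomorphic_on V \<longrightarrow> (\<forall>z\<in>V. cmod (u z) \<le> \<delta>) \<longrightarrow> C_k_le k c (\<lambda>z. cf z * u z)"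
  using assms
proof (induction k arbitrary: cf V c)
  have cont: "continuous_on S cf" if "C_infinity cf" for S cf
    using that C_k.simps(1) continuous_on_subset unfolding C_infinity_def by blast
  have bd: "\<exists>\<delta>>0. \<forall>u. u holomorphic_on V \<longrightarrow> (\<forall>z\<in>V. cmod (u z) \<le> \<delta>) \<longrightarrow> (\<forall>z. cmod (cf z * u z) \<le> c)"
    if "C_infinity cf" "L \<subseteq> V" "\<And>z. z \<notin> L \<Longrightarrow> cf z = 0" "c > 0" for cf V and c :: real
  proof -
    have "compact (cf ` L)" using cont[OF that(1)] assms(2) compact_continuous_image by blast
    then obtain B where B: "B > 0" "\<And>z. z \<in> L \<Longrightarrow> cmod (cf z) \<le> B"
      using compact_imp_bounded bounded_pos by (metis imageI)
    show ?thesis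
    proof (intro exI[of _ "c / B"] conjI allI impI)
      show "c / B > 0" using B that by simp
      fix u z assume u: "\<forall>z\<in>V. cmod (u z) \<le> c / B"
      show "cmod (cf z * u z) \<le> c"
      proof (cases "z \<in> L")
        case True
        have "cmod (cf z) * cmod (u z) \<le> B * (c / B)" using True u that B by (intro mult_mono) auto
        then show ?thesis using B by (simp add: norm_mult)
      qed (use that in auto)
    qed
  qed
  {
    case 0
    obtain \<delta> where d: "\<delta> > 0" "\<And>u z. u holomorphic_on V \<Longrightarrow> (\<forall>z\<in>V. cmod (u z) \<le> \<delta>) \<Longrightarrow> cmod (cf z * u z) \<le> c"
      using bd[of cf V c] 0 by blast
    show ?case
    proof (intro exI[of _ \<delta>] conjI allI impI d(1))
      fix u assume u: "u holomorphic_on V" "\<forall>z\<in>V. cmod (u z) \<le> \<delta>"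
      have "continuous_on (V \<union> - L) (\<lambda>z. cf z * u z)"
      proof (rule continuous_on_open_Un)
        show "continuous_on V (\<lambda>z. cf z * u z)"
          by (intro continuous_on_mult cont[OF 0(1)] holomorphic_on_imp_continuous_on[OF u(1)])
        have "continuous_on (- L) (\<lambda>z. 0::complex)" by simp
        then show "continuous_on (- L) (\<lambda>z. cf z * u z)"
          by (rule continuous_on_eq) (use 0 in auto)
      qed (use 0 in \<open>auto simp: compact_imp_closed open_Compl\<close>)
      moreover have "V \<union> - L = UNIV" using 0 by auto
      ultimately show "C_k_le 0 c (\<lambda>z. cf z * u z)" using d(2)[OF u] by simp
    qed
  next
    case (Suc k)
    note prems = Suc.prems
    have clL: "closed L" using prems compact_imp_closed by blast
    obtain d K2 where d: "d > 0" "compact K2" "K2 \<subseteq> V" "\<And>x y. x \<in> L \<Longrightarrow> dist x y \<le> d \<Longrightarrow> y \<in> interior K2"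
      using compact_fatten[of L V] prems by metis
    \<comment> \<open>Passing to a smaller domain at each order leaves room for discs of radius
      \<open>d/2\<close>, on which Cauchy's estimate bounds \<open>deriv u\<close>.\<close>
    define V' where "V' = (\<Union>x\<in>L. ball x (d/2))"
    have V': "open V'" "L \<subseteq> V'" unfolding V'_def using d by force+
    have cb: "cball z (d/2) \<subseteq> V" if "z \<in> V'" for z
    proof
      fix y assume "y \<in> cball z (d/2)"
      moreover from that obtain x where "x \<in> L" "dist x z < d/2" by (auto simp: V'_def)
      ultimately have "dist x y \<le> d" using dist_triangle[of x y z] by auto
      then show "y \<in> V" using d(3,4) \<open>x \<in> L\<close> interior_subset by blast
    qed
    have V'V: "V' \<subseteq> V" using cb d by (meson centre_in_cball subset_iff less_imp_le half_gt_zero)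
    let ?D = "\<lambda>v z. frechet_derivative cf (at z) v"
    have Dz: "?D v z = 0" if "z \<notin> L" for v z
      by (rule frechet_derivative_zero_outside[OF clL _ that]) (rule prems(5))
    have c2: "c / 2 > 0" using prems by simp
    obtain \<delta>0 where 0: "\<delta>0 > 0" "\<And>u z. u holomorphic_on V \<Longrightarrow> (\<forall>z\<in>V. cmod (u z) \<le> \<delta>0) \<Longrightarrow> cmod (cf z * u z) \<le> c"
      using bd[of cf V c] prems by blast
    obtain \<delta>1 where 1: "\<delta>1 > 0" "\<And>u. u holomorphic_on V \<Longrightarrow> (\<forall>z\<in>V. cmod (u z) \<le> \<delta>1) \<Longrightarrow> C_k_le k (c/2) (\<lambda>z. ?D 1 z * u z)"
      using Suc.IH[of "?D 1" V "c/2"] prems c2 Dz C_infinity_deriv[OF prems(1)] by blast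
    obtain \<delta>2 where 2: "\<delta>2 > 0" "\<And>u. u holomorphic_on V \<Longrightarrow> (\<forall>z\<in>V. cmod (u z) \<le> \<delta>2) \<Longrightarrow> C_k_le k (c/2) (\<lambda>z. ?D \<i> z * u z)"
      using Suc.IH[of "?D \<i>" V "c/2"] prems c2 Dz C_infinity_deriv[OF prems(1)] by blast
    obtain \<delta>3 where 3: "\<delta>3 > 0" "\<And>u. u holomorphic_on V' \<Longrightarrow> (\<forall>z\<in>V'. cmod (u z) \<le> \<delta>3) \<Longrightarrow> C_k_le k (c/2) (\<lambda>z. cf z * u z)"
      using Suc.IH[of cf V' "c/2"] prems c2 V' by blast
    define \<delta> where "\<delta> = Min {\<delta>0, \<delta>1, \<delta>2, \<delta>3 * (d/2)}"
    have dd: "\<delta> > 0" "\<delta> \<le> \<delta>0" "\<delta> \<le> \<delta>1" "\<delta> \<le> \<delta>2" "\<delta> \<le> \<delta>3 * (d/2)"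
      unfolding \<delta>_def using 0 1 2 3 d by auto
    show ?case
    proof (intro exI[of _ \<delta>] conjI allI impI dd(1))
      fix u assume u: "u holomorphic_on V" "\<forall>z\<in>V. cmod (u z) \<le> \<delta>"
      have du: "deriv u holomorphic_on V" using u prems holomorphic_deriv by blast
      have db: "cmod (deriv u z) \<le> \<delta>3" if "z \<in> V'" for z
      proof -
        have "cmod (deriv u z) \<le> \<delta> / (d/2)"
          by (rule deriv_bound[OF u(1) cb[OF that]]) (use d u in auto)
        also have "\<dots> \<le> \<delta>3" using dd(5) d by (simp add: field_simps)
        finally show ?thesis .
      qed
      have C3: "C_k_le k (c/2) (\<lambda>z. cf z * deriv u z)"
        using 3(2)[of "deriv u"] du V'V db holomorphic_on_subset by blast
      have C3': "C_k_le k (c/2) (\<lambda>z. \<i> * (cf z * deriv u z))"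
        using C_k_le_cmult[OF C3, of \<i>] by simp
      show "C_k_le (Suc k) c (\<lambda>z. cf z * u z)"
      proof (rule C_k_le_SucI)
        \<comment> \<open>The product rule gives the differentiated cutoff times \<open>u\<close>
          and the cutoff times \<open>deriv u\<close>, both covered by the induction hypothesis. Off
          \<open>V\<close> the product is 0 in a whole neighbourhood of the point.\<close>
        show "((\<lambda>z. cf z * u z) has_derivative (\<lambda>v. ?D v z * u z + v * (cf z * deriv u z))) (at z)" for z
        proof (cases "z \<in> V")
          case True
          have "(u has_derivative (\<lambda>v. deriv u z * v)) (at z)"
            using holomorphic_derivI[OF u(1) prems(4) True] by (simp add: has_field_derivative_def)
          moreover have "(cf has_derivative (\<lambda>v. ?D v z)) (at z)"
            using prems(1) unfolding C_infinity_def by (metis C_k.simps(2) frechet_derivative_works)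
          ultimately show ?thesis
            using has_derivative_mult[of cf "\<lambda>v. ?D v z" z UNIV u "\<lambda>v. deriv u z * v"]
            by (simp add: algebra_simps)
        next
          case False
          then have zL: "z \<notin> L" using prems by auto
          have "((\<lambda>z. cf z * u z) has_derivative (\<lambda>v. 0)) (at z)"
            by (rule has_derivative_transform_within_open[of "\<lambda>z. 0" _ _ UNIV "- L"])
               (use prems zL clL in \<open>auto simp: open_Compl\<close>)
          then show ?thesis using Dz[OF zL] prems(5)[OF zL] by simp
        qed
        show "cmod (cf z * u z) \<le> c" for z
          by (rule 0(2)[OF u(1)]) (use u dd in force)
        show "C_k_le k c (\<lambda>z. ?D 1 z * u z + 1 * (cf z * deriv u z))"
          using C_k_le_add[OF 1(2)[OF u(1)] C3] u dd by force
        show "C_k_le k c (\<lambda>z. ?D \<i> z * u z + \<i> * (cf z * deriv u z))"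
          using C_k_le_add[OF 2(2)[OF u(1)] C3'] u dd by force
      qed
    qed
  }
qed

text \<open>A scalar multiple of \<open>u\<close> is small enough, on a smaller neighbourhood of
  \<open>L\<close>, for the quantitative statement; scaling back does not affect smoothness.\<close>

lemma cutoff_product_C_infinity:
  assumes "C_infinity cf" "compact L" "L \<subseteq> V" "open V" "\<And>z. z \<notin> L \<Longrightarrow> cf z = 0"
    and u: "u holomorphic_on V"
  shows "C_infinity (\<lambda>z. cf z * u z)"
  unfolding C_infinity_def
proof
  fix k
  obtain d K2 where d: "d > 0" "compact K2" "K2 \<subseteq> V" "\<And>x y. x \<in> L \<Longrightarrow> dist x y \<le> d \<Longrightarrow> y \<in> interior K2"
    using compact_fatten[of L V] assms by metis
  define V' where "V' = interior K2"
  have V': "open V'" "L \<subseteq> V'" unfolding V'_def using d(1,4) by (auto intro: d(4)[of x x for x])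
  obtain B where B: "B \<ge> 1" "\<And>z. z \<in> K2 \<Longrightarrow> cmod (u z) \<le> B"
    using compact_holomorphic_bound[OF d(2) u d(3)] by metis
  obtain \<delta> where de: "\<delta> > 0" "\<And>u. u holomorphic_on V' \<Longrightarrow> (\<forall>z\<in>V'. cmod (u z) \<le> \<delta>) \<Longrightarrow> C_k_le k 1 (\<lambda>z. cf z * u z)"
    using cutoff_product_C_k_le[of cf L V' 1 k] assms V' by auto
  let ?a = "complex_of_real (\<delta> / B)"
  have "C_k_le k 1 (\<lambda>z. cf z * (?a * u z))"
  proof (rule de(2))
    have "V' \<subseteq> K2" unfolding V'_def by (rule interior_subset)
    then show "(\<lambda>z. ?a * u z) holomorphic_on V'"
      using u d(3) by (intro holomorphic_intros) (auto intro: holomorphic_on_subset)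
    show "\<forall>z\<in>V'. cmod (?a * u z) \<le> \<delta>"
    proof
      fix z assume "z \<in> V'"
      then have "cmod (u z) \<le> B" using B \<open>V' \<subseteq> K2\<close> by auto
      then have "\<delta> / B * cmod (u z) \<le> \<delta> / B * B" using de B by (intro mult_left_mono) auto
      then show "cmod (?a * u z) \<le> \<delta>" using de B by (simp add: norm_mult norm_divide)
    qed
  qed
  then have "C_k k (\<lambda>z. inverse ?a * (cf z * (?a * u z)))"
    by (intro C_k_mult C_k_const C_k_le_imp_C_k)
  moreover have "inverse ?a * (cf z * (?a * u z)) = cf z * u z" for z
    using de B by (simp add: field_simps)
  ultimately show "C_k k (\<lambda>z. cf z * u z)" by simp
qed

lemma summable_half_powers: "summable (\<lambda>n. (1/2::real) ^ n)"
  by (rule summable_geometric) simp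

lemma series_uniform_limit:
  assumes "\<And>z. \<forall>\<^sub>F n in sequentially. \<forall>z. cmod (u n z) \<le> (1/2) ^ n"
  shows "uniform_limit UNIV (\<lambda>n z. \<Sum>i<n. u i z) (\<lambda>z. \<Sum>i. u i z) sequentially"
  by (rule Weierstrass_m_test_ev[OF _ summable_half_powers]) (use assms in auto)

text \<open>For each order the bound is asked only for large \<open>n\<close>, so it suffices to
  control the \<open>n\<close>-th term in order \<open>n\<close>; this is how the corrections are
  produced. Termwise differentiation reduces order \<open>k + 1\<close> to order \<open>k\<close>
  for the series of derivatives.\<close>

lemma series_C_k:
  assumes "\<And>k. \<forall>\<^sub>F n in sequentially. C_k_le k ((1/2) ^ n) (u n)" "\<And>n. C_infinity (u n)"
  shows "C_k k (\<lambda>z. \<Sum>n. u n z) \<and> (\<forall>z. summable (\<lambda>n. u n z)) \<and>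
    (\<forall>z. ((\<lambda>z. \<Sum>n. u n z) has_derivative (\<lambda>v. \<Sum>n. frechet_derivative (u n) (at z) v)) (at z))"
  using assms
proof (induction k arbitrary: u)
  have ev0: "\<forall>\<^sub>F n in sequentially. \<forall>z. cmod (u n z) \<le> (1/2) ^ n"
    if "\<And>k. \<forall>\<^sub>F n in sequentially. C_k_le k ((1/2) ^ n) (u n)" for u
    using that[of 0] by eventually_elim auto
  have smb: "summable (\<lambda>n. u n z)" if "\<And>k. \<forall>\<^sub>F n in sequentially. C_k_le k ((1/2) ^ n) (u n)" for u z
    by (rule summable_comparison_test_ev[OF _ summable_half_powers])
       (use ev0[OF that] in \<open>auto elim!: eventually_mono\<close>)
  let ?D = "\<lambda>u v n z. frechet_derivative (u n) (at z) v"
  have D: "\<forall>\<^sub>F n in sequentially. C_k_le k ((1/2) ^ n) (?D u 1 n)" "\<forall>\<^sub>F n in sequentially. C_k_le k ((1/2) ^ n) (?D u \<i> n)"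
    if "\<And>k. \<forall>\<^sub>F n in sequentially. C_k_le k ((1/2) ^ n) (u n)" for u k
    by (rule eventually_mono[OF that[of "Suc k"]]; simp)+
  have der: "((\<lambda>z. \<Sum>n. u n z) has_derivative (\<lambda>v. of_real (Re v) * (\<Sum>n. ?D u 1 n z) + of_real (Im v) * (\<Sum>n. ?D u \<i> n z))) (at z)"
    and comp: "(\<Sum>n. ?D u v n z) = of_real (Re v) * (\<Sum>n. ?D u 1 n z) + of_real (Im v) * (\<Sum>n. ?D u \<i> n z)"
    if ev: "\<And>k. \<forall>\<^sub>F n in sequentially. C_k_le k ((1/2) ^ n) (u n)" and inf: "\<And>n. C_infinity (u n)"
    for u z v
  proof -
    have diff: "u n differentiable at z" for n z
      using inf[of n] unfolding C_infinity_def by (metis C_k.simps(2))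
    have ul1: "uniform_limit UNIV (\<lambda>n z. \<Sum>i<n. ?D u 1 i z) (\<lambda>z. \<Sum>i. ?D u 1 i z) sequentially"
      by (rule series_uniform_limit) (rule ev0, rule D(1)[OF ev])
    have uli: "uniform_limit UNIV (\<lambda>n z. \<Sum>i<n. ?D u \<i> i z) (\<lambda>z. \<Sum>i. ?D u \<i> i z) sequentially"
      by (rule series_uniform_limit) (rule ev0, rule D(2)[OF ev])
    have s1: "summable (\<lambda>n. ?D u 1 n z)" "summable (\<lambda>n. ?D u \<i> n z)" for z
      by (intro smb D[OF ev])+
    have Dv: "?D u w n z = of_real (Re w) * ?D u 1 n z + of_real (Im w) * ?D u \<i> n z" for w n z
      by (rule frechet_derivative_components[OF diff])
    show "(\<Sum>n. ?D u v n z) = of_real (Re v) * (\<Sum>n. ?D u 1 n z) + of_real (Im v) * (\<Sum>n. ?D u \<i> n z)" for z v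
      unfolding Dv[of _ _ v] by (subst suminf_add[symmetric]) (auto simp: s1 suminf_mult summable_mult)
    have "\<exists>g. \<forall>z\<in>UNIV. (\<lambda>n. u n z) sums (g z) \<and>
      (g has_derivative (\<lambda>v. of_real (Re v) * (\<Sum>n. ?D u 1 n z) + of_real (Im v) * (\<Sum>n. ?D u \<i> n z))) (at z within UNIV)"
    proof (rule has_derivative_series)
      show "(u n has_derivative (\<lambda>v. ?D u v n z)) (at z within UNIV)" for n z
        using diff frechet_derivative_works by blast
      show "(\<lambda>n. u n 0) sums (\<Sum>n. u n 0)" using smb[OF ev] by (simp add: summable_sums)
      fix e :: real assume e: "e > 0"
      have "\<forall>\<^sub>F n in sequentially. (\<forall>z\<in>UNIV. dist (\<Sum>i<n. ?D u 1 i z) (\<Sum>i. ?D u 1 i z) < e/2) \<and>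
         (\<forall>z\<in>UNIV. dist (\<Sum>i<n. ?D u \<i> i z) (\<Sum>i. ?D u \<i> i z) < e/2)"
        by (intro eventually_conj uniform_limitD ul1 uli) (use e in auto)
      then show "\<forall>\<^sub>F n in sequentially. \<forall>z\<in>UNIV. \<forall>v. cmod ((\<Sum>i<n. ?D u v i z) - (of_real (Re v) * (\<Sum>n. ?D u 1 n z) + of_real (Im v) * (\<Sum>n. ?D u \<i> n z))) \<le> e * cmod v"
      proof eventually_elim
        case (elim n)
        show ?case
        proof (intro ballI allI)
          fix z v
          let ?p = "(\<Sum>i<n. ?D u 1 i z) - (\<Sum>i. ?D u 1 i z)" and ?q = "(\<Sum>i<n. ?D u \<i> i z) - (\<Sum>i. ?D u \<i> i z)"
          have "cmod ?p \<le> e/2" "cmod ?q \<le> e/2" using elim by (auto simp: dist_norm less_imp_le)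
          have "cmod ((\<Sum>i<n. ?D u v i z) - (of_real (Re v) * (\<Sum>n. ?D u 1 n z) + of_real (Im v) * (\<Sum>n. ?D u \<i> n z)))
             = cmod (of_real (Re v) * ?p + of_real (Im v) * ?q)"
            unfolding Dv[of _ _ v] by (rule arg_cong[of _ _ cmod]) (simp add: sum.distrib sum_distrib_left algebra_simps)
          also have "\<dots> \<le> \<bar>Re v\<bar> * cmod ?p + \<bar>Im v\<bar> * cmod ?q"
            using norm_triangle_ineq[of "of_real (Re v) * ?p" "of_real (Im v) * ?q"] by (simp add: norm_mult)
          also have "\<dots> \<le> cmod v * (e/2) + cmod v * (e/2)"
            using \<open>cmod ?p \<le> e/2\<close> \<open>cmod ?q \<le> e/2\<close> abs_Re_le_cmod[of v] abs_Im_le_cmod[of v]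
            by (intro add_mono mult_mono) auto
          finally show "cmod ((\<Sum>i<n. ?D u v i z) - (of_real (Re v) * (\<Sum>n. ?D u 1 n z) + of_real (Im v) * (\<Sum>n. ?D u \<i> n z))) \<le> e * cmod v"
            by (simp add: algebra_simps)
        qed
      qed
    qed auto
    then obtain g where g: "\<And>z. (\<lambda>n. u n z) sums (g z)"
      "\<And>z. (g has_derivative (\<lambda>v. of_real (Re v) * (\<Sum>n. ?D u 1 n z) + of_real (Im v) * (\<Sum>n. ?D u \<i> n z))) (at z)"
      by auto
    have "g = (\<lambda>z. \<Sum>n. u n z)" using g(1) sums_unique by blast
    then show "((\<lambda>z. \<Sum>n. u n z) has_derivative (\<lambda>v. of_real (Re v) * (\<Sum>n. ?D u 1 n z) + of_real (Im v) * (\<Sum>n. ?D u \<i> n z))) (at z)" for z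
      using g(2) by simp
  qed
  have rest: "(\<forall>z. summable (\<lambda>n. u n z)) \<and>
    (\<forall>z. ((\<lambda>z. \<Sum>n. u n z) has_derivative (\<lambda>v. \<Sum>n. frechet_derivative (u n) (at z) v)) (at z))"
    if ev: "\<And>k. \<forall>\<^sub>F n in sequentially. C_k_le k ((1/2) ^ n) (u n)" and inf: "\<And>n. C_infinity (u n)" for u
  proof (intro conjI allI)
    fix z
    have "(\<lambda>v. \<Sum>n. ?D u v n z) = (\<lambda>v. of_real (Re v) * (\<Sum>n. ?D u 1 n z) + of_real (Im v) * (\<Sum>n. ?D u \<i> n z))"
      by (rule ext) (rule comp[OF ev inf])
    then show "((\<lambda>z. \<Sum>n. u n z) has_derivative (\<lambda>v. \<Sum>n. ?D u v n z)) (at z)"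
      using der[OF ev inf, of z] by simp
  qed (rule smb[OF ev])
  {
    case 0
    have "continuous_on UNIV (\<lambda>z. \<Sum>n. u n z)"
      using rest[OF 0] by (meson continuous_at_imp_continuous_on has_derivative_continuous)
    then show ?case using rest[OF 0] by simp
  next
    case (Suc k)
    have C: "C_k k (\<lambda>z. \<Sum>n. ?D u 1 n z)" "C_k k (\<lambda>z. \<Sum>n. ?D u \<i> n z)"
      using Suc.IH[of "?D u 1"] Suc.IH[of "?D u \<i>"] D[OF Suc.prems(1)] C_infinity_deriv[OF Suc.prems(2)] by blast+
    have "C_k (Suc k) (\<lambda>z. \<Sum>n. u n z)"
      by (rule C_k_Suc_derivI[OF der[OF Suc.prems]]) (intro C_k_add C_k_mult C_k_const C)
    then show ?case using rest[OF Suc.prems] by blast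
  }
qed

text \<open>The difference of \<open>\<theta>\<close> and the identity is a contraction. Hence
  distances shrink at most by the factor 3/4, which gives injectivity, and Banach's theorem for
  \<open>y - (\<theta> x - x)\<close> gives surjectivity. The constant also keeps the Jacobian away
  from 0, and the formula for the derivative of the inverse then yields its smoothness.\<close>

lemma near_identity_diffeomorphism:
  assumes smooth: "C_infinity \<theta>"
    and lip: "\<And>z w. cmod ((\<theta> z - z) - (\<theta> w - w)) \<le> 1/4 * cmod (z - w)"
  shows "smooth_diffeomorphism \<theta>"
proof -
  have low: "3/4 * cmod (z - w) \<le> cmod (\<theta> z - \<theta> w)" for z w
  proof -
    have "z - w = (\<theta> z - \<theta> w) - ((\<theta> z - z) - (\<theta> w - w))" by simp
    then have "cmod (z - w) \<le> cmod (\<theta> z - \<theta> w) + cmod ((\<theta> z - z) - (\<theta> w - w))" by (metis norm_triangle_ineq4)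
    then show ?thesis using lip[of z w] by simp
  qed
  have inj: "inj \<theta>"
  proof (rule injI)
    fix z w assume "\<theta> z = \<theta> w"
    then show "z = w" using low[of z w] by simp
  qed
  have surj: "surj \<theta>"
  proof (rule surjI)
    fix y
    have "\<exists>!x. y - (\<theta> x - x) = x"
    proof (rule banach_fix_type[of "1/4"])
      show "\<forall>x z. dist (y - (\<theta> x - x)) (y - (\<theta> z - z)) \<le> 1/4 * dist x z"
      proof (intro allI)
        fix x z
        have "dist (y - (\<theta> x - x)) (y - (\<theta> z - z)) = cmod ((\<theta> z - z) - (\<theta> x - x))"
          unfolding dist_norm by (rule arg_cong[of _ _ cmod]) simp
        then show "dist (y - (\<theta> x - x)) (y - (\<theta> z - z)) \<le> 1/4 * dist x z"
          using lip[of z x] by (simp add: dist_norm norm_minus_commute)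
      qed
    qed auto
    then have "\<exists>x. \<theta> x = y" by (metis add.commute diff_add_cancel diff_diff_eq2 diff_eq_eq)
    then show "\<theta> (SOME x. \<theta> x = y) = y" by (rule someI_ex)
  qed
  have bij: "bij \<theta>" using inj surj by (simp add: bij_def)
  define \<psi> where "\<psi> = inv \<theta>"
  have tp: "\<theta> (\<psi> y) = y" for y unfolding \<psi>_def using surj surj_f_inv_f by metis
  have contpsi: "continuous_on UNIV \<psi>"
  proof -
    have "cmod (\<psi> a - \<psi> b) \<le> 4/3 * cmod (a - b)" for a b
      using low[of "\<psi> a" "\<psi> b"] by (simp add: tp)
    then show ?thesis
      by (intro lipschitz_on_continuous_on[of "4/3"] lipschitz_onI) (auto simp: dist_norm)
  qed
  let ?p = "\<lambda>z. frechet_derivative \<theta> (at z) 1" and ?q = "\<lambda>z. frechet_derivative \<theta> (at z) \<i>"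
  have C: "C_k k \<theta>" for k using smooth by (simp add: C_infinity_def)
  have diff: "\<theta> differentiable at z" for z using C[of 1] by simp
  have Dth: "(\<theta> has_derivative (\<lambda>v. of_real (Re v) * ?p z + of_real (Im v) * ?q z)) (at z)" for z
    using diff[of z] unfolding frechet_derivative_works
    by (simp only: frechet_derivative_components[OF diff[of z], symmetric] eta_contract_eq)
  have Dbound: "cmod (frechet_derivative \<theta> (at z) v - v) \<le> 1/4 * cmod v" for z v
  proof -
    have d: "((\<lambda>z. \<theta> z - z) has_derivative (\<lambda>v. frechet_derivative \<theta> (at z) v - v)) (at z)"
      using diff[of z] unfolding frechet_derivative_works by (intro has_derivative_diff has_derivative_ident)
    let ?f = "\<lambda>v. frechet_derivative \<theta> (at z) v - v"
    have bl: "bounded_linear ?f" using d has_derivative_bounded_linear by blast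
    show "cmod (?f v) \<le> 1/4 * cmod v"
    proof (cases "v = 0")
      case True
      then show ?thesis using linear_0[OF bounded_linear.linear[OF bl]] by simp
    next
      case False
      have "cmod (?f v) / cmod v \<le> 1/4"
      proof (rule field_le_epsilon)
        fix e :: real assume "e > 0"
        then obtain s where s: "s > 0" "\<And>y. cmod (y - z) < s \<Longrightarrow> cmod ((\<theta> y - y) - (\<theta> z - z) - ?f (y - z)) \<le> e * cmod (y - z)"
          using d unfolding has_derivative_at_alt by blast
        define t where "t = s / 2 / cmod v"
        have t: "t > 0" "cmod (t *\<^sub>R v) < s" using s False by (auto simp: t_def)
        have "?f (t *\<^sub>R v) = t *\<^sub>R ?f v" by (rule linear_scale[OF bounded_linear.linear[OF bl]])
        then have "t * cmod (?f v) = cmod (?f (t *\<^sub>R v))" using t by simp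
        also have "\<dots> \<le> cmod ((\<theta> (z + t *\<^sub>R v) - (z + t *\<^sub>R v)) - (\<theta> z - z)) + e * cmod (t *\<^sub>R v)"
          using s(2)[of "z + t *\<^sub>R v"] t
          norm_triangle_ineq4[of "(\<theta> (z + t *\<^sub>R v) - (z + t *\<^sub>R v)) - (\<theta> z - z)"
            "(\<theta> (z + t *\<^sub>R v) - (z + t *\<^sub>R v)) - (\<theta> z - z) - ?f (t *\<^sub>R v)"]
          by simp
        also have "\<dots> \<le> 1/4 * cmod (t *\<^sub>R v) + e * cmod (t *\<^sub>R v)"
          using lip[of "z + t *\<^sub>R v" z] by simp
        also have "\<dots> = t * ((1/4 + e) * cmod v)" using t by (simp add: algebra_simps)
        finally have "cmod (?f v) \<le> (1/4 + e) * cmod v" using t by simp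
        then show "cmod (?f v) / cmod v \<le> 1/4 + e" using False by (simp add: pos_divide_le_eq)
      qed
      then show ?thesis using False by (simp add: pos_divide_le_eq)
    qed
  qed
  \<comment> \<open>The real Jacobian determinant: \<open>?p\<close> and \<open>?q\<close> are the
    columns of the derivative, within distance 1/4 of 1 and \<open>\<i>\<close>.\<close>
  define J where "J = (\<lambda>z. Im (cnj (?p z) * ?q z))"
  have J: "J z \<noteq> 0" for z
  proof -
    have p: "cmod (?p z - 1) \<le> 1/4" and q: "cmod (?q z - \<i>) \<le> 1/4"
      using Dbound[of z 1] Dbound[of z \<i>] by auto
    have "\<bar>Re (?p z) - 1\<bar> \<le> 1/4" "\<bar>Im (?p z)\<bar> \<le> 1/4" "\<bar>Re (?q z)\<bar> \<le> 1/4" "\<bar>Im (?q z) - 1\<bar> \<le> 1/4"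
      using order_trans[OF abs_Re_le_cmod p] order_trans[OF abs_Im_le_cmod p]
        order_trans[OF abs_Re_le_cmod q] order_trans[OF abs_Im_le_cmod q] by auto
    then have "(3/4) * (3/4) \<le> Re (?p z) * Im (?q z)" "\<bar>Im (?p z)\<bar> * \<bar>Re (?q z)\<bar> \<le> 1/4 * (1/4)"
      by (intro mult_mono; linarith)+
    moreover have "Im (?p z) * Re (?q z) \<le> \<bar>Im (?p z)\<bar> * \<bar>Re (?q z)\<bar>"
      by (metis abs_ge_self abs_mult)
    ultimately have "Re (?p z) * Im (?q z) - Im (?p z) * Re (?q z) > 0" by linarith
    then show ?thesis unfolding J_def by simp
  qed
  \<comment> \<open>Cramer's rule for the inverse of the real-linear map with columns
    \<open>?p\<close> and \<open>?q\<close>.\<close>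
  define g' where "g' = (\<lambda>y v. of_real (Im (cnj v * ?q (\<psi> y)) / J (\<psi> y)) + \<i> * of_real (Im (cnj (?p (\<psi> y)) * v) / J (\<psi> y)))"
  have Dpsi: "(\<psi> has_derivative g' y) (at y)" for y
  proof (rule has_derivative_inverse_basic[OF Dth])
    show "bounded_linear (g' y)" unfolding g'_def
      by (intro bounded_linear_add bounded_linear_const_mult bounded_linear_compose[OF bounded_linear_of_real]
           bounded_linear_divide[THEN bounded_linear_compose] bounded_linear_compose[OF bounded_linear_Im] bounded_linear_mult_const bounded_linear_cnj bounded_linear_ident)
    show "g' y \<circ> (\<lambda>v. of_real (Re v) * ?p (\<psi> y) + of_real (Im v) * ?q (\<psi> y)) = id"
    proof (rule ext)
      fix v
      have J': "Re (?p (\<psi> y)) * Im (?q (\<psi> y)) - Im (?p (\<psi> y)) * Re (?q (\<psi> y)) \<noteq> 0"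
        using J[of "\<psi> y"] by (simp add: J_def)
      show "(g' y \<circ> (\<lambda>v. of_real (Re v) * ?p (\<psi> y) + of_real (Im v) * ?q (\<psi> y))) v = id v"
        using J' by (simp add: g'_def J_def complex_eq_iff) (simp add: divide_simps, simp add: algebra_simps)
    qed
    show "continuous (at y) \<psi>" using contpsi by (simp add: continuous_on_eq_continuous_at)
    show "\<theta> (\<psi> y) = y" for y by (rule tp)
  qed (rule open_UNIV UNIV_I)+
  \<comment> \<open>The derivative of \<open>\<psi>\<close> is a smooth expression in derivatives of
    \<open>\<theta>\<close> taken at \<open>\<psi>\<close>, so each order of smoothness of
    \<open>\<psi>\<close> yields the next one.\<close>
  have Cpsi: "C_k k \<psi>" for k
  proof (induction k)
    case 0 then show ?case using contpsi by simp
  next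
    case (Suc k)
    have pq: "C_k k (\<lambda>y. ?p (\<psi> y))" "C_k k (\<lambda>y. ?q (\<psi> y))"
      using C[of "Suc k"] Suc by (auto intro!: C_k_compose[of k _ \<psi>])
    have JJ: "complex_of_real (Im (cnj (?p (\<psi> y)) * ?q (\<psi> y))) \<noteq> 0" for y
      using J[of "\<psi> y"] unfolding J_def of_real_eq_0_iff .
    have g'eq: "g' y v = of_real (Im (cnj v * ?q (\<psi> y))) * inverse (of_real (Im (cnj (?p (\<psi> y)) * ?q (\<psi> y))))
        + \<i> * (of_real (Im (cnj (?p (\<psi> y)) * v)) * inverse (of_real (Im (cnj (?p (\<psi> y)) * ?q (\<psi> y)))))" for y v
      unfolding g'_def J_def by (simp add: divide_inverse)
    show ?case
      by (rule C_k_Suc_derivI[OF Dpsi], unfold g'eq, intro C_k_add C_k_mult C_k_const C_k_Im C_k_cnj pq C_k_inverse JJ)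
  qed
  show ?thesis unfolding smooth_diffeomorphism_def using bij smooth Cpsi by (simp add: C_infinity_def \<psi>_def)
qed

section \<open>Stability of a conjugacy under perturbation\<close>

text \<open>The error splits as \<open>(f (v z) - f (u z)) + (f (u z) - T (u z))\<close>. A
  Lipschitz constant near \<open>Y\<close> that is the same for all admissible \<open>f\<close>
  handles the first part, the weight inequality \<open>Qw\<close> the second. All errors stay
  relative to \<open>w\<close>, so they keep vanishing where \<open>w\<close> does.\<close>

lemma composition_close:
  fixes w Q :: "complex \<Rightarrow> real"
  assumes O: "open O'" and T: "T holomorphic_on O'" and Y: "compact Y" "Y \<subseteq> O'"
    and u: "\<And>z. z \<in> V \<Longrightarrow> u z \<in> Y" and Q: "continuous_on O' Q" "\<And>y. y \<in> O' \<Longrightarrow> 0 \<le> Q y"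
    and w: "\<And>z. z \<in> V \<Longrightarrow> 0 \<le> w z" "\<And>z. z \<in> V \<Longrightarrow> w z \<le> B"
    and Qw: "\<And>z. z \<in> V \<Longrightarrow> Q (u z) \<le> C * w z" and eps: "\<epsilon> > 0"
  shows "\<exists>\<delta>>0. \<forall>f v. f holomorphic_on O' \<longrightarrow> (\<forall>y\<in>O'. cmod (f y - T y) \<le> \<delta> * Q y) \<longrightarrow>
     (\<forall>z\<in>V. cmod (v z - u z) \<le> \<delta> * w z) \<longrightarrow> (\<forall>z\<in>V. v z \<in> O' \<and> cmod (f (v z) - T (u z)) \<le> \<epsilon> * w z)"
proof -
  obtain D K2 where D: "D > 0" "compact K2" "K2 \<subseteq> O'" "\<And>x y. x \<in> Y \<Longrightarrow> dist x y \<le> D \<Longrightarrow> y \<in> interior K2"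
    using compact_fatten[OF Y(1) O Y(2)] by metis
  obtain BT where BT: "BT \<ge> 1" "\<And>z. z \<in> K2 \<Longrightarrow> cmod (T z) \<le> BT"
    using compact_holomorphic_bound[OF D(2) T D(3)] by metis
  have "compact (Q ` K2)" using D Q continuous_on_subset compact_continuous_image by blast
  then obtain BQ where BQ: "BQ > 0" "\<And>z. z \<in> K2 \<Longrightarrow> \<bar>Q z\<bar> \<le> BQ"
    using compact_imp_bounded bounded_pos by (metis imageI real_norm_def)
  \<comment> \<open>For \<open>\<delta> \<le> 1\<close> every admissible \<open>f\<close> is bounded
    by \<open>BT + BQ\<close> on the interior of \<open>K2\<close>; Cauchy's estimate with radius
    \<open>D / 2\<close> turns this into the bound \<open>L\<close> for the derivative.\<close>
  define L where "L = (BT + BQ) / (D / 2)"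
  have L: "L > 0" using BT BQ D by (simp add: L_def)
  define B1 where "B1 = max B 1"
  define C1 where "C1 = max C 1"
  define \<delta> where "\<delta> = Min {1, D / 2 / B1, \<epsilon> / (L + C1)}"
  have B1: "B1 \<ge> 1" "B1 \<ge> B" and C1: "C1 \<ge> 1" "C1 \<ge> C" by (auto simp: B1_def C1_def)
  have d: "\<delta> > 0" "\<delta> \<le> 1" "\<delta> \<le> D / 2 / B1" "\<delta> \<le> \<epsilon> / (L + C1)"
    unfolding \<delta>_def using D B1 C1 L eps by auto
  have d2: "\<delta> * B1 \<le> D / 2" "\<delta> * (L + C1) \<le> \<epsilon>"
    using d(3,4) B1 C1 L by (auto simp: pos_le_divide_eq)
  show ?thesis
  proof (rule exI[of _ \<delta>], intro conjI allI impI ballI d(1))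
    fix f v z
    assume f: "f holomorphic_on O'" and fT: "\<forall>y\<in>O'. cmod (f y - T y) \<le> \<delta> * Q y"
      and v: "\<forall>z\<in>V. cmod (v z - u z) \<le> \<delta> * w z" and z: "z \<in> V"
    have uz: "cball (u z) D \<subseteq> interior K2" using D(4)[OF u[OF z]] by auto
    have wB: "w z \<le> B1" using w(2)[OF z] B1 by simp
    have "\<delta> * w z \<le> \<delta> * B1" using wB d by (intro mult_left_mono) auto
    then have vz: "cmod (v z - u z) \<le> D / 2" using v z d2 by force
    then have vin: "v z \<in> cball (u z) (D/2)" by (simp add: dist_norm norm_minus_commute)
    have "v z \<in> cball (u z) D" using vin D(1) by auto
    then show "v z \<in> O'" using uz D(3) interior_subset[of K2] by blast
    have fb: "cmod (f y) \<le> BT + BQ" if "y \<in> interior K2" for y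
    proof -
      have y: "y \<in> K2" "y \<in> O'" using that interior_subset D by blast+
      have "cmod (f y) \<le> cmod (T y) + cmod (f y - T y)" by (metis norm_triangle_sub)
      moreover have "cmod (f y - T y) \<le> \<delta> * Q y" using fT y by auto
      moreover have "\<delta> * Q y \<le> 1 * BQ" using d BQ(2)[OF y(1)] Q(2)[OF y(2)] by (intro mult_mono) auto
      ultimately show ?thesis using BT(2)[OF y(1)] by simp
    qed
    have "cmod (f (v z) - f (u z)) \<le> L * cmod (v z - u z)"
    proof (rule field_differentiable_bound[where S="cball (u z) (D/2)" and f'="deriv f"])
      fix x assume x: "x \<in> cball (u z) (D/2)"
      have cb: "cball x (D/2) \<subseteq> cball (u z) D"
      proof
        fix y assume "y \<in> cball x (D/2)"
        then show "y \<in> cball (u z) D" using x dist_triangle[of "u z" y x] by auto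
      qed
      have xO: "x \<in> O'" using x uz D interior_subset[of K2] by force
      show "(f has_field_derivative deriv f x) (at x within cball (u z) (D/2))"
        using f O xO by (meson holomorphic_derivI has_field_derivative_at_within)
      have "f holomorphic_on interior K2" using f D(3) interior_subset holomorphic_on_subset by blast
      then show "cmod (deriv f x) \<le> L" unfolding L_def
        using cb uz D fb by (intro deriv_bound[of f "interior K2"]) auto
    qed (use vin D in auto)
    also have "\<dots> \<le> L * (\<delta> * w z)" using v z L by (intro mult_left_mono) auto
    finally have 1: "cmod (f (v z) - f (u z)) \<le> L * (\<delta> * w z)" .
    have uO: "u z \<in> O'" using u[OF z] Y by auto
    have "cmod (f (u z) - T (u z)) \<le> \<delta> * Q (u z)" using fT uO by auto
    also have "\<dots> \<le> \<delta> * (C1 * w z)"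
      using Qw[OF z] C1 w(1)[OF z] d mult_right_mono[of C C1 "w z"] by (intro mult_left_mono) auto
    finally have 2: "cmod (f (u z) - T (u z)) \<le> \<delta> * (C1 * w z)" .
    have "cmod (f (v z) - T (u z)) \<le> cmod (f (v z) - f (u z)) + cmod (f (u z) - T (u z))"
      using norm_triangle_ineq[of "f (v z) - f (u z)" "f (u z) - T (u z)"] by simp
    also have "\<dots> \<le> \<delta> * (L + C1) * w z" using 1 2 by (simp add: algebra_simps)
    also have "\<dots> \<le> \<epsilon> * w z" using d2 w(1)[OF z] by (intro mult_right_mono) auto
    finally show "cmod (f (v z) - T (u z)) \<le> \<epsilon> * w z" .
  qed
qed

text \<open>One link of the backward recursion: \<open>\<xi>'\<close> is the displacement already
  found on the next set. Both the threefold iterate of \<open>f\<close> after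
  \<open>\<theta>\<close> and \<open>\<tau> \<circ> \<xi>' \<circ> \<phi>\<close> are perturbations
  of \<open>\<tau> \<circ> \<phi>\<close>, so Newton lifting with
  \<open>G = \<tau> \<circ> \<phi>\<close> supplies \<open>\<xi>\<close>. The neighbourhood
  \<open>V\<close> is found before the tolerance, because the preceding set must be mapped into it
  whatever \<open>f\<close> will be.\<close>

lemma conjugacy_step:
  fixes q q' Q :: "complex \<Rightarrow> real"
  assumes W: "open W" and X: "compact X" "X \<subseteq> W" and phi: "\<phi> holomorphic_on W" and th: "\<theta> holomorphic_on W"
    and W': "open W'" "open W1" "W' \<subseteq> W1" "\<phi> ` X \<subseteq> W'" and tau: "\<tau> holomorphic_on W1" "\<And>y. y \<in> W1 \<Longrightarrow> deriv \<tau> y \<noteq> 0"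
    and O: "open O1" "open O2" "open O3" and T: "T holomorphic_on O1" "T holomorphic_on O2" "T holomorphic_on O3"
    and orb: "\<theta> ` X \<subseteq> O1" "T ` \<theta> ` X \<subseteq> O2" "T ` T ` \<theta> ` X \<subseteq> O3"
    and eq: "\<And>z. z \<in> W \<Longrightarrow> T (T (T (\<theta> z))) = \<tau> (\<phi> z)"
    and iso: "\<And>z. z \<in> W \<Longrightarrow> \<forall>\<^sub>F y in at z. deriv \<phi> y \<noteq> 0"
    and q: "\<And>z. z \<in> W \<Longrightarrow> 0 \<le> q z" "\<And>z. z \<in> W \<Longrightarrow> q z \<le> C * cmod (deriv \<phi> z)"
    and q': "\<And>y. 0 \<le> q' y" "\<And>z. z \<in> W \<Longrightarrow> q' (\<phi> z) \<le> C * (cmod (deriv \<phi> z) * q z)"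
    and Q: "continuous_on UNIV Q" "\<And>y. 0 \<le> Q y" "\<And>z. z \<in> W \<Longrightarrow> Q (\<theta> z) \<le> C * (cmod (deriv \<phi> z) * q z)"
      "\<And>z. z \<in> W \<Longrightarrow> Q (T (\<theta> z)) \<le> C * (cmod (deriv \<phi> z) * q z)"
      "\<And>z. z \<in> W \<Longrightarrow> Q (T (T (\<theta> z))) \<le> C * (cmod (deriv \<phi> z) * q z)"
  obtains V where "open V" "X \<subseteq> V" "V \<subseteq> W" "\<phi> ` V \<subseteq> W'"
    "\<And>\<epsilon>. \<epsilon> > 0 \<Longrightarrow> \<exists>\<delta>>0. \<forall>f \<xi>'. f holomorphic_on O1 \<longrightarrow> f holomorphic_on O2 \<longrightarrow> f holomorphic_on O3 \<longrightarrow>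
       (\<forall>y\<in>O1 \<union> O2 \<union> O3. cmod (f y - T y) \<le> \<delta> * Q y) \<longrightarrow>
       \<xi>' holomorphic_on W' \<longrightarrow> (\<forall>y\<in>W'. cmod (\<xi>' y - y) \<le> \<delta> * q' y) \<longrightarrow>
       (\<exists>\<xi>. \<xi> holomorphic_on V \<and> (\<forall>z\<in>V. \<xi> z \<in> W \<and> cmod (\<xi> z - z) \<le> \<epsilon> * q z \<and>
          \<theta> (\<xi> z) \<in> O1 \<and> f (\<theta> (\<xi> z)) \<in> O2 \<and> f (f (\<theta> (\<xi> z))) \<in> O3 \<and>
          f (f (f (\<theta> (\<xi> z)))) = \<tau> (\<xi>' (\<phi> z))))"
proof -
  have orb': "\<theta> x \<in> O1" "T (\<theta> x) \<in> O2" "T (T (\<theta> x)) \<in> O3" if "x \<in> X" for x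
    using orb that by blast+
  define A0 where "A0 = W \<inter> \<phi> -` W'"
  define A1 where "A1 = A0 \<inter> \<theta> -` O1"
  define A2 where "A2 = A1 \<inter> (T \<circ> \<theta>) -` O2"
  define A3 where "A3 = A2 \<inter> (T \<circ> (T \<circ> \<theta>)) -` O3"
  have A0: "open A0" "X \<subseteq> A0" "A0 \<subseteq> W"
    unfolding A0_def using W W' X phi
    by (auto intro!: continuous_open_preimage holomorphic_on_imp_continuous_on)
  have th0: "\<theta> holomorphic_on A0" using th A0 holomorphic_on_subset by blast
  have A1: "open A1" "X \<subseteq> A1" "A1 \<subseteq> A0"
    unfolding A1_def using A0 O orb' th0
    by (auto intro!: continuous_open_preimage holomorphic_on_imp_continuous_on)
  have th1: "(T \<circ> \<theta>) holomorphic_on A1"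
    by (rule holomorphic_on_compose_gen[OF holomorphic_on_subset[OF th0 A1(3)] T(1)]) (auto simp: A1_def)
  have A2: "open A2" "X \<subseteq> A2" "A2 \<subseteq> A1"
    unfolding A2_def using A1 O orb' th1
    by (auto intro!: continuous_open_preimage holomorphic_on_imp_continuous_on)
  have th2: "(T \<circ> (T \<circ> \<theta>)) holomorphic_on A2"
    by (rule holomorphic_on_compose_gen[OF holomorphic_on_subset[OF th1 A2(3)] T(2)]) (auto simp: A2_def)
  have A3: "open A3" "X \<subseteq> A3" "A3 \<subseteq> A2"
    unfolding A3_def using A2 O orb' th2
    by (auto intro!: continuous_open_preimage holomorphic_on_imp_continuous_on)
  have mem: "z \<in> W" "\<phi> z \<in> W'" "\<theta> z \<in> O1" "T (\<theta> z) \<in> O2" "T (T (\<theta> z)) \<in> O3" if "z \<in> A3" for z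
    using that by (auto simp: A3_def A2_def A1_def A0_def)
  obtain D K2 where D: "D > 0" "compact K2" "K2 \<subseteq> A3" "\<And>x y. x \<in> X \<Longrightarrow> dist x y \<le> D \<Longrightarrow> y \<in> interior K2"
    using compact_fatten[OF X(1) A3(1,2)] by metis
  define V1 where "V1 = interior K2"
  have V1: "open V1" "X \<subseteq> V1" "V1 \<subseteq> K2" "V1 \<subseteq> A3"
    unfolding V1_def using D interior_subset[of K2] by (auto intro: D(4)[of x x for x])
  have K2W: "K2 \<subseteq> W" using D mem by blast
  have Ycomp: "compact (\<phi> ` K2)" "compact (\<theta> ` K2)" "compact ((T \<circ> \<theta>) ` K2)" "compact ((T \<circ> (T \<circ> \<theta>)) ` K2)"
  proof -
    have h: "compact (g ` K2)" if "g holomorphic_on S" "K2 \<subseteq> S" for g :: "complex \<Rightarrow> complex" and S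
      using that D(2) compact_continuous_image continuous_on_subset holomorphic_on_imp_continuous_on by metis
    have "K2 \<subseteq> A1" "K2 \<subseteq> A2" using D A3 A2 by auto
    then show "compact (\<phi> ` K2)" "compact (\<theta> ` K2)" "compact ((T \<circ> \<theta>) ` K2)" "compact ((T \<circ> (T \<circ> \<theta>)) ` K2)"
      using h[OF phi K2W] h[OF th K2W] h[OF th1] h[OF th2] by blast+
  qed
  have hdphi: "deriv \<phi> holomorphic_on W" by (intro holomorphic_deriv phi W)
  obtain Bp where Bp: "Bp \<ge> 1" "\<And>z. z \<in> K2 \<Longrightarrow> cmod (deriv \<phi> z) \<le> Bp"
    using compact_holomorphic_bound[OF D(2) hdphi K2W] by metis
  define C1 where "C1 = max C 1"
  have C1: "C1 \<ge> 1" and CC: "x \<ge> 0 \<Longrightarrow> C * x \<le> C1 * x" for x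
    by (auto simp: C1_def intro: mult_right_mono)
  \<comment> \<open>The common weight of all errors along the orbit. Newton lifting asks for
    \<open>q * cmod (deriv G)\<close> instead, and the two are comparable because
    \<open>deriv \<tau>\<close> is bounded away from 0 on the compact image.\<close>
  define s where "s = (\<lambda>z. cmod (deriv \<phi> z) * q z)"
  have s: "0 \<le> s z" "s z \<le> Bp * (C1 * Bp)" if "z \<in> V1" for z
  proof -
    have z: "z \<in> K2" "z \<in> W" using that V1 K2W by auto
    show "0 \<le> s z" using q(1)[OF z(2)] by (simp add: s_def)
    have "q z \<le> C1 * cmod (deriv \<phi> z)" using q(2)[OF z(2)] CC[of "cmod (deriv \<phi> z)"] by simp
    also have "\<dots> \<le> C1 * Bp" using C1 Bp(2)[OF z(1)] by (intro mult_left_mono) auto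
    finally show "s z \<le> Bp * (C1 * Bp)" unfolding s_def using Bp(2)[OF z(1)] q(1)[OF z(2)] Bp(1)
      by (intro mult_mono) auto
  qed
  have hdtau: "deriv \<tau> holomorphic_on W1" by (intro holomorphic_deriv tau W')
  obtain c where c: "c > 0" "\<And>z. z \<in> K2 \<Longrightarrow> c \<le> cmod (deriv \<tau> (\<phi> z))"
  proof -
    have sub: "\<phi> ` K2 \<subseteq> W1" using D mem W'(3) by blast
    have hin: "(\<lambda>y. inverse (deriv \<tau> y)) holomorphic_on W1" by (intro holomorphic_intros hdtau tau)
    obtain b where b: "b \<ge> 1" "\<And>z. z \<in> \<phi> ` K2 \<Longrightarrow> cmod (inverse (deriv \<tau> z)) \<le> b"
      using compact_holomorphic_bound[OF Ycomp(1) hin sub] by metis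
    show ?thesis
    proof (rule that[of "1/b"])
      fix z assume "z \<in> K2"
      then have "cmod (inverse (deriv \<tau> (\<phi> z))) \<le> b" "deriv \<tau> (\<phi> z) \<noteq> 0" using b sub tau(2) by auto
      then have "1 / cmod (deriv \<tau> (\<phi> z)) \<le> b" "cmod (deriv \<tau> (\<phi> z)) > 0"
        by (simp_all add: norm_inverse inverse_eq_divide norm_divide)
      then have "1 \<le> b * cmod (deriv \<tau> (\<phi> z))" by (simp add: pos_divide_le_eq)
      then show "1/b \<le> cmod (deriv \<tau> (\<phi> z))" using b(1) by (simp add: pos_divide_le_eq mult.commute)
    qed (use b in simp)
  qed
  define G where "G = (\<lambda>z. \<tau> (\<phi> z))"
  have Ghol: "G holomorphic_on V1"
  proof -
    have "\<phi> ` V1 \<subseteq> W1" "V1 \<subseteq> W" using V1 mem W' K2W by blast+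
    then show ?thesis unfolding G_def
      using holomorphic_on_compose_gen[OF holomorphic_on_subset[OF phi] tau(1)] by (auto simp: o_def)
  qed
  have dG: "deriv G z = deriv \<tau> (\<phi> z) * deriv \<phi> z" if "z \<in> V1" for z
  proof -
    have "z \<in> A3" using that V1 by auto
    then have "z \<in> W" "\<phi> z \<in> W1" using mem W'(3) by blast+
    then have "((\<lambda>z. \<tau> (\<phi> z)) has_field_derivative deriv \<tau> (\<phi> z) * deriv \<phi> z) (at z)"
      using DERIV_chain2[OF holomorphic_derivI[OF tau(1) W'(2)] holomorphic_derivI[OF phi W]] by blast
    then show ?thesis unfolding G_def by (rule DERIV_imp_deriv)
  qed
  have dGlow: "c * cmod (deriv \<phi> z) \<le> cmod (deriv G z)" if "z \<in> V1" for z
    unfolding dG[OF that] norm_mult using c(2)[of z] V1 that by (intro mult_right_mono) auto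
  have isoG: "\<forall>\<^sub>F y in at z. deriv G y \<noteq> 0" if z: "z \<in> V1" for z
  proof -
    have "\<forall>\<^sub>F y in at z. y \<in> V1" using V1 z eventually_at_in_open' by blast
    moreover have "\<forall>\<^sub>F y in at z. deriv \<phi> y \<noteq> 0" using iso z V1 K2W by blast
    ultimately show ?thesis
    proof eventually_elim
      case (elim y)
      then have "\<phi> y \<in> W1" using V1 mem W' by blast
      then show ?case using elim dG tau by auto
    qed
  qed
  have qC: "q z \<le> C1 / c * cmod (deriv G z)" if "z \<in> V1" for z
  proof -
    have "q z \<le> C1 * cmod (deriv \<phi> z)" using q(2)[of z] CC[of "cmod (deriv \<phi> z)"] that V1 K2W by force
    also have "\<dots> = C1 / c * (c * cmod (deriv \<phi> z))" using c by simp
    also have "\<dots> \<le> C1 / c * cmod (deriv G z)" using dGlow[OF that] C1 c by (intro mult_left_mono) auto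
    finally show ?thesis .
  qed
  have q0: "0 \<le> q z" if "z \<in> V1" for z using q(1) that V1 K2W by blast
  obtain V where V: "open V" "X \<subseteq> V" "V \<subseteq> V1" and
    lift: "\<And>\<epsilon>. \<epsilon> > 0 \<Longrightarrow> \<exists>\<kappa>>0. \<forall>G1 H. G1 holomorphic_on V1 \<longrightarrow> H holomorphic_on V1 \<longrightarrow>
       (\<forall>z\<in>V1. cmod (G1 z - G z) \<le> \<kappa> * (q z * cmod (deriv G z))) \<longrightarrow>
       (\<forall>z\<in>V1. cmod (H z - G z) \<le> \<kappa> * (q z * cmod (deriv G z))) \<longrightarrow>
       (\<exists>\<xi>. \<xi> holomorphic_on V \<and> (\<forall>z\<in>V. \<xi> z \<in> V1 \<and> G1 (\<xi> z) = H z \<and> cmod (\<xi> z - z) \<le> \<epsilon> * q z))"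
    by (rule newton_lift[OF V1(1) X(1) V1(2) Ghol isoG q0 qC]; (assumption | (rule that; assumption)))
  show ?thesis
  proof (rule that[OF V(1,2)])
    show "V \<subseteq> W" using V V1 K2W by auto
    show "\<phi> ` V \<subseteq> W'" using V V1 mem by blast
    fix \<epsilon> :: real assume "\<epsilon> > 0"
    from lift[OF this] obtain \<kappa> where kap: "\<kappa> > 0" and
      lift': "\<And>G1 H. G1 holomorphic_on V1 \<Longrightarrow> H holomorphic_on V1 \<Longrightarrow>
       (\<forall>z\<in>V1. cmod (G1 z - G z) \<le> \<kappa> * (q z * cmod (deriv G z))) \<Longrightarrow>
       (\<forall>z\<in>V1. cmod (H z - G z) \<le> \<kappa> * (q z * cmod (deriv G z))) \<Longrightarrow>
       (\<exists>\<xi>. \<xi> holomorphic_on V \<and> (\<forall>z\<in>V. \<xi> z \<in> V1 \<and> G1 (\<xi> z) = H z \<and> cmod (\<xi> z - z) \<le> \<epsilon> * q z))"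
      by blast
    have kc: "\<kappa> * c > 0" using kap c by simp
    have sG: "\<kappa> * c * s z \<le> \<kappa> * (q z * cmod (deriv G z))" if "z \<in> V1" for z
    proof -
      have "\<kappa> * c * s z = \<kappa> * (q z * (c * cmod (deriv \<phi> z)))" by (simp add: s_def)
      also have "\<dots> \<le> \<kappa> * (q z * cmod (deriv G z))"
        using kap q0[OF that] dGlow[OF that] by (intro mult_left_mono) auto
      finally show ?thesis .
    qed
    have Qc: "continuous_on S Q" for S using Q(1) continuous_on_subset by blast
    have VK: "z \<in> K2" "z \<in> W" if "z \<in> V1" for z using that V1 K2W by auto
    have Y1: "\<theta> ` K2 \<subseteq> O1" "(T \<circ> \<theta>) ` K2 \<subseteq> O2" "(T \<circ> (T \<circ> \<theta>)) ` K2 \<subseteq> O3" "\<phi> ` K2 \<subseteq> W1"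
    proof -
      have m: "z \<in> A3" if "z \<in> K2" for z using that D(3) by blast
      show "\<theta> ` K2 \<subseteq> O1" "(T \<circ> \<theta>) ` K2 \<subseteq> O2" "(T \<circ> (T \<circ> \<theta>)) ` K2 \<subseteq> O3" "\<phi> ` K2 \<subseteq> W1"
        using mem[OF m] W'(3) by auto
    qed
    \<comment> \<open>Tolerances are chosen against the direction of the orbit: the error allowed
      after the third step determines the one allowed after the second, and so on.\<close>
    obtain \<delta>3 where d3: "\<delta>3 > 0" "\<And>f v. f holomorphic_on O3 \<Longrightarrow> (\<forall>y\<in>O3. cmod (f y - T y) \<le> \<delta>3 * Q y) \<Longrightarrow>
     (\<forall>z\<in>V1. cmod (v z - T (T (\<theta> z))) \<le> \<delta>3 * s z) \<Longrightarrow> (\<forall>z\<in>V1. v z \<in> O3 \<and> cmod (f (v z) - T (T (T (\<theta> z)))) \<le> (\<kappa> * c) * s z)"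
      using composition_close[OF O(3) T(3) Ycomp(4) Y1(3), of V1 "\<lambda>z. T (T (\<theta> z))" Q s "Bp * (C1 * Bp)" C "\<kappa> * c"]
        VK Qc Q s kc by (auto simp: s_def)
    obtain \<delta>2 where d2: "\<delta>2 > 0" "\<And>f v. f holomorphic_on O2 \<Longrightarrow> (\<forall>y\<in>O2. cmod (f y - T y) \<le> \<delta>2 * Q y) \<Longrightarrow>
     (\<forall>z\<in>V1. cmod (v z - T (\<theta> z)) \<le> \<delta>2 * s z) \<Longrightarrow> (\<forall>z\<in>V1. v z \<in> O2 \<and> cmod (f (v z) - T (T (\<theta> z))) \<le> \<delta>3 * s z)"
      using composition_close[OF O(2) T(2) Ycomp(3) Y1(2), of V1 "\<lambda>z. T (\<theta> z)" Q s "Bp * (C1 * Bp)" C "\<delta>3"]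
        VK Qc Q s d3(1) by (auto simp: s_def)
    obtain \<delta>1 where d1: "\<delta>1 > 0" "\<And>f v. f holomorphic_on O1 \<Longrightarrow> (\<forall>y\<in>O1. cmod (f y - T y) \<le> \<delta>1 * Q y) \<Longrightarrow>
     (\<forall>z\<in>V1. cmod (v z - \<theta> z) \<le> \<delta>1 * s z) \<Longrightarrow> (\<forall>z\<in>V1. v z \<in> O1 \<and> cmod (f (v z) - T (\<theta> z)) \<le> \<delta>2 * s z)"
      using composition_close[OF O(1) T(1) Ycomp(2) Y1(1), of V1 "\<lambda>z. \<theta> z" Q s "Bp * (C1 * Bp)" C "\<delta>2"]
        VK Qc Q s d2(1) by (auto simp: s_def)
    \<comment> \<open>Here \<open>f\<close> and \<open>T\<close> are both \<open>\<tau>\<close> and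
      the weight \<open>Q\<close> is 0, since only the argument is perturbed.\<close>
    obtain \<delta>0 where d0: "\<delta>0 > 0" "\<And>v. (\<forall>z\<in>V1. cmod (v z - \<phi> z) \<le> \<delta>0 * s z) \<Longrightarrow>
         (\<forall>z\<in>V1. v z \<in> W1 \<and> cmod (\<tau> (v z) - \<tau> (\<phi> z)) \<le> (\<kappa> * c) * s z)"
      using composition_close[OF W'(2) tau(1) Ycomp(1) Y1(4), of V1 "\<phi>" "\<lambda>_. 0" s "Bp * (C1 * Bp)" C1 "\<kappa> * c"]
        VK s kc C1 tau(1) by auto
    define \<delta> where "\<delta> = Min {\<delta>1, \<delta>2, \<delta>3, \<delta>0 / C1}"
    have dd: "\<delta> > 0" "\<delta> \<le> \<delta>1" "\<delta> \<le> \<delta>2" "\<delta> \<le> \<delta>3" "\<delta> \<le> \<delta>0 / C1"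
      unfolding \<delta>_def using d0 d1 d2 d3 C1 by auto
    have d01: "\<delta> * C1 \<le> \<delta>0" using dd(5) C1 by (simp add: pos_le_divide_eq)
    show "\<exists>\<delta>>0. \<forall>f \<xi>'. f holomorphic_on O1 \<longrightarrow> f holomorphic_on O2 \<longrightarrow> f holomorphic_on O3 \<longrightarrow>
       (\<forall>y\<in>O1 \<union> O2 \<union> O3. cmod (f y - T y) \<le> \<delta> * Q y) \<longrightarrow>
       \<xi>' holomorphic_on W' \<longrightarrow> (\<forall>y\<in>W'. cmod (\<xi>' y - y) \<le> \<delta> * q' y) \<longrightarrow>
       (\<exists>\<xi>. \<xi> holomorphic_on V \<and> (\<forall>z\<in>V. \<xi> z \<in> W \<and> cmod (\<xi> z - z) \<le> \<epsilon> * q z \<and>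
          \<theta> (\<xi> z) \<in> O1 \<and> f (\<theta> (\<xi> z)) \<in> O2 \<and> f (f (\<theta> (\<xi> z))) \<in> O3 \<and>
          f (f (f (\<theta> (\<xi> z)))) = \<tau> (\<xi>' (\<phi> z))))"
    proof (rule exI[of _ \<delta>], intro conjI allI impI dd(1))
      fix f \<xi>' assume f: "f holomorphic_on O1" "f holomorphic_on O2" "f holomorphic_on O3"
        and fT: "\<forall>y\<in>O1 \<union> O2 \<union> O3. cmod (f y - T y) \<le> \<delta> * Q y"
        and x: "\<xi>' holomorphic_on W'" "\<forall>y\<in>W'. cmod (\<xi>' y - y) \<le> \<delta> * q' y"
      have up: "\<delta> * Q y \<le> \<delta>' * Q y" if "\<delta> \<le> \<delta>'" for \<delta>' y using Q(2) that by (intro mult_right_mono)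
      have fT': "\<forall>y\<in>O1. cmod (f y - T y) \<le> \<delta>1 * Q y" "\<forall>y\<in>O2. cmod (f y - T y) \<le> \<delta>2 * Q y" "\<forall>y\<in>O3. cmod (f y - T y) \<le> \<delta>3 * Q y"
        using fT up[OF dd(2)] up[OF dd(3)] up[OF dd(4)] by (meson UnCI order_trans)+
      have r1: "\<forall>z\<in>V1. \<theta> z \<in> O1 \<and> cmod (f (\<theta> z) - T (\<theta> z)) \<le> \<delta>2 * s z"
        by (rule d1(2)[OF f(1) fT'(1)]) (use d1 s in auto)
      have r2: "\<forall>z\<in>V1. f (\<theta> z) \<in> O2 \<and> cmod (f (f (\<theta> z)) - T (T (\<theta> z))) \<le> \<delta>3 * s z"
        by (rule d2(2)[OF f(2) fT'(2)]) (use r1 in auto)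
      have r3: "\<forall>z\<in>V1. f (f (\<theta> z)) \<in> O3 \<and> cmod (f (f (f (\<theta> z))) - T (T (T (\<theta> z)))) \<le> (\<kappa> * c) * s z"
        by (rule d3(2)[OF f(3) fT'(3)]) (use r2 in auto)
      have x1: "cmod (\<xi>' (\<phi> z) - \<phi> z) \<le> \<delta>0 * s z" if z: "z \<in> V1" for z
      proof -
        have "cmod (\<xi>' (\<phi> z) - \<phi> z) \<le> \<delta> * q' (\<phi> z)" using x(2) mem(2)[of z] z V1 by blast
        also have "\<dots> \<le> \<delta> * (C1 * s z)"
          using q'(2)[OF VK(2)[OF z]] CC[OF s(1)[OF z]] dd(1) by (intro mult_left_mono) (auto simp: s_def)
        also have "\<dots> \<le> \<delta>0 * s z" using d01 s(1)[OF z] by (metis mult.assoc mult_right_mono)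
        finally show ?thesis .
      qed
      have r0: "\<forall>z\<in>V1. \<xi>' (\<phi> z) \<in> W1 \<and> cmod (\<tau> (\<xi>' (\<phi> z)) - \<tau> (\<phi> z)) \<le> (\<kappa> * c) * s z"
        by (rule d0(2)) (use x1 in auto)
      have th': "\<theta> holomorphic_on V1" "\<phi> holomorphic_on V1" using th phi VK holomorphic_on_subset by blast+
      have h1: "(\<lambda>z. f (\<theta> z)) holomorphic_on V1"
        using holomorphic_on_compose_gen[OF th'(1) f(1)] r1 by (auto simp: o_def)
      have h2: "(\<lambda>z. f (f (\<theta> z))) holomorphic_on V1"
        using holomorphic_on_compose_gen[OF h1 f(2)] r2 by (auto simp: o_def)
      have h3: "(\<lambda>z. f (f (f (\<theta> z)))) holomorphic_on V1"
        using holomorphic_on_compose_gen[OF h2 f(3)] r3 by (auto simp: o_def)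
      have g1: "(\<lambda>z. \<xi>' (\<phi> z)) holomorphic_on V1"
        using holomorphic_on_compose_gen[OF th'(2) x(1)] mem(2) V1 by (auto simp: o_def)
      have g2: "(\<lambda>z. \<tau> (\<xi>' (\<phi> z))) holomorphic_on V1"
        using holomorphic_on_compose_gen[OF g1 tau(1)] r0 by (auto simp: o_def)
      have "\<exists>\<xi>. \<xi> holomorphic_on V \<and> (\<forall>z\<in>V. \<xi> z \<in> V1 \<and> f (f (f (\<theta> (\<xi> z)))) = \<tau> (\<xi>' (\<phi> z)) \<and> cmod (\<xi> z - z) \<le> \<epsilon> * q z)"
      proof (rule lift'[OF h3 g2])
        show "\<forall>z\<in>V1. cmod (f (f (f (\<theta> z))) - G z) \<le> \<kappa> * (q z * cmod (deriv G z))"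
          using r3 sG eq VK unfolding G_def by (metis order_trans)
        show "\<forall>z\<in>V1. cmod (\<tau> (\<xi>' (\<phi> z)) - G z) \<le> \<kappa> * (q z * cmod (deriv G z))"
          using r0 sG unfolding G_def by (meson order_trans)
      qed
      then show "\<exists>\<xi>. \<xi> holomorphic_on V \<and> (\<forall>z\<in>V. \<xi> z \<in> W \<and> cmod (\<xi> z - z) \<le> \<epsilon> * q z \<and>
          \<theta> (\<xi> z) \<in> O1 \<and> f (\<theta> (\<xi> z)) \<in> O2 \<and> f (f (\<theta> (\<xi> z))) \<in> O3 \<and>
          f (f (f (\<theta> (\<xi> z)))) = \<tau> (\<xi>' (\<phi> z)))"
        using r1 r2 r3 VK by meson
    qed
  qed
qed

section \<open>Polynomial weights near compact sets\<close>

lemma wt_bounded: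
  assumes "bounded S" obtains M where "M \<ge> 0" "\<And>z. z \<in> S \<Longrightarrow> wt l z \<le> M"
proof -
  have "compact (wt l ` closure S)"
    using assms by (intro compact_continuous_image continuous_on_wt continuous_on_id) (simp add: compact_closure)
  then obtain b where "\<And>z. z \<in> closure S \<Longrightarrow> norm (wt l z) \<le> b"
    using compact_imp_bounded bounded_iff by (metis imageI)
  then show ?thesis using closure_subset[of S] by (intro that[of "max b 0"]) (auto simp: le_max_iff_disj)
qed

lemma wt_append_bound:
  assumes "bounded S" obtains M where "M \<ge> 0" "\<And>z. z \<in> S \<Longrightarrow> wt (l1 @ l @ l2) z \<le> M * wt l z"
proof -
  obtain M1 where 1: "M1 \<ge> 0" "\<And>z. z \<in> S \<Longrightarrow> wt l1 z \<le> M1" using wt_bounded[OF assms] by metis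
  obtain M2 where 2: "M2 \<ge> 0" "\<And>z. z \<in> S \<Longrightarrow> wt l2 z \<le> M2" using wt_bounded[OF assms] by metis
  have "wt (l1 @ l @ l2) z \<le> (M1 * M2) * wt l z" if "z \<in> S" for z
  proof -
    have "wt l1 z * wt l2 z \<le> M1 * M2" using 1 2 that by (intro mult_mono) auto
    then have "(wt l1 z * wt l2 z) * wt l z \<le> (M1 * M2) * wt l z" by (intro mult_right_mono) auto
    then show ?thesis by (simp add: algebra_simps)
  qed
  then show ?thesis using 1 2 by (intro that[of "M1 * M2"]) auto
qed

lemma wt_concat_bound:
  assumes "bounded S" "x \<in> set xs"
  obtains M where "M \<ge> 0" "\<And>z. z \<in> S \<Longrightarrow> wt (concat (map f xs)) z \<le> M * wt (f x) z"
proof -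
  obtain ys zs where "xs = ys @ x # zs" using assms(2) by (meson split_list)
  then have "concat (map f xs) = concat (map f ys) @ f x @ concat (map f zs)" by simp
  then show ?thesis using wt_append_bound[OF assms(1), of "concat (map f ys)" "f x" "concat (map f zs)"] that by metis
qed

lemma wt_replicate: "wt (replicate m a) z = cmod (z - a) ^ m"
  by (induction m) auto

lemma wt_map_le:
  assumes "\<And>a. a \<in> set l \<Longrightarrow> cmod (u - g a) \<le> L * cmod (z - a)" "L \<ge> 0"
  shows "wt (map g l) u \<le> L ^ length l * wt l z"
  using assms
proof (induction l)
  case (Cons a l)
  have "cmod (u - g a) * wt (map g l) u \<le> (L * cmod (z - a)) * (L ^ length l * wt l z)"
    using Cons by (intro mult_mono) auto
  then show ?case by (simp add: algebra_simps)
qed auto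

text \<open>No convexity is assumed. Points at distance at most \<open>D\<close> from
  \<open>a\<close> lie in a disc about \<open>a\<close> inside \<open>K2\<close>, where the
  derivative is bounded; for the others the trivial bound \<open>2 * B0\<close> on the difference is
  at most a multiple of the distance.\<close>

lemma lipschitz_near_compact:
  assumes g: "g holomorphic_on W" and W: "open W" "compact K" "K \<subseteq> W"
  obtains N L where "open N" "K \<subseteq> N" "N \<subseteq> W" "L \<ge> 0" "\<And>z a. z \<in> N \<Longrightarrow> a \<in> K \<Longrightarrow> cmod (g z - g a) \<le> L * cmod (z - a)"
proof -
  obtain D K2 where D: "D > 0" "compact K2" "K2 \<subseteq> W" "\<And>x y. x \<in> K \<Longrightarrow> dist x y \<le> D \<Longrightarrow> y \<in> interior K2"
    using compact_fatten[OF W(2,1,3)] by metis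
  have hd: "deriv g holomorphic_on W" by (intro holomorphic_deriv g W)
  obtain B0 where B0: "B0 \<ge> 1" "\<And>z. z \<in> K2 \<Longrightarrow> cmod (g z) \<le> B0"
    using compact_holomorphic_bound[OF D(2) g D(3)] by metis
  obtain B1 where B1: "B1 \<ge> 1" "\<And>z. z \<in> K2 \<Longrightarrow> cmod (deriv g z) \<le> B1"
    using compact_holomorphic_bound[OF D(2) hd D(3)] by metis
  define L where "L = max B1 (2 * B0 / D)"
  show ?thesis
  proof (rule that)
    show "open (interior K2)" by simp
    show "K \<subseteq> interior K2" using D(1) D(4)[of x x for x] by auto
    show "interior K2 \<subseteq> W" using interior_subset D by blast
    show "L \<ge> 0" using B1 by (simp add: L_def le_max_iff_disj)
    fix z a assume z: "z \<in> interior K2" and a: "a \<in> K"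
    show "cmod (g z - g a) \<le> L * cmod (z - a)"
    proof (cases "dist a z \<le> D")
      case True
      have "cmod (g z - g a) \<le> B1 * cmod (z - a)"
      proof (rule field_differentiable_bound[where S="cball a D" and f'="deriv g"])
        fix x assume "x \<in> cball a D"
        then have x: "x \<in> K2" using D(4)[OF a] interior_subset by fastforce
        show "(g has_field_derivative deriv g x) (at x within cball a D)"
          using g W x D by (meson holomorphic_derivI has_field_derivative_at_within subsetD)
        show "cmod (deriv g x) \<le> B1" using B1 x by auto
      qed (use True D in auto)
      also have "\<dots> \<le> L * cmod (z - a)" by (intro mult_right_mono) (auto simp: L_def)
      finally show ?thesis .
    next
      case False
      have "a \<in> K2" "z \<in> K2" using D(1) D(4)[OF a, of a] z interior_subset by auto
      then have "cmod (g z - g a) \<le> 2 * B0" using B0(2)[of a] B0(2)[of z] norm_triangle_ineq4[of "g z" "g a"] by simp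
      also have "\<dots> = 2 * B0 / D * D" using D by simp
      also have "\<dots> \<le> L * cmod (z - a)" using False D B0 by (intro mult_mono) (auto simp: L_def dist_norm norm_minus_commute le_max_iff_disj)
      finally show ?thesis .
    qed
  qed
qed

text \<open>Vanishing at the images \<open>g a\<close> pulls back under \<open>g\<close> to
  vanishing at the points \<open>a\<close> themselves, because \<open>g\<close> is Lipschitz near
  \<open>K\<close>.\<close>

lemma wt_map_near_compact:
  assumes g: "g holomorphic_on W" and W: "open W" "compact K" "K \<subseteq> W" and l: "set l \<subseteq> K"
  obtains N C where "open N" "K \<subseteq> N" "N \<subseteq> W" "C \<ge> 0" "\<And>z. z \<in> N \<Longrightarrow> wt (map g l) (g z) \<le> C * wt l z"
proof -
  obtain N L where N: "open N" "K \<subseteq> N" "N \<subseteq> W" "L \<ge> 0" "\<And>z a. z \<in> N \<Longrightarrow> a \<in> K \<Longrightarrow> cmod (g z - g a) \<le> L * cmod (z - a)"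
    using lipschitz_near_compact[OF g W] by metis
  show ?thesis
    by (rule that[of N "L ^ length l"]) (use N l in \<open>auto intro!: wt_map_le\<close>)
qed

text \<open>The exponent \<open>m\<close> is the order of vanishing of \<open>\<psi>\<close> at
  \<open>z0\<close>; the cofactor has no zero and is bounded below on a smaller disc.\<close>

lemma wt_dominated_local:
  assumes psi: "\<psi> holomorphic_on W" and W: "open W" "z0 \<in> W" and nz: "\<forall>\<^sub>F y in at z0. \<psi> y \<noteq> 0"
  shows "\<exists>r>0. \<exists>m C. C \<ge> 0 \<and> ball z0 r \<subseteq> W \<and> (\<forall>z\<in>ball z0 r. cmod (z - z0) ^ m \<le> C * cmod (\<psi> z))"
proof -
  obtain m :: nat and g r where r: "r > 0" "ball z0 r \<subseteq> W" "g holomorphic_on ball z0 r"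
    "\<And>w. w \<in> ball z0 r \<Longrightarrow> \<psi> w = (w - z0) ^ m * g w" "\<And>w. w \<in> ball z0 r \<Longrightarrow> g w \<noteq> 0"
  proof (cases "\<psi> z0 = 0")
    case False
    have "open (W \<inter> \<psi> -` (- {0}))" using psi W by (intro continuous_open_preimage holomorphic_on_imp_continuous_on) auto
    moreover have "z0 \<in> W \<inter> \<psi> -` (- {0})" using False W by auto
    ultimately obtain r where r: "r > 0" "ball z0 r \<subseteq> W \<inter> \<psi> -` (- {0})" using open_contains_ball by blast
    show ?thesis
      by (rule that[of r \<psi> 0]) (use r psi in \<open>auto intro: holomorphic_on_subset\<close>)
  next
    case True
    obtain s where s: "s > 0" "ball z0 s \<subseteq> W" using W open_contains_ball by blast
    have h: "\<psi> holomorphic_on ball z0 s" using psi s holomorphic_on_subset by blast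
    have nc: "\<not> \<psi> constant_on ball z0 s"
    proof
      assume "\<psi> constant_on ball z0 s"
      then obtain c where c: "\<And>y. y \<in> ball z0 s \<Longrightarrow> \<psi> y = c" unfolding constant_on_def by auto
      then have c0: "c = 0" using True s by force
      have "\<forall>\<^sub>F y in at z0. y \<in> ball z0 s" using s eventually_at_in_open'[of "ball z0 s"] by auto
      then have "\<forall>\<^sub>F y in at z0. False" using nz
      proof eventually_elim
        case (elim y)
        then show ?case using c c0 by auto
      qed
      then show False by simp
    qed
    obtain g r n where "0 < n" "0 < r" "ball z0 r \<subseteq> ball z0 s" "g holomorphic_on ball z0 r"
      "\<And>w. w \<in> ball z0 r \<Longrightarrow> \<psi> w = (w - z0) ^ n * g w" "\<And>w. w \<in> ball z0 r \<Longrightarrow> g w \<noteq> 0"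
      using holomorphic_factor_zero_nonconstant[OF h open_ball connected_ball _ True nc] s(1) centre_in_ball by metis
    then show ?thesis using s by (intro that[of r g n]) auto
  qed
  have hin: "(\<lambda>w. inverse (g w)) holomorphic_on ball z0 r" using r by (intro holomorphic_intros) auto
  obtain B where B: "B \<ge> 1" "\<And>z. z \<in> cball z0 (r/2) \<Longrightarrow> cmod (inverse (g z)) \<le> B"
  proof -
    have "cball z0 (r/2) \<subseteq> ball z0 r" using r(1) by auto
    then show ?thesis using compact_holomorphic_bound[OF compact_cball hin] that by metis
  qed
  show ?thesis
  proof (intro exI conjI ballI)
    show "0 < r/2" using r by simp
    show "B \<ge> 0" using B by simp
    show "ball z0 (r/2) \<subseteq> W" using r by auto
    fix z assume z: "z \<in> ball z0 (r/2)"
    then have zr: "z \<in> ball z0 r" using r(1) by auto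
    have "cmod (z - z0) ^ m = cmod (\<psi> z) * cmod (inverse (g z))"
      unfolding r(4)[OF zr] using r(5)[OF zr] by (simp add: norm_mult norm_power norm_inverse)
    also have "\<dots> \<le> cmod (\<psi> z) * B" using B(2)[of z] z by (intro mult_left_mono) auto
    finally show "cmod (z - z0) ^ m \<le> B * cmod (\<psi> z)" by (simp add: mult.commute)
  qed
qed

text \<open>The nodes are the centres of a finite cover by discs from the local statement, repeated
  with their exponents. On each disc only the factor of its centre is used, all others being
  bounded.\<close>

lemma wt_dominated:
  assumes psi: "\<psi> holomorphic_on W" and W: "open W" "compact K" "K \<subseteq> W" and nz: "\<And>z. z \<in> K \<Longrightarrow> \<forall>\<^sub>F y in at z. \<psi> y \<noteq> 0"
  obtains l N C where "set l \<subseteq> K" "open N" "K \<subseteq> N" "N \<subseteq> W" "C \<ge> 0" "\<And>z. z \<in> N \<Longrightarrow> wt l z \<le> C * cmod (\<psi> z)"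
proof -
  have "\<forall>z0\<in>K. \<exists>r m C. r > 0 \<and> C \<ge> 0 \<and> ball z0 r \<subseteq> W \<and> (\<forall>z\<in>ball z0 r. cmod (z - z0) ^ m \<le> C * cmod (\<psi> z))"
    using wt_dominated_local[OF psi W(1) _ nz] W by blast
  then obtain r m C where rmC: "\<And>z0. z0 \<in> K \<Longrightarrow> r z0 > 0 \<and> C z0 \<ge> 0 \<and> ball z0 (r z0) \<subseteq> W \<and>
       (\<forall>z\<in>ball z0 (r z0). cmod (z - z0) ^ (m z0) \<le> C z0 * cmod (\<psi> z))"
    by metis
  obtain F where F: "F \<subseteq> K" "finite F" "K \<subseteq> (\<Union>x\<in>F. ball x (r x))"
    using compactE_image[OF W(2), of K "\<lambda>x. ball x (r x)"] rmC by force
  obtain fs where fs: "set fs = F" using finite_list[OF F(2)] by blast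
  define l where "l = concat (map (\<lambda>x. replicate (m x) x) fs)"
  define N where "N = (\<Union>x\<in>F. ball x (r x))"
  have bN: "bounded N" unfolding N_def using F by auto
  have "\<exists>M\<ge>0. \<forall>z\<in>N. wt l z \<le> M * wt (replicate (m x) x) z" if "x \<in> F" for x
    using wt_concat_bound[OF bN, of x fs "\<lambda>x. replicate (m x) x"] that fs unfolding l_def by metis
  then obtain M where M: "\<And>x. x \<in> F \<Longrightarrow> M x \<ge> 0 \<and> (\<forall>z\<in>N. wt l z \<le> M x * wt (replicate (m x) x) z)" by metis
  define CC where "CC = (\<Sum>x\<in>F. M x * C x)"
  have MC: "M x * C x \<ge> 0" if "x \<in> F" for x using that M rmC F by auto
  show ?thesis
  proof (rule that)
    show "set l \<subseteq> K" using F fs by (auto simp: l_def)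
    show "open N" "K \<subseteq> N" "N \<subseteq> W" using F rmC by (auto simp: N_def)
    show "CC \<ge> 0" unfolding CC_def using MC by (intro sum_nonneg) auto
    fix z assume z: "z \<in> N"
    then obtain x where x: "x \<in> F" "z \<in> ball x (r x)" by (auto simp: N_def)
    have "wt l z \<le> M x * cmod (z - x) ^ m x" using M[OF x(1)] z by (simp add: wt_replicate)
    also have "\<dots> \<le> M x * (C x * cmod (\<psi> z))" using rmC[of x] x F M[OF x(1)] by (intro mult_left_mono) auto
    also have "\<dots> = M x * C x * cmod (\<psi> z)" by simp
    also have "\<dots> \<le> CC * cmod (\<psi> z)" unfolding CC_def using x F MC by (intro mult_right_mono member_le_sum) auto
    finally show "wt l z \<le> CC * cmod (\<psi> z)" .
  qed
qed

section \<open>Discs and neighbourhoods around escaping compact sets\<close>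

definition escaping :: "(nat \<Rightarrow> complex set) \<Rightarrow> bool" where
  "escaping A \<longleftrightarrow> (\<forall>B. \<exists>N. \<forall>n\<ge>N. A n \<inter> cball 0 B = {})"

lemma escapingE:
  assumes "escaping A" obtains N where "\<And>n. n \<ge> N \<Longrightarrow> A n \<inter> cball 0 B = {}"
  using assms unfolding escaping_def by blast

lemma escaping_subset: "escaping A \<Longrightarrow> (\<And>n. B n \<subseteq> A n) \<Longrightarrow> escaping B"
  unfolding escaping_def by blast

lemma escaping_Un:
  assumes "escaping A" "escaping B" shows "escaping (\<lambda>n. A n \<union> B n)"
  unfolding escaping_def
proof
  fix M
  obtain N1 where 1: "\<And>n. n \<ge> N1 \<Longrightarrow> A n \<inter> cball 0 M = {}" using escapingE[OF assms(1)] by metis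
  obtain N2 where 2: "\<And>n. n \<ge> N2 \<Longrightarrow> B n \<inter> cball 0 M = {}" using escapingE[OF assms(2)] by metis
  show "\<exists>N. \<forall>n\<ge>N. (A n \<union> B n) \<inter> cball 0 M = {}"
    using 1 2 by (intro exI[of _ "max N1 N2"]) (simp add: Int_Un_distrib2)
qed

text \<open>A convergent sequence is bounded, so it meets only finitely many of the sets.\<close>

lemma closed_Union_escaping:
  assumes A: "\<And>n. closed (A n)" and "escaping A" shows "closed (\<Union>n\<in>I. A n)"
  unfolding closed_sequential_limits
proof (intro allI impI, elim conjE)
  fix x l assume x: "\<forall>n. x n \<in> (\<Union>m\<in>I. A m)" and l: "x \<longlonglongrightarrow> l"
  obtain B where B: "\<And>n. cmod (x n) \<le> B"
    using convergent_imp_Bseq[OF convergentI[OF l]] unfolding Bseq_def by blast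
  obtain N where N: "\<And>n. n \<ge> N \<Longrightarrow> A n \<inter> cball 0 B = {}" using escapingE[OF assms(2)] by metis
  have "x n \<in> (\<Union>m\<in>I \<inter> {..<N}. A m)" for n
  proof -
    obtain m where m: "m \<in> I" "x n \<in> A m" using x by auto
    have "x n \<in> cball 0 B" using B[of n] by auto
    then have "\<not> m \<ge> N" using m N[of m] by blast
    then show ?thesis using m by auto
  qed
  moreover have "closed (\<Union>m\<in>I \<inter> {..<N}. A m)" using A by (intro closed_UN) auto
  ultimately have "l \<in> (\<Union>m\<in>I \<inter> {..<N}. A m)" using l closed_sequentially by blast
  then show "l \<in> (\<Union>m\<in>I. A m)" by auto
qed

lemma escaping_radii:
  assumes "escaping A"
  obtains R :: "nat \<Rightarrow> real" where "filterlim R at_top sequentially" "\<And>m n. m \<ge> n \<Longrightarrow> A m \<inter> cball 0 (R n) = {}"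
proof -
  define G where "G n k \<longleftrightarrow> (\<forall>m\<ge>n. A m \<inter> cball 0 (real k - 1) = {})" for n k
  \<comment> \<open>The cap \<open>n\<close> guarantees a maximum even if all sets from
    \<open>n\<close> on are empty, and \<open>k = 0\<close> always qualifies because a ball of
    radius -1 is empty.\<close>
  define K where "K n = Max {k. k \<le> n \<and> G n k}" for n
  have fin: "finite {k. k \<le> n \<and> G n k}" for n by simp
  have G0: "G n 0" for n by (simp add: G_def)
  have "K n \<in> {k. k \<le> n \<and> G n k}" for n unfolding K_def using G0 by (intro Max_in fin) auto
  then have GK: "G n (K n)" for n by blast
  show ?thesis
  proof (rule that[of "\<lambda>n. real (K n) - 1"])
    show "filterlim (\<lambda>n. real (K n) - 1) at_top sequentially"
      unfolding filterlim_at_top eventually_sequentially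
    proof
      fix B :: real
      obtain k :: nat where k: "B + 1 \<le> real k" using real_arch_simple by blast
      obtain N where N: "\<And>n. n \<ge> N \<Longrightarrow> A n \<inter> cball 0 (real k - 1) = {}" using escapingE[OF assms] by metis
      show "\<exists>N. \<forall>n\<ge>N. B \<le> real (K n) - 1"
      proof (intro exI allI impI)
        fix n assume n: "max N k \<le> n"
        then have "G n k" using N by (simp add: G_def)
        then have "k \<le> K n" unfolding K_def using n by (intro Max_ge fin) auto
        then show "B \<le> real (K n) - 1" using k by simp
      qed
    qed
    show "A m \<inter> cball 0 (real (K n) - 1) = {}" if "m \<ge> n" for m n using GK[of n] that unfolding G_def by blast
  qed
qed

text \<open>A neighbourhood of infinity is connected, so it is not a locally finite union of disjoint compact sets.\<close>
lemma escaping_complement_unbounded: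
  assumes X: "\<And>n. compact (X n)" and dis: "disjoint_family X" and esc: "escaping X"
  shows "\<exists>z. cmod z > B \<and> z \<notin> (\<Union>n. X n)"
proof (rule ccontr)
  have disj: "X m \<inter> X n = {}" if "m \<noteq> n" for m n using disjoint_family_onD[OF dis] that by simp
  let ?A = "- cball (0::complex) B"
  assume "\<not> ?thesis"
  then have A: "?A \<subseteq> (\<Union>n. X n)" by auto
  have con: "connected ?A" by (rule connected_complement_bounded_convex) auto
  have nb: "\<not> bounded ?A" by (metis bounded_cball cobounded_imp_unbounded double_compl)
  have "X n \<inter> ?A = {}" for n
  proof -
    let ?Y = "\<Union>m\<in>-{n}. X m"
    have "X n \<inter> ?A = {} \<or> ?Y \<inter> ?A = {}"
    proof (rule connected_closedD[OF con])
      have "X n \<inter> X m = {}" if "m \<in> -{n}" for m using disj[of n m] that by simp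
      then show "X n \<inter> ?Y \<inter> ?A = {}" by blast
      show "?A \<subseteq> X n \<union> ?Y" using A by auto
      show "closed (X n)" using X by (simp add: compact_imp_closed)
      show "closed ?Y" using X esc by (intro closed_Union_escaping) (auto simp: compact_imp_closed)
    qed
    moreover have "?Y \<inter> ?A \<noteq> {}"
    proof
      assume "?Y \<inter> ?A = {}"
      then have "x \<in> X n" if "x \<in> X m" "x \<in> ?A" for x m using that by (cases "m = n") blast+
      then have "?A \<subseteq> X n" using A by blast
      then show False using nb X compact_imp_bounded bounded_subset by blast
    qed
    ultimately show ?thesis by blast
  qed
  then have "?A = {}" using A by blast
  then show False using nb by simp
qed

text \<open>Room is made once and for all: the disc about the pole and the target discs are placed
  in the complement of the union of the \<open>X n\<close>, which is open and unbounded. The growing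
  discs of radius \<open>R n\<close> are untouched by the sets of index \<open>n\<close> and above,
  so that later changes of the map can be kept small on them.\<close>

lemma wandering_geometry:
  assumes X: "\<And>n. compact (X n)" and dis: "disjoint_family X" and esc: "escaping X"
    and U: "open U" "(\<Union>n. X n) \<subseteq> U"
  shows "\<exists>V p \<rho> e r R. (\<forall>n. open (V n) \<and> X n \<subseteq> V n \<and> V n \<subseteq> U \<and> bounded (V n)) \<and>
    (\<forall>m n. m \<noteq> n \<longrightarrow> V m \<inter> V n = {}) \<and> 0 < \<rho> \<and> \<rho> \<le> 1 \<and> (\<forall>n. 0 < r n) \<and>
    (\<forall>n. V n \<inter> cball p \<rho> = {}) \<and> (\<forall>m n. V n \<inter> cball (e m) (r m) = {}) \<and>
    (\<forall>n. cball (e n) (r n) \<inter> cball p \<rho> = {}) \<and>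
    (\<forall>m n. m \<noteq> n \<longrightarrow> cball (e m) (r m) \<inter> cball (e n) (r n) = {}) \<and> (\<forall>n. cmod (e n) \<ge> 2 / \<rho> + 1) \<and>
    (\<forall>m n. m \<ge> n \<longrightarrow> V m \<inter> cball 0 (R n) = {} \<and> cball (e m) (r m) \<inter> cball 0 (R n) = {}) \<and>
    filterlim R at_top sequentially"
proof -
  let ?X = "\<Union>n. X n"
  have disj: "X m \<inter> X n = {}" if "m \<noteq> n" for m n using disjoint_family_onD[OF dis] that by simp
  have Xc: "closed (X n)" for n using X by (simp add: compact_imp_closed)
  have clX: "closed ?X" using closed_Union_escaping[OF Xc esc, of UNIV] by simp
  then have opX: "open (- ?X)" by (rule open_Compl)
  obtain p where p: "p \<notin> ?X" using escaping_complement_unbounded[OF X dis esc] by blast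
  then obtain \<rho>' where rho': "\<rho>' > 0" "cball p \<rho>' \<subseteq> - ?X" using opX open_contains_cball by (metis ComplI)
  define \<rho> where "\<rho> = min \<rho>' 1"
  have rho: "0 < \<rho>" "\<rho> \<le> 1" "cball p \<rho> \<inter> ?X = {}" using rho' subset_cball[of \<rho> \<rho>' p] by (auto simp: \<rho>_def)
  \<comment> \<open>The first entry lets \<open>1 / (z - p)\<close> reach \<open>e n\<close> from
    inside the disc about \<open>p\<close>; the second separates the discs about the
    \<open>e n\<close> from the disc about \<open>p\<close>.\<close>
  define B where "B = max (2 / \<rho> + 1) (cmod p + 3)"
  \<comment> \<open>Moduli growing by at least 1, against radii of at most 1/4, make the discs about
    the \<open>e n\<close> disjoint.\<close>
  have "\<exists>e. \<forall>n. (e n \<notin> ?X \<and> cmod (e n) \<ge> B + real n) \<and> cmod (e (Suc n)) \<ge> cmod (e n) + 1"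
  proof (rule dependent_nat_choice)
    show "\<exists>z. z \<notin> ?X \<and> cmod z \<ge> B + real 0"
      using escaping_complement_unbounded[OF X dis esc, of B] by (auto intro: less_imp_le)
    fix x n assume "x \<notin> ?X \<and> cmod x \<ge> B + real n"
    then show "\<exists>y. (y \<notin> ?X \<and> cmod y \<ge> B + real (Suc n)) \<and> cmod y \<ge> cmod x + 1"
      using escaping_complement_unbounded[OF X dis esc, of "cmod x + 1"] by (force intro: less_imp_le)
  qed
  then obtain e where e: "\<And>n. e n \<notin> ?X" "\<And>n. cmod (e n) \<ge> B + real n" "\<And>n. cmod (e (Suc n)) \<ge> cmod (e n) + 1" by blast
  have "\<exists>r. 0 < r \<and> r \<le> 1/4 \<and> cball (e n) r \<inter> ?X = {}" for n
  proof -
    obtain r where r: "r > 0" "cball (e n) r \<subseteq> - ?X" using opX open_contains_cball e(1) by (metis ComplI)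
    then show ?thesis using subset_cball[of "min r (1/4)" r "e n"] by (intro exI[of _ "min r (1/4)"]) auto
  qed
  then obtain r where r: "\<And>n. 0 < r n" "\<And>n. r n \<le> 1/4" "\<And>n. cball (e n) (r n) \<inter> ?X = {}" by metis
  have e_far: "cmod (e n) \<ge> cmod (e m) + 1" if "m < n" for m n using that
  proof (induction n)
    case (Suc n)
    then show ?case using e(3)[of n] by (cases "m = n") auto
  qed simp
  have e_e: "cball (e m) (r m) \<inter> cball (e n) (r n) = {}" if "m < n" for m n
  proof (rule ccontr)
    assume "\<not> ?thesis"
    then obtain z where z: "dist (e m) z \<le> r m" "dist (e n) z \<le> r n" by auto
    have "cmod (e n) - cmod (e m) \<le> dist (e n) (e m)" by (metis dist_norm norm_triangle_ineq2)
    also have "\<dots> \<le> dist (e n) z + dist (e m) z" by (rule dist_triangle2)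
    finally show False using z r(2)[of m] r(2)[of n] e_far[OF that] by linarith
  qed
  have e_p: "cball (e n) (r n) \<inter> cball p \<rho> = {}" for n
  proof (rule ccontr)
    assume "\<not> ?thesis"
    then obtain z where z: "dist (e n) z \<le> r n" "dist p z \<le> \<rho>" by auto
    have "cmod (e n) - cmod p \<le> dist (e n) p" by (metis dist_norm norm_triangle_ineq2)
    also have "\<dots> \<le> dist (e n) z + dist p z" by (rule dist_triangle2)
    finally show False using z r(2)[of n] rho(2) e(2)[of n] by (simp add: B_def)
  qed
  define E where "E n = cball (e n) (r n)" for n
  have escE: "escaping E"
    unfolding escaping_def
  proof
    fix M
    obtain N :: nat where N: "M + 1 \<le> real N" using real_arch_simple by blast
    have "E n \<inter> cball 0 M = {}" if "n \<ge> N" for n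
    proof (rule ccontr)
      assume "\<not> ?thesis"
      then obtain z where z: "dist (e n) z \<le> r n" "cmod z \<le> M" by (auto simp: E_def)
      have "cmod (e n) \<le> cmod z + dist (e n) z" by (metis add.commute dist_norm norm_triangle_sub)
      moreover have "B \<ge> 0" unfolding B_def by (simp add: le_max_iff_disj add_nonneg_nonneg)
      moreover have "real N \<le> real n" using that by simp
      ultimately show False using z r(2)[of n] e(2)[of n] N by linarith
    qed
    then show "\<exists>N. \<forall>n\<ge>N. E n \<inter> cball 0 M = {}" by blast
  qed
  have clE: "closed (\<Union>n. E n)" by (rule closed_Union_escaping[OF _ escE]) (simp add: E_def)
  define O' where "O' = U - (\<Union>n. E n) - cball p \<rho>"
  have O': "open O'" "?X \<subseteq> O'"
  proof -
    show "open O'" unfolding O'_def by (intro open_Diff U(1) clE closed_cball)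
    have "?X \<inter> E m = {}" for m using r(3)[of m] unfolding E_def by blast
    then show "?X \<subseteq> O'" using U(2) rho(3) unfolding O'_def by blast
  qed
  have "\<exists>d>0. \<forall>x\<in>X n. \<forall>y\<in>(\<Union>m\<in>-{n}. X m). d \<le> dist x y" for n
  proof (intro separate_compact_closed X closed_Union_escaping Xc esc)
    have "X n \<inter> X m = {}" if "m \<in> -{n}" for m using disj[of n m] that by simp
    then show "X n \<inter> (\<Union>m\<in>-{n}. X m) = {}" by blast
  qed
  then obtain d where d: "\<And>n. d n > 0" "\<And>n x y. x \<in> X n \<Longrightarrow> y \<in> (\<Union>m\<in>-{n}. X m) \<Longrightarrow> d n \<le> dist x y" by metis
  \<comment> \<open>Half of the distance to the other sets gives disjoint neighbourhoods; the cap 1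
    lets them escape together with the \<open>X n\<close>.\<close>
  define \<delta> where "\<delta> n = min 1 (d n / 2)" for n
  have delta: "0 < \<delta> n" "\<delta> n \<le> 1" "\<delta> n \<le> d n / 2" for n using d(1)[of n] by (auto simp: \<delta>_def)
  define V where "V n = O' \<inter> (\<Union>x\<in>X n. ball x (\<delta> n))" for n
  have VE: "\<exists>x\<in>X n. dist x z < \<delta> n" if "z \<in> V n" for z n using that by (auto simp: V_def)
  have V_disj: "V m \<inter> V n = {}" if mn: "m \<noteq> n" for m n
  proof (rule ccontr)
    assume "\<not> ?thesis"
    then obtain z where "z \<in> V m" "z \<in> V n" by blast
    then obtain x y where xy: "x \<in> X m" "dist x z < \<delta> m" "y \<in> X n" "dist y z < \<delta> n" using VE by metis
    have "d m \<le> dist x y" using d(2)[OF xy(1)] xy(3) mn by blast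
    moreover have "d n \<le> dist y x" using d(2)[OF xy(3)] xy(1) mn by blast
    moreover have "dist x y \<le> dist x z + dist y z" by (rule dist_triangle2)
    ultimately show False using xy delta(3)[of m] delta(3)[of n] by (simp add: dist_commute)
  qed
  have escV: "escaping V"
    unfolding escaping_def
  proof
    fix M
    obtain N where N: "\<And>n. n \<ge> N \<Longrightarrow> X n \<inter> cball 0 (M + 1) = {}" using escapingE[OF esc] by metis
    have "V n \<inter> cball 0 M = {}" if "n \<ge> N" for n
    proof (rule ccontr)
      assume "\<not> ?thesis"
      then obtain z where z: "z \<in> V n" "cmod z \<le> M" by auto
      obtain x where x: "x \<in> X n" "dist x z < \<delta> n" using VE[OF z(1)] by blast
      have "cmod x \<le> cmod z + dist x z" by (metis add.commute dist_norm norm_triangle_sub)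
      then have "x \<in> cball 0 (M + 1)" using x z delta(2)[of n] by simp
      then show False using N[OF that] x(1) by blast
    qed
    then show "\<exists>N. \<forall>n\<ge>N. V n \<inter> cball 0 M = {}" by blast
  qed
  obtain R where R: "filterlim R at_top sequentially" "\<And>m n. m \<ge> n \<Longrightarrow> (V m \<union> E m) \<inter> cball 0 (R n) = {}"
    using escaping_radii[OF escaping_Un[OF escV escE]] by metis
  show ?thesis
  proof (rule exI[of _ V], rule exI[of _ p], rule exI[of _ \<rho>], rule exI[of _ e], rule exI[of _ r], rule exI[of _ R],
      intro conjI allI impI)
    show "open (V n)" for n unfolding V_def using O'(1) by auto
    show "X n \<subseteq> V n" for n unfolding V_def using O'(2) delta(1)[of n] by force
    show "V n \<subseteq> U" for n unfolding V_def O'_def by blast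
    show "bounded (V n)" for n
    proof -
      obtain b where b: "\<And>x. x \<in> X n \<Longrightarrow> cmod x \<le> b" using compact_imp_bounded[OF X] bounded_iff by metis
      have "V n \<subseteq> cball 0 (b + 1)"
      proof
        fix z assume "z \<in> V n"
        then obtain x where x: "x \<in> X n" "dist x z < \<delta> n" using VE by blast
        have "cmod z \<le> cmod x + dist x z" by (metis dist_commute dist_norm norm_triangle_sub)
        then show "z \<in> cball 0 (b + 1)" using x b[OF x(1)] delta(2)[of n] by simp
      qed
      then show ?thesis using bounded_cball bounded_subset by blast
    qed
    show "V m \<inter> V n = {}" if "m \<noteq> n" for m n using V_disj[OF that] .
    show "0 < \<rho>" "\<rho> \<le> 1" "0 < r n" for n using rho r by auto
    show "V n \<inter> cball p \<rho> = {}" for n unfolding V_def O'_def by blast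
    show "V n \<inter> cball (e m) (r m) = {}" for n m unfolding V_def O'_def E_def by blast
    show "cball (e n) (r n) \<inter> cball p \<rho> = {}" for n by (rule e_p)
    show "cball (e m) (r m) \<inter> cball (e n) (r n) = {}" if "m \<noteq> n" for m n
      using that e_e[of m n] e_e[of n m] by (metis Int_commute linorder_neqE_nat)
    show "cmod (e n) \<ge> 2 / \<rho> + 1" for n using e(2)[of n] by (simp add: B_def)
    show "V m \<inter> cball 0 (R n) = {}" "cball (e m) (r m) \<inter> cball 0 (R n) = {}" if "m \<ge> n" for m n
      using R(2)[OF that] by (auto simp: E_def)
    show "filterlim R at_top sequentially" by (rule R(1))
  qed
qed

section \<open>Weights and nowhere constant maps\<close>

lemma holomorphic_on_prod_list:
  "(\<lambda>z. \<Prod>a\<leftarrow>l. (z - a)) holomorphic_on S" for l :: "complex list"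
  by (induction l) (auto intro!: holomorphic_intros)

text \<open>The list \<open>q\<close> will measure displacements and \<open>z\<close> errors of the
  map. Newton lifting tolerates errors of size \<open>cmod (deriv \<phi> x) * wt q x\<close>, so
  \<open>z\<close> comes from dominating \<open>deriv \<phi>\<close> times the polynomial with root
  list \<open>q\<close>. The points of \<open>D\<close> enter \<open>q\<close> in order to stay
  fixed, and \<open>l0\<close> is inherited from the preceding set.\<close>

lemma weight_step:
  assumes phi: "\<phi> holomorphic_on W" and W: "open W" "compact K" "K \<subseteq> W"
    and nz: "\<And>z. z \<in> K \<Longrightarrow> \<forall>\<^sub>F y in at z. deriv \<phi> y \<noteq> 0"
    and D: "finite D" "D \<subseteq> K" and l0: "set l0 \<subseteq> K"
  shows "\<exists>q l z. q = l0 @ l \<and> set q \<subseteq> K \<and> D \<subseteq> set q \<and> set z \<subseteq> K \<and>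
    (\<exists>N c. open N \<and> K \<subseteq> N \<and> (\<forall>x\<in>N. wt q x \<le> c * cmod (deriv \<phi> x))) \<and>
    (\<exists>N c. open N \<and> K \<subseteq> N \<and> (\<forall>x\<in>N. wt z x \<le> c * (cmod (deriv \<phi> x) * wt q x)))"
proof -
  have d: "deriv \<phi> holomorphic_on W" using phi W(1) by (rule holomorphic_deriv)
  obtain ld where ld: "set ld = D" using finite_list[OF D(1)] by blast
  obtain l1 N1 C1 where 1: "set l1 \<subseteq> K" "open N1" "K \<subseteq> N1" "C1 \<ge> 0" "\<And>x. x \<in> N1 \<Longrightarrow> wt l1 x \<le> C1 * cmod (deriv \<phi> x)"
    using wt_dominated[OF d W nz] by metis
  define q where "q = (l0 @ ld) @ l1 @ []"
  have q: "set q \<subseteq> K" "D \<subseteq> set q" using l0 1 ld D by (auto simp: q_def)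
  obtain b where b: "\<And>x. x \<in> K \<Longrightarrow> cmod x \<le> b" using compact_imp_bounded[OF W(2)] bounded_iff by metis
  obtain M where M: "M \<ge> 0" "\<And>z. z \<in> ball 0 (b + 1) \<Longrightarrow> wt q z \<le> M * wt l1 z"
    unfolding q_def using wt_append_bound[OF bounded_ball[of "0::complex" "b + 1"]] by metis
  have qb: "\<exists>N c. open N \<and> K \<subseteq> N \<and> (\<forall>x\<in>N. wt q x \<le> c * cmod (deriv \<phi> x))"
  proof (intro exI conjI ballI)
    show "open (N1 \<inter> ball 0 (b + 1))" using 1 by auto
    show "K \<subseteq> N1 \<inter> ball 0 (b + 1)" using 1(3) b by fastforce
    fix x assume x: "x \<in> N1 \<inter> ball 0 (b + 1)"
    have "wt q x \<le> M * wt l1 x" using M(2) x by blast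
    also have "\<dots> \<le> M * (C1 * cmod (deriv \<phi> x))" using 1(5) x M(1) by (intro mult_left_mono) auto
    finally show "wt q x \<le> (M * C1) * cmod (deriv \<phi> x)" by (simp add: mult.assoc)
  qed
  define \<psi> where "\<psi> z = deriv \<phi> z * (\<Prod>a\<leftarrow>q. (z - a))" for z
  have norm_prod: "cmod (\<Prod>a\<leftarrow>l. (z - a)) = wt l z" for z l by (induction l) (auto simp: norm_mult)
  have psi: "\<psi> holomorphic_on W" unfolding \<psi>_def by (intro holomorphic_on_mult d holomorphic_on_prod_list)
  have psi_norm: "cmod (\<psi> z) = cmod (deriv \<phi> z) * wt q z" for z by (simp add: \<psi>_def norm_mult norm_prod)
  have "\<forall>\<^sub>F y in at z. \<psi> y \<noteq> 0" if "z \<in> K" for z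
  proof -
    have "\<forall>\<^sub>F y in at z. y \<in> - set q \<union> {z}"
    proof -
      have "open (- (set q - {z}))" by (intro open_Compl finite_imp_closed) auto
      then have "\<forall>\<^sub>F y in at z. y \<in> - (set q - {z})" by (rule eventually_at_in_open') simp
      then show ?thesis by eventually_elim auto
    qed
    moreover have "\<forall>\<^sub>F y in at z. y \<noteq> z" by (simp add: eventually_at_filter)
    ultimately have "\<forall>\<^sub>F y in at z. y \<notin> set q" by eventually_elim auto
    with nz[OF that] show ?thesis
    proof eventually_elim
      case (elim y)
      then have "cmod (\<psi> y) \<noteq> 0" unfolding psi_norm by (simp add: wt_eq_0_iff)
      then show ?case by simp
    qed
  qed
  then obtain l2 N2 C2 where 2: "set l2 \<subseteq> K" "open N2" "K \<subseteq> N2" "\<And>x. x \<in> N2 \<Longrightarrow> wt l2 x \<le> C2 * cmod (\<psi> x)"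
    using wt_dominated[OF psi W] by metis
  have "\<exists>N c. open N \<and> K \<subseteq> N \<and> (\<forall>x\<in>N. wt l2 x \<le> c * (cmod (deriv \<phi> x) * wt q x))"
    using 2 unfolding psi_norm by blast
  then show ?thesis using q qb 2(1) by (intro exI[of _ q] exI[of _ "ld @ l1"] exI[of _ l2] conjI) (simp_all add: q_def)
qed

text \<open>The lists are built forwards in \<open>n\<close>, although corrections will run
  backwards. They are fixed before any approximation, so the same nodes serve at every stage and
  their points are never moved.\<close>

lemma weight_sequences:
  assumes phi: "\<And>n. \<phi> holomorphic_on V n" and V: "\<And>n. open (V n)" "\<And>n. compact (X n)" "\<And>n. X n \<subseteq> V n"
    and nz: "\<And>n z. z \<in> X n \<Longrightarrow> \<forall>\<^sub>F y in at z. deriv \<phi> y \<noteq> 0"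
    and D: "\<And>n. finite (D n)" "\<And>n. D n \<subseteq> X n" and im: "\<And>n. \<phi> ` X n \<subseteq> X (Suc n)"
  obtains ql zl where "\<And>n. set (ql n) \<subseteq> X n" "\<And>n. D n \<subseteq> set (ql n)" "\<And>n. set (zl n) \<subseteq> X n"
    "\<And>n. \<exists>N c. open N \<and> X n \<subseteq> N \<and> (\<forall>x\<in>N. wt (ql n) x \<le> c * cmod (deriv \<phi> x))"
    "\<And>n. \<exists>N c. open N \<and> X n \<subseteq> N \<and> (\<forall>x\<in>N. wt (zl n) x \<le> c * (cmod (deriv \<phi> x) * wt (ql n) x))"
    "\<And>n. \<exists>l. ql (Suc n) = map \<phi> (zl n) @ l"
proof -
  define P where "P n s \<longleftrightarrow> (case s of (q, z) \<Rightarrow> set q \<subseteq> X n \<and> D n \<subseteq> set q \<and> set z \<subseteq> X n \<and>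
    (\<exists>N c. open N \<and> X n \<subseteq> N \<and> (\<forall>x\<in>N. wt q x \<le> c * cmod (deriv \<phi> x))) \<and>
    (\<exists>N c. open N \<and> X n \<subseteq> N \<and> (\<forall>x\<in>N. wt z x \<le> c * (cmod (deriv \<phi> x) * wt q x))))" for n s
  define Q where "Q s t \<longleftrightarrow> (\<exists>l. fst t = map \<phi> (snd s) @ l)" for s t :: "complex list \<times> complex list"
  have step: "\<exists>q l z. q = l0 @ l \<and> P n (q, z)" if "set l0 \<subseteq> X n" for n l0
    unfolding P_def split by (rule weight_step[OF phi V nz D that])
  have "\<exists>s. \<forall>n. P n (s n) \<and> Q (s n) (s (Suc n))"
  proof (rule dependent_nat_choice)
    show "\<exists>s. P 0 s" using step[of "[]" 0] by auto
    fix s n assume "P n s"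
    then have "set (snd s) \<subseteq> X n" by (auto simp: P_def split: prod.splits)
    then have "set (map \<phi> (snd s)) \<subseteq> X (Suc n)" using im[of n] by auto
    from step[OF this] show "\<exists>t. P (Suc n) t \<and> Q s t" by (auto simp: Q_def)
  qed
  then obtain s where s: "\<And>n. P n (s n)" "\<And>n. Q (s n) (s (Suc n))" by blast
  show ?thesis
    by (rule that[of "\<lambda>n. fst (s n)" "\<lambda>n. snd (s n)"]) (use s in \<open>simp_all add: P_def Q_def split_beta\<close>)
qed

lemma deriv_isolated_zeros_or_constant:
  assumes "\<phi> holomorphic_on U" "open U" "x \<in> U"
  shows "(\<forall>\<^sub>F y in at x. deriv \<phi> y \<noteq> 0) \<or> (\<forall>\<^sub>F y in nhds x. \<phi> y = \<phi> x)"
proof (cases "\<exists>\<^sub>F y in at x. deriv \<phi> y \<noteq> 0")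
  case True
  have "deriv \<phi> analytic_on {x}"
    using assms holomorphic_deriv[OF assms(1,2)] analytic_at by blast
  then show ?thesis
    using non_zero_neighbour[OF isolated_singularity_at_analytic not_essential_analytic True] by blast
next
  case False
  then have "\<forall>\<^sub>F y in at x. deriv \<phi> y = 0" by (simp add: not_frequently)
  then obtain r where r: "r > 0" "\<And>y. y \<noteq> x \<Longrightarrow> dist y x < r \<Longrightarrow> deriv \<phi> y = 0"
    unfolding eventually_at by auto
  obtain s where s: "s > 0" "ball x s \<subseteq> U" using assms open_contains_ball by blast
  define t where "t = min r s"
  have t: "t > 0" "ball x t \<subseteq> U" using r s by (auto simp: t_def)
  have hol: "\<phi> holomorphic_on ball x t" using assms(1) t(2) by (rule holomorphic_on_subset)
  have d0: "deriv \<phi> y = 0" if y: "y \<in> ball x t" for y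
  proof (cases "y = x")
    case True
    have "continuous_on (ball x t) (deriv \<phi>)"
      using holomorphic_deriv[OF hol] by (auto intro: holomorphic_on_imp_continuous_on)
    then have "isCont (deriv \<phi>) x" using t by (simp add: continuous_on_eq_continuous_at)
    then have "(deriv \<phi> \<longlongrightarrow> deriv \<phi> x) (at x)" by (simp add: isCont_def)
    moreover have "(deriv \<phi> \<longlongrightarrow> 0) (at x)" using \<open>\<forall>\<^sub>F y in at x. deriv \<phi> y = 0\<close> by (rule tendsto_eventually)
    ultimately show ?thesis using True tendsto_unique by (metis at_neq_bot)
  qed (use r y in \<open>auto simp: t_def dist_commute\<close>)
  have "\<exists>c. \<forall>y\<in>ball x t. \<phi> y = c"
  proof (rule has_field_derivative_zero_constant)
    fix y assume y: "y \<in> ball x t"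
    then have "(\<phi> has_field_derivative deriv \<phi> y) (at y)" using holomorphic_derivI[OF hol] by blast
    then show "(\<phi> has_field_derivative 0) (at y within ball x t)" unfolding d0[OF y] by (rule has_field_derivative_at_within)
  qed simp
  then have "\<forall>y\<in>ball x t. \<phi> y = \<phi> x" using t(1) by (metis centre_in_ball)
  then have "\<forall>\<^sub>F y in nhds x. \<phi> y = \<phi> x" using t(1) unfolding eventually_nhds by (metis centre_in_ball open_ball)
  then show ?thesis by blast
qed

text \<open>Where \<open>\<phi>\<close> is constant near a point of \<open>S\<close>, the hypothesis
  \<open>nc\<close> makes this point isolated in \<open>S\<close>, and \<open>\<phi>\<close> can be
  replaced near it by a translation with the same value there. The conjugacy involves only the
  values on \<open>S\<close>.\<close>

lemma nowhere_constant_replacement: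
  assumes phi: "\<phi> holomorphic_on U" "open U" "S \<subseteq> U"
    and nc: "\<And>x. x \<in> S \<Longrightarrow> x islimpt S \<Longrightarrow> nonconstant_near \<phi> x"
  obtains \<psi> U' where "open U'" "S \<subseteq> U'" "\<psi> holomorphic_on U'" "\<And>z. z \<in> S \<Longrightarrow> \<psi> z = \<phi> z"
    "\<And>z. z \<in> U' \<Longrightarrow> \<forall>\<^sub>F y in at z. deriv \<psi> y \<noteq> 0"
proof -
  define U1 where "U1 = {x\<in>U. \<forall>\<^sub>F y in at x. deriv \<phi> y \<noteq> 0}"
  define I where "I = S - U1"
  have op1: "open U1"
  proof (rule Topological_Spaces.openI)
    fix x assume x: "x \<in> U1"
    then have "\<forall>\<^sub>F y in at x. deriv \<phi> y \<noteq> 0" by (simp add: U1_def)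
    then obtain T where T: "open T" "x \<in> T" "\<And>y. y \<in> T \<Longrightarrow> y \<noteq> x \<Longrightarrow> deriv \<phi> y \<noteq> 0"
      unfolding eventually_at_topological by blast
    have "y \<in> U1" if y: "y \<in> T \<inter> U" for y
    proof (cases "y = x")
      case False
      have "open (T - {x})" using T(1) by (rule open_delete)
      have "\<forall>\<^sub>F w in at y. w \<in> T - {x}" using \<open>open (T - {x})\<close> by (rule eventually_at_in_open') (use y False in blast)
      then have "\<forall>\<^sub>F w in at y. deriv \<phi> w \<noteq> 0" by eventually_elim (use T in blast)
      then show ?thesis using y by (simp add: U1_def)
    qed (use x in simp)
    then show "\<exists>T. open T \<and> x \<in> T \<and> T \<subseteq> U1"
      using T phi(2) x by (intro exI[of _ "T \<inter> U"]) (auto simp: U1_def)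
  qed
  have "\<exists>d>0. ball x d \<inter> S = {x} \<and> ball x d \<inter> U1 = {}" if x: "x \<in> I" for x
  proof -
    have xU: "x \<in> U" "x \<in> S" "\<not> (\<forall>\<^sub>F y in at x. deriv \<phi> y \<noteq> 0)" using x phi(3) by (auto simp: I_def U1_def)
    then have c: "\<forall>\<^sub>F y in nhds x. \<phi> y = \<phi> x" using deriv_isolated_zeros_or_constant[OF phi(1,2)] by blast
    then have "\<not> x islimpt S" using nc[OF xU(2)] unfolding nonconstant_near_def by blast
    then obtain d1 where d1: "d1 > 0" "\<And>y. y \<in> S \<Longrightarrow> y \<noteq> x \<Longrightarrow> \<not> dist y x < d1" unfolding islimpt_approachable by blast
    obtain d2 where d2: "d2 > 0" "\<And>y. dist y x < d2 \<Longrightarrow> \<phi> y = \<phi> x" using c unfolding eventually_nhds_metric by blast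
    have d2': "\<phi> v = \<phi> x" if "v \<in> ball x d2" for v using that d2(2)[of v] by (simp add: dist_commute)
    have "y \<notin> U1" if y: "y \<in> ball x d2" for y
    proof -
      have "\<forall>\<^sub>F w in at y. w \<in> ball x d2" using eventually_at_in_open'[OF open_ball y] .
      then have "\<forall>\<^sub>F w in at y. deriv \<phi> w = 0"
      proof eventually_elim
        case (elim w)
        have "\<forall>\<^sub>F v in nhds w. v \<in> ball x d2" using eventually_nhds_in_open[OF open_ball elim] .
        then have "\<forall>\<^sub>F v in nhds w. \<phi> v = \<phi> x" by eventually_elim (rule d2')
        then have "deriv \<phi> w = deriv (\<lambda>_. \<phi> x) w" by (rule deriv_cong_ev) simp
        then show ?case by simp
      qed
      then have "\<not> (\<forall>\<^sub>F w in at y. deriv \<phi> w \<noteq> 0)"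
      proof (rule contrapos_pn)
        assume "\<forall>\<^sub>F w in at y. deriv \<phi> w \<noteq> 0"
        then have "\<exists>\<^sub>F w in at y. deriv \<phi> w \<noteq> 0" by (rule eventually_frequently[OF at_neq_bot])
        then show "\<not> (\<forall>\<^sub>F w in at y. deriv \<phi> w = 0)" by (simp add: frequently_def)
      qed
      then show ?thesis by (simp add: U1_def)
    qed
    then have "ball x (min d1 d2) \<inter> U1 = {}" by auto
    moreover have "y = x" if "y \<in> ball x (min d1 d2)" "y \<in> S" for y
      using d1(2)[OF that(2)] that(1) by (cases "y = x") (simp_all add: dist_commute)
    then have "ball x (min d1 d2) \<inter> S = {x}" using xU(2) d1(1) d2(1) by auto
    ultimately show ?thesis using d1(1) d2(1) by (intro exI[of _ "min d1 d2"]) simp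
  qed
  then obtain d where d: "\<And>x. x \<in> I \<Longrightarrow> d x > 0" "\<And>x. x \<in> I \<Longrightarrow> ball x (d x) \<inter> S = {x}" "\<And>x. x \<in> I \<Longrightarrow> ball x (d x) \<inter> U1 = {}"
    by metis
  \<comment> \<open>Halving the radii makes the discs about different points of \<open>I\<close>
    disjoint, so that the translations fit together.\<close>
  define b where "b x = ball x (d x / 2)" for x
  have b: "open (b x)" "b x \<subseteq> ball x (d x)" if "x \<in> I" for x using d(1)[OF that] by (auto simp: b_def)
  have bx: "x \<in> b x" if "x \<in> I" for x using d(1)[OF that] by (simp add: b_def)
  have b_disj: "x = y" if xy: "x \<in> I" "y \<in> I" "z \<in> b x" "z \<in> b y" for x y z
  proof (rule ccontr)
    assume "x \<noteq> y"
    have "x \<in> S" "y \<in> S" using xy(1,2) by (simp_all add: I_def)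
    then have "y \<notin> ball x (d x)" "x \<notin> ball y (d y)"
      using d(2)[OF xy(1)] d(2)[OF xy(2)] \<open>x \<noteq> y\<close> by (metis IntI singletonD)+
    then have "d x \<le> dist x y" "d y \<le> dist x y" by (simp_all add: dist_commute)
    moreover have "dist x y \<le> dist x z + dist y z" by (rule dist_triangle2)
    ultimately show False using xy(3,4) by (simp add: b_def)
  qed
  define ct where "ct z = (THE x. x \<in> I \<and> z \<in> b x)" for z
  have ct: "ct z = x" if "x \<in> I" "z \<in> b x" for x z
    unfolding ct_def using that b_disj[OF _ that(1) _ that(2)] by blast
  define \<psi> where "\<psi> z = (if z \<in> U1 then \<phi> z else \<phi> (ct z) + (z - ct z))" for z
  have psi1: "\<psi> z = \<phi> z" if "z \<in> U1" for z using that by (simp add: \<psi>_def)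
  have psi2: "\<psi> z = \<phi> x + (z - x)" if "x \<in> I" "z \<in> b x" for x z
    using that d(3)[OF that(1)] b(2)[OF that(1)] ct[OF that] by (auto simp: \<psi>_def)
  show ?thesis
  proof (rule that[of "U1 \<union> (\<Union>x\<in>I. b x)" \<psi>])
    show "open (U1 \<union> (\<Union>x\<in>I. b x))" using op1 b(1) by auto
    show "S \<subseteq> U1 \<union> (\<Union>x\<in>I. b x)" using bx unfolding I_def by blast
    show "\<psi> holomorphic_on U1 \<union> (\<Union>x\<in>I. b x)"
    proof (intro holomorphic_on_Un holomorphic_on_UN_open op1 open_UN ballI b(1))
      have "\<phi> holomorphic_on U1" using phi(1) by (rule holomorphic_on_subset) (auto simp: U1_def)
      then show "\<psi> holomorphic_on U1" using psi1 by (simp cong: holomorphic_cong)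
      show "\<psi> holomorphic_on b x" if "x \<in> I" for x
      proof -
        have "(\<lambda>z. \<phi> x + (z - x)) holomorphic_on b x" by (intro holomorphic_intros)
        then show ?thesis using psi2[OF that] by (simp cong: holomorphic_cong)
      qed
    qed
    show "\<psi> z = \<phi> z" if "z \<in> S" for z
      using that psi1[of z] psi2[of z z] bx[of z] by (cases "z \<in> U1") (auto simp: I_def)
    show "\<forall>\<^sub>F y in at z. deriv \<psi> y \<noteq> 0" if z: "z \<in> U1 \<union> (\<Union>x\<in>I. b x)" for z
    proof (cases "z \<in> U1")
      case True
      then have "\<forall>\<^sub>F y in at z. deriv \<phi> y \<noteq> 0" by (simp add: U1_def)
      moreover have "\<forall>\<^sub>F y in at z. y \<in> U1" using eventually_at_in_open'[OF op1 True] .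
      ultimately show ?thesis
      proof eventually_elim
        case (elim y)
        have "\<forall>\<^sub>F w in nhds y. w \<in> U1" using eventually_nhds_in_open[OF op1 elim(2)] .
        then have "\<forall>\<^sub>F w in nhds y. \<psi> w = \<phi> w" by eventually_elim (rule psi1)
        then have "deriv \<psi> y = deriv \<phi> y" by (rule deriv_cong_ev) simp
        then show ?case using elim(1) by simp
      qed
    next
      case False
      then obtain x where x: "x \<in> I" "z \<in> b x" using z by blast
      have "\<forall>\<^sub>F y in at z. y \<in> b x" using eventually_at_in_open'[OF b(1)[OF x(1)] x(2)] .
      then show ?thesis
      proof eventually_elim
        case (elim y)
        have "\<forall>\<^sub>F w in nhds y. w \<in> b x" using eventually_nhds_in_open[OF b(1)[OF x(1)] elim] .
        then have "\<forall>\<^sub>F w in nhds y. \<psi> w = \<phi> x + (w - x)" by eventually_elim (rule psi2[OF x(1)])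
        then have "deriv \<psi> y = deriv (\<lambda>w. \<phi> x + (w - x)) y" by (rule deriv_cong_ev) simp
        moreover have "deriv (\<lambda>w. \<phi> x + (w - x)) y = 1"
          by (rule DERIV_imp_deriv) (auto intro!: derivative_eq_intros)
        ultimately show ?case by simp
      qed
    qed
  qed
qed

section \<open>The inductive construction\<close>

text \<open>
  The map under construction sends \<open>X n\<close> into the disc of radius \<open>\<rho>\<close> about its pole \<open>p\<close>, from there
  into the small disc about the distant point \<open>e n\<close>, and then to \<open>X (Suc n)\<close>. At the points of
  \<open>ql n\<close> the conjugacy agrees with the identity. The weight \<open>zl n\<close> is the order to which an error
  of the approximating map has to vanish so that the Newton iteration for \<open>\<phi>\<close> on \<open>X n\<close> converges
  with an error controlled by \<open>ql n\<close>; since \<open>ql (Suc n)\<close> contains the image of \<open>zl n\<close>, the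
  estimates propagate backwards from \<open>X (Suc n)\<close> to \<open>X n\<close>.
\<close>

locale bungee_setup =
  fixes X V C :: "nat \<Rightarrow> complex set" and \<phi> :: "complex \<Rightarrow> complex" and \<epsilon> :: "nat \<Rightarrow> real"
    and p :: complex and \<rho> :: real and e :: "nat \<Rightarrow> complex" and r R :: "nat \<Rightarrow> real"
    and ql zl :: "nat \<Rightarrow> complex list"
  assumes X_compact: "compact (X n)" and V_open: "open (V n)" and X_V: "X n \<subseteq> V n"
    and V_bounded: "bounded (V n)" and V_disj: "m \<noteq> n \<Longrightarrow> V m \<inter> V n = {}"
    and phi_hol: "\<phi> holomorphic_on V n" and phi_iso: "z \<in> V n \<Longrightarrow> \<forall>\<^sub>F y in at z. deriv \<phi> y \<noteq> 0"
    and phi_X: "\<phi> ` X n \<subseteq> X (Suc n)" and phi_frontier: "\<phi> ` frontier (X n) \<subseteq> frontier (X (Suc n))"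
    and rho: "0 < \<rho>" "\<rho> \<le> 1" and r_pos: "0 < r n"
    and V_p: "V n \<inter> cball p \<rho> = {}" and V_e: "V n \<inter> cball (e m) (r m) = {}"
    and e_p: "cball (e n) (r n) \<inter> cball p \<rho> = {}"
    and e_e: "m \<noteq> n \<Longrightarrow> cball (e m) (r m) \<inter> cball (e n) (r n) = {}"
    and e_big: "cmod (e n) \<ge> 2 / \<rho> + 1"
    and R_V: "m \<ge> n \<Longrightarrow> V m \<inter> cball 0 (R n) = {}" and R_e: "m \<ge> n \<Longrightarrow> cball (e m) (r m) \<inter> cball 0 (R n) = {}"
    and R_lim: "filterlim R at_top sequentially"
    and eps: "0 < \<epsilon> n"
    and ql: "set (ql n) \<subseteq> X n" "C n \<subseteq> set (ql n)" and zl: "set (zl n) \<subseteq> X n"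
    and ql_bound: "\<exists>N c. open N \<and> X n \<subseteq> N \<and> (\<forall>z\<in>N. wt (ql n) z \<le> c * cmod (deriv \<phi> z))"
    and zl_bound: "\<exists>N c. open N \<and> X n \<subseteq> N \<and> (\<forall>z\<in>N. wt (zl n) z \<le> c * (cmod (deriv \<phi> z) * wt (ql n) z))"
    and ql_Suc: "\<exists>l. ql (Suc n) = map \<phi> (zl n) @ l"
begin

text \<open>The principal part at \<open>p\<close> is split off for good; at every stage the
  remaining term \<open>h\<close> is holomorphic and bounded by 1 on the disc about
  \<open>p\<close>.\<close>

definition F :: "(complex \<Rightarrow> complex) \<Rightarrow> complex \<Rightarrow> complex" where
  "F h = (\<lambda>z. 1 / (z - p) + h z)"

text \<open>The region reserved for step \<open>n\<close>: poles and frozen points created before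
  that step have to avoid it.\<close>

definition XE :: "nat \<Rightarrow> complex set" where
  "XE n = X n \<union> cball (e n) (r n)"

lemma escaping_XE: "escaping XE"
  unfolding escaping_def
proof
  fix B
  obtain N where N: "B \<le> R N" using R_lim unfolding filterlim_at_top eventually_sequentially by blast
  have "XE n \<inter> cball 0 B = {}" if "n \<ge> N" for n
  proof -
    have "cball (0::complex) B \<subseteq> cball 0 (R N)" using N by (rule subset_cball)
    moreover have "XE n \<inter> cball 0 (R N) = {}"
      using R_V[OF that] R_e[OF that] X_V[of n] unfolding XE_def by blast
    ultimately show ?thesis by blast
  qed
  then show "\<exists>N. \<forall>n\<ge>N. XE n \<inter> cball 0 B = {}" by blast
qed

lemma closed_XE_Union: "closed (\<Union>m\<in>I. XE m)"
  by (rule closed_Union_escaping[OF _ escaping_XE])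
    (auto simp: XE_def X_compact compact_imp_closed)

text \<open>Nodes at the images of \<open>zl n\<close> under \<open>g\<close> make the weight small
  at \<open>g z\<close>; the other nodes of \<open>Ql\<close> contribute bounded factors. It serves
  for \<open>g = \<phi>\<close> and for the maps that give the first three points of the
  orbit.\<close>

lemma Q_bound:
  assumes W: "open W" "X n \<subseteq> W" and g: "g holomorphic_on W" and Ql: "\<exists>a b. Ql = a @ map g (zl n) @ b"
  shows "\<exists>N c. open N \<and> X n \<subseteq> N \<and> N \<subseteq> W \<and> c \<ge> 0 \<and> (\<forall>z\<in>N. wt Ql (g z) \<le> c * (cmod (deriv \<phi> z) * wt (ql n) z))"
proof -
  obtain a b where ab: "Ql = a @ map g (zl n) @ b" using Ql by blast
  obtain N1 C1 where 1: "open N1" "X n \<subseteq> N1" "N1 \<subseteq> W" "C1 \<ge> 0" "\<And>z. z \<in> N1 \<Longrightarrow> wt (map g (zl n)) (g z) \<le> C1 * wt (zl n) z"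
    using wt_map_near_compact[OF g W(1) X_compact W(2) zl] by metis
  obtain N2 C2 where 2: "open N2" "X n \<subseteq> N2" "\<And>z. z \<in> N2 \<Longrightarrow> wt (zl n) z \<le> C2 * (cmod (deriv \<phi> z) * wt (ql n) z)"
    using zl_bound by metis
  obtain d K2 where K2: "d > 0" "compact K2" "K2 \<subseteq> W" "\<And>x y. x \<in> X n \<Longrightarrow> dist x y \<le> d \<Longrightarrow> y \<in> interior K2"
    using compact_fatten[OF X_compact W] by metis
  have "compact (g ` K2)" using K2 g continuous_on_subset holomorphic_on_imp_continuous_on compact_continuous_image by metis
  then obtain M where M: "M \<ge> 0" "\<And>z. z \<in> g ` K2 \<Longrightarrow> wt Ql z \<le> M * wt (map g (zl n)) z"
    unfolding ab using wt_append_bound compact_imp_bounded by metis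
  define C2' where "C2' = max C2 0"
  show ?thesis
  proof (intro exI conjI ballI)
    show "open (N1 \<inter> N2 \<inter> interior K2)" using 1 2 by auto
    show "X n \<subseteq> N1 \<inter> N2 \<inter> interior K2" using 1 2 K2(1) K2(4)[of x x for x] by auto
    show "N1 \<inter> N2 \<inter> interior K2 \<subseteq> W" using 1 by auto
    show "0 \<le> M * (C1 * C2')" using M 1 by (simp add: C2'_def)
    fix z assume z: "z \<in> N1 \<inter> N2 \<inter> interior K2"
    let ?s = "cmod (deriv \<phi> z) * wt (ql n) z"
    have "wt (zl n) z \<le> C2 * ?s" using 2(3) z by auto
    also have "\<dots> \<le> C2' * ?s" unfolding C2'_def by (intro mult_right_mono) auto
    finally have "wt (map g (zl n)) (g z) \<le> C1 * (C2' * ?s)"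
      using 1(5)[of z] mult_left_mono[OF _ 1(4)] z by (meson IntD1 order_trans)
    then have "M * wt (map g (zl n)) (g z) \<le> M * (C1 * (C2' * ?s))" using M by (intro mult_left_mono)
    moreover have "wt Ql (g z) \<le> M * wt (map g (zl n)) (g z)" using M(2)[of "g z"] z interior_subset by blast
    ultimately show "wt Ql (g z) \<le> M * (C1 * C2') * ?s" by (simp add: mult.assoc)
  qed
qed

text \<open>Downward induction on the index: the displacement is the identity on
  \<open>X (Suc N)\<close>, and \<open>conjugacy_step\<close> passes from
  \<open>\<xi> (Suc j)\<close> to \<open>\<xi> j\<close>. The neighbourhoods \<open>V'\<close> are
  fixed before the tolerance, and \<phi> maps each of them into the next.\<close>

lemma lift_all:
  fixes N :: nat and T \<theta> :: "complex \<Rightarrow> complex" and O1 O2 O3 W :: "nat \<Rightarrow> complex set"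
  assumes inj: "inj \<theta>"
    and W: "\<And>n. n \<le> Suc N \<Longrightarrow> open (W n) \<and> X n \<subseteq> W n \<and> W n \<subseteq> V n \<and> \<theta> holomorphic_on W n"
    and O: "\<And>n. n \<le> N \<Longrightarrow> open (O1 n) \<and> open (O2 n) \<and> open (O3 n)"
    and T: "\<And>n. n \<le> N \<Longrightarrow> T holomorphic_on O1 n \<and> T holomorphic_on O2 n \<and> T holomorphic_on O3 n"
    and orb: "\<And>n x. n \<le> N \<Longrightarrow> x \<in> X n \<Longrightarrow> \<theta> x \<in> O1 n \<and> T (\<theta> x) \<in> O2 n \<and> T (T (\<theta> x)) \<in> O3 n"
    and eq: "\<And>n z. n \<le> N \<Longrightarrow> z \<in> W n \<Longrightarrow> T (T (T (\<theta> z))) = \<theta> (\<phi> z)"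
    and Ql: "\<And>n. n \<le> N \<Longrightarrow> \<exists>a b. Ql = a @ map \<theta> (zl n) @ b"
      "\<And>n. n \<le> N \<Longrightarrow> \<exists>a b. Ql = a @ map (T \<circ> \<theta>) (zl n) @ b"
      "\<And>n. n \<le> N \<Longrightarrow> \<exists>a b. Ql = a @ map (T \<circ> (T \<circ> \<theta>)) (zl n) @ b"
  shows "\<exists>V'. (\<forall>n\<le>Suc N. open (V' n) \<and> X n \<subseteq> V' n \<and> V' n \<subseteq> W n) \<and> (\<forall>n\<le>N. \<phi> ` V' n \<subseteq> V' (Suc n)) \<and>
     (\<forall>\<epsilon>>0. \<exists>\<delta>>0. \<forall>f. (\<forall>n\<le>N. f holomorphic_on O1 n \<and> f holomorphic_on O2 n \<and> f holomorphic_on O3 n \<and>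
         (\<forall>y\<in>O1 n \<union> O2 n \<union> O3 n. cmod (f y - T y) \<le> \<delta> * wt Ql y)) \<longrightarrow>
       (\<exists>\<xi>. \<xi> (Suc N) = (\<lambda>z. z) \<and> (\<forall>n\<le>N. \<xi> n holomorphic_on V' n \<and>
          (\<forall>z\<in>V' n. \<xi> n z \<in> W n \<and> cmod (\<xi> n z - z) \<le> \<epsilon> * wt (ql n) z \<and>
            \<theta> (\<xi> n z) \<in> O1 n \<and> f (\<theta> (\<xi> n z)) \<in> O2 n \<and> f (f (\<theta> (\<xi> n z))) \<in> O3 n \<and>
            f (f (f (\<theta> (\<xi> n z)))) = \<theta> (\<xi> (Suc n) (\<phi> z))))))"
proof -
  define P where "P = (\<lambda>j. \<exists>V'. (\<forall>n\<le>Suc N. j \<le> n \<longrightarrow> open (V' n) \<and> X n \<subseteq> V' n \<and> V' n \<subseteq> W n) \<and>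
     (\<forall>n\<le>N. j \<le> n \<longrightarrow> \<phi> ` V' n \<subseteq> V' (Suc n)) \<and>
     (\<forall>\<epsilon>>0. \<exists>\<delta>>0. \<forall>f. (\<forall>n\<le>N. f holomorphic_on O1 n \<and> f holomorphic_on O2 n \<and> f holomorphic_on O3 n \<and>
         (\<forall>y\<in>O1 n \<union> O2 n \<union> O3 n. cmod (f y - T y) \<le> \<delta> * wt Ql y)) \<longrightarrow>
       (\<exists>\<xi>. \<xi> (Suc N) = (\<lambda>z. z) \<and> (\<forall>n\<le>N. j \<le> n \<longrightarrow> \<xi> n holomorphic_on V' n \<and>
          (\<forall>z\<in>V' n. \<xi> n z \<in> W n \<and> cmod (\<xi> n z - z) \<le> \<epsilon> * wt (ql n) z \<and>
            \<theta> (\<xi> n z) \<in> O1 n \<and> f (\<theta> (\<xi> n z)) \<in> O2 n \<and> f (f (\<theta> (\<xi> n z))) \<in> O3 n \<and>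
            f (f (f (\<theta> (\<xi> n z)))) = \<theta> (\<xi> (Suc n) (\<phi> z)))))))"
  have "P 0"
  proof (rule inc_induct[of 0 "Suc N" P])
    show "P (Suc N)" unfolding P_def
    proof (intro exI[of _ W] conjI allI impI)
      fix \<epsilon> :: real assume "\<epsilon> > 0"
      show "\<exists>\<delta>>0. \<forall>f. (\<forall>n\<le>N. f holomorphic_on O1 n \<and> f holomorphic_on O2 n \<and> f holomorphic_on O3 n \<and>
         (\<forall>y\<in>O1 n \<union> O2 n \<union> O3 n. cmod (f y - T y) \<le> \<delta> * wt Ql y)) \<longrightarrow>
       (\<exists>\<xi>. \<xi> (Suc N) = (\<lambda>z. z) \<and> (\<forall>n\<le>N. Suc N \<le> n \<longrightarrow> \<xi> n holomorphic_on W n \<and>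
          (\<forall>z\<in>W n. \<xi> n z \<in> W n \<and> cmod (\<xi> n z - z) \<le> \<epsilon> * wt (ql n) z \<and>
            \<theta> (\<xi> n z) \<in> O1 n \<and> f (\<theta> (\<xi> n z)) \<in> O2 n \<and> f (f (\<theta> (\<xi> n z))) \<in> O3 n \<and>
            f (f (f (\<theta> (\<xi> n z)))) = \<theta> (\<xi> (Suc n) (\<phi> z)))))"
        by (intro exI[of _ 1] conjI allI impI exI[of _ "\<lambda>_ z. z"]) auto
    qed (use W in auto)
  next
    fix j assume jN: "j < Suc N" and "P (Suc j)"
    then obtain V' where V'0: "\<forall>n\<le>Suc N. Suc j \<le> n \<longrightarrow> open (V' n) \<and> X n \<subseteq> V' n \<and> V' n \<subseteq> W n"
      and phV'0: "\<forall>n\<le>N. Suc j \<le> n \<longrightarrow> \<phi> ` V' n \<subseteq> V' (Suc n)"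
      and IH: "\<forall>\<epsilon>>0. \<exists>\<delta>>0. \<forall>f. (\<forall>n\<le>N. f holomorphic_on O1 n \<and> f holomorphic_on O2 n \<and> f holomorphic_on O3 n \<and>
         (\<forall>y\<in>O1 n \<union> O2 n \<union> O3 n. cmod (f y - T y) \<le> \<delta> * wt Ql y)) \<longrightarrow>
       (\<exists>\<xi>. \<xi> (Suc N) = (\<lambda>z. z) \<and> (\<forall>n\<le>N. Suc j \<le> n \<longrightarrow> \<xi> n holomorphic_on V' n \<and>
          (\<forall>z\<in>V' n. \<xi> n z \<in> W n \<and> cmod (\<xi> n z - z) \<le> \<epsilon> * wt (ql n) z \<and>
            \<theta> (\<xi> n z) \<in> O1 n \<and> f (\<theta> (\<xi> n z)) \<in> O2 n \<and> f (f (\<theta> (\<xi> n z))) \<in> O3 n \<and>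
            f (f (f (\<theta> (\<xi> n z)))) = \<theta> (\<xi> (Suc n) (\<phi> z)))))"
      unfolding P_def by (elim exE conjE) (rule that; assumption)
    have V': "open (V' n) \<and> X n \<subseteq> V' n \<and> V' n \<subseteq> W n" if "n \<le> Suc N" "Suc j \<le> n" for n using V'0 that by blast
    have phV': "\<phi> ` V' n \<subseteq> V' (Suc n)" if "n \<le> N" "Suc j \<le> n" for n using phV'0 that by blast
    have j: "j \<le> N" using jN by simp
    have Wj: "open (W j)" "X j \<subseteq> W j" "W j \<subseteq> V j" "\<theta> holomorphic_on W j" using W[of j] j by auto
    have WS: "open (W (Suc j))" "\<theta> holomorphic_on W (Suc j)" using W[of "Suc j"] j by auto
    have Oj: "open (O1 j)" "open (O2 j)" "open (O3 j)" using O[OF j] by auto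
    have Tj: "T holomorphic_on O1 j" "T holomorphic_on O2 j" "T holomorphic_on O3 j" using T[OF j] by auto
    have orbj: "\<theta> x \<in> O1 j" "T (\<theta> x) \<in> O2 j" "T (T (\<theta> x)) \<in> O3 j" if "x \<in> X j" for x using orb[OF j that] by auto
    define A1 where "A1 = W j \<inter> \<theta> -` O1 j"
    define A2 where "A2 = A1 \<inter> (T \<circ> \<theta>) -` O2 j"
    have A1: "open A1" "X j \<subseteq> A1" "A1 \<subseteq> W j"
      unfolding A1_def using Wj Oj orbj by (auto intro!: continuous_open_preimage holomorphic_on_imp_continuous_on)
    have th1: "(T \<circ> \<theta>) holomorphic_on A1"
      by (rule holomorphic_on_compose_gen[OF holomorphic_on_subset[OF Wj(4) A1(3)] Tj(1)]) (auto simp: A1_def)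
    have A2: "open A2" "X j \<subseteq> A2" "A2 \<subseteq> A1"
      unfolding A2_def using A1 Oj orbj th1 by (auto intro!: continuous_open_preimage holomorphic_on_imp_continuous_on)
    have th2: "(T \<circ> (T \<circ> \<theta>)) holomorphic_on A2"
      by (rule holomorphic_on_compose_gen[OF holomorphic_on_subset[OF th1 A2(3)] Tj(2)]) (auto simp: A2_def)
    have phW: "\<phi> holomorphic_on W j" using phi_hol Wj holomorphic_on_subset by blast
    have "\<exists>l. ql (Suc j) = [] @ map \<phi> (zl j) @ l" using ql_Suc by auto
    then have qlS: "\<exists>a b. ql (Suc j) = a @ map \<phi> (zl j) @ b" by blast
    obtain M0 c0 where M0: "open M0" "X j \<subseteq> M0" "c0 \<ge> 0" "\<And>z. z \<in> M0 \<Longrightarrow> wt (ql (Suc j)) (\<phi> z) \<le> c0 * (cmod (deriv \<phi> z) * wt (ql j) z)"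
      using Q_bound[OF Wj(1,2) phW qlS] by metis
    obtain M1 c1 where M1: "open M1" "X j \<subseteq> M1" "c1 \<ge> 0" "\<And>z. z \<in> M1 \<Longrightarrow> wt Ql (\<theta> z) \<le> c1 * (cmod (deriv \<phi> z) * wt (ql j) z)"
      using Q_bound[OF Wj(1,2,4) Ql(1)[OF j]] by metis
    obtain M2 c2 where M2: "open M2" "X j \<subseteq> M2" "c2 \<ge> 0" "\<And>z. z \<in> M2 \<Longrightarrow> wt Ql ((T \<circ> \<theta>) z) \<le> c2 * (cmod (deriv \<phi> z) * wt (ql j) z)"
      using Q_bound[OF A1(1,2) th1 Ql(2)[OF j]] by metis
    obtain M3 c3 where M3: "open M3" "X j \<subseteq> M3" "c3 \<ge> 0" "\<And>z. z \<in> M3 \<Longrightarrow> wt Ql ((T \<circ> (T \<circ> \<theta>)) z) \<le> c3 * (cmod (deriv \<phi> z) * wt (ql j) z)"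
      using Q_bound[OF A2(1,2) th2 Ql(3)[OF j]] by metis
    obtain M4 c4 where M4: "open M4" "X j \<subseteq> M4" "\<And>z. z \<in> M4 \<Longrightarrow> wt (ql j) z \<le> c4 * cmod (deriv \<phi> z)"
      using ql_bound by metis
    define cc where "cc = c0 + c1 + c2 + c3 + \<bar>c4\<bar>"
    have up: "c0 * x \<le> cc * x" "c1 * x \<le> cc * x" "c2 * x \<le> cc * x" "c3 * x \<le> cc * x" "c4 * x \<le> cc * x"
      if "x \<ge> 0" for x using M0 M1 M2 M3 that unfolding cc_def by (intro mult_right_mono; linarith)+
    define W0 where "W0 = W j \<inter> M0 \<inter> M1 \<inter> M2 \<inter> M3 \<inter> M4"
    have W0: "open W0" "X j \<subseteq> W0" "W0 \<subseteq> W j"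
    proof -
      show "open W0" unfolding W0_def by (intro open_Int Wj M0 M1 M2 M3 M4)
      show "X j \<subseteq> W0" unfolding W0_def using Wj(2) M0(2) M1(2) M2(2) M3(2) M4(2) by blast
      show "W0 \<subseteq> W j" unfolding W0_def by blast
    qed
    \<comment> \<open>An injective holomorphic map has no critical points, so
      \<open>\<theta>\<close> near \<open>X (Suc j)\<close> can serve as
      \<open>\<tau>\<close>.\<close>
    have reg: "deriv \<theta> y \<noteq> 0" if "y \<in> W (Suc j)" for y
      using holomorphic_injective_imp_regular[OF WS(2,1) inj_on_subset[OF inj] that] by simp
    have VS: "open (V' (Suc j))" "V' (Suc j) \<subseteq> W (Suc j)" "\<phi> ` X j \<subseteq> V' (Suc j)"
      using V'[of "Suc j"] j phi_X by auto
    have b: "0 \<le> wt (ql j) z" "wt (ql j) z \<le> cc * cmod (deriv \<phi> z)"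
      "wt (ql (Suc j)) (\<phi> z) \<le> cc * (cmod (deriv \<phi> z) * wt (ql j) z)"
      "wt Ql (\<theta> z) \<le> cc * (cmod (deriv \<phi> z) * wt (ql j) z)"
      "wt Ql (T (\<theta> z)) \<le> cc * (cmod (deriv \<phi> z) * wt (ql j) z)"
      "wt Ql (T (T (\<theta> z))) \<le> cc * (cmod (deriv \<phi> z) * wt (ql j) z)" if "z \<in> W0" for z
      using M0(4)[of z] M1(4)[of z] M2(4)[of z] M3(4)[of z] M4(3)[of z] that up[of "cmod (deriv \<phi> z) * wt (ql j) z"] up[of "cmod (deriv \<phi> z)"]
      unfolding W0_def by auto
    obtain Vj where Vj: "open Vj" "X j \<subseteq> Vj" "Vj \<subseteq> W0" "\<phi> ` Vj \<subseteq> V' (Suc j)" and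
     step: "\<And>\<epsilon>. \<epsilon> > 0 \<Longrightarrow> \<exists>\<delta>>0. \<forall>f \<xi>'. f holomorphic_on O1 j \<longrightarrow> f holomorphic_on O2 j \<longrightarrow> f holomorphic_on O3 j \<longrightarrow>
       (\<forall>y\<in>O1 j \<union> O2 j \<union> O3 j. cmod (f y - T y) \<le> \<delta> * wt Ql y) \<longrightarrow>
       \<xi>' holomorphic_on V' (Suc j) \<longrightarrow> (\<forall>y\<in>V' (Suc j). cmod (\<xi>' y - y) \<le> \<delta> * wt (ql (Suc j)) y) \<longrightarrow>
       (\<exists>\<xi>. \<xi> holomorphic_on Vj \<and> (\<forall>z\<in>Vj. \<xi> z \<in> W0 \<and> cmod (\<xi> z - z) \<le> \<epsilon> * wt (ql j) z \<and>
          \<theta> (\<xi> z) \<in> O1 j \<and> f (\<theta> (\<xi> z)) \<in> O2 j \<and> f (f (\<theta> (\<xi> z))) \<in> O3 j \<and>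
          f (f (f (\<theta> (\<xi> z)))) = \<theta> (\<xi>' (\<phi> z))))"
    proof (rule conjugacy_step[where W=W0 and X="X j" and \<phi>=\<phi> and \<theta>=\<theta> and W'="V' (Suc j)" and ?W1.0="W (Suc j)"
          and \<tau>=\<theta> and ?O1.0="O1 j" and ?O2.0="O2 j" and ?O3.0="O3 j" and T=T and q="wt (ql j)" and C=cc
          and q'="wt (ql (Suc j))" and Q="wt Ql"])
      show "\<phi> holomorphic_on W0" "\<theta> holomorphic_on W0" using phW Wj W0 holomorphic_on_subset by blast+
      show "\<theta> ` X j \<subseteq> O1 j" "T ` \<theta> ` X j \<subseteq> O2 j" "T ` T ` \<theta> ` X j \<subseteq> O3 j" using orbj by auto
      show "T (T (T (\<theta> z))) = \<theta> (\<phi> z)" if "z \<in> W0" for z using eq[OF j] that W0 by blast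
      show "\<forall>\<^sub>F y in at z. deriv \<phi> y \<noteq> 0" if "z \<in> W0" for z using phi_iso that W0 Wj by blast
      show "continuous_on UNIV (wt Ql)" by (intro continuous_on_wt continuous_on_id)
    qed (use W0 X_compact VS WS reg Oj Tj b in \<open>simp_all; fail\<close>)+
    define V2 where "V2 = V'(j := Vj)"
    show "P j" unfolding P_def
    proof (intro exI[of _ V2] conjI allI impI)
      fix n assume n: "n \<le> Suc N" "j \<le> n"
      show "open (V2 n)" "X n \<subseteq> V2 n" "V2 n \<subseteq> W n"
        using V'[OF n(1)] n(2) Vj W0 by (cases "n = j"; simp add: V2_def; blast)+
    next
      fix n assume n: "n \<le> N" "j \<le> n"
      show "\<phi> ` V2 n \<subseteq> V2 (Suc n)" using phV'[OF n(1)] n(2) Vj(4) by (cases "n = j") (simp_all add: V2_def)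
    next
      fix \<epsilon> :: real assume eps: "\<epsilon> > 0"
      from step[OF this] obtain \<delta>1 where d1: "\<delta>1 > 0" and
        step1: "\<And>f \<xi>'. f holomorphic_on O1 j \<Longrightarrow> f holomorphic_on O2 j \<Longrightarrow> f holomorphic_on O3 j \<Longrightarrow>
       (\<forall>y\<in>O1 j \<union> O2 j \<union> O3 j. cmod (f y - T y) \<le> \<delta>1 * wt Ql y) \<Longrightarrow>
       \<xi>' holomorphic_on V' (Suc j) \<Longrightarrow> (\<forall>y\<in>V' (Suc j). cmod (\<xi>' y - y) \<le> \<delta>1 * wt (ql (Suc j)) y) \<Longrightarrow>
       (\<exists>\<xi>. \<xi> holomorphic_on Vj \<and> (\<forall>z\<in>Vj. \<xi> z \<in> W0 \<and> cmod (\<xi> z - z) \<le> \<epsilon> * wt (ql j) z \<and>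
          \<theta> (\<xi> z) \<in> O1 j \<and> f (\<theta> (\<xi> z)) \<in> O2 j \<and> f (f (\<theta> (\<xi> z))) \<in> O3 j \<and>
          f (f (f (\<theta> (\<xi> z)))) = \<theta> (\<xi>' (\<phi> z))))" by blast
      \<comment> \<open>The displacement on the later sets must meet the wanted tolerance and also
        be small enough as input of the step at \<open>j\<close>.\<close>
      define \<epsilon>' where "\<epsilon>' = min \<epsilon> \<delta>1"
      have e': "\<epsilon>' > 0" "\<epsilon>' \<le> \<epsilon>" "\<epsilon>' \<le> \<delta>1" using eps d1 by (auto simp: \<epsilon>'_def)
      obtain \<delta>2 where d2: "\<delta>2 > 0" and
        IH2: "\<And>f. (\<forall>n\<le>N. f holomorphic_on O1 n \<and> f holomorphic_on O2 n \<and> f holomorphic_on O3 n \<and>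
         (\<forall>y\<in>O1 n \<union> O2 n \<union> O3 n. cmod (f y - T y) \<le> \<delta>2 * wt Ql y)) \<Longrightarrow>
       (\<exists>\<xi>. \<xi> (Suc N) = (\<lambda>z. z) \<and> (\<forall>n\<le>N. Suc j \<le> n \<longrightarrow> \<xi> n holomorphic_on V' n \<and>
          (\<forall>z\<in>V' n. \<xi> n z \<in> W n \<and> cmod (\<xi> n z - z) \<le> \<epsilon>' * wt (ql n) z \<and>
            \<theta> (\<xi> n z) \<in> O1 n \<and> f (\<theta> (\<xi> n z)) \<in> O2 n \<and> f (f (\<theta> (\<xi> n z))) \<in> O3 n \<and>
            f (f (f (\<theta> (\<xi> n z)))) = \<theta> (\<xi> (Suc n) (\<phi> z)))))"
        using IH e'(1) by blast
      define \<delta> where "\<delta> = min \<delta>1 \<delta>2"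
      have d: "\<delta> > 0" "\<delta> \<le> \<delta>1" "\<delta> \<le> \<delta>2" using d1 d2 by (auto simp: \<delta>_def)
      show "\<exists>\<delta>>0. \<forall>f. (\<forall>n\<le>N. f holomorphic_on O1 n \<and> f holomorphic_on O2 n \<and> f holomorphic_on O3 n \<and>
         (\<forall>y\<in>O1 n \<union> O2 n \<union> O3 n. cmod (f y - T y) \<le> \<delta> * wt Ql y)) \<longrightarrow>
       (\<exists>\<xi>. \<xi> (Suc N) = (\<lambda>z. z) \<and> (\<forall>n\<le>N. j \<le> n \<longrightarrow> \<xi> n holomorphic_on V2 n \<and>
          (\<forall>z\<in>V2 n. \<xi> n z \<in> W n \<and> cmod (\<xi> n z - z) \<le> \<epsilon> * wt (ql n) z \<and>
            \<theta> (\<xi> n z) \<in> O1 n \<and> f (\<theta> (\<xi> n z)) \<in> O2 n \<and> f (f (\<theta> (\<xi> n z))) \<in> O3 n \<and>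
            f (f (f (\<theta> (\<xi> n z)))) = \<theta> (\<xi> (Suc n) (\<phi> z)))))"
      proof (rule exI[of _ \<delta>], intro conjI allI impI d(1))
        fix f assume f: "\<forall>n\<le>N. f holomorphic_on O1 n \<and> f holomorphic_on O2 n \<and> f holomorphic_on O3 n \<and>
         (\<forall>y\<in>O1 n \<union> O2 n \<union> O3 n. cmod (f y - T y) \<le> \<delta> * wt Ql y)"
        have upd: "\<delta> * wt Ql y \<le> \<delta>1 * wt Ql y" "\<delta> * wt Ql y \<le> \<delta>2 * wt Ql y" for y
          using d by (intro mult_right_mono; simp)+
        obtain \<xi> where xN: "\<xi> (Suc N) = (\<lambda>z. z)" and x: "\<And>n. n \<le> N \<Longrightarrow> Suc j \<le> n \<Longrightarrow> \<xi> n holomorphic_on V' n \<and>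
          (\<forall>z\<in>V' n. \<xi> n z \<in> W n \<and> cmod (\<xi> n z - z) \<le> \<epsilon>' * wt (ql n) z \<and>
            \<theta> (\<xi> n z) \<in> O1 n \<and> f (\<theta> (\<xi> n z)) \<in> O2 n \<and> f (f (\<theta> (\<xi> n z))) \<in> O3 n \<and>
            f (f (f (\<theta> (\<xi> n z)))) = \<theta> (\<xi> (Suc n) (\<phi> z)))"
        proof -
          have "\<forall>n\<le>N. f holomorphic_on O1 n \<and> f holomorphic_on O2 n \<and> f holomorphic_on O3 n \<and>
            (\<forall>y\<in>O1 n \<union> O2 n \<union> O3 n. cmod (f y - T y) \<le> \<delta>2 * wt Ql y)"
            using f order_trans[OF _ upd(2)] by blast
          from IH2[OF this] show ?thesis using that by blast
        qed
        have xS: "\<xi> (Suc j) holomorphic_on V' (Suc j)" "\<forall>y\<in>V' (Suc j). cmod (\<xi> (Suc j) y - y) \<le> \<delta>1 * wt (ql (Suc j)) y"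
        proof -
          have "\<xi> (Suc j) holomorphic_on V' (Suc j) \<and> (\<forall>y\<in>V' (Suc j). cmod (\<xi> (Suc j) y - y) \<le> \<epsilon>' * wt (ql (Suc j)) y)"
          proof (cases "j = N")
            case True then show ?thesis using xN e' by simp
          next
            case False then show ?thesis using x[of "Suc j"] j by simp
          qed
          moreover have "\<epsilon>' * wt (ql (Suc j)) y \<le> \<delta>1 * wt (ql (Suc j)) y" for y
            using e' by (intro mult_right_mono) auto
          ultimately show "\<xi> (Suc j) holomorphic_on V' (Suc j)" "\<forall>y\<in>V' (Suc j). cmod (\<xi> (Suc j) y - y) \<le> \<delta>1 * wt (ql (Suc j)) y"
            by (auto intro: order_trans)
        qed
        have fj: "f holomorphic_on O1 j" "f holomorphic_on O2 j" "f holomorphic_on O3 j"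
          "\<forall>y\<in>O1 j \<union> O2 j \<union> O3 j. cmod (f y - T y) \<le> \<delta>1 * wt Ql y"
          using f j order_trans[OF _ upd(1)] by blast+
        obtain \<xi>j where xj: "\<xi>j holomorphic_on Vj" "\<And>z. z\<in>Vj \<Longrightarrow> \<xi>j z \<in> W0 \<and> cmod (\<xi>j z - z) \<le> \<epsilon> * wt (ql j) z \<and>
          \<theta> (\<xi>j z) \<in> O1 j \<and> f (\<theta> (\<xi>j z)) \<in> O2 j \<and> f (f (\<theta> (\<xi>j z))) \<in> O3 j \<and>
          f (f (f (\<theta> (\<xi>j z)))) = \<theta> (\<xi> (Suc j) (\<phi> z))"
          using step1[OF fj xS] by blast
        have ew: "\<epsilon>' * wt (ql n) z \<le> \<epsilon> * wt (ql n) z" for n z using e' by (intro mult_right_mono) auto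
        show "\<exists>\<xi>. \<xi> (Suc N) = (\<lambda>z. z) \<and> (\<forall>n\<le>N. j \<le> n \<longrightarrow> \<xi> n holomorphic_on V2 n \<and>
          (\<forall>z\<in>V2 n. \<xi> n z \<in> W n \<and> cmod (\<xi> n z - z) \<le> \<epsilon> * wt (ql n) z \<and>
            \<theta> (\<xi> n z) \<in> O1 n \<and> f (\<theta> (\<xi> n z)) \<in> O2 n \<and> f (f (\<theta> (\<xi> n z))) \<in> O3 n \<and>
            f (f (f (\<theta> (\<xi> n z)))) = \<theta> (\<xi> (Suc n) (\<phi> z))))"
        proof (rule exI[of _ "\<xi>(j := \<xi>j)"], rule conjI)
          show "(\<xi>(j := \<xi>j)) (Suc N) = (\<lambda>z. z)" using xN j by simp
          show "\<forall>n\<le>N. j \<le> n \<longrightarrow> (\<xi>(j := \<xi>j)) n holomorphic_on V2 n \<and>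
          (\<forall>z\<in>V2 n. (\<xi>(j := \<xi>j)) n z \<in> W n \<and> cmod ((\<xi>(j := \<xi>j)) n z - z) \<le> \<epsilon> * wt (ql n) z \<and>
            \<theta> ((\<xi>(j := \<xi>j)) n z) \<in> O1 n \<and> f (\<theta> ((\<xi>(j := \<xi>j)) n z)) \<in> O2 n \<and> f (f (\<theta> ((\<xi>(j := \<xi>j)) n z))) \<in> O3 n \<and>
            f (f (f (\<theta> ((\<xi>(j := \<xi>j)) n z)))) = \<theta> ((\<xi>(j := \<xi>j)) (Suc n) (\<phi> z)))"
          proof (intro allI impI)
            fix n assume n: "n \<le> N" "j \<le> n"
            show "(\<xi>(j := \<xi>j)) n holomorphic_on V2 n \<and>
          (\<forall>z\<in>V2 n. (\<xi>(j := \<xi>j)) n z \<in> W n \<and> cmod ((\<xi>(j := \<xi>j)) n z - z) \<le> \<epsilon> * wt (ql n) z \<and>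
            \<theta> ((\<xi>(j := \<xi>j)) n z) \<in> O1 n \<and> f (\<theta> ((\<xi>(j := \<xi>j)) n z)) \<in> O2 n \<and> f (f (\<theta> ((\<xi>(j := \<xi>j)) n z))) \<in> O3 n \<and>
            f (f (f (\<theta> ((\<xi>(j := \<xi>j)) n z)))) = \<theta> ((\<xi>(j := \<xi>j)) (Suc n) (\<phi> z)))"
            proof (cases "n = j")
              case True
              then show ?thesis using xj W0(3) unfolding V2_def by auto
            next
              case False
              then have "Suc j \<le> n" using n by simp
              from x[OF n(1) this] show ?thesis using False n unfolding V2_def by (auto intro: order_trans[OF _ ew])
            qed
          qed
        qed
      qed
    qed
  qed simp
  then show ?thesis unfolding P_def by simp
qed

text \<open>
  After \<open>N\<close> steps \<^term>\<open>F h\<close> realises the dynamics on \<open>X n\<close> for \<open>n < N\<close> through the conjugacy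
  \<open>\<theta>\<close>. The finite set \<open>A\<close> contains its poles, and \<open>S\<close> the points at which its values are kept in
  all later steps.
\<close>

definition stage :: "nat \<Rightarrow> (complex \<Rightarrow> complex) \<Rightarrow> complex set \<Rightarrow> complex set \<Rightarrow> (complex \<Rightarrow> complex) \<Rightarrow> bool" where
  "stage N h A S \<theta> \<longleftrightarrow> finite A \<and> finite S \<and> A \<inter> cball p \<rho> = {p} \<and> S \<inter> A = {} \<and>
     (\<forall>m\<ge>N. (A \<union> S) \<inter> XE m = {}) \<and>
     h holomorphic_on - (A - {p}) \<and> h meromorphic_on UNIV \<and> (\<forall>z\<in>cball p \<rho>. cmod (h z) \<le> 1 - (1/2) ^ N) \<and>
     C_infinity \<theta> \<and> (\<forall>z w. cmod ((\<theta> z - z) - (\<theta> w - w)) \<le> 1/4 * (1 - (1/2) ^ N) * cmod (z - w)) \<and>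
     (\<forall>z. z \<notin> (\<Union>n<N. V n) \<longrightarrow> \<theta> z = z) \<and> (\<forall>n. \<forall>c\<in>set (ql n). \<theta> c = c) \<and>
     (\<forall>n<N. \<exists>W. open W \<and> X n \<subseteq> W \<and> W \<subseteq> V n \<and> \<theta> holomorphic_on W \<and>
        (\<forall>z\<in>W. \<theta> z \<notin> A \<and> F h (\<theta> z) \<in> ball p \<rho> - {p} \<and> F h (F h (\<theta> z)) \<in> ball (e n) (r n) - A \<and>
           F h (F h (F h (\<theta> z))) = \<theta> (\<phi> z)))"

lemma stage_simps:
  assumes "stage N h A S \<theta>"
  shows "finite A" "finite S" "A \<inter> cball p \<rho> = {p}" "S \<inter> A = {}" "p \<in> A"
    "\<And>m. m \<ge> N \<Longrightarrow> (A \<union> S) \<inter> XE m = {}"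
    "h holomorphic_on - (A - {p})" "h meromorphic_on UNIV"
    "\<And>z. z \<in> cball p \<rho> \<Longrightarrow> cmod (h z) \<le> 1 - (1/2) ^ N" "C_infinity \<theta>"
    "\<And>z w. cmod ((\<theta> z - z) - (\<theta> w - w)) \<le> 1/4 * (1 - (1/2) ^ N) * cmod (z - w)"
    "\<And>z. z \<notin> (\<Union>n<N. V n) \<Longrightarrow> \<theta> z = z" "\<And>n c. c\<in>set (ql n) \<Longrightarrow> \<theta> c = c"
    "\<And>n. n < N \<Longrightarrow> \<exists>W. open W \<and> X n \<subseteq> W \<and> W \<subseteq> V n \<and> \<theta> holomorphic_on W \<and>
        (\<forall>z\<in>W. \<theta> z \<notin> A \<and> F h (\<theta> z) \<in> ball p \<rho> - {p} \<and> F h (F h (\<theta> z)) \<in> ball (e n) (r n) - A \<and>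
           F h (F h (F h (\<theta> z))) = \<theta> (\<phi> z))"
  using assms unfolding stage_def by blast+

lemma stage_F_holomorphic: "stage N h A S \<theta> \<Longrightarrow> F h holomorphic_on - A"
proof -
  assume s: "stage N h A S \<theta>"
  have "h holomorphic_on - A" using stage_simps(7)[OF s] by (rule holomorphic_on_subset) blast
  moreover have "z - p \<noteq> 0" if "z \<in> - A" for z using that stage_simps(5)[OF s] by auto
  ultimately show ?thesis unfolding F_def by (intro holomorphic_intros)
qed

lemma quarter_lipschitz_inj:
  assumes "\<And>z w. cmod ((\<theta> z - z) - (\<theta> w - w)) \<le> c * cmod (z - w)" "c < (1::real)"
  shows "inj \<theta>"
proof (rule injI)
  fix z w :: complex assume eq: "\<theta> z = \<theta> w"
  have "cmod (z - w) \<le> c * cmod (z - w)"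
    using assms(1)[of z w] eq by (simp add: norm_minus_commute)
  then have "(1 - c) * cmod (z - w) \<le> 0" by (simp add: algebra_simps)
  then show "z = w" using assms(2) by (simp add: mult_le_0_iff)
qed

lemma stage_inj: "stage N h A S \<theta> \<Longrightarrow> inj \<theta>"
  by (rule quarter_lipschitz_inj[OF stage_simps(11)]) (auto simp: mult_less_cancel_left1 less_le_trans[of _ 1])

lemma stage_id:
  assumes "stage N h A S \<theta>"
  shows "m \<ge> N \<Longrightarrow> z \<in> V m \<Longrightarrow> \<theta> z = z" "z \<in> cball (e n) (r n) \<Longrightarrow> \<theta> z = z" "z \<in> cball p \<rho> \<Longrightarrow> \<theta> z = z"
proof -
  show "\<theta> z = z" if "m \<ge> N" "z \<in> V m"
  proof -
    have "z \<notin> V n" if "n < N" for n using V_disj[of n m] that \<open>m \<ge> N\<close> \<open>z \<in> V m\<close> by auto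
    then show ?thesis using stage_simps(12)[OF assms] by blast
  qed
  show "\<theta> z = z" if "z \<in> cball (e n) (r n)" using stage_simps(12)[OF assms] that V_e by blast
  show "\<theta> z = z" if "z \<in> cball p \<rho>" using stage_simps(12)[OF assms] that V_p by blast
qed

text \<open>If \<open>\<theta> z\<close> lies where \<open>\<theta>\<close> is the identity, then
  \<open>\<theta> (\<theta> z) = \<theta> z\<close>, and injectivity gives
  \<open>\<theta> z = z\<close>; but \<open>V n\<close> is disjoint from these regions.\<close>

lemma stage_moved:
  assumes s: "stage N h A S \<theta>" and n: "n < N" and z: "z \<in> V n"
  shows "m \<ge> N \<Longrightarrow> \<theta> z \<notin> V m" "\<theta> z \<notin> cball (e m) (r m)" "\<theta> z \<notin> cball p \<rho>"
proof -
  have key: "False" if "\<theta> (\<theta> z) = \<theta> z" "\<theta> z \<notin> V n"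
    using injD[OF stage_inj[OF s] that(1)] that(2) z by simp
  show "\<theta> z \<notin> V m" if "m \<ge> N"
  proof
    assume a: "\<theta> z \<in> V m"
    then have "\<theta> z \<notin> V n" using V_disj[of m n] n that by auto
    then show False using key stage_id(1)[OF s that a] by blast
  qed
  show "\<theta> z \<notin> cball (e m) (r m)"
  proof
    assume a: "\<theta> z \<in> cball (e m) (r m)"
    then have "\<theta> z \<notin> V n" using V_e[of n m] by blast
    then show False using key stage_id(2)[OF s a] by blast
  qed
  show "\<theta> z \<notin> cball p \<rho>"
  proof
    assume a: "\<theta> z \<in> cball p \<rho>"
    then have "\<theta> z \<notin> V n" using V_p[of n] by blast
    then show False using key stage_id(3)[OF s a] by blast
  qed
qed

lemma XE_disjoint_e: "m \<noteq> n \<Longrightarrow> XE m \<inter> cball (e n) (r n) = {}"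
  unfolding XE_def using X_V[of m] V_e[of m n] e_e[of m n] by blast

text \<open>Near \<open>p\<close> the map is used as it is: there is a point \<open>d\<close> of the
  punctured disc with \<open>F h d = e N\<close> at which \<open>F h\<close> is locally injective,
  and \<open>\<alpha>\<close> contracts \<open>V N\<close> affinely into a small disc about
  \<open>d\<close>.\<close>

lemma entry_map:
  assumes s: "stage N h A S \<theta>"
  obtains \<alpha> where "\<alpha> holomorphic_on UNIV" "inj \<alpha>" "\<alpha> ` V N \<subseteq> ball p \<rho> - {p}"
    "F h ` \<alpha> ` V N \<subseteq> ball (e N) (r N)" "inj_on (F h \<circ> \<alpha>) (V N)"
proof -
  have A: "A \<inter> cball p \<rho> = {p}" and hhol: "h holomorphic_on - (A - {p})" and Fhol: "F h holomorphic_on - A"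
    using stage_simps(3,7)[OF s] stage_F_holomorphic[OF s] by auto
  have finA: "finite A" using stage_simps[OF s] by auto
  have sub: "cball p \<rho> \<subseteq> - (A - {p})" using A by blast
  have hp: "h holomorphic_on cball p \<rho>" using hhol sub holomorphic_on_subset by blast
  have hb: "cmod (h z) \<le> 1" if "z \<in> cball p \<rho>" for z
    using stage_simps(9)[OF s that] by (smt (verit) zero_le_power half_gt_zero)
  have low: "2 / \<rho> \<le> cmod (e N - h z)" if "z \<in> cball p \<rho>" for z
    using hb[OF that] e_big[of N] norm_triangle_ineq2[of "e N" "h z"] by linarith
  have rp: "2 / \<rho> > 0" using rho by simp
  have half: "cball p (\<rho>/2) \<subseteq> cball p \<rho>" using rho by auto
  \<comment> \<open>A fixed point of \<open>g\<close> solves \<open>1 / (d - p) + h d = e N\<close>.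
    The lower bound \<open>2 / \<rho>\<close> for the denominator makes \<open>g\<close> a self-map
    of the disc of radius \<open>\<rho> / 2\<close>.\<close>
  define g where "g = (\<lambda>z. p + 1 / (e N - h z))"
  have nz: "e N - h z \<noteq> 0" if "z \<in> cball p \<rho>" for z using low[OF that] rp by auto
  obtain d where d: "d \<in> cball p (\<rho>/2)" "g d = d"
  proof (rule brouwer[of "cball p (\<rho>/2)" g])
    show "continuous_on (cball p (\<rho>/2)) g" unfolding g_def
    proof (intro continuous_intros holomorphic_on_imp_continuous_on[OF holomorphic_on_subset[OF hp]] half ballI)
      show "e N - h z \<noteq> 0" if "z \<in> cball p (\<rho>/2)" for z using nz half that by blast
    qed
    show "g \<in> cball p (\<rho>/2) \<rightarrow> cball p (\<rho>/2)"
    proof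
      fix z assume "z \<in> cball p (\<rho>/2)"
      then have l: "2 / \<rho> \<le> cmod (e N - h z)" using low half by blast
      have "1 / cmod (e N - h z) \<le> 1 / (2 / \<rho>)" using l rp by (intro divide_left_mono mult_pos_pos) auto
      then show "g z \<in> cball p (\<rho>/2)" by (simp add: g_def dist_norm norm_divide)
    qed
  qed (use rho in auto)
  have dr: "d \<in> cball p \<rho>" using d half by blast
  have dp: "d - p = 1 / (e N - h d)" using d(2) unfolding g_def by (simp add: algebra_simps)
  have dnp: "d \<noteq> p" using dp nz[OF dr] by auto
  have Fd: "F h d = e N" unfolding F_def dp using nz[OF dr] by simp
  have dball: "d \<in> ball p \<rho> - {p}" using d(1) dnp rho by auto
  have Odef: "ball p \<rho> - {p} \<subseteq> - A" using A ball_subset_cball[of p \<rho>] by blast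
  have dA: "d \<in> - A" using dball Odef by blast
  have openA: "open (- A)" using finA by (simp add: finite_imp_closed open_Compl)
  \<comment> \<open>A critical point would require \<open>deriv h d = 1 / (d - p)^2\<close>, of
    modulus at least \<open>(2 / \<rho>)^2\<close>, whereas Cauchy's estimate bounds
    \<open>deriv h d\<close> by \<open>2 / \<rho>\<close>. This is smaller because
    \<open>\<rho> \<le> 1\<close>.\<close>
  have "deriv (F h) d \<noteq> 0"
  proof
    assume z0: "deriv (F h) d = 0"
    have "d \<in> - (A - {p})" using dA by blast
    moreover have "open (- (A - {p}))" using finA by (intro open_Compl finite_imp_closed) auto
    ultimately have "(h has_field_derivative deriv h d) (at d)" using hhol holomorphic_derivI by blast
    then have "(F h has_field_derivative - 1 / (d - p)^2 + deriv h d) (at d)"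
      unfolding F_def using dnp by (auto intro!: derivative_eq_intros simp: power2_eq_square)
    then have "deriv (F h) d = - 1 / (d - p)^2 + deriv h d" by (rule DERIV_imp_deriv)
    then have e1: "deriv h d = 1 / (d - p)^2" using z0 by simp
    have "cball d (\<rho>/2) \<subseteq> cball p \<rho>"
    proof
      fix y assume "y \<in> cball d (\<rho>/2)"
      then show "y \<in> cball p \<rho>" using d(1) dist_triangle[of p y d] by auto
    qed
    then have "cmod (deriv h d) \<le> 1 / (\<rho>/2)"
      using deriv_bound[OF hp, of d "\<rho>/2" 1] rho hb by auto
    then have "cmod (1 / (d - p)^2) \<le> 2 / \<rho>" using e1 by simp
    moreover have "cmod (1 / (d - p)^2) = (cmod (e N - h d))^2" unfolding dp by (simp add: norm_power norm_divide power_divide)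
    moreover have "(2 / \<rho>)^2 \<le> (cmod (e N - h d))^2" using low[OF dr] rp by (intro power_mono) auto
    ultimately have "(2/\<rho>) * (2 / \<rho>) \<le> 1 * (2 / \<rho>)" by (simp add: power2_eq_square)
    then have "2 / \<rho> \<le> 1" using rp by (rule mult_right_le_imp_le)
    then show False using rho by (simp add: field_simps)
  qed
  then obtain s1 where s1: "s1 > 0" "ball d s1 \<subseteq> - A" "inj_on (F h) (ball d s1)"
    using has_complex_derivative_locally_injective[OF Fhol dA openA] by blast
  have "open ((ball p \<rho> - {p}) \<inter> F h -` ball (e N) (r N))"
    by (intro continuous_open_preimage holomorphic_on_imp_continuous_on holomorphic_on_subset[OF Fhol Odef]) auto
  moreover have "d \<in> (ball p \<rho> - {p}) \<inter> F h -` ball (e N) (r N)" using dball Fd r_pos by auto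
  ultimately obtain s2 where s2: "s2 > 0" "ball d s2 \<subseteq> (ball p \<rho> - {p}) \<inter> F h -` ball (e N) (r N)"
    using open_contains_ball by blast
  obtain B where B: "B > 0" "\<And>z. z \<in> V N \<Longrightarrow> cmod z \<le> B" using V_bounded[of N] unfolding bounded_pos by blast
  define s0 where "s0 = min s1 s2 / (2 * B)"
  have s0: "s0 > 0" "s0 * B < s1" "s0 * B < s2" using s1 s2 B by (auto simp: s0_def field_simps min_def)
  define \<alpha> where "\<alpha> = (\<lambda>z. d + of_real s0 * z)"
  have ain: "\<alpha> z \<in> ball d s1" "\<alpha> z \<in> ball d s2" if "z \<in> V N" for z
  proof -
    have "dist d (\<alpha> z) = s0 * cmod z" using s0 by (simp add: \<alpha>_def dist_norm norm_mult)
    also have "\<dots> \<le> s0 * B" using B(2)[OF that] s0 by (intro mult_left_mono) auto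
    finally show "\<alpha> z \<in> ball d s1" "\<alpha> z \<in> ball d s2" using s0 by auto
  qed
  have inja: "inj \<alpha>" using s0 by (auto simp: \<alpha>_def inj_def)
  show ?thesis
  proof (rule that[of \<alpha>])
    show "\<alpha> holomorphic_on UNIV" unfolding \<alpha>_def by (intro holomorphic_intros)
    show "inj \<alpha>" by fact
    show "\<alpha> ` V N \<subseteq> ball p \<rho> - {p}" using ain(2) s2(2) by blast
    show "F h ` \<alpha> ` V N \<subseteq> ball (e N) (r N)" using ain(2) s2(2) by blast
    show "inj_on (F h \<circ> \<alpha>) (V N)"
      using inja s1(3) ain(1) by (intro comp_inj_on) (auto simp: inj_on_def)
  qed
qed

lemma finite_avoid:
  assumes "open (U :: complex set)" "U \<noteq> {}" "finite B" shows "\<exists>t\<in>U. t \<notin> B"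
proof (rule ccontr)
  assume "\<not> ?thesis"
  then have "U \<subseteq> B" by blast
  then have "finite U" using assms finite_subset by blast
  obtain x where x: "x \<in> U" using assms by blast
  have "x islimpt U" using assms(1) x interior_limit_point interior_open by metis
  then show False using \<open>finite U\<close> islimpt_finite by blast
qed

lemma phi_open_image:
  assumes x: "x \<in> V n" and U: "open U" "x \<in> U"
  obtains U' where "U' \<subseteq> U \<inter> V n" "open U'" "x \<in> U'" "open (\<phi> ` U')"
proof -
  have "open (U \<inter> V n)" using U V_open by auto
  then obtain s where s: "s > 0" "ball x s \<subseteq> U \<inter> V n" using U x open_contains_ball by blast
  have hol: "\<phi> holomorphic_on ball x s" using phi_hol s holomorphic_on_subset by blast
  have "\<not> \<phi> constant_on ball x s"
  proof
    assume "\<phi> constant_on ball x s"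
    then obtain c where c: "\<And>y. y \<in> ball x s \<Longrightarrow> \<phi> y = c" unfolding constant_on_def by auto
    have d0: "deriv \<phi> y = 0" if "y \<in> ball x s" for y
    proof (rule DERIV_imp_deriv)
      have "((\<lambda>_. c) has_field_derivative 0) (at y)" by simp
      then show "(\<phi> has_field_derivative 0) (at y)"
        using has_field_derivative_transform_within_open[of "\<lambda>_. c" 0 y "ball x s" \<phi>] that c by auto
    qed
    have "\<forall>\<^sub>F y in at x. y \<in> ball x s" using s eventually_at_in_open'[of "ball x s"] by auto
    then have "\<forall>\<^sub>F y in at x. False" using phi_iso[OF x]
    proof eventually_elim
      case (elim y) then show ?case using d0 by auto
    qed
    then show False by simp
  qed
  then have "open (\<phi> ` ball x s)" using open_mapping_thm[OF hol open_ball connected_ball open_ball] by blast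
  then show ?thesis using s by (intro that[of "ball x s"]) auto
qed

text \<open>
  As \<open>\<phi>\<close> is open and maps boundaries to boundaries, the orbits of the points near \<open>x\<close> under \<open>\<phi>\<close>
  reach all points near a boundary point of \<open>X N\<close>, and some of these lie outside of \<open>X N\<close>.
\<close>

lemma julia_chain:
  assumes s: "stage N h A S \<theta>" and "n \<le> N" and "x \<in> frontier (X n)" and "open U" "x \<in> U" and B: "finite B"
  shows "\<exists>t k. t \<in> U \<inter> V n \<and> (\<forall>i<k. (F h ^^ i) (\<theta> t) \<notin> A \<and> (\<forall>m\<ge>N. (F h ^^ i) (\<theta> t) \<notin> V m \<union> cball (e m) (r m))) \<and>
     (F h ^^ k) (\<theta> t) \<in> V N - X N - B"
  using assms(2-5)
proof (induction n arbitrary: x U rule: inc_induct)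
  case base
  have clX: "closed (X N)" by (simp add: X_compact compact_imp_closed)
  have xV: "x \<in> V N" using base(1) X_V clX frontier_subset_closed by blast
  have "open (U \<inter> V N - X N)" using base V_open clX by (intro open_Diff) auto
  moreover have "U \<inter> V N - X N \<noteq> {}"
  proof -
    have "x \<in> closure (- X N)" using base(1) by (simp add: frontier_closures)
    moreover have "open (U \<inter> V N)" "x \<in> U \<inter> V N" using base xV V_open by auto
    ultimately have "(U \<inter> V N) \<inter> - X N \<noteq> {}" using open_Int_closure_eq_empty by blast
    then show ?thesis by blast
  qed
  ultimately obtain t where t: "t \<in> U \<inter> V N - X N" "t \<notin> B" using finite_avoid[OF _ _ B] by blast
  \<comment> \<open>On \<open>V N\<close> the map \<open>\<theta>\<close> is still the identity, so
    a chain of length 0 suffices.\<close>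
  have "\<theta> t = t" using stage_id(1)[OF s, of N] t by auto
  then show ?case using t by (intro exI[of _ t] exI[of _ 0]) auto
next
  case (step n)
  have clX: "closed (X n)" by (simp add: X_compact compact_imp_closed)
  have xX: "x \<in> X n" using step(4) clX frontier_subset_closed by blast
  obtain W where W: "open W" "X n \<subseteq> W" "W \<subseteq> V n" "\<theta> holomorphic_on W" and
     Wz: "\<And>z. z\<in>W \<Longrightarrow> \<theta> z \<notin> A \<and> F h (\<theta> z) \<in> ball p \<rho> - {p} \<and> F h (F h (\<theta> z)) \<in> ball (e n) (r n) - A \<and>
           F h (F h (F h (\<theta> z))) = \<theta> (\<phi> z)"
    using stage_simps(14)[OF s step(2)] by blast
  have xV: "x \<in> V n" using xX X_V by blast
  have UW: "open (U \<inter> W)" "x \<in> U \<inter> W" using step W xX by auto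
  \<comment> \<open>The image has to be open for the induction hypothesis at
    \<open>\<phi> x\<close>; each of its points then lifts to a point of \<open>U\<close>.\<close>
  obtain U' where U': "U' \<subseteq> (U \<inter> W) \<inter> V n" "open U'" "x \<in> U'" "open (\<phi> ` U')"
    using phi_open_image[OF xV UW] by blast
  have "\<phi> x \<in> frontier (X (Suc n))" using phi_frontier step(4) by blast
  then obtain t' k where t': "t' \<in> \<phi> ` U' \<inter> V (Suc n)" and
    k: "\<And>i. i<k \<Longrightarrow> (F h ^^ i) (\<theta> t') \<notin> A \<and> (\<forall>m\<ge>N. (F h ^^ i) (\<theta> t') \<notin> V m \<union> cball (e m) (r m))"
     "(F h ^^ k) (\<theta> t') \<in> V N - X N - B"
    using step.IH[of "\<phi> x" "\<phi> ` U'"] U' by blast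
  obtain t where t: "t \<in> U'" "t' = \<phi> t" using t' by blast
  have tW: "t \<in> W" "t \<in> V n" "t \<in> U" using t U' by auto
  note w = Wz[OF tW(1)]
  have pA: "A \<inter> cball p \<rho> = {p}" using stage_simps(3)[OF s] .
  \<comment> \<open>The three new orbit points lie in the image of \<open>V n\<close> under
    \<open>\<theta>\<close>, in the disc about \<open>p\<close> and in the disc about
    \<open>e n\<close>. None of them is in \<open>A\<close>, and none enters a region needed from
    step \<open>N\<close> on.\<close>
  have g: "(F h ^^ i) (\<theta> t) \<notin> A \<and> (\<forall>m\<ge>N. (F h ^^ i) (\<theta> t) \<notin> V m \<union> cball (e m) (r m))" if i: "i < k + 3" for i
  proof -
    consider "i = 0" | "i = 1" | "i = 2" | j where "i = j + 3" "j < k" using i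
      by (metis One_nat_def Suc_1 add.commute add_less_cancel_right less_Suc_eq less_one not_less_eq numeral_3_eq_3 le_Suc_ex not_less)
    then show ?thesis
    proof cases
      case 1
      then show ?thesis using w stage_moved[OF s step(2) tW(2)] by auto
    next
      case 2
      have b: "F h (\<theta> t) \<in> cball p \<rho>" "F h (\<theta> t) \<noteq> p" using w by auto
      then have "F h (\<theta> t) \<notin> A" using pA by blast
      moreover have "F h (\<theta> t) \<notin> V m \<union> cball (e m) (r m)" for m using b V_p[of m] e_p[of m] by blast
      ultimately show ?thesis using 2 by simp
    next
      case 3
      have b: "F h (F h (\<theta> t)) \<in> cball (e n) (r n)" using w by auto
      have "F h (F h (\<theta> t)) \<notin> V m \<union> cball (e m) (r m)" if "m \<ge> N" for m
        using b V_e[of m n] e_e[of m n] that step(2) by auto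
      then show ?thesis using 3 w by (simp add: numeral_2_eq_2)
    next
      case 4
      have "(F h ^^ i) (\<theta> t) = (F h ^^ j) (F h (F h (F h (\<theta> t))))" unfolding 4 funpow_add by (simp add: numeral_3_eq_3)
      then show ?thesis using w k(1)[OF 4(2)] t by simp
    qed
  qed
  have "(F h ^^ (k + 3)) (\<theta> t) = (F h ^^ k) (\<theta> t')" using w t unfolding funpow_add by (simp add: numeral_3_eq_3)
  then show ?case using g k(2) tW by (intro exI[of _ t] exI[of _ "k + 3"]) auto
qed

text \<open>The local displacements \<open>\<xi> n\<close> are merged into one global smooth
  correction: \<open>u\<close> is the sum of the differences
  \<open>\<theta> \<circ> \<xi> n - \<theta>\<close>, each cut off inside \<open>V' n\<close>, so
  that \<open>\<theta> + u\<close> equals \<open>\<theta> \<circ> \<xi> n\<close> near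
  \<open>X n\<close>.\<close>

lemma smooth_correction:
  fixes N k :: nat and T \<theta> :: "complex \<Rightarrow> complex" and O1 O2 O3 W :: "nat \<Rightarrow> complex set"
  assumes inj: "inj \<theta>" and lip: "\<And>a b. cmod (\<theta> a - \<theta> b) \<le> 2 * cmod (a - b)"
    and W: "\<And>n. n \<le> Suc N \<Longrightarrow> open (W n) \<and> X n \<subseteq> W n \<and> W n \<subseteq> V n \<and> \<theta> holomorphic_on W n"
    and O: "\<And>n. n \<le> N \<Longrightarrow> open (O1 n) \<and> open (O2 n) \<and> open (O3 n)"
    and T: "\<And>n. n \<le> N \<Longrightarrow> T holomorphic_on O1 n \<and> T holomorphic_on O2 n \<and> T holomorphic_on O3 n"
    and orb: "\<And>n x. n \<le> N \<Longrightarrow> x \<in> X n \<Longrightarrow> \<theta> x \<in> O1 n \<and> T (\<theta> x) \<in> O2 n \<and> T (T (\<theta> x)) \<in> O3 n"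
    and eq: "\<And>n z. n \<le> N \<Longrightarrow> z \<in> W n \<Longrightarrow> T (T (T (\<theta> z))) = \<theta> (\<phi> z)"
    and Ql: "\<And>n. n \<le> N \<Longrightarrow> \<exists>a b. Ql = a @ map \<theta> (zl n) @ b"
      "\<And>n. n \<le> N \<Longrightarrow> \<exists>a b. Ql = a @ map (T \<circ> \<theta>) (zl n) @ b"
      "\<And>n. n \<le> N \<Longrightarrow> \<exists>a b. Ql = a @ map (T \<circ> (T \<circ> \<theta>)) (zl n) @ b"
    and c: "c > 0"
  shows "\<exists>\<delta>>0. \<forall>f. (\<forall>n\<le>N. f holomorphic_on O1 n \<and> f holomorphic_on O2 n \<and> f holomorphic_on O3 n \<and>
         (\<forall>y\<in>O1 n \<union> O2 n \<union> O3 n. cmod (f y - T y) \<le> \<delta> * wt Ql y)) \<longrightarrow>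
     (\<exists>u. C_infinity u \<and> C_k_le k c u \<and> (\<forall>z. z \<notin> (\<Union>n\<le>N. V n) \<longrightarrow> u z = 0) \<and> (\<forall>n. \<forall>a\<in>set (ql n). u a = 0) \<and>
        (\<forall>n\<le>N. \<exists>W'. open W' \<and> X n \<subseteq> W' \<and> W' \<subseteq> V n \<and> (\<lambda>z. \<theta> z + u z) holomorphic_on W' \<and>
           (\<forall>z\<in>W'. \<theta> z + u z \<in> O1 n \<and> f (\<theta> z + u z) \<in> O2 n \<and> f (f (\<theta> z + u z)) \<in> O3 n \<and>
              f (f (f (\<theta> z + u z))) = \<theta> (\<phi> z) + u (\<phi> z))))"
proof -
  obtain V' where V'0: "\<forall>n\<le>Suc N. open (V' n) \<and> X n \<subseteq> V' n \<and> V' n \<subseteq> W n" and phV': "\<forall>n\<le>N. \<phi> ` V' n \<subseteq> V' (Suc n)"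
    and lift: "\<forall>\<epsilon>>0. \<exists>\<delta>>0. \<forall>f. (\<forall>n\<le>N. f holomorphic_on O1 n \<and> f holomorphic_on O2 n \<and> f holomorphic_on O3 n \<and>
         (\<forall>y\<in>O1 n \<union> O2 n \<union> O3 n. cmod (f y - T y) \<le> \<delta> * wt Ql y)) \<longrightarrow>
       (\<exists>\<xi>. \<xi> (Suc N) = (\<lambda>z. z) \<and> (\<forall>n\<le>N. \<xi> n holomorphic_on V' n \<and>
          (\<forall>z\<in>V' n. \<xi> n z \<in> W n \<and> cmod (\<xi> n z - z) \<le> \<epsilon> * wt (ql n) z \<and>
            \<theta> (\<xi> n z) \<in> O1 n \<and> f (\<theta> (\<xi> n z)) \<in> O2 n \<and> f (f (\<theta> (\<xi> n z))) \<in> O3 n \<and>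
            f (f (f (\<theta> (\<xi> n z)))) = \<theta> (\<xi> (Suc n) (\<phi> z)))))"
    by (rule exE[OF lift_all[where N=N and T=T and \<theta>=\<theta> and ?O1.0=O1 and ?O2.0=O2 and ?O3.0=O3 and W=W and Ql=Ql]];
      ((rule inj W O T orb eq Ql; assumption?) | (elim conjE, rule that; assumption)))
  have V': "open (V' n)" "X n \<subseteq> V' n" "V' n \<subseteq> W n" "V' n \<subseteq> V n" if "n \<le> Suc N" for n
    using V'0 W that by blast+
  have "\<exists>cf Nn L. C_infinity cf \<and> open Nn \<and> X n \<subseteq> Nn \<and> Nn \<subseteq> V' n \<and> (\<forall>z\<in>Nn. cf z = 1) \<and> compact L \<and> L \<subseteq> V' n \<and> (\<forall>z. z \<notin> L \<longrightarrow> cf z = 0)"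
    if "n \<le> N" for n
  proof -
    have n: "n \<le> Suc N" using that by simp
    show ?thesis by (rule smooth_cutoff[OF X_compact V'(1)[OF n] V'(2)[OF n]]) blast
  qed
  then obtain cf Nn L where cf: "\<And>n. n \<le> N \<Longrightarrow> C_infinity (cf n) \<and> open (Nn n) \<and> X n \<subseteq> Nn n \<and> Nn n \<subseteq> V' n \<and>
     (\<forall>z\<in>Nn n. cf n z = 1) \<and> compact (L n) \<and> L n \<subseteq> V' n \<and> (\<forall>z. z \<notin> L n \<longrightarrow> cf n z = 0)"
    by metis
  have "\<exists>d>0. \<forall>u. u holomorphic_on V' n \<longrightarrow> (\<forall>z\<in>V' n. cmod (u z) \<le> d) \<longrightarrow> C_k_le k (c / (N + 1)) (\<lambda>z. cf n z * u z)"
    if "n \<le> N" for n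
    by (rule cutoff_product_C_k_le[of "cf n" "L n"]) (use cf[OF that] V'[of n] that c in auto)
  then obtain dc where dc: "\<And>n. n \<le> N \<Longrightarrow> dc n > 0 \<and> (\<forall>u. u holomorphic_on V' n \<longrightarrow> (\<forall>z\<in>V' n. cmod (u z) \<le> dc n) \<longrightarrow>
      C_k_le k (c / (N + 1)) (\<lambda>z. cf n z * u z))" by metis
  have "\<exists>M\<ge>0. \<forall>z\<in>V n. wt (ql n) z \<le> M" for n using wt_bounded[OF V_bounded] by metis
  then obtain M where M: "\<And>n. M n \<ge> 0" "\<And>n z. z \<in> V n \<Longrightarrow> wt (ql n) z \<le> M n" by metis
  \<comment> \<open>The difference \<open>\<theta> \<circ> \<xi> n - \<theta>\<close> is at most
    twice the displacement; this choice keeps it below the threshold \<open>dc n\<close> of the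
    cutoff estimate.\<close>
  define e0 where "e0 = Min ((\<lambda>n. dc n / (2 * (M n + 1))) ` {..N})"
  have e0: "e0 > 0" unfolding e0_def using dc M(1) by (auto simp: add_nonneg_pos)
  have e0M: "2 * (e0 * M n) \<le> dc n" if "n \<le> N" for n
  proof -
    have "e0 \<le> dc n / (2 * (M n + 1))" unfolding e0_def using that by (intro Min_le) auto
    then have "e0 * (2 * (M n + 1)) \<le> dc n" using M(1)[of n] by (simp add: pos_le_divide_eq)
    then show ?thesis using e0 by (simp add: algebra_simps)
  qed
  obtain \<delta> where d: "\<delta> > 0" and lift2: "\<And>f. (\<forall>n\<le>N. f holomorphic_on O1 n \<and> f holomorphic_on O2 n \<and> f holomorphic_on O3 n \<and>
         (\<forall>y\<in>O1 n \<union> O2 n \<union> O3 n. cmod (f y - T y) \<le> \<delta> * wt Ql y)) \<Longrightarrow>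
       (\<exists>\<xi>. \<xi> (Suc N) = (\<lambda>z. z) \<and> (\<forall>n\<le>N. \<xi> n holomorphic_on V' n \<and>
          (\<forall>z\<in>V' n. \<xi> n z \<in> W n \<and> cmod (\<xi> n z - z) \<le> e0 * wt (ql n) z \<and>
            \<theta> (\<xi> n z) \<in> O1 n \<and> f (\<theta> (\<xi> n z)) \<in> O2 n \<and> f (f (\<theta> (\<xi> n z))) \<in> O3 n \<and>
            f (f (f (\<theta> (\<xi> n z)))) = \<theta> (\<xi> (Suc n) (\<phi> z)))))"
    using lift e0 by blast
  show ?thesis
  proof (rule exI[of _ \<delta>], intro conjI allI impI d)
    fix f assume f: "\<forall>n\<le>N. f holomorphic_on O1 n \<and> f holomorphic_on O2 n \<and> f holomorphic_on O3 n \<and>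
         (\<forall>y\<in>O1 n \<union> O2 n \<union> O3 n. cmod (f y - T y) \<le> \<delta> * wt Ql y)"
    obtain \<xi> where xN: "\<xi> (Suc N) = (\<lambda>z. z)" and x0: "\<forall>n\<le>N. \<xi> n holomorphic_on V' n \<and>
          (\<forall>z\<in>V' n. \<xi> n z \<in> W n \<and> cmod (\<xi> n z - z) \<le> e0 * wt (ql n) z \<and>
            \<theta> (\<xi> n z) \<in> O1 n \<and> f (\<theta> (\<xi> n z)) \<in> O2 n \<and> f (f (\<theta> (\<xi> n z))) \<in> O3 n \<and>
            f (f (f (\<theta> (\<xi> n z)))) = \<theta> (\<xi> (Suc n) (\<phi> z)))"
      using lift2[OF f] by blast
    have xhol: "\<xi> n holomorphic_on V' n" if "n \<le> N" for n using x0 that by blast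
    have x: "\<xi> n z \<in> W n" "cmod (\<xi> n z - z) \<le> e0 * wt (ql n) z" "\<theta> (\<xi> n z) \<in> O1 n" "f (\<theta> (\<xi> n z)) \<in> O2 n" "f (f (\<theta> (\<xi> n z))) \<in> O3 n"
            "f (f (f (\<theta> (\<xi> n z)))) = \<theta> (\<xi> (Suc n) (\<phi> z))" if "n \<le> N" "z \<in> V' n" for n z
      using x0 that by blast+
    define v where "v = (\<lambda>n z. \<theta> (\<xi> n z) - \<theta> z)"
    define u where "u = (\<lambda>z. \<Sum>n\<le>N. cf n z * v n z)"
    have vhol: "v n holomorphic_on V' n" and txhol: "(\<lambda>z. \<theta> (\<xi> n z)) holomorphic_on V' n" if n: "n \<le> N" for n
    proof -
      have th: "\<theta> holomorphic_on W n" using W[of n] n by auto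
      show h: "(\<lambda>z. \<theta> (\<xi> n z)) holomorphic_on V' n"
        using holomorphic_on_compose_gen[OF xhol[OF n] th] x(1)[OF n] by (auto simp: o_def)
      have "\<theta> holomorphic_on V' n" using th V'(3)[of n] n holomorphic_on_subset by auto
      then show "v n holomorphic_on V' n" unfolding v_def using h by (intro holomorphic_on_diff)
    qed
    have vb: "cmod (v n z) \<le> dc n" if n: "n \<le> N" and z: "z \<in> V' n" for n z
    proof -
      have zV: "z \<in> V n" using V'(4)[of n] n z by auto
      have "cmod (v n z) \<le> 2 * cmod (\<xi> n z - z)" unfolding v_def by (rule lip)
      also have "\<dots> \<le> 2 * (e0 * wt (ql n) z)" using x(2)[OF n z] by simp
      also have "\<dots> \<le> 2 * (e0 * M n)" using M(2)[OF zV] e0 by simp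
      finally show ?thesis using e0M[OF n] by simp
    qed
    have term_k: "C_k_le k (c / (N + 1)) (\<lambda>z. cf n z * v n z)" if n: "n \<le> N" for n
      using dc[OF n] vhol[OF n] vb[OF n] by blast
    have term_inf: "C_infinity (\<lambda>z. cf n z * v n z)" if n: "n \<le> N" for n
      by (rule cutoff_product_C_infinity[of _ "L n" "V' n"]) (use cf[OF n] V'[of n] n vhol[OF n] in auto)
    have "C_k_le k (of_nat (card {..N}) * (c / (N + 1))) u"
      unfolding u_def using term_k by (intro C_k_le_sum) auto
    then have uk: "C_k_le k c u" by simp
    have uinf: "C_infinity u" unfolding u_def C_infinity_def
      using term_inf unfolding C_infinity_def by (intro allI C_k_sum) auto
    have cf0: "cf n z = 0" if "n \<le> N" "z \<notin> V n" for n z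
    proof -
      have "L n \<subseteq> V n" using cf[OF that(1)] V'(4)[of n] that(1) by auto
      then have "z \<notin> L n" using that(2) by blast
      then show ?thesis using cf[OF that(1)] by blast
    qed
    have supp: "u z = 0" if "z \<notin> (\<Union>n\<le>N. V n)" for z
      unfolding u_def using cf0 that by (intro sum.neutral) auto
    have uloc: "u z = cf n z * v n z" if n: "n \<le> N" and z: "z \<in> V n" for n z
    proof -
      have "u z = (\<Sum>m\<le>N. if m = n then cf n z * v n z else 0)" unfolding u_def
      proof (rule sum.cong)
        fix m assume m: "m \<in> {..N}"
        show "cf m z * v m z = (if m = n then cf n z * v n z else 0)"
        proof (cases "m = n")
          case False
          then have "z \<notin> V m" using V_disj[of m n] z by auto
          then show ?thesis using cf0[of m z] m False by simp
        qed simp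
      qed simp
      then show ?thesis using n by simp
    qed
    \<comment> \<open>Near \<open>X (Suc N)\<close> the correction \<open>u\<close> is 0 and no
      cutoff is involved, so there all of \<open>V'\<close> can be taken.\<close>
    define NN where "NN = (\<lambda>n. if n \<le> N then Nn n else V' n)"
    have NN: "open (NN n)" "X n \<subseteq> NN n" "NN n \<subseteq> V' n" if "n \<le> Suc N" for n
      using cf[of n] V'[of n] that by (auto simp: NN_def)
    have key: "\<theta> z + u z = \<theta> (\<xi> n z)" if n: "n \<le> Suc N" and z: "z \<in> NN n" for n z
    proof (cases "n \<le> N")
      case True
      have "cf n z = 1" using cf[OF True] z True by (auto simp: NN_def)
      moreover have "z \<in> V n" using NN(3)[OF n] V'(4)[OF n] z by blast
      ultimately show ?thesis using uloc[OF True] by (simp add: v_def)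
    next
      case False
      then have nN: "n = Suc N" using n by simp
      have zV: "z \<in> V (Suc N)" using NN(3)[OF n] V'(4)[OF n] z nN by blast
      have "z \<notin> V m" if "m \<le> N" for m using V_disj[of m "Suc N"] that zV by auto
      then have "u z = 0" using supp by blast
      then show ?thesis using nN xN by simp
    qed
    \<comment> \<open>The weight vanishes at its nodes, which forces \<open>\<xi> n a = a\<close>;
      nodes in later sets lie outside the support of \<open>u\<close>.\<close>
    have qlz: "u a = 0" if a: "a \<in> set (ql n)" for n a
    proof -
      have aX: "a \<in> X n" using a ql by blast
      show ?thesis
      proof (cases "n \<le> N")
        case True
        have n: "n \<le> Suc N" using True by simp
        have aN: "a \<in> NN n" using NN(2)[OF n] aX by blast
        then have aV: "a \<in> V' n" using NN(3)[OF n] by blast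
        have "wt (ql n) a = 0" using a wt_eq_0_iff by blast
        then have "\<xi> n a = a" using x(2)[OF True aV] by simp
        then show ?thesis using key[OF n aN] by simp
      next
        case False
        have "a \<notin> V m" if "m \<le> N" for m using V_disj[of m n] that False aX X_V[of n] by auto
        then show ?thesis using supp by blast
      qed
    qed
    have conj: "\<exists>W'. open W' \<and> X n \<subseteq> W' \<and> W' \<subseteq> V n \<and> (\<lambda>z. \<theta> z + u z) holomorphic_on W' \<and>
           (\<forall>z\<in>W'. \<theta> z + u z \<in> O1 n \<and> f (\<theta> z + u z) \<in> O2 n \<and> f (f (\<theta> z + u z)) \<in> O3 n \<and>
              f (f (f (\<theta> z + u z))) = \<theta> (\<phi> z) + u (\<phi> z))" if n: "n \<le> N" for n
    proof -
      have n': "n \<le> Suc N" and Sn: "Suc n \<le> Suc N" using n by auto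
      have NV: "NN n \<subseteq> V n" using NN(3)[OF n'] V'(4)[OF n'] by blast
      define W' where "W' = NN n \<inter> \<phi> -` NN (Suc n)"
      have oW: "open W'" unfolding W'_def
        using NN(1)[OF n'] NN(1)[OF Sn] holomorphic_on_imp_continuous_on[OF holomorphic_on_subset[OF phi_hol NV]]
        by (intro continuous_open_preimage)
      have WN: "W' \<subseteq> NN n" unfolding W'_def by blast
      have k1: "\<theta> z + u z = \<theta> (\<xi> n z)" if "z \<in> W'" for z using key[OF n'] WN that by blast
      have k2: "\<theta> (\<phi> z) + u (\<phi> z) = \<theta> (\<xi> (Suc n) (\<phi> z))" if "z \<in> W'" for z
        using key[OF Sn] that unfolding W'_def by blast
      have WV': "W' \<subseteq> V' n" using WN NN(3)[OF n'] by blast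
      have hol: "(\<lambda>z. \<theta> z + u z) holomorphic_on W'"
        by (rule holomorphic_transform[OF holomorphic_on_subset[OF txhol[OF n] WV']]) (simp add: k1)
      show ?thesis
      proof (intro exI[of _ W'] conjI ballI oW hol)
        show "X n \<subseteq> W'" unfolding W'_def using NN(2)[OF n'] NN(2)[OF Sn] phi_X by blast
        show "W' \<subseteq> V n" using WN NV by blast
        fix z assume z: "z \<in> W'"
        then have zV': "z \<in> V' n" using WV' by blast
        show "\<theta> z + u z \<in> O1 n" "f (\<theta> z + u z) \<in> O2 n" "f (f (\<theta> z + u z)) \<in> O3 n"
          unfolding k1[OF z] by (rule x[OF n zV'])+
        show "f (f (f (\<theta> z + u z))) = \<theta> (\<phi> z) + u (\<phi> z)"
          unfolding k1[OF z] k2[OF z] by (rule x[OF n zV'])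
      qed
    qed
    show "\<exists>u. C_infinity u \<and> C_k_le k c u \<and> (\<forall>z. z \<notin> (\<Union>n\<le>N. V n) \<longrightarrow> u z = 0) \<and> (\<forall>n. \<forall>a\<in>set (ql n). u a = 0) \<and>
        (\<forall>n\<le>N. \<exists>W'. open W' \<and> X n \<subseteq> W' \<and> W' \<subseteq> V n \<and> (\<lambda>z. \<theta> z + u z) holomorphic_on W' \<and>
           (\<forall>z\<in>W'. \<theta> z + u z \<in> O1 n \<and> f (\<theta> z + u z) \<in> O2 n \<and> f (f (\<theta> z + u z)) \<in> O3 n \<and>
              f (f (f (\<theta> z + u z))) = \<theta> (\<phi> z) + u (\<phi> z)))"
      using uinf uk supp qlz conj by blast
  qed
qed

end

text \<open>Each of the two coordinate directions contributes \<open>c\<close> to the operator norm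
  of the derivative, whence the factor 2.\<close>

lemma C_k_le_lipschitz:
  assumes "C_k_le (Suc k) c u"
  shows "cmod (u z - u w) \<le> 2 * c * cmod (z - w)"
proof -
  have d: "u differentiable at x" for x using assms by simp
  have b: "cmod (frechet_derivative u (at x) 1) \<le> c" "cmod (frechet_derivative u (at x) \<i>) \<le> c" for x
    using assms C_k_le_bound[of k c "\<lambda>x. frechet_derivative u (at x) 1"] C_k_le_bound[of k c "\<lambda>x. frechet_derivative u (at x) \<i>"]
    by auto
  have c0: "c \<ge> 0" using b(1)[of 0] norm_ge_zero order_trans by blast
  have "norm (u z - u w) \<le> (2 * c) * norm (z - w)"
  proof (rule differentiable_bound[of UNIV u "\<lambda>x. frechet_derivative u (at x)"])
    fix x
    show "(u has_derivative frechet_derivative u (at x)) (at x within UNIV)"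
      using d frechet_derivative_works by auto
    show "onorm (frechet_derivative u (at x)) \<le> 2 * c"
    proof (rule onorm_bound)
      fix v
      have "cmod (frechet_derivative u (at x) v) \<le> cmod (complex_of_real (Re v) * frechet_derivative u (at x) 1)
          + cmod (complex_of_real (Im v) * frechet_derivative u (at x) \<i>)"
        unfolding frechet_derivative_components[OF d, of x v] by (rule norm_triangle_ineq)
      also have "\<dots> \<le> cmod v * c + cmod v * c"
        unfolding norm_mult norm_of_real using b[of x] abs_Re_le_cmod[of v] abs_Im_le_cmod[of v]
        by (intro add_mono mult_mono) auto
      finally show "cmod (frechet_derivative u (at x) v) \<le> 2 * c * cmod v" by (simp add: algebra_simps)
    qed (use c0 in simp)
  qed auto
  then show ?thesis .
qed

context bungee_setup begin

text \<open>
  The last conjunct puts a new pole on the orbit of a point close to \<open>\<theta> x\<close>, where \<open>x\<close> is a boundary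
  point of some \<open>X n\<close>; the orbit up to the pole is frozen by \<open>S'\<close>.
\<close>

definition step_rel where
  "step_rel N x h A S \<theta> g D S' \<theta>' \<longleftrightarrow> fin_mero g D \<and> D \<inter> (cball 0 (R N) \<union> cball p \<rho> \<union> A \<union> S') = {} \<and>
     (\<forall>z\<in>cball 0 (R N). cmod (g z) \<le> (1/2) ^ Suc N) \<and> (\<forall>z\<in>S'. g z = 0) \<and> S \<subseteq> S' \<and>
     C_infinity (\<lambda>z. \<theta>' z - \<theta> z) \<and> C_k_le N ((1/2) ^ N) (\<lambda>z. \<theta>' z - \<theta> z) \<and>
     (\<forall>n. \<forall>z\<in>X n. cmod (\<theta>' z - \<theta> z) \<le> (1/2) ^ Suc N * \<epsilon> n) \<and>
     ((\<exists>n\<le>N. x \<in> frontier (X n)) \<longrightarrow> (\<exists>t k. cmod (t - \<theta> x) < 1 / real (Suc N) \<and>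
        (\<forall>i<k. (F (\<lambda>z. h z + g z) ^^ i) t \<in> S') \<and> is_pole g ((F (\<lambda>z. h z + g z) ^^ k) t)))"

text \<open>\<open>S0\<close> is the orbit to be frozen and \<open>P\<close> the site of the new
  pole. Both can be empty if \<open>x\<close> is no boundary point of the sets up to
  \<open>X N\<close>, so that the stage step treats both cases alike.\<close>

lemma julia_data:
  assumes s: "stage N h A S \<theta>"
  shows "\<exists>S0 P. finite S0 \<and> S0 \<inter> A = {} \<and> (\<forall>m\<ge>N. S0 \<inter> (V m \<union> cball (e m) (r m)) = {}) \<and>
    P \<subseteq> V N - X N - (A \<union> S \<union> S0) \<and> (P = {} \<or> (\<exists>a. P = {a})) \<and>
    ((\<exists>n\<le>N. x \<in> frontier (X n)) \<longrightarrow> (\<exists>t k. cmod (t - \<theta> x) < 1 / real (Suc N) \<and>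
        (\<forall>i<k. (F h ^^ i) t \<in> S0) \<and> (F h ^^ k) t \<in> P))"
proof (cases "\<exists>n\<le>N. x \<in> frontier (X n)")
  case False
  then show ?thesis by (intro exI[of _ "{}"]) simp
next
  case True
  then obtain n where n: "n \<le> N" "x \<in> frontier (X n)" by blast
  have "continuous_on UNIV \<theta>" using stage_simps(10)[OF s] C_k.simps(1) unfolding C_infinity_def by metis
  then have "open (\<theta> -` ball (\<theta> x) (1 / real (Suc N)))" by (intro open_vimage) auto
  moreover have "x \<in> \<theta> -` ball (\<theta> x) (1 / real (Suc N))" by simp
  moreover have "finite (A \<union> S)" using stage_simps(1,2)[OF s] by simp
  ultimately obtain t k where t: "t \<in> \<theta> -` ball (\<theta> x) (1 / real (Suc N))"
    and k: "\<And>i. i<k \<Longrightarrow> (F h ^^ i) (\<theta> t) \<notin> A \<and> (\<forall>m\<ge>N. (F h ^^ i) (\<theta> t) \<notin> V m \<union> cball (e m) (r m))"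
      "(F h ^^ k) (\<theta> t) \<in> V N - X N - (A \<union> S)"
    using julia_chain[OF s n, of "\<theta> -` ball (\<theta> x) (1 / real (Suc N))" "A \<union> S"] by blast
  define S0 where "S0 = (\<lambda>i. (F h ^^ i) (\<theta> t)) ` {..<k}"
  have S0: "finite S0" "S0 \<inter> A = {}" "\<forall>m\<ge>N. S0 \<inter> (V m \<union> cball (e m) (r m)) = {}"
    unfolding S0_def using k(1) by (simp, blast, blast)
  have "(F h ^^ k) (\<theta> t) \<notin> S0" using S0(3) k(2) by blast
  then have P: "{(F h ^^ k) (\<theta> t)} \<subseteq> V N - X N - (A \<union> S \<union> S0)" using k(2) by blast
  have "cmod (\<theta> t - \<theta> x) < 1 / real (Suc N)" using t by (simp add: dist_norm norm_minus_commute)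
  moreover have "\<forall>i<k. (F h ^^ i) (\<theta> t) \<in> S0" by (simp add: S0_def)
  ultimately have J: "\<exists>t' k'. cmod (t' - \<theta> x) < 1 / real (Suc N) \<and> (\<forall>i<k'. (F h ^^ i) t' \<in> S0) \<and> (F h ^^ k') t' \<in> {(F h ^^ k) (\<theta> t)}"
    by (intro exI[of _ "\<theta> t"] exI[of _ k]) simp
  show ?thesis
    by (rule exI[of _ S0], rule exI[of _ "{(F h ^^ k) (\<theta> t)}"], intro conjI impI S0 P J) blast
qed

text \<open>The map wanted is \<open>T = f + G\<close>: the term \<open>G\<close> is 0 on the region
  already settled, redirects a neighbourhood of \<open>X N\<close> by \<open>\<alpha>\<close>, and
  on the second image of this neighbourhood replaces \<open>f\<close> by \<phi> after the inverse of
  the first two steps. As these three open sets are disjoint, \<open>G\<close> is holomorphic and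
  can be approximated by \<open>g\<close>; the deviation of \<open>f + g\<close> from
  \<open>T\<close> is absorbed into the conjugacy by \<open>smooth_correction\<close>.\<close>

lemma stage_step:
  assumes s: "stage N h A S \<theta>"
  shows "\<exists>g D S' \<theta>'. stage (Suc N) (\<lambda>z. h z + g z) (A \<union> D) S' \<theta>' \<and> step_rel N x h A S \<theta> g D S' \<theta>'"
proof -
  define f where "f = F h"
  have finA: "finite A" and finS: "finite S" and Ap: "A \<inter> cball p \<rho> = {p}" and SA: "S \<inter> A = {}" and pA: "p \<in> A"
    and AS: "\<And>m. m \<ge> N \<Longrightarrow> (A \<union> S) \<inter> XE m = {}" using stage_simps(1-6)[OF s] by auto
  have fhol: "f holomorphic_on - A" unfolding f_def by (rule stage_F_holomorphic[OF s])
  have inj: "inj \<theta>" by (rule stage_inj[OF s])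
  have XEe: "cball (e m) (r m) \<subseteq> XE m" "X m \<subseteq> XE m" for m by (auto simp: XE_def)
  have XEsub: "XE m \<subseteq> V m \<union> cball (e m) (r m)" for m unfolding XE_def using X_V by blast
  obtain S0 P where S00: "finite S0" "S0 \<inter> A = {}" "\<forall>m\<ge>N. S0 \<inter> (V m \<union> cball (e m) (r m)) = {}"
    and P: "P \<subseteq> V N - X N - (A \<union> S \<union> S0)" "P = {} \<or> (\<exists>a. P = {a})"
    and J: "(\<exists>n\<le>N. x \<in> frontier (X n)) \<longrightarrow> (\<exists>t k. cmod (t - \<theta> x) < 1 / real (Suc N) \<and>
        (\<forall>i<k. (f ^^ i) t \<in> S0) \<and> (f ^^ k) t \<in> P)"
    using julia_data[OF s, of x] unfolding f_def[symmetric] by (elim exE conjE) (rule that; assumption)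
  have S0: "finite S0" "S0 \<inter> A = {}" "\<And>m. m \<ge> N \<Longrightarrow> S0 \<inter> (V m \<union> cball (e m) (r m)) = {}"
    using S00 by auto
  have finP: "finite P" using P(2) by auto
  define S' where "S' = S \<union> S0"
  have S': "finite S'" "S' \<inter> A = {}" "S \<subseteq> S'" "S0 \<subseteq> S'" using finS S0 SA by (auto simp: S'_def)
  have SXE: "S' \<inter> XE m = {}" if "m \<ge> N" for m unfolding S'_def using AS[OF that] S0(3)[OF that] XEsub[of m] by blast
  obtain \<alpha> where al: "\<alpha> holomorphic_on UNIV" "inj \<alpha>" "\<alpha> ` V N \<subseteq> ball p \<rho> - {p}"
    "f ` \<alpha> ` V N \<subseteq> ball (e N) (r N)" "inj_on (f \<circ> \<alpha>) (V N)"
    using entry_map[OF s] unfolding f_def by blast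
  define \<beta> where "\<beta> = f \<circ> \<alpha>"
  have bpA: "ball p \<rho> - {p} \<subseteq> - A" using Ap ball_subset_cball[of p \<rho>] by blast
  have al_hol: "\<alpha> holomorphic_on S" for S using al(1) holomorphic_on_subset by blast
  have be_hol: "\<beta> holomorphic_on V N" unfolding \<beta>_def
    by (rule holomorphic_on_compose_gen[OF al_hol fhol]) (use al(3) bpA in blast)
  have be_im: "\<beta> z \<in> ball (e N) (r N)" if "z \<in> V N" for z using al(4) that unfolding \<beta>_def o_def by blast
  define B0 where "B0 = A \<union> S' \<union> P"
  have finB0: "finite B0" using finA S' finP by (simp add: B0_def)
  have B0X: "B0 \<inter> X N = {}" unfolding B0_def using AS[of N] SXE[of N] P(1) XEe(2)[of N] by blast
  define W0 where "W0 = V N \<inter> \<phi> -` V (Suc N) - B0"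
  have oW0: "open W0" unfolding W0_def
    by (intro open_Diff continuous_open_preimage holomorphic_on_imp_continuous_on phi_hol V_open finite_imp_closed finB0)
  have XW0: "X N \<subseteq> W0" unfolding W0_def using X_V[of N] X_V[of "Suc N"] phi_X[of N] B0X by blast
  obtain d2 K2 where K2: "d2 > 0" "compact K2" "K2 \<subseteq> W0" "\<And>x y. x \<in> X N \<Longrightarrow> dist x y \<le> d2 \<Longrightarrow> y \<in> interior K2"
    using compact_fatten[OF X_compact oW0 XW0] by blast
  define V1 where "V1 = interior K2"
  have V1: "open V1" "V1 \<subseteq> K2" "X N \<subseteq> V1" unfolding V1_def using K2(1) K2(4)[of z z for z] interior_subset by auto
  have K2V: "K2 \<subseteq> V N" and K2B: "K2 \<inter> B0 = {}" and K2phi: "\<And>z. z \<in> K2 \<Longrightarrow> \<phi> z \<in> V (Suc N)"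
    using K2(3) unfolding W0_def by blast+
  have V1V: "V1 \<subseteq> V N" using V1(2) K2V by blast
  have be_hol1: "\<beta> holomorphic_on V1" using be_hol V1V holomorphic_on_subset by blast
  have be_inj: "inj_on \<beta> V1" using al(5) V1V inj_on_subset unfolding \<beta>_def by blast
  define Ob where "Ob = \<beta> ` V1"
  have oOb: "open Ob" unfolding Ob_def by (rule open_mapping_thm3[OF be_hol1 V1(1) be_inj])
  have Ob_e: "Ob \<subseteq> ball (e N) (r N)" unfolding Ob_def using be_im V1V by blast
  \<comment> \<open>The inverse of the first two steps, so that the third one can land exactly on
    \<open>\<phi> z\<close>.\<close>
  obtain \<psi> where psi: "\<psi> holomorphic_on Ob" "\<And>z. z \<in> V1 \<Longrightarrow> \<psi> (\<beta> z) = z"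
    using holomorphic_has_inverse[OF be_hol1 V1(1) be_inj] unfolding Ob_def by metis
  have psi_V1: "\<psi> z \<in> V1" if "z \<in> Ob" for z using that psi(2) unfolding Ob_def by auto
  \<comment> \<open>The complement of this closed set is the settled region, where \<open>G\<close>
    is 0. The sets and discs reserved for later steps are contained in \<open>Cc\<close>; they stay
    outside \<open>Om\<close>, hence free of poles of \<open>g\<close>.\<close>
  define Cc where "Cc = K2 \<union> cball (e N) (r N) \<union> (\<Union>m\<in>{Suc N..}. XE m)"
  have clCc: "closed Cc" unfolding Cc_def
    by (intro closed_Un closed_XE_Union closed_cball compact_imp_closed[OF K2(2)])
  define Oo where "Oo = - Cc"
  have oOo: "open Oo" unfolding Oo_def using clCc by (simp add: open_Compl)
  have OoI: "z \<in> Oo" if "z \<notin> K2" "z \<notin> cball (e N) (r N)" "\<And>m. m \<ge> Suc N \<Longrightarrow> z \<notin> XE m" for z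
    using that unfolding Oo_def Cc_def by auto
  have OoI2: "z \<in> Oo" if out: "\<And>m. m \<ge> N \<Longrightarrow> z \<notin> V m \<and> z \<notin> cball (e m) (r m)" for z
  proof (rule OoI)
    show "z \<notin> K2" using out[of N] K2V by auto
    show "z \<notin> cball (e N) (r N)" using out[of N] by auto
    show "z \<notin> XE m" if "m \<ge> Suc N" for m using out[of m] that XEsub[of m] by auto
  qed
  have disj: "V1 \<inter> Ob = {}" "V1 \<inter> Oo = {}" "Ob \<inter> Oo = {}"
    using V1V Ob_e V_e[of N N] ball_subset_cball[of "e N" "r N"] V1(2) unfolding Oo_def Cc_def by blast+
  define G where "G = (\<lambda>z. if z \<in> V1 then \<alpha> z - f z else if z \<in> Ob then \<phi> (\<psi> z) - f z else 0)"
  define T where "T = (\<lambda>z. f z + G z)"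
  have Told: "T z = f z" "G z = 0" if "z \<in> Oo" for z using that disj by (auto simp: T_def G_def)
  have TV1: "T z = \<alpha> z" if "z \<in> V1" for z using that by (simp add: T_def G_def)
  have TOb: "T z = \<phi> (\<psi> z)" if "z \<in> Ob" for z using that disj by (auto simp: T_def G_def)
  have V1A: "V1 \<subseteq> - A" using V1(2) K2B unfolding B0_def by blast
  have ObA: "Ob \<subseteq> - A" using Ob_e AS[of N] XEe(1)[of N] ball_subset_cball[of "e N" "r N"] by blast
  define Om where "Om = (Oo \<union> V1) \<union> Ob"
  have oOm: "open Om" unfolding Om_def by (intro open_Un oOo V1(1) oOb)
  have Ghol: "G holomorphic_on Om"
    unfolding Om_def
  proof (intro holomorphic_on_Un)
    show "G holomorphic_on Oo" by (rule holomorphic_transform[of "\<lambda>_. 0"]) (auto simp: Told)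
    have "(\<lambda>z. \<alpha> z - f z) holomorphic_on V1"
      using al_hol holomorphic_on_subset[OF fhol V1A] by (intro holomorphic_on_diff)
    then show "G holomorphic_on V1" by (rule holomorphic_transform) (simp add: G_def)
    have "\<phi> holomorphic_on V1" using phi_hol V1V holomorphic_on_subset by blast
    then have "(\<lambda>z. \<phi> (\<psi> z)) holomorphic_on Ob"
      using holomorphic_on_compose_gen[OF psi(1)] psi_V1 by (auto simp: o_def)
    then have "(\<lambda>z. \<phi> (\<psi> z) - f z) holomorphic_on Ob"
      using holomorphic_on_subset[OF fhol ObA] by (intro holomorphic_on_diff)
    then show "G holomorphic_on Ob" by (rule holomorphic_transform) (use disj in \<open>auto simp: G_def\<close>)
  qed (use oOo V1 oOb in auto)
  have "\<exists>Wf. \<forall>n<N. open (Wf n) \<and> X n \<subseteq> Wf n \<and> Wf n \<subseteq> V n \<and> \<theta> holomorphic_on Wf n \<and>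
        (\<forall>z\<in>Wf n. \<theta> z \<notin> A \<and> f (\<theta> z) \<in> ball p \<rho> - {p} \<and> f (f (\<theta> z)) \<in> ball (e n) (r n) - A \<and>
           f (f (f (\<theta> z))) = \<theta> (\<phi> z))"
    using stage_simps(14)[OF s] unfolding f_def by metis
  then obtain Wf where Wf0: "\<forall>n<N. open (Wf n) \<and> X n \<subseteq> Wf n \<and> Wf n \<subseteq> V n \<and> \<theta> holomorphic_on Wf n \<and>
        (\<forall>z\<in>Wf n. \<theta> z \<notin> A \<and> f (\<theta> z) \<in> ball p \<rho> - {p} \<and> f (f (\<theta> z)) \<in> ball (e n) (r n) - A \<and>
           f (f (f (\<theta> z))) = \<theta> (\<phi> z))" by blast
  have Wf: "open (Wf n)" "X n \<subseteq> Wf n" "Wf n \<subseteq> V n" "\<theta> holomorphic_on Wf n" if "n < N" for n using Wf0 that by blast+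
  have Wz: "\<theta> z \<notin> A" "f (\<theta> z) \<in> ball p \<rho> - {p}" "f (f (\<theta> z)) \<in> ball (e n) (r n) - A" "f (f (f (\<theta> z))) = \<theta> (\<phi> z)"
    if "n < N" "z \<in> Wf n" for n z using Wf0 that by blast+
  have bp_Oo: "z \<in> Oo" if "z \<in> cball p \<rho>" for z
    by (rule OoI2) (use that V_p e_p in blast)
  have be_Oo: "z \<in> Oo" if "n < N" "z \<in> ball (e n) (r n)" for z n
  proof (rule OoI2)
    fix m assume "m \<ge> N"
    then have "m \<noteq> n" using that by auto
    then show "z \<notin> V m \<and> z \<notin> cball (e m) (r m)"
      using that(2) V_e[of m n] e_e[of m n] ball_subset_cball[of "e n" "r n"] by blast
  qed
  have th_Oo: "\<theta> z \<in> Oo" if "n < N" "z \<in> V n" for z n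
    by (rule OoI2) (use stage_moved[OF s that] in blast)
  have thVN: "\<theta> z = z" if "z \<in> V m" "m \<ge> N" for z m using stage_id(1)[OF s that(2,1)] .
  \<comment> \<open>The first and third orbit points of all sets up to \<open>X N\<close>. The
    second ones lie in the disc about \<open>p\<close>, which becomes part of \<open>K\<close> as a
    whole.\<close>
  define Y where "Y = (\<Union>n<N. \<theta> ` X n \<union> (f \<circ> (f \<circ> \<theta>)) ` X n) \<union> X N \<union> \<beta> ` X N"
  have ffhol: "(f \<circ> (f \<circ> \<theta>)) holomorphic_on Wf n" if n: "n < N" for n
  proof -
    have "(f \<circ> \<theta>) holomorphic_on Wf n"
      by (rule holomorphic_on_compose_gen[OF Wf(4)[OF n] fhol]) (use Wz(1)[OF n] in blast)
    moreover have "f (\<theta> z) \<in> - A" if "z \<in> Wf n" for z using Wz(2)[OF n that] bpA by blast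
    ultimately show ?thesis
      by (intro holomorphic_on_compose_gen[of "f \<circ> \<theta>", OF _ fhol]) auto
  qed
  have compX: "compact (q ` X n)" if "q holomorphic_on S" "X n \<subseteq> S" for q n S
    using that X_compact compact_continuous_image continuous_on_subset holomorphic_on_imp_continuous_on by metis
  have Ycomp: "compact Y" unfolding Y_def
    using compX[OF Wf(4) Wf(2)] compX[OF ffhol Wf(2)] compX[OF be_hol X_V] X_compact
    by (intro compact_Un compact_UN) auto
  have YO: "Y \<subseteq> Om - (A \<union> P)"
  proof
    fix y assume "y \<in> Y"
    then consider n z where "n < N" "z \<in> X n" "y = \<theta> z" | n z where "n < N" "z \<in> X n" "y = f (f (\<theta> z))"
      | "y \<in> X N" | z where "z \<in> X N" "y = \<beta> z" unfolding Y_def by auto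
    then show "y \<in> Om - (A \<union> P)"
    proof cases
      case 1
      have zV: "z \<in> V n" and zW: "z \<in> Wf n" using X_V 1 Wf(2) by blast+
      have "y \<notin> V N" using stage_moved(1)[OF s 1(1) zV, of N] 1 by simp
      then have "y \<notin> P" using P(1) by blast
      then show ?thesis using th_Oo[OF 1(1) zV] Wz(1)[OF 1(1) zW] 1(3) unfolding Om_def by blast
    next
      case 2
      have zW: "z \<in> Wf n" using 2 Wf(2) by blast
      have y: "y \<in> ball (e n) (r n)" "y \<notin> A" using Wz(3)[OF 2(1) zW] 2(3) by blast+
      then have "y \<notin> V N" using V_e[of N n] ball_subset_cball[of "e n" "r n"] by blast
      then have "y \<notin> P" using P(1) by blast
      then show ?thesis using be_Oo[OF 2(1) y(1)] y unfolding Om_def by blast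
    next
      case 3
      then have "y \<in> V1" using V1 by blast
      moreover have "y \<notin> P" using P(1) 3 by blast
      ultimately show ?thesis using V1A unfolding Om_def by blast
    next
      case 4
      then have "y \<in> Ob" unfolding Ob_def using V1(3) by blast
      moreover have "y \<notin> V N" using calculation Ob_e V_e[of N N] ball_subset_cball[of "e N" "r N"] by blast
      moreover have "y \<notin> P" using P(1) calculation by blast
      ultimately show ?thesis using ObA unfolding Om_def by blast
    qed
  qed
  have oOAP: "open (Om - (A \<union> P))" using oOm finA finP by (intro open_Diff finite_imp_closed) auto
  obtain dM M where M: "dM > 0" "compact M" "M \<subseteq> Om - (A \<union> P)" "\<And>x y. x \<in> Y \<Longrightarrow> dist x y \<le> dM \<Longrightarrow> y \<in> interior M"
    using compact_fatten[OF Ycomp oOAP YO] by blast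
  have YM: "y \<in> interior M" if "y \<in> Y" for y using M(4)[OF that, of y] M(1) by simp
  have iM: "interior M \<subseteq> M" by (rule interior_subset)
  define K where "K = cball 0 (R N) \<union> cball p \<rho> \<union> A \<union> S' \<union> M"
  have Kcomp: "compact K" unfolding K_def using finA S' M(2) by (intro compact_Un) (auto simp: finite_imp_compact)
  have R_Oo: "cball 0 (R N) \<subseteq> Oo" using OoI2 R_V R_e by blast
  have A_Oo: "A \<subseteq> Oo"
  proof
    fix a assume a: "a \<in> A"
    show "a \<in> Oo"
    proof (rule OoI)
      show "a \<notin> K2" using K2B a unfolding B0_def by blast
      show "a \<notin> cball (e N) (r N)" using AS[of N] XEe(1)[of N] a by blast
      show "a \<notin> XE m" if "m \<ge> Suc N" for m using AS[of m] that a by auto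
    qed
  qed
  have S_Oo: "S' \<subseteq> Oo"
  proof
    fix a assume a: "a \<in> S'"
    show "a \<in> Oo"
    proof (rule OoI)
      show "a \<notin> K2" using K2B a unfolding B0_def by blast
      show "a \<notin> cball (e N) (r N)" using SXE[of N] XEe(1)[of N] a by blast
      show "a \<notin> XE m" if "m \<ge> Suc N" for m using SXE[of m] that a by auto
    qed
  qed
  have KOm: "K \<subseteq> Om" unfolding K_def using R_Oo A_Oo S_Oo bp_Oo M(3) unfolding Om_def by blast
  have PK: "P \<inter> K = {}"
  proof -
    have "P \<subseteq> V N" "P \<inter> (A \<union> S') = {}" using P(1) unfolding S'_def by blast+
    then show ?thesis unfolding K_def using R_V[of N N] V_p[of N] M(3) by blast
  qed
  obtain sl where sl: "set sl = S'" using finite_list[OF S'(1)] by blast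
  define blk where "blk = (\<lambda>n. map \<theta> (zl n) @ map (T \<circ> \<theta>) (zl n) @ map (T \<circ> (T \<circ> \<theta>)) (zl n))"
  define Ql where "Ql = sl @ concat (map blk [0..<Suc N])"
  have Tth: "T (\<theta> z) = f (\<theta> z)" "T (T (\<theta> z)) = f (f (\<theta> z))" "T (T (T (\<theta> z))) = \<theta> (\<phi> z)" if n: "n < N" and z: "z \<in> Wf n" for n z
  proof -
    have zV: "z \<in> V n" using Wf(3)[OF n] z by blast
    show 1: "T (\<theta> z) = f (\<theta> z)" using Told(1)[OF th_Oo[OF n zV]] .
    have "f (\<theta> z) \<in> cball p \<rho>" using Wz(2)[OF n z] ball_subset_cball[of p \<rho>] by blast
    then show 2: "T (T (\<theta> z)) = f (f (\<theta> z))" unfolding 1 using Told(1) bp_Oo by blast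
    show "T (T (T (\<theta> z))) = \<theta> (\<phi> z)" unfolding 2
      using Told(1)[OF be_Oo[OF n]] Wz(3,4)[OF n z] by simp
  qed
  have TthN: "T (\<theta> z) = \<alpha> z" "T (T (\<theta> z)) = \<beta> z" "T (T (T (\<theta> z))) = \<theta> (\<phi> z)" if z: "z \<in> V1" for z
  proof -
    have t: "\<theta> z = z" using thVN[of z N] z V1V by auto
    show 1: "T (\<theta> z) = \<alpha> z" unfolding t using TV1[OF z] .
    have "\<alpha> z \<in> cball p \<rho>" using al(3) z V1V ball_subset_cball[of p \<rho>] by blast
    then show 2: "T (T (\<theta> z)) = \<beta> z" unfolding 1 \<beta>_def using Told(1) bp_Oo by simp
    have "\<beta> z \<in> Ob" using z unfolding Ob_def by blast
    moreover have "\<theta> (\<phi> z) = \<phi> z" using thVN[of "\<phi> z" "Suc N"] K2phi[of z] V1(2) z by auto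
    ultimately show "T (T (T (\<theta> z))) = \<theta> (\<phi> z)" unfolding 2 using TOb psi(2)[OF z] by simp
  qed
  have orb: "\<theta> z \<in> interior M" "T (\<theta> z) \<in> ball p \<rho> - {p}" "T (T (\<theta> z)) \<in> interior M \<inter> ball (e n) (r n)"
    if n: "n \<le> N" and z: "z \<in> X n" for n z
  proof -
    show "\<theta> z \<in> interior M" "T (\<theta> z) \<in> ball p \<rho> - {p}" "T (T (\<theta> z)) \<in> interior M \<inter> ball (e n) (r n)"
    proof (atomize (full), cases "n = N")
      case True
      have zV: "z \<in> V1" using V1(3) z True by blast
      have t: "\<theta> z = z" using thVN[of z N] zV V1V by auto
      have "z \<in> Y" "\<beta> z \<in> Y" using z True unfolding Y_def by blast+
      moreover have "\<alpha> z \<in> ball p \<rho> - {p}" "\<beta> z \<in> ball (e n) (r n)" using al(3) be_im zV V1V True by blast+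
      ultimately show "\<theta> z \<in> interior M \<and> T (\<theta> z) \<in> ball p \<rho> - {p} \<and> T (T (\<theta> z)) \<in> interior M \<inter> ball (e n) (r n)"
        unfolding TthN(2)[OF zV] unfolding TthN(1)[OF zV] using YM t by auto
    next
      case False
      then have nN: "n < N" using n by simp
      have zW: "z \<in> Wf n" using Wf(2)[OF nN] z by blast
      have "\<theta> z \<in> Y" "f (f (\<theta> z)) \<in> Y" using z nN unfolding Y_def by force+
      then show "\<theta> z \<in> interior M \<and> T (\<theta> z) \<in> ball p \<rho> - {p} \<and> T (T (\<theta> z)) \<in> interior M \<inter> ball (e n) (r n)"
        unfolding Tth(2)[OF nN zW] unfolding Tth(1)[OF nN zW] using YM Wz(2,3)[OF nN zW] by blast
    qed
  qed
  have QlK: "set Ql \<subseteq> K"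
  proof
    fix y assume "y \<in> set Ql"
    then have "y \<in> S' \<or> (\<exists>n\<in>set [0..<Suc N]. y \<in> set (blk n))"
      unfolding Ql_def using sl by (simp del: upt_Suc)
    then consider "y \<in> S'" | n where "n \<le> N" "y \<in> set (blk n)" by (auto simp: less_Suc_eq_le simp del: upt_Suc)
    then consider "y \<in> S'" | n z where "n \<le> N" "z \<in> X n" "y \<in> {\<theta> z, T (\<theta> z), T (T (\<theta> z))}"
    proof cases
      case 2
      then obtain z where "z \<in> set (zl n)" "y \<in> {\<theta> z, T (\<theta> z), T (T (\<theta> z))}" by (auto simp: blk_def)
      then show ?thesis using that(2)[OF 2(1)] zl by blast
    qed (use that in blast)
    then show "y \<in> K"
    proof cases
      case 2
      show ?thesis using orb[OF 2(1,2)] 2(3) iM ball_subset_cball[of p \<rho>] unfolding K_def by blast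
    qed (simp add: K_def)
  qed
  have "\<exists>a b. Ql = a @ blk n @ b" if "n \<le> N" for n
  proof -
    have "n \<in> set [0..<Suc N]" using that by (auto simp del: upt_Suc)
    then obtain us vs where "[0..<Suc N] = us @ n # vs" by (meson split_list)
    then have "Ql = (sl @ concat (map blk us)) @ blk n @ concat (map blk vs)" by (simp add: Ql_def del: upt_Suc)
    then show ?thesis by blast
  qed
  then have Qlsub: "\<exists>a b. Ql = a @ map \<theta> (zl n) @ b" "\<exists>a b. Ql = a @ map (T \<circ> \<theta>) (zl n) @ b" "\<exists>a b. Ql = a @ map (T \<circ> (T \<circ> \<theta>)) (zl n) @ b"
    if "n \<le> N" for n
    using that unfolding blk_def by (metis append.assoc)+
  define Wg where "Wg = (\<lambda>n. if n < N then Wf n else if n = N then V1 else V n)"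
  have Wg: "open (Wg n) \<and> X n \<subseteq> Wg n \<and> Wg n \<subseteq> V n \<and> \<theta> holomorphic_on Wg n" for n
  proof -
    have idh: "\<theta> holomorphic_on S" if "S \<subseteq> V m" "m \<ge> N" for S m
      by (rule holomorphic_transform[of "\<lambda>z. z"]) (use thVN that in auto)
    consider "n < N" | "n = N" | "n > N" by linarith
    then show ?thesis
    proof cases
      case 1 then show ?thesis using Wf[OF 1] by (simp add: Wg_def)
    next
      case 2 then show ?thesis using V1 V1V idh[OF V1V] by (simp add: Wg_def)
    next
      case 3 then show ?thesis using V_open X_V idh[of "V n" n] by (simp add: Wg_def)
    qed
  qed
  have eqT: "T (T (T (\<theta> z))) = \<theta> (\<phi> z)" if "n \<le> N" "z \<in> Wg n" for n z
    using that Tth(3)[of n z] TthN(3)[of z] unfolding Wg_def by (cases "n < N") auto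
  have MA: "interior M \<subseteq> - A" "interior M \<subseteq> Om" using M(3) iM by blast+
  have bpO: "ball p \<rho> - {p} \<subseteq> Om" using bp_Oo ball_subset_cball[of p \<rho>] unfolding Om_def by blast
  have Thol: "T holomorphic_on S" if "S \<subseteq> - A" "S \<subseteq> Om" for S
    unfolding T_def using holomorphic_on_subset[OF fhol that(1)] holomorphic_on_subset[OF Ghol that(2)] by (intro holomorphic_on_add)
  have TT: "T holomorphic_on interior M \<and> T holomorphic_on ball p \<rho> - {p} \<and> T holomorphic_on interior M \<inter> ball (e n) (r n)" for n
    using Thol[OF MA] Thol[OF bpA bpO] holomorphic_on_subset[OF Thol[OF MA]] by blast
  have Op: "open (interior M) \<and> open (ball p \<rho> - {p}) \<and> open (interior M \<inter> ball (e n) (r n))" for n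
    by (auto intro: open_Int open_Diff)
  have orbc: "\<theta> z \<in> interior M \<and> T (\<theta> z) \<in> ball p \<rho> - {p} \<and> T (T (\<theta> z)) \<in> interior M \<inter> ball (e n) (r n)"
    if "n \<le> N" "z \<in> X n" for n z using orb[OF that] by blast
  \<comment> \<open>The constant \<open>2 * c\<close> from the Lipschitz estimate may be at most
    \<open>1/8 * (1/2)^N\<close>, the increment of the Lipschitz bound from stage \<open>N\<close>
    to the next; this gives the exponent \<open>N + 4\<close>. The other entries serve the
    displacement bounds \<open>\<epsilon> n\<close>.\<close>
  define c where "c = Min (insert ((1/2) ^ (N + 4)) ((\<lambda>n. (1/2) ^ Suc N * \<epsilon> n) ` {..N}))"
  have c0: "c > 0" unfolding c_def using eps by (subst Min_gr_iff) auto
  have c1: "c \<le> (1/2) ^ (N + 4)" unfolding c_def by (intro Min_le) auto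
  have c2: "c \<le> (1/2) ^ Suc N * \<epsilon> n" if "n \<le> N" for n unfolding c_def using that by (intro Min_le) auto
  have lip2: "cmod (\<theta> a - \<theta> b) \<le> 2 * cmod (a - b)" for a b
  proof -
    have "cmod ((\<theta> a - a) - (\<theta> b - b)) \<le> 1/4 * (1 - (1/2) ^ N) * cmod (a - b)" by (rule stage_simps(11)[OF s])
    also have "\<dots> \<le> 1 * cmod (a - b)" by (intro mult_right_mono) (auto simp: field_simps)
    finally show ?thesis using norm_triangle_ineq[of "(\<theta> a - a) - (\<theta> b - b)" "a - b"] by (simp add: algebra_simps)
  qed
  have "\<exists>\<delta>>0. \<forall>f. (\<forall>n\<le>N. f holomorphic_on interior M \<and> f holomorphic_on ball p \<rho> - {p} \<and> f holomorphic_on interior M \<inter> ball (e n) (r n) \<and>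
         (\<forall>y\<in>interior M \<union> (ball p \<rho> - {p}) \<union> (interior M \<inter> ball (e n) (r n)). cmod (f y - T y) \<le> \<delta> * wt Ql y)) \<longrightarrow>
     (\<exists>u. C_infinity u \<and> C_k_le (Suc N) c u \<and> (\<forall>z. z \<notin> (\<Union>n\<le>N. V n) \<longrightarrow> u z = 0) \<and> (\<forall>n. \<forall>a\<in>set (ql n). u a = 0) \<and>
        (\<forall>n\<le>N. \<exists>W'. open W' \<and> X n \<subseteq> W' \<and> W' \<subseteq> V n \<and> (\<lambda>z. \<theta> z + u z) holomorphic_on W' \<and>
           (\<forall>z\<in>W'. \<theta> z + u z \<in> interior M \<and> f (\<theta> z + u z) \<in> ball p \<rho> - {p} \<and> f (f (\<theta> z + u z)) \<in> interior M \<inter> ball (e n) (r n) \<and>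
              f (f (f (\<theta> z + u z))) = \<theta> (\<phi> z) + u (\<phi> z))))"
    by (rule smooth_correction[where W=Wg and N=N and k="Suc N" and \<theta>=\<theta> and Ql=Ql and c=c and T=T and ?O1.0="\<lambda>n. interior M" and ?O2.0="\<lambda>n. ball p \<rho> - {p}" and ?O3.0="\<lambda>n. interior M \<inter> ball (e n) (r n)"];
       (rule inj lip2 Wg Op TT orbc eqT Qlsub c0; assumption?))
  then obtain \<delta> where d: "\<delta> > 0" and corr: "\<And>f. (\<forall>n\<le>N. f holomorphic_on interior M \<and> f holomorphic_on ball p \<rho> - {p} \<and> f holomorphic_on interior M \<inter> ball (e n) (r n) \<and>
         (\<forall>y\<in>interior M \<union> (ball p \<rho> - {p}) \<union> (interior M \<inter> ball (e n) (r n)). cmod (f y - T y) \<le> \<delta> * wt Ql y)) \<Longrightarrow>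
     (\<exists>u. C_infinity u \<and> C_k_le (Suc N) c u \<and> (\<forall>z. z \<notin> (\<Union>n\<le>N. V n) \<longrightarrow> u z = 0) \<and> (\<forall>n. \<forall>a\<in>set (ql n). u a = 0) \<and>
        (\<forall>n\<le>N. \<exists>W'. open W' \<and> X n \<subseteq> W' \<and> W' \<subseteq> V n \<and> (\<lambda>z. \<theta> z + u z) holomorphic_on W' \<and>
           (\<forall>z\<in>W'. \<theta> z + u z \<in> interior M \<and> f (\<theta> z + u z) \<in> ball p \<rho> - {p} \<and> f (f (\<theta> z + u z)) \<in> interior M \<inter> ball (e n) (r n) \<and>
              f (f (f (\<theta> z + u z))) = \<theta> (\<phi> z) + u (\<phi> z))))"
    by blast
  obtain MQ where MQ: "MQ \<ge> 0" "\<And>z. z \<in> K \<Longrightarrow> wt Ql z \<le> MQ" using wt_bounded[OF compact_imp_bounded[OF Kcomp]] by metis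
  \<comment> \<open>The first entry is the closeness demanded by the correction; the second makes
    \<open>g\<close> itself small at the points of \<open>K\<close> where \<open>G\<close> is 0, as
    the convergence of the limit requires.\<close>
  define \<tau> where "\<tau> = min \<delta> ((1/2) ^ Suc N / (MQ + 1))"
  have tau: "\<tau> > 0" "\<tau> \<le> \<delta>" "\<tau> * MQ \<le> (1/2) ^ Suc N"
  proof -
    show "\<tau> > 0" "\<tau> \<le> \<delta>" using d MQ by (auto simp: \<tau>_def)
    have "\<tau> \<le> (1/2) ^ Suc N / (MQ + 1)" by (simp add: \<tau>_def)
    moreover have "MQ + 1 > 0" using MQ by simp
    ultimately have "\<tau> * (MQ + 1) \<le> (1/2) ^ Suc N" using pos_le_divide_eq by blast
    then show "\<tau> * MQ \<le> (1/2) ^ Suc N" using \<open>\<tau> > 0\<close> unfolding distrib_left by linarith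
  qed
  \<comment> \<open>The site \<open>P\<close> lies off \<open>K\<close>, so a pole can be forced
    there without spoiling the approximation.\<close>
  obtain g D where g: "fin_mero g D" "D \<subseteq> P \<union> (Om - K)" "\<And>a. a \<in> P \<Longrightarrow> is_pole g a" "\<And>z. z \<in> K \<Longrightarrow> cmod (G z - g z) \<le> \<tau> * wt Ql z"
  proof (cases "P = {}")
    case True
    obtain g D where "fin_mero g D" "D \<subseteq> Om - K" "\<forall>z\<in>K. cmod (G z - g z) \<le> \<tau> * wt Ql z"
      using runge_interpolation[OF Kcomp oOm KOm Ghol QlK tau(1)] by blast
    then show ?thesis using True by (intro that[of g D]) auto
  next
    case False
    then obtain a where a: "P = {a}" using P(2) by blast
    have "a \<notin> K" using PK a by blast
    from runge_interpolation_pole[OF Kcomp oOm KOm Ghol QlK tau(1) this] obtain g D where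
      "fin_mero g D" "D \<subseteq> insert a (Om - K)" "is_pole g a" "\<forall>z\<in>K. cmod (G z - g z) \<le> \<tau> * wt Ql z"
      by blast
    then show ?thesis using a by (intro that[of g D]) auto
  qed
  have DK: "D \<inter> K = {}" using g(2) PK by blast
  have finD: "finite D" and ghol: "g holomorphic_on - D" and gmero: "g meromorphic_on UNIV" using g(1) unfolding fin_mero_def by auto
  \<comment> \<open>New poles lie in \<open>V N\<close>, in the disc about \<open>e N\<close> or in
    \<open>Oo\<close>, and all three avoid what is reserved for later steps.\<close>
  have DXE: "D \<inter> XE m = {}" if m: "m \<ge> Suc N" for m
  proof -
    have "V m \<inter> V N = {}" using V_disj[of m N] m by simp
    then have 1: "V N \<inter> XE m = {}" unfolding XE_def using X_V[of m] V_e[of N m] by blast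
    have "XE m \<inter> cball (e N) (r N) = {}" using XE_disjoint_e[of m N] m by simp
    then have 2: "ball (e N) (r N) \<inter> XE m = {}" using ball_subset_cball[of "e N" "r N"] by blast
    have 3: "Oo \<inter> XE m = {}" unfolding Oo_def Cc_def using m by auto
    have "P \<subseteq> V N" using P(1) by blast
    moreover have "Om \<subseteq> V N \<union> ball (e N) (r N) \<union> Oo" using V1V Ob_e unfolding Om_def by blast
    ultimately have "D \<subseteq> V N \<union> ball (e N) (r N) \<union> Oo" using g(2) by blast
    then show ?thesis using 1 2 3 by blast
  qed
  define h' where "h' = (\<lambda>z. h z + g z)"
  define f' where "f' = F h'"
  have f'eq: "f' z = f z + g z" for z by (simp add: f'_def f_def F_def h'_def)
  have gsmall: "cmod (g z) \<le> (1/2) ^ Suc N" if "z \<in> K" "G z = 0" for z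
  proof -
    have "cmod (g z) \<le> \<tau> * wt Ql z" using g(4)[OF that(1)] that(2) by simp
    also have "\<dots> \<le> \<tau> * MQ" using MQ(2)[OF that(1)] tau(1) by (intro mult_left_mono) auto
    finally show ?thesis using tau(3) by simp
  qed
  have f'hol: "f' holomorphic_on S" if "S \<subseteq> - A" "S \<subseteq> K" for S
  proof -
    have "S \<subseteq> - D" using that DK by blast
    then have "(\<lambda>z. f z + g z) holomorphic_on S"
      using holomorphic_on_subset[OF fhol that(1)] holomorphic_on_subset[OF ghol] by (intro holomorphic_on_add) auto
    then show ?thesis using f'eq by presburger
  qed
  have iMK: "interior M \<subseteq> K" using iM unfolding K_def by blast
  have bpK: "ball p \<rho> - {p} \<subseteq> K" using ball_subset_cball[of p \<rho>] unfolding K_def by blast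
  have close: "cmod (f' y - T y) \<le> \<delta> * wt Ql y" if "y \<in> K" for y
  proof -
    have "cmod (f' y - T y) = cmod (G y - g y)" unfolding f'eq T_def by (simp add: norm_minus_commute)
    also have "\<dots> \<le> \<tau> * wt Ql y" using g(4)[OF that] .
    also have "\<dots> \<le> \<delta> * wt Ql y" using tau(2) by (intro mult_right_mono) auto
    finally show ?thesis .
  qed
  have "\<forall>n\<le>N. f' holomorphic_on interior M \<and> f' holomorphic_on ball p \<rho> - {p} \<and> f' holomorphic_on interior M \<inter> ball (e n) (r n) \<and>
         (\<forall>y\<in>interior M \<union> (ball p \<rho> - {p}) \<union> (interior M \<inter> ball (e n) (r n)). cmod (f' y - T y) \<le> \<delta> * wt Ql y)"
  proof (intro allI impI conjI ballI)
    show "f' holomorphic_on interior M" using f'hol[OF MA(1) iMK] .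
    then show "f' holomorphic_on interior M \<inter> ball (e n) (r n)" for n using holomorphic_on_subset by blast
    show "f' holomorphic_on ball p \<rho> - {p}" using f'hol[OF bpA bpK] .
    show "cmod (f' y - T y) \<le> \<delta> * wt Ql y" if "y \<in> interior M \<union> (ball p \<rho> - {p}) \<union> (interior M \<inter> ball (e n) (r n))" for n y
    proof (rule close)
      show "y \<in> K" using that iMK bpK by blast
    qed
  qed
  from corr[OF this] obtain u where u: "C_infinity u" "C_k_le (Suc N) c u" and usupp: "\<forall>z. z \<notin> (\<Union>n\<le>N. V n) \<longrightarrow> u z = 0"
    and uql: "\<forall>n. \<forall>a\<in>set (ql n). u a = 0"
    and uW: "\<forall>n\<le>N. \<exists>W'. open W' \<and> X n \<subseteq> W' \<and> W' \<subseteq> V n \<and> (\<lambda>z. \<theta> z + u z) holomorphic_on W' \<and>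
           (\<forall>z\<in>W'. \<theta> z + u z \<in> interior M \<and> f' (\<theta> z + u z) \<in> ball p \<rho> - {p} \<and> f' (f' (\<theta> z + u z)) \<in> interior M \<inter> ball (e n) (r n) \<and>
              f' (f' (f' (\<theta> z + u z))) = \<theta> (\<phi> z) + u (\<phi> z))"
    by blast
  define \<theta>' where "\<theta>' = (\<lambda>z. \<theta> z + u z)"
  have iMA: "interior M \<inter> (A \<union> D) = {}" using MA(1) iMK DK by blast
  have st: "stage (Suc N) h' (A \<union> D) S' \<theta>'"
    unfolding stage_def
  proof (intro conjI)
    show "finite (A \<union> D)" "finite S'" using finA finD S' by auto
    have "D \<inter> cball p \<rho> = {}" using DK unfolding K_def by blast
    then show "(A \<union> D) \<inter> cball p \<rho> = {p}" using Ap by blast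
    show "S' \<inter> (A \<union> D) = {}" using S'(2) DK unfolding K_def by blast
    show "\<forall>m\<ge>Suc N. (A \<union> D \<union> S') \<inter> XE m = {}"
    proof (intro allI impI)
      fix m assume "m \<ge> Suc N"
      then show "(A \<union> D \<union> S') \<inter> XE m = {}" using AS[of m] DXE[of m] SXE[of m] by auto
    qed
    show "h' holomorphic_on - (A \<union> D - {p})"
    proof -
      have "p \<notin> D" using pA DK unfolding K_def by blast
      then have "- (A \<union> D - {p}) \<subseteq> - (A - {p})" "- (A \<union> D - {p}) \<subseteq> - D" by auto
      then show ?thesis unfolding h'_def
        using holomorphic_on_subset[OF stage_simps(7)[OF s]] holomorphic_on_subset[OF ghol] by (intro holomorphic_on_add) auto
    qed
    show "h' meromorphic_on UNIV" unfolding h'_def using stage_simps(8)[OF s] gmero by (intro meromorphic_intros)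
    show "\<forall>z\<in>cball p \<rho>. cmod (h' z) \<le> 1 - (1 / 2) ^ Suc N"
    proof
      fix z assume z: "z \<in> cball p \<rho>"
      have "z \<in> K" using z unfolding K_def by blast
      then have "cmod (g z) \<le> (1/2) ^ Suc N" using gsmall Told(2)[OF bp_Oo[OF z]] by blast
      moreover have "cmod (h z) \<le> 1 - (1/2) ^ N" using stage_simps(9)[OF s z] .
      ultimately show "cmod (h' z) \<le> 1 - (1 / 2) ^ Suc N"
        using norm_triangle_ineq[of "h z" "g z"] unfolding h'_def by simp
    qed
    show "C_infinity \<theta>'" using u(1) stage_simps(10)[OF s] unfolding \<theta>'_def C_infinity_def by (blast intro: C_k_add)
    show "\<forall>z w. cmod (\<theta>' z - z - (\<theta>' w - w)) \<le> 1 / 4 * (1 - (1 / 2) ^ Suc N) * cmod (z - w)"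
    proof (intro allI)
      fix z w
      have "cmod (\<theta>' z - z - (\<theta>' w - w)) \<le> cmod ((\<theta> z - z) - (\<theta> w - w)) + cmod (u z - u w)"
        unfolding \<theta>'_def using norm_triangle_ineq[of "(\<theta> z - z) - (\<theta> w - w)" "u z - u w"] by (simp add: algebra_simps)
      also have "\<dots> \<le> 1/4 * (1 - (1/2) ^ N) * cmod (z - w) + 2 * c * cmod (z - w)"
        by (intro add_mono stage_simps(11)[OF s] C_k_le_lipschitz[OF u(2)])
      also have "\<dots> \<le> 1/4 * (1 - (1/2) ^ N) * cmod (z - w) + 2 * (1/2) ^ (N + 4) * cmod (z - w)"
        using c1 by (intro add_left_mono mult_right_mono) auto
      also have "\<dots> = 1 / 4 * (1 - (1 / 2) ^ Suc N) * cmod (z - w)"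
      proof -
        have "(1/2::real) ^ (N + 4) = (1/2) ^ N / 16" by (simp add: power_add power_divide)
        then show ?thesis by (simp add: algebra_simps)
      qed
      finally show "cmod (\<theta>' z - z - (\<theta>' w - w)) \<le> 1 / 4 * (1 - (1 / 2) ^ Suc N) * cmod (z - w)" .
    qed
    show "\<forall>z. z \<notin> (\<Union>n<Suc N. V n) \<longrightarrow> \<theta>' z = z"
    proof (intro allI impI)
      fix z assume z: "z \<notin> (\<Union>n<Suc N. V n)"
      then have "z \<notin> (\<Union>n<N. V n)" "z \<notin> (\<Union>n\<le>N. V n)" by (auto simp: less_Suc_eq_le)
      then show "\<theta>' z = z" using stage_simps(12)[OF s] usupp unfolding \<theta>'_def by simp
    qed
    show "\<forall>n. \<forall>c\<in>set (ql n). \<theta>' c = c" using stage_simps(13)[OF s] uql unfolding \<theta>'_def by simp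
    show "\<forall>n<Suc N. \<exists>W. open W \<and> X n \<subseteq> W \<and> W \<subseteq> V n \<and> \<theta>' holomorphic_on W \<and>
        (\<forall>z\<in>W. \<theta>' z \<notin> A \<union> D \<and> F h' (\<theta>' z) \<in> ball p \<rho> - {p} \<and> F h' (F h' (\<theta>' z)) \<in> ball (e n) (r n) - (A \<union> D) \<and>
           F h' (F h' (F h' (\<theta>' z))) = \<theta>' (\<phi> z))"
    proof (intro allI impI)
      fix n assume "n < Suc N"
      then have nN: "n \<le> N" by simp
      obtain W' where W': "open W'" "X n \<subseteq> W'" "W' \<subseteq> V n" "(\<lambda>z. \<theta> z + u z) holomorphic_on W'"
        "\<forall>z\<in>W'. \<theta> z + u z \<in> interior M \<and> f' (\<theta> z + u z) \<in> ball p \<rho> - {p} \<and> f' (f' (\<theta> z + u z)) \<in> interior M \<inter> ball (e n) (r n) \<and>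
              f' (f' (f' (\<theta> z + u z))) = \<theta> (\<phi> z) + u (\<phi> z)"
        using mp[OF spec[OF uW] nN] by (elim exE conjE) (rule that; assumption)
      show "\<exists>W. open W \<and> X n \<subseteq> W \<and> W \<subseteq> V n \<and> \<theta>' holomorphic_on W \<and>
        (\<forall>z\<in>W. \<theta>' z \<notin> A \<union> D \<and> F h' (\<theta>' z) \<in> ball p \<rho> - {p} \<and> F h' (F h' (\<theta>' z)) \<in> ball (e n) (r n) - (A \<union> D) \<and>
           F h' (F h' (F h' (\<theta>' z))) = \<theta>' (\<phi> z))"
      proof (intro exI[of _ W'] conjI ballI W'(1-3))
        show "\<theta>' holomorphic_on W'" using W'(4) unfolding \<theta>'_def .
        fix z assume z: "z \<in> W'"
        have w: "\<theta>' z \<in> interior M" "f' (\<theta>' z) \<in> ball p \<rho> - {p}" "f' (f' (\<theta>' z)) \<in> interior M \<inter> ball (e n) (r n)"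
          "f' (f' (f' (\<theta>' z))) = \<theta>' (\<phi> z)"
          using bspec[OF W'(5) z] unfolding \<theta>'_def by blast+
        show "\<theta>' z \<notin> A \<union> D" using w(1) iMA by blast
        show "F h' (\<theta>' z) \<in> ball p \<rho> - {p}" using w(2) unfolding f'_def .
        show "F h' (F h' (\<theta>' z)) \<in> ball (e n) (r n) - (A \<union> D)" using w(3) iMA unfolding f'_def by blast
        show "F h' (F h' (F h' (\<theta>' z))) = \<theta>' (\<phi> z)" using w(4) unfolding f'_def .
      qed
    qed
  qed
  have gS0: "g z = 0" if "z \<in> S'" for z
  proof -
    have "z \<in> K" "G z = 0" using that Told(2) S_Oo unfolding K_def by blast+
    moreover have "wt Ql z = 0" unfolding wt_eq_0_iff Ql_def using sl that by simp
    ultimately show ?thesis using g(4)[of z] by simp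
  qed
  have "step_rel N x h A S \<theta> g D S' \<theta>'"
    unfolding step_rel_def h'_def[symmetric] f'_def[symmetric]
  proof (intro conjI impI)
    show "fin_mero g D" by fact
    show "D \<inter> (cball 0 (R N) \<union> cball p \<rho> \<union> A \<union> S') = {}" using DK unfolding K_def by blast
    show "\<forall>z\<in>cball 0 (R N). cmod (g z) \<le> (1 / 2) ^ Suc N"
      using gsmall Told(2) R_Oo unfolding K_def by blast
    show "\<forall>z\<in>S'. g z = 0" using gS0 by blast
    show "S \<subseteq> S'" by fact
    have uu: "(\<lambda>z. \<theta>' z - \<theta> z) = u" by (auto simp: \<theta>'_def)
    show "C_infinity (\<lambda>z. \<theta>' z - \<theta> z)" unfolding uu by fact
    have "c \<le> (1/2) ^ N" using c1 order_trans[OF _ power_decreasing[of N "N + 4" "1/2::real"]] by auto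
    then show "C_k_le N ((1 / 2) ^ N) (\<lambda>z. \<theta>' z - \<theta> z)" unfolding uu
      using C_k_le_mono[OF C_k_le_Suc_imp[OF u(2)]] by blast
    show "\<forall>n. \<forall>z\<in>X n. cmod (\<theta>' z - \<theta> z) \<le> (1 / 2) ^ Suc N * \<epsilon> n"
    proof (intro allI ballI)
      fix n z assume z: "z \<in> X n"
      show "cmod (\<theta>' z - \<theta> z) \<le> (1 / 2) ^ Suc N * \<epsilon> n"
      proof (cases "n \<le> N")
        case True
        have "cmod (u z) \<le> c" using C_k_le_bound[OF u(2)] .
        then show ?thesis using c2[OF True] by (simp add: \<theta>'_def)
      next
        case False
        have "z \<notin> V m" if "m \<le> N" for m using V_disj[of m n] that False z X_V[of n] by auto
        then have "u z = 0" using usupp by blast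
        then show ?thesis using eps[of n] by (simp add: \<theta>'_def)
      qed
    qed
    assume "\<exists>n\<le>N. x \<in> frontier (X n)"
    then obtain t k where t: "cmod (t - \<theta> x) < 1 / real (Suc N)" and k: "\<forall>i<k. (f ^^ i) t \<in> S0" "(f ^^ k) t \<in> P"
      using J by blast
    have it: "(f' ^^ i) t = (f ^^ i) t" if "i \<le> k" for i
      using that
    proof (induction i)
      case (Suc i)
      then have "(f ^^ i) t \<in> S'" using k(1) S'(4) by (meson Suc_le_lessD subsetD)
      then have "g ((f ^^ i) t) = 0" using gS0 by blast
      then show ?case using Suc by (simp add: f'eq)
    qed simp
    show "\<exists>t k. cmod (t - \<theta> x) < 1 / real (Suc N) \<and> (\<forall>i<k. (f' ^^ i) t \<in> S') \<and> is_pole g ((f' ^^ k) t)"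
    proof (intro exI conjI allI impI)
      show "cmod (t - \<theta> x) < 1 / real (Suc N)" by fact
      show "(f' ^^ i) t \<in> S'" if "i < k" for i using it[of i] k(1) S'(4) that by auto
      show "is_pole g ((f' ^^ k) t)" using it[of k] k(2) g(3) by simp
    qed
  qed
  with st show ?thesis unfolding h'_def by blast
qed

end

section \<open>The limit function\<close>

text \<open>The sequences arising from repeated use of \<open>stage_step\<close> are taken as given;
  \<open>xx N\<close> is the point offered to step \<open>N\<close> as a boundary point to be
  approached by orbits that hit poles.\<close>

locale bungee_limit = bungee_setup +
  fixes hs gs ths :: "nat \<Rightarrow> complex \<Rightarrow> complex" and As Ds Ss :: "nat \<Rightarrow> complex set" and xx :: "nat \<Rightarrow> complex"
  assumes hs_0: "hs 0 = (\<lambda>z. 0)" and As_0: "As 0 = {p}" and ths_0: "ths 0 = (\<lambda>z. z)"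
    and hs_Suc: "hs (Suc N) = (\<lambda>z. hs N z + gs N z)" and As_Suc: "As (Suc N) = As N \<union> Ds N"
    and st: "stage N (hs N) (As N) (Ss N) (ths N)"
    and rel: "step_rel N (xx N) (hs N) (As N) (Ss N) (ths N) (gs N) (Ds N) (Ss (Suc N)) (ths (Suc N))"
begin

definition us :: "nat \<Rightarrow> complex \<Rightarrow> complex" where "us N = (\<lambda>z. ths (Suc N) z - ths N z)"
definition \<theta> :: "complex \<Rightarrow> complex" where "\<theta> = (\<lambda>z. z + (\<Sum>N. us N z))"
definition F0 :: "complex \<Rightarrow> complex" where "F0 = F (\<lambda>z. \<Sum>N. gs N z)"
text \<open>\<open>F0\<close> is a pointwise sum with arbitrary values at its poles;
  \<open>remove_sings\<close> brings it into the nicely meromorphic normal form.\<close>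

definition f :: "complex \<Rightarrow> complex" where "f = remove_sings F0"

section \<open>The limit conjugacy\<close>

lemma us_props: "C_infinity (us N)" "C_k_le N ((1/2) ^ N) (us N)" "z \<in> X n \<Longrightarrow> cmod (us N z) \<le> (1/2) ^ Suc N * \<epsilon> n"
  using rel[of N] unfolding step_rel_def us_def by blast+

lemma us_eventually: "\<forall>\<^sub>F n in sequentially. C_k_le k ((1/2) ^ n) (us n)"
  unfolding eventually_sequentially using us_props(2) C_k_le_mono_k by blast

lemmas us_series = series_C_k[of us, OF us_eventually us_props(1)]

lemma ths_sum: "ths N z = z + (\<Sum>n<N. us n z)"
  by (induction N) (auto simp: ths_0 us_def)

lemma ths_lim: "(\<lambda>N. ths N z) \<longlonglongrightarrow> \<theta> z"
proof -
  have "(\<lambda>N. z + (\<Sum>n<N. us n z)) \<longlonglongrightarrow> z + (\<Sum>N. us N z)"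
    using us_series by (intro tendsto_intros summable_LIMSEQ) blast
  moreover have "ths N z = z + (\<Sum>n<N. us n z)" for N by (rule ths_sum)
  moreover have "\<theta> z = z + (\<Sum>N. us N z)" by (simp only: \<theta>_def)
  ultimately show ?thesis by presburger
qed

lemma theta_C_infinity: "C_infinity \<theta>"
  unfolding C_infinity_def \<theta>_def using us_series by (intro allI C_k_add C_k_id) blast

lemma theta_lipschitz: "cmod ((\<theta> z - z) - (\<theta> w - w)) \<le> 1/4 * cmod (z - w)"
proof (rule LIMSEQ_le_const2)
  show "(\<lambda>N. cmod ((ths N z - z) - (ths N w - w))) \<longlonglongrightarrow> cmod ((\<theta> z - z) - (\<theta> w - w))"
    by (intro tendsto_intros ths_lim)
  show "\<exists>M. \<forall>N\<ge>M. cmod ((ths N z - z) - (ths N w - w)) \<le> 1/4 * cmod (z - w)"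
  proof (intro exI allI impI)
    fix N :: nat
    have "cmod ((ths N z - z) - (ths N w - w)) \<le> 1/4 * (1 - (1/2) ^ N) * cmod (z - w)"
      by (rule stage_simps(11)[OF st])
    also have "\<dots> \<le> 1/4 * cmod (z - w)" by (intro mult_right_mono) auto
    finally show "cmod ((ths N z - z) - (ths N w - w)) \<le> 1/4 * cmod (z - w)" .
  qed
qed

lemma theta_diffeo: "smooth_diffeomorphism \<theta>"
  by (rule near_identity_diffeomorphism[OF theta_C_infinity theta_lipschitz])

lemma theta_inj: "inj \<theta>" and theta_bij: "bij \<theta>"
  using theta_diffeo unfolding smooth_diffeomorphism_def bij_def by auto

lemma theta_cont: "continuous_on S \<theta>"
  using theta_C_infinity C_k.simps(1) continuous_on_subset unfolding C_infinity_def by blast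

lemma theta_id: "z \<in> cball (e n) (r n) \<Longrightarrow> \<theta> z = z" "z \<in> cball p \<rho> \<Longrightarrow> \<theta> z = z"
  using ths_lim[of z] stage_id(2,3)[OF st] LIMSEQ_unique[OF _ tendsto_const] by simp_all

lemma theta_ql: "c \<in> set (ql n) \<Longrightarrow> \<theta> c = c"
  using ths_lim[of c] stage_simps(13)[OF st] LIMSEQ_unique[OF _ tendsto_const] by simp

lemma theta_close: assumes "z \<in> X n" shows "cmod (\<theta> z - z) \<le> \<epsilon> n"
proof (rule LIMSEQ_le_const2)
  show "(\<lambda>N. cmod (ths N z - z)) \<longlonglongrightarrow> cmod (\<theta> z - z)" by (intro tendsto_intros ths_lim)
  have "cmod (ths N z - z) \<le> (1 - (1/2) ^ N) * \<epsilon> n" for N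
  proof (induction N)
    case (Suc N)
    have "cmod (ths (Suc N) z - z) \<le> cmod (ths N z - z) + cmod (us N z)"
      unfolding us_def using norm_triangle_ineq[of "ths N z - z" "ths (Suc N) z - ths N z"] by simp
    also have "\<dots> \<le> (1 - (1/2) ^ N) * \<epsilon> n + (1/2) ^ Suc N * \<epsilon> n"
      using Suc us_props(3)[OF assms] by (intro add_mono)
    finally show ?case by (simp add: algebra_simps)
  qed (simp add: ths_0)
  moreover have "(1 - (1/2) ^ N) * \<epsilon> n \<le> \<epsilon> n" for N using eps[of n] by (simp add: algebra_simps)
  ultimately show "\<exists>M. \<forall>N\<ge>M. cmod (ths N z - z) \<le> \<epsilon> n" using order_trans by blast
qed

lemma ths_holomorphic_near: obtains W where "open W" "X n \<subseteq> W" "ths N holomorphic_on W"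
proof (cases "n < N")
  case True
  then show ?thesis using stage_simps(14)[OF st True] that by blast
next
  case False
  have "ths N holomorphic_on V n"
    by (rule holomorphic_transform[of "\<lambda>z. z"]) (use stage_id(1)[OF st, of N n] False in auto)
  then show ?thesis using that V_open X_V by blast
qed

text \<open>Each \<open>us N\<close> is holomorphic near \<open>X n\<close>, but on neighbourhoods
  that may shrink with \<open>N\<close>, so holomorphy of \<open>\<theta>\<close> near
  \<open>X n\<close> cannot be inferred. Complex linearity of the derivatives at the points of
  \<open>X n\<close> does survive in the limit.\<close>

lemma theta_deriv:
  assumes z: "z \<in> X n" shows "\<exists>d. (\<theta> has_field_derivative d) (at z)"
proof -
  have lin: "frechet_derivative (us N) (at z) v = frechet_derivative (us N) (at z) 1 * v" for N v
  proof -
    obtain W1 where 1: "open W1" "X n \<subseteq> W1" "ths N holomorphic_on W1" by (rule ths_holomorphic_near)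
    obtain W2 where 2: "open W2" "X n \<subseteq> W2" "ths (Suc N) holomorphic_on W2" by (rule ths_holomorphic_near)
    have "us N holomorphic_on W1 \<inter> W2" unfolding us_def
      using 1 2 by (intro holomorphic_on_diff) (auto elim: holomorphic_on_subset)
    then obtain d where "(us N has_field_derivative d) (at z)"
      using holomorphic_derivI[of "us N" "W1 \<inter> W2" z] 1 2 z by blast
    then have "(us N has_derivative (\<lambda>v. d * v)) (at z)" by (simp add: has_field_derivative_def)
    then have "frechet_derivative (us N) (at z) v = d * v" for v by (rule frechet_derivativeI)
    then show ?thesis by simp
  qed
  have D1: "\<forall>\<^sub>F n in sequentially. C_k_le k ((1/2) ^ n) (\<lambda>z. frechet_derivative (us n) (at z) 1)" for k
    by (rule eventually_mono[OF us_eventually[of "Suc k"]]) simp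
  have sm: "summable (\<lambda>n. frechet_derivative (us n) (at z) 1)"
    using series_C_k[of "\<lambda>n z. frechet_derivative (us n) (at z) 1", OF D1 C_infinity_deriv[OF us_props(1)]] by blast
  let ?d = "\<Sum>n. frechet_derivative (us n) (at z) 1"
  have "((\<lambda>z. \<Sum>n. us n z) has_derivative (\<lambda>v. \<Sum>n. frechet_derivative (us n) (at z) v)) (at z)"
    using us_series by blast
  moreover have "(\<lambda>v. \<Sum>n. frechet_derivative (us n) (at z) v) = (*) ?d"
  proof (rule ext)
    fix v
    have "(\<Sum>n. frechet_derivative (us n) (at z) v) = (\<Sum>n. frechet_derivative (us n) (at z) 1 * v)"
      by (rule suminf_cong) (rule lin)
    then show "(\<Sum>n. frechet_derivative (us n) (at z) v) = ?d * v" unfolding suminf_mult2[OF sm, of v] .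
  qed
  ultimately have "((\<lambda>z. \<Sum>n. us n z) has_field_derivative ?d) (at z)" unfolding has_field_derivative_def by metis
  then have "(\<theta> has_field_derivative 1 + ?d) (at z)" unfolding \<theta>_def by (intro DERIV_add DERIV_ident)
  then show ?thesis by blast
qed

lemma theta_CR: assumes "z \<in> X n" shows "Cauchy_Riemann_at \<theta> z"
proof -
  obtain d where "(\<theta> has_field_derivative d) (at z)" using theta_deriv[OF assms] by blast
  then have d: "(\<theta> has_derivative (\<lambda>v. d * v)) (at z)" by (simp add: has_field_derivative_def)
  then have "\<theta> differentiable at z" by (auto simp: differentiable_def)
  then show ?thesis unfolding Cauchy_Riemann_at_def by (simp add: frechet_derivativeI[OF d])
qed

lemma theta_conformal: "conformal_on \<theta> (interior (\<Union>n. X n))"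
proof -
  have "\<theta> holomorphic_on interior (\<Union>n. X n)"
  proof (unfold holomorphic_on_open[OF open_interior], intro ballI)
    fix z assume "z \<in> interior (\<Union>n. X n)"
    then obtain n where "z \<in> X n" using interior_subset by blast
    then show "\<exists>f'. (\<theta> has_field_derivative f') (at z)" using theta_deriv by blast
  qed
  moreover have "inj_on \<theta> (interior (\<Union>n. X n))" using theta_inj inj_on_subset by blast
  ultimately show ?thesis unfolding conformal_on_def
    using holomorphic_injective_imp_regular[OF _ open_interior] by blast
qed

section \<open>The meromorphic limit of the stage maps\<close>

lemma gs_props: "fin_mero (gs N) (Ds N)" "Ds N \<inter> cball 0 (R N) = {}" "Ds N \<inter> As N = {}"
  "z \<in> cball 0 (R N) \<Longrightarrow> cmod (gs N z) \<le> (1/2) ^ Suc N" "z \<in> Ss (Suc N) \<Longrightarrow> gs N z = 0" "Ss N \<subseteq> Ss (Suc N)"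
  using rel[of N] unfolding step_rel_def by blast+

lemma As_mono: "N \<le> M \<Longrightarrow> As N \<subseteq> As M"
  by (rule lift_Suc_mono_le[of As]) (simp add: As_Suc)

lemma Ss_mono: "N \<le> M \<Longrightarrow> Ss N \<subseteq> Ss M"
  by (rule lift_Suc_mono_le[of Ss]) (rule gs_props)

lemma Ss_As: "Ss N \<inter> As M = {}"
proof -
  have "Ss (max N M) \<inter> As (max N M) = {}" using stage_simps(4)[OF st] .
  then show ?thesis using As_mono[of M "max N M"] Ss_mono[of N "max N M"] by auto
qed

lemma R_eventually: "\<exists>M. \<forall>N\<ge>M. R N \<ge> B"
  using R_lim unfolding filterlim_at_top eventually_sequentially by blast

lemma gs_summable: "summable (\<lambda>N. gs N z)"
proof (rule summable_comparison_test)
  obtain M where "\<forall>N\<ge>M. R N \<ge> cmod z" using R_eventually by blast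
  then show "\<exists>M. \<forall>N\<ge>M. norm (gs N z) \<le> (1/2) ^ Suc N" using gs_props(4) by (intro exI[of _ M]) auto
  show "summable (\<lambda>N. (1/2::real) ^ Suc N)" using summable_half_powers by (subst summable_Suc_iff)
qed

text \<open>The change of the map after stage \<open>M\<close>. On a disc of radius \<open>B\<close>
  it is holomorphic and at most \<open>(1/2)^M\<close> once all \<open>R N\<close> with
  \<open>N \<ge> M\<close> are at least \<open>B\<close>.\<close>

definition tl :: "nat \<Rightarrow> complex \<Rightarrow> complex" where "tl M z = (\<Sum>N. gs (N + M) z)"

lemma F0_split: "F0 z = F (hs M) z + tl M z"
proof -
  have "hs M z = (\<Sum>N<M. gs N z)" by (induction M) (auto simp: hs_0 hs_Suc)
  then show ?thesis unfolding F0_def F_def tl_def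
    using suminf_split_initial_segment[OF gs_summable, of z M] by simp
qed

lemma tl_bound:
  assumes "\<And>N. N \<ge> M \<Longrightarrow> R N \<ge> B" "z \<in> cball 0 B"
  shows "cmod (tl M z) \<le> (1/2) ^ M"
proof -
  have b: "cmod (gs (N + M) z) \<le> (1/2) ^ (N + M) / 2" for N
    using gs_props(4)[of z "N + M"] assms(1)[of "N + M"] assms(2) by auto
  have s: "summable (\<lambda>N. (1/2::real) ^ (N + M) / 2)"
    using summable_ignore_initial_segment[OF summable_half_powers, of M] by (rule summable_divide)
  have "cmod (tl M z) \<le> (\<Sum>N. (1/2) ^ (N + M) / 2)" unfolding tl_def
    by (rule norm_suminf_le[OF b s])
  also have "\<dots> = (\<Sum>N. (1/2) ^ N * ((1/2) ^ M / 2))" by (simp add: power_add)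
  also have "\<dots> = (\<Sum>N. (1/2::real) ^ N) * ((1/2) ^ M / 2)" by (rule suminf_mult2[OF summable_half_powers, symmetric])
  also have "(\<Sum>N. (1/2::real) ^ N) = 2" by (subst suminf_geometric) auto
  finally show ?thesis by simp
qed

lemma tl_holomorphic:
  assumes "\<And>N. N \<ge> M \<Longrightarrow> R N \<ge> B"
  shows "tl M holomorphic_on ball 0 B"
proof (rule holomorphic_uniform_sequence[of _ "\<lambda>n z. \<Sum>N<n. gs (N + M) z"])
  have sub: "ball 0 B \<subseteq> - Ds (N + M)" for N
    using gs_props(2)[of "N + M"] assms[of "N + M"] by force
  have "gs (N + M) holomorphic_on ball 0 B" for N
    using gs_props(1)[of "N + M"] holomorphic_on_subset[OF _ sub] unfolding fin_mero_def by blast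
  then show "(\<lambda>z. \<Sum>N<n. gs (N + M) z) holomorphic_on ball 0 B" for n by (intro holomorphic_on_sum) auto
  have ul: "uniform_limit (ball 0 B) (\<lambda>n z. \<Sum>N<n. gs (N + M) z) (\<lambda>z. tl M z) sequentially"
    unfolding tl_def
  proof (rule Weierstrass_m_test[OF _ summable_half_powers])
    fix N z assume "z \<in> ball (0::complex) B"
    then have "cmod (gs (N + M) z) \<le> (1/2) ^ Suc (N + M)"
      using gs_props(4)[of z "N + M"] assms[of "N + M"] by auto
    also have "\<dots> \<le> (1/2) ^ N" by (intro power_decreasing) auto
    finally show "cmod (gs (N + M) z) \<le> (1/2) ^ N" .
  qed
  fix z :: complex assume "z \<in> ball 0 B"
  then obtain d where "d > 0" "cball z d \<subseteq> ball 0 B" using open_contains_cball open_ball by blast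
  then show "\<exists>d>0. cball z d \<subseteq> ball 0 B \<and> uniform_limit (cball z d) (\<lambda>n z. \<Sum>N<n. gs (N + M) z) (tl M) sequentially"
    using uniform_limit_on_subset[OF ul] by blast
qed simp

lemma F_hs_meromorphic: "F (hs M) meromorphic_on UNIV"
  unfolding F_def using stage_simps(8)[OF st] by (intro meromorphic_intros)

lemma F0_meromorphic: "F0 meromorphic_on UNIV"
  unfolding meromorphic_on_meromorphic_at[of _ UNIV]
proof
  fix x :: complex
  obtain M where M: "\<And>N. N \<ge> M \<Longrightarrow> R N \<ge> cmod x + 1" using R_eventually by blast
  have "tl M analytic_on ball 0 (cmod x + 1)"
    using tl_holomorphic[OF M] by (simp add: analytic_on_open)
  then have "tl M analytic_on {x}" by (rule analytic_on_subset) auto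
  then have "tl M meromorphic_on {x}" by (rule analytic_on_imp_meromorphic_on)
  moreover have "F (hs M) meromorphic_on {x}" using F_hs_meromorphic meromorphic_on_subset by blast
  ultimately have "(\<lambda>z. F (hs M) z + tl M z) meromorphic_on {x}" by (intro meromorphic_intros)
  moreover have "F0 = (\<lambda>z. F (hs M) z + tl M z)" by (rule ext) (rule F0_split)
  ultimately show "F0 meromorphic_on {x}" by (simp only:)
qed

lemma F0_analytic:
  assumes "\<And>N. z \<notin> As N" shows "F0 analytic_on {z}"
proof -
  obtain M where M: "\<And>N. N \<ge> M \<Longrightarrow> R N \<ge> cmod z + 1" using R_eventually by blast
  have "tl M analytic_on ball 0 (cmod z + 1)"
    using tl_holomorphic[OF M] by (simp add: analytic_on_open)
  then have "tl M analytic_on {z}" by (rule analytic_on_subset) auto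
  moreover have "F (hs M) analytic_on {z}"
  proof (rule analytic_on_subset[of _ "- As M"])
    have "open (- As M)" using stage_simps(1)[OF st] by (intro open_Compl finite_imp_closed)
    then show "F (hs M) analytic_on - As M" using stage_F_holomorphic[OF st] by (simp add: analytic_on_open)
  qed (use assms in auto)
  ultimately have "(\<lambda>z. F (hs M) z + tl M z) analytic_on {z}" by (intro analytic_intros)
  moreover have "F0 = (\<lambda>z. F (hs M) z + tl M z)" by (rule ext) (rule F0_split)
  ultimately show ?thesis by (simp only:)
qed

lemma f_nicely: "f nicely_meromorphic_on UNIV"
  unfolding f_def by (rule remove_sings_nicely_meromorphic[OF F0_meromorphic])

lemma is_pole_f: "is_pole f z \<longleftrightarrow> is_pole F0 z"
proof -
  have "isolated_singularity_at F0 z" using F0_meromorphic unfolding meromorphic_on_altdef by blast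
  then show ?thesis unfolding f_def by (rule is_pole_remove_sings_iff)
qed

lemma f_eq: assumes "\<And>N. z \<notin> As N" shows "f z = F0 z" "\<not> is_pole f z"
proof -
  show "f z = F0 z" unfolding f_def using F0_analytic[OF assms] by simp
  have "isCont F0 z" using F0_analytic[OF assms] analytic_at_imp_isCont by blast
  then show "\<not> is_pole f z" unfolding is_pole_f unfolding is_pole_def isCont_def
    by (metis at_neq_bot not_tendsto_and_filterlim_at_infinity)
qed

lemma As_local:
  assumes "\<And>N. N \<ge> M \<Longrightarrow> R N \<ge> B" "z \<in> cball 0 B" "z \<notin> As M" shows "z \<notin> As N"
proof (cases "N \<le> M")
  case True then show ?thesis using As_mono[OF True] assms by auto
next
  case False
  then have "M \<le> N" by simp
  then show ?thesis
  proof (induction N rule: dec_induct)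
    case base then show ?case using assms by simp
  next
    case (step N)
    have "z \<notin> Ds N" using gs_props(2)[of N] assms(1)[of N] assms(2) step by auto
    then show ?case using step by (simp add: As_Suc)
  qed
qed

text \<open>On a bounded region \<open>f\<close> and \<open>F (hs N)\<close> differ by a tail of
  size \<open>(1/2)^N\<close> for large \<open>N\<close>, so the stage maps can be followed along
  moving points. If \<open>y0\<close> were a pole, the values at \<open>y N\<close> would tend to
  infinity, against the bound \<open>CB\<close>.\<close>

lemma limit_step:
  assumes y: "y \<longlonglongrightarrow> y0" and nA: "\<forall>\<^sub>F N in sequentially. y N \<notin> As N"
    and bd: "\<forall>\<^sub>F N in sequentially. cmod (F (hs N) (y N)) \<le> CB"
  shows "\<not> is_pole f y0" "(\<lambda>N. F (hs N) (y N)) \<longlonglongrightarrow> f y0"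
proof -
  define B where "B = cmod y0 + 1"
  obtain M where M: "\<And>N. N \<ge> M \<Longrightarrow> R N \<ge> B" using R_eventually by blast
  have "\<forall>\<^sub>F N in sequentially. dist (y N) y0 < 1" using y by (rule tendstoD) simp
  then have ev: "\<forall>\<^sub>F N in sequentially. f (y N) = F (hs N) (y N) + tl N (y N) \<and> cmod (tl N (y N)) \<le> (1/2) ^ N \<and> \<not> is_pole f (y N)"
    using nA eventually_ge_at_top[of M]
  proof eventually_elim
    case (elim N)
    have yB: "y N \<in> cball 0 B" using elim(1) norm_triangle_ineq2[of "y N" y0] unfolding B_def by (simp add: dist_norm)
    have "y N \<notin> As K" for K
    proof (rule As_local[of N])
      show "R K \<ge> B" if "K \<ge> N" for K using M that elim(3) by simp
    qed (use yB elim in auto)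
    then have "f (y N) = F0 (y N)" "\<not> is_pole f (y N)" using f_eq by blast+
    moreover have "cmod (tl N (y N)) \<le> (1/2) ^ N" using tl_bound[of N B "y N"] M yB elim(3) by simp
    ultimately show ?case using F0_split[of "y N" N] by simp
  qed
  have tl0: "(\<lambda>N. tl N (y N)) \<longlonglongrightarrow> 0"
  proof (rule Lim_null_comparison)
    show "\<forall>\<^sub>F N in sequentially. norm (tl N (y N)) \<le> (1/2) ^ N" using ev by eventually_elim simp
    show "(\<lambda>N. (1/2::real) ^ N) \<longlonglongrightarrow> 0" by (rule LIMSEQ_power_zero) simp
  qed
  show np: "\<not> is_pole f y0"
  proof
    assume pole: "is_pole f y0"
    have "\<forall>\<^sub>F N in sequentially. y N \<noteq> y0" using ev by eventually_elim (use pole in auto)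
    then have "filterlim y (at y0) sequentially" using y by (simp add: filterlim_at)
    then have inf: "filterlim (\<lambda>N. f (y N)) at_infinity sequentially"
      using pole unfolding is_pole_def by (rule filterlim_compose[rotated])
    have "\<forall>\<^sub>F N in sequentially. \<bar>CB\<bar> + 2 \<le> cmod (f (y N))"
      using inf unfolding filterlim_at_infinity[OF order_refl] by auto
    then have "\<forall>\<^sub>F N in sequentially. False" using ev bd
    proof eventually_elim
      case (elim N)
      have "cmod (f (y N)) \<le> cmod (F (hs N) (y N)) + cmod (tl N (y N))" using elim(2) norm_triangle_ineq by metis
      moreover have "(1/2::real) ^ N \<le> 1" by (simp add: power_le_one)
      ultimately show ?case using elim by linarith
    qed
    then show False by simp
  qed
  have "f analytic_on {y0}" using nicely_meromorphic_on_imp_analytic_at[OF f_nicely _ np] by simp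
  then have "isCont f y0" by (rule analytic_at_imp_isCont)
  then have "(\<lambda>N. f (y N) - tl N (y N)) \<longlonglongrightarrow> f y0 - 0"
    by (intro tendsto_diff tl0 isCont_tendsto_compose[OF _ y])
  moreover have "\<forall>\<^sub>F N in sequentially. f (y N) - tl N (y N) = F (hs N) (y N)" using ev by eventually_elim simp
  ultimately show "(\<lambda>N. F (hs N) (y N)) \<longlonglongrightarrow> f y0" using tendsto_cong by force
qed

text \<open>The three steps are carried to the limit one after the other, and the open discs of the
  stages turn into closed ones. The discs also supply the bounds that exclude poles at the first two
  points; for the third point the bound comes from the convergence of
  \<open>ths N (\<phi> z)\<close>.\<close>

lemma conjugacy:
  assumes z: "z \<in> X n"
  shows "\<not> is_pole f (\<theta> z)" "\<not> is_pole f (f (\<theta> z))" "\<not> is_pole f (f (f (\<theta> z)))"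
    "f (\<theta> z) \<in> cball p \<rho>" "f (f (\<theta> z)) \<in> cball (e n) (r n)" "f (f (f (\<theta> z))) = \<theta> (\<phi> z)"
proof -
  let ?f = "\<lambda>N. F (hs N)"
  have key: "\<forall>\<^sub>F N in sequentially. ths N z \<notin> As N \<and> ?f N (ths N z) \<in> ball p \<rho> - {p} \<and>
     ?f N (?f N (ths N z)) \<in> ball (e n) (r n) - As N \<and> ?f N (?f N (?f N (ths N z))) = ths N (\<phi> z)"
    unfolding eventually_sequentially
  proof (intro exI allI impI)
    fix N assume "Suc n \<le> N"
    then have "n < N" by simp
    from stage_simps(14)[OF st this] obtain W where "X n \<subseteq> W" and
      W: "\<forall>z\<in>W. ths N z \<notin> As N \<and> ?f N (ths N z) \<in> ball p \<rho> - {p} \<and>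
       ?f N (?f N (ths N z)) \<in> ball (e n) (r n) - As N \<and> ?f N (?f N (?f N (ths N z))) = ths N (\<phi> z)"
      by (elim exE conjE) (rule that; assumption)
    then show "ths N z \<notin> As N \<and> ?f N (ths N z) \<in> ball p \<rho> - {p} \<and>
     ?f N (?f N (ths N z)) \<in> ball (e n) (r n) - As N \<and> ?f N (?f N (?f N (ths N z))) = ths N (\<phi> z)"
      using z by (intro bspec[OF W]) blast
  qed
  have b1: "cmod y \<le> cmod p + \<rho>" if "y \<in> ball p \<rho>" for y
    using that norm_triangle_ineq2[of y p] by (simp add: dist_norm norm_minus_commute)
  have b2: "cmod y \<le> cmod (e n) + r n" if "y \<in> ball (e n) (r n)" for y
    using that norm_triangle_ineq2[of y "e n"] by (simp add: dist_norm norm_minus_commute)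
  have s1: "\<not> is_pole f (\<theta> z)" "(\<lambda>N. ?f N (ths N z)) \<longlonglongrightarrow> f (\<theta> z)"
    by (rule limit_step[OF ths_lim, where CB="cmod p + \<rho>"]; rule eventually_mono[OF key]; use b1 in blast)+
  have s2: "\<not> is_pole f (f (\<theta> z))" "(\<lambda>N. ?f N (?f N (ths N z))) \<longlonglongrightarrow> f (f (\<theta> z))"
  proof (rule limit_step[OF s1(2), where CB="cmod (e n) + r n"], goal_cases)
    case 1 show ?case
    proof (rule eventually_mono[OF key])
      fix N assume a: "ths N z \<notin> As N \<and> ?f N (ths N z) \<in> ball p \<rho> - {p} \<and>
         ?f N (?f N (ths N z)) \<in> ball (e n) (r n) - As N \<and> ?f N (?f N (?f N (ths N z))) = ths N (\<phi> z)"
      then have "?f N (ths N z) \<in> cball p \<rho>" "?f N (ths N z) \<noteq> p" using ball_subset_cball by blast+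
      then show "?f N (ths N z) \<notin> As N" using stage_simps(3)[OF st, of N] by blast
    qed
  next
    case 2 show ?case by (rule eventually_mono[OF key]) (use b2 in blast)
  next
    case 3 show ?case
    proof (rule limit_step[OF s1(2), where CB="cmod (e n) + r n"])
      show "\<forall>\<^sub>F N in sequentially. ?f N (ths N z) \<notin> As N"
      proof (rule eventually_mono[OF key])
        fix N assume a: "ths N z \<notin> As N \<and> ?f N (ths N z) \<in> ball p \<rho> - {p} \<and>
           ?f N (?f N (ths N z)) \<in> ball (e n) (r n) - As N \<and> ?f N (?f N (?f N (ths N z))) = ths N (\<phi> z)"
        then have "?f N (ths N z) \<in> cball p \<rho>" "?f N (ths N z) \<noteq> p" using ball_subset_cball by blast+
        then show "?f N (ths N z) \<notin> As N" using stage_simps(3)[OF st, of N] by blast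
      qed
      show "\<forall>\<^sub>F N in sequentially. cmod (?f N (?f N (ths N z))) \<le> cmod (e n) + r n"
        by (rule eventually_mono[OF key]) (use b2 in blast)
    qed
  qed
  have "\<forall>\<^sub>F N in sequentially. dist (ths N (\<phi> z)) (\<theta> (\<phi> z)) < 1" by (rule tendstoD[OF ths_lim]) simp
  then have bd3: "\<forall>\<^sub>F N in sequentially. cmod (?f N (?f N (?f N (ths N z)))) \<le> cmod (\<theta> (\<phi> z)) + 1"
    using key
  proof eventually_elim
    case (elim N)
    have "cmod (ths N (\<phi> z)) \<le> cmod (\<theta> (\<phi> z)) + 1"
      using elim(1) norm_triangle_ineq2[of "ths N (\<phi> z)" "\<theta> (\<phi> z)"] by (simp add: dist_norm)
    then show ?case using elim(2) by simp
  qed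
  have nA3: "\<forall>\<^sub>F N in sequentially. ?f N (?f N (ths N z)) \<notin> As N" by (rule eventually_mono[OF key]) blast
  have s3: "\<not> is_pole f (f (f (\<theta> z)))" "(\<lambda>N. ?f N (?f N (?f N (ths N z)))) \<longlonglongrightarrow> f (f (f (\<theta> z)))"
    by (rule limit_step[OF s2(2) nA3 bd3])+
  show "\<not> is_pole f (\<theta> z)" "\<not> is_pole f (f (\<theta> z))" "\<not> is_pole f (f (f (\<theta> z)))" by fact+
  show "f (\<theta> z) \<in> cball p \<rho>"
  proof (rule Lim_in_closed_set[OF closed_cball _ _ s1(2)])
    show "\<forall>\<^sub>F N in sequentially. ?f N (ths N z) \<in> cball p \<rho>"
      by (rule eventually_mono[OF key]) (use ball_subset_cball in blast)
  qed simp
  show "f (f (\<theta> z)) \<in> cball (e n) (r n)"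
  proof (rule Lim_in_closed_set[OF closed_cball _ _ s2(2)])
    show "\<forall>\<^sub>F N in sequentially. ?f N (?f N (ths N z)) \<in> cball (e n) (r n)"
      by (rule eventually_mono[OF key]) (use ball_subset_cball in blast)
  qed simp
  have "(\<lambda>N. ?f N (?f N (?f N (ths N z)))) \<longlonglongrightarrow> \<theta> (\<phi> z)"
  proof (rule Lim_transform_eventually[OF ths_lim])
    show "\<forall>\<^sub>F N in sequentially. ths N (\<phi> z) = ?f N (?f N (?f N (ths N z)))"
      by (rule eventually_mono[OF key]) simp
  qed
  then show "f (f (f (\<theta> z))) = \<theta> (\<phi> z)" using s3(2) LIMSEQ_unique by blast
qed

end

section \<open>Dynamics of the limit function\<close>

context bungee_limit begin

lemma X_disj: "m \<noteq> n \<Longrightarrow> X m \<inter> X n = {}"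
  using X_V V_disj by blast

lemma phi_iter: "z \<in> X n \<Longrightarrow> (\<phi> ^^ m) z \<in> X (n + m)"
  by (induction m) (use phi_X in auto)

lemma f_iter_3: "z \<in> X n \<Longrightarrow> (f ^^ (3 * m)) (\<theta> z) = \<theta> ((\<phi> ^^ m) z)"
proof (induction m)
  case (Suc m)
  have "(f ^^ (3 * Suc m)) (\<theta> z) = (f ^^ 3) ((f ^^ (3 * m)) (\<theta> z))"
    using funpow_add[of 3 "3 * m" f] by (simp add: add.commute)
  also have "\<dots> = f (f (f (\<theta> ((\<phi> ^^ m) z))))" using Suc by (simp add: numeral_3_eq_3)
  also have "\<dots> = \<theta> (\<phi> ((\<phi> ^^ m) z))" using conjugacy(6)[OF phi_iter[OF Suc.prems]] .
  finally show ?case by simp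
qed simp

lemma f_iter:
  assumes "z \<in> X n"
  shows "(f ^^ (3 * m + 1)) (\<theta> z) \<in> cball p \<rho>" "(f ^^ (3 * m + 2)) (\<theta> z) \<in> cball (e (n + m)) (r (n + m))"
    "\<not> is_pole f ((f ^^ j) (\<theta> z))"
proof -
  have 1: "(f ^^ (3 * m + 1)) (\<theta> z) = f (\<theta> ((\<phi> ^^ m) z))" for m using f_iter_3[OF assms] by simp
  have 2: "(f ^^ (3 * m + 2)) (\<theta> z) = f (f (\<theta> ((\<phi> ^^ m) z)))" for m using f_iter_3[OF assms] by simp
  show "(f ^^ (3 * m + 1)) (\<theta> z) \<in> cball p \<rho>" unfolding 1 by (rule conjugacy(4)[OF phi_iter[OF assms]])
  show "(f ^^ (3 * m + 2)) (\<theta> z) \<in> cball (e (n + m)) (r (n + m))" unfolding 2 by (rule conjugacy(5)[OF phi_iter[OF assms]])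
  have "j = 3 * (j div 3) + j mod 3" by simp
  moreover have "j mod 3 < 3" by simp
  ultimately consider "j = 3 * (j div 3)" | "j = 3 * (j div 3) + 1" | "j = 3 * (j div 3) + 2" by linarith
  then show "\<not> is_pole f ((f ^^ j) (\<theta> z))"
  proof cases
    case 1 then show ?thesis using f_iter_3[OF assms, of "j div 3"] conjugacy(1)[OF phi_iter[OF assms]] by metis
  next
    case 2 then show ?thesis using 1[of "j div 3"] conjugacy(2)[OF phi_iter[OF assms]] by metis
  next
    case 3 then show ?thesis using 2[of "j div 3"] conjugacy(3)[OF phi_iter[OF assms]] by metis
  qed
qed

lemma all_defined: "z \<in> X n \<Longrightarrow> all_iterates_defined f (\<theta> z)"
  unfolding all_iterates_defined_def iterate_finite_def using f_iter(3) by blast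

lemma semiconj: assumes "z \<in> X n" shows "iterate_finite f 3 (\<theta> z)" "(f ^^ 3) (\<theta> z) = \<theta> (\<phi> z)"
  using f_iter(3)[OF assms] f_iter_3[OF assms, of 1] by (auto simp: iterate_finite_def)

text \<open>At the times \<open>3 * m + 1\<close> the orbit is in the disc about \<open>p\<close>.
  At the times \<open>3 * m\<close> it is at the image under \<open>\<theta>\<close> of a point of
  \<open>X (n + m)\<close>, and these tend to infinity since the distance of
  \<open>\<theta> w\<close> from \<open>w\<close> grows at most like a quarter of
  \<open>cmod w\<close>.\<close>

lemma bungee: assumes z: "z \<in> X n" shows "\<theta> z \<in> bungee_set f"
proof -
  let ?x = "\<lambda>j. ereal (cmod ((f ^^ j) (\<theta> z)))"
  have "liminf ?x \<le> liminf (?x \<circ> (\<lambda>m. 3 * m + 1))" by (rule liminf_subseq_mono) (auto simp: strict_mono_def)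
  also have "\<dots> \<le> limsup (?x \<circ> (\<lambda>m. 3 * m + 1))" by (rule Liminf_le_Limsup) simp
  also have "\<dots> \<le> ereal (cmod p + \<rho>)"
  proof (rule Limsup_bounded, rule always_eventually, rule allI)
    fix m
    have "cmod ((f ^^ (3 * m + 1)) (\<theta> z)) \<le> cmod p + \<rho>"
      using f_iter(1)[OF z, of m] norm_triangle_ineq2[of "(f ^^ (3 * m + 1)) (\<theta> z)" p]
      by (simp add: dist_norm norm_minus_commute)
    then show "(?x \<circ> (\<lambda>m. 3 * m + 1)) m \<le> ereal (cmod p + \<rho>)" by simp
  qed
  finally have 1: "liminf ?x < \<infinity>" by (rule le_less_trans) simp
  have low: "cmod (\<theta> w) \<ge> 3/4 * cmod w - cmod (\<theta> 0)" for w
  proof -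
    have "cmod ((\<theta> w - w) - (\<theta> 0 - 0)) \<le> 1/4 * cmod (w - 0)" by (rule theta_lipschitz)
    moreover have "w = \<theta> w - ((\<theta> w - w) - (\<theta> 0 - 0)) - \<theta> 0" by simp
    then have "cmod w \<le> cmod (\<theta> w) + cmod ((\<theta> w - w) - (\<theta> 0 - 0)) + cmod (\<theta> 0)"
      by (metis add_mono_thms_linordered_semiring(3) norm_triangle_ineq4 order_trans)
    ultimately show ?thesis by simp
  qed
  have inf: "(?x \<circ> (\<lambda>m. 3 * m)) \<longlonglongrightarrow> \<infinity>"
    unfolding tendsto_PInfty o_def
  proof (intro allI impI)
    fix B :: real
    obtain M where M: "\<And>N. N \<ge> M \<Longrightarrow> R N \<ge> 4/3 * (B + cmod (\<theta> 0))" using R_eventually by blast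
    show "\<forall>\<^sub>F m in sequentially. ereal B < ereal (cmod ((f ^^ (3 * m)) (\<theta> z)))"
      unfolding eventually_sequentially
    proof (intro exI allI impI)
      fix m assume "M \<le> m"
      then have R: "R (n + m) \<ge> 4/3 * (B + cmod (\<theta> 0))" using M by simp
      have "(\<phi> ^^ m) z \<in> V (n + m)" using phi_iter[OF z] X_V by blast
      then have "(\<phi> ^^ m) z \<notin> cball 0 (R (n + m))" using R_V[of "n + m" "n + m"] by blast
      then have "cmod ((\<phi> ^^ m) z) > 4/3 * (B + cmod (\<theta> 0))" using R by simp
      then show "ereal B < ereal (cmod ((f ^^ (3 * m)) (\<theta> z)))"
        using low[of "(\<phi> ^^ m) z"] f_iter_3[OF z, of m] by simp
    qed
  qed
  have "\<infinity> = limsup (?x \<circ> (\<lambda>m. 3 * m))" using lim_imp_Limsup[OF _ inf] by simp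
  also have "\<dots> \<le> limsup ?x" by (rule limsup_subseq_mono) (auto simp: strict_mono_def)
  finally have "limsup ?x = \<infinity>" by simp
  with 1 show ?thesis unfolding bungee_set_def using all_defined[OF z] by simp
qed

text \<open>Applying the iterate of order \<open>2 * i\<close> moves the first point to the image of
  \<open>X (n + i)\<close> under \<open>\<theta>\<close>, and the second to time
  \<open>2 * i + j > 3 * i\<close>. By its residue modulo 3 the latter lies in the image of some
  \<open>X (n + m)\<close> with \<open>m \<noteq> i\<close> or in a disc where
  \<open>\<theta>\<close> is the identity; injectivity of \<open>\<theta>\<close> then contradicts
  the disjointness of the original sets.\<close>

lemma orbits_disjoint:
  assumes "i < j" shows "(f ^^ i) ` \<theta> ` X n \<inter> (f ^^ j) ` \<theta> ` X n = {}"
proof (rule ccontr)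
  assume "\<not> ?thesis"
  then obtain a b where ab: "a \<in> X n" "b \<in> X n" "(f ^^ i) (\<theta> a) = (f ^^ j) (\<theta> b)" by blast
  have "(f ^^ (3 * i)) (\<theta> a) = (f ^^ (2 * i)) ((f ^^ i) (\<theta> a))" using funpow_add[of "2 * i" i f] by simp
  also have "\<dots> = (f ^^ (2 * i + j)) (\<theta> b)" unfolding ab(3) using funpow_add[of "2 * i" j f] by simp
  finally have eq: "\<theta> ((\<phi> ^^ i) a) = (f ^^ (2 * i + j)) (\<theta> b)" using f_iter_3[OF ab(1)] by simp
  have aX: "(\<phi> ^^ i) a \<in> X (n + i)" using phi_iter[OF ab(1)] .
  define J m where "J = 2 * i + j" and "m = J div 3"
  have "J = 3 * m + J mod 3" "J mod 3 < 3" by (simp_all add: m_def)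
  then consider "J = 3 * m" | "J = 3 * m + 1" | "J = 3 * m + 2" by linarith
  then show False
  proof cases
    case 1
    then have "\<theta> ((\<phi> ^^ i) a) = \<theta> ((\<phi> ^^ m) b)" using eq f_iter_3[OF ab(2), of m] by (simp add: J_def)
    then have "(\<phi> ^^ i) a = (\<phi> ^^ m) b" by (rule injD[OF theta_inj])
    moreover have "(\<phi> ^^ m) b \<in> X (n + m)" using phi_iter[OF ab(2)] .
    moreover have "n + i \<noteq> n + m" using 1 assms by (simp add: J_def)
    ultimately show False using X_disj[of "n + i" "n + m"] aX by auto
  next
    case 2
    then have w: "\<theta> ((\<phi> ^^ i) a) \<in> cball p \<rho>" using eq f_iter(1)[OF ab(2), of m] by (simp add: J_def)
    then have "\<theta> (\<theta> ((\<phi> ^^ i) a)) = \<theta> ((\<phi> ^^ i) a)" using theta_id by blast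
    then have "\<theta> ((\<phi> ^^ i) a) = (\<phi> ^^ i) a" by (rule injD[OF theta_inj])
    then show False using w aX X_V V_p by (metis IntI empty_iff subsetD)
  next
    case 3
    then have w: "\<theta> ((\<phi> ^^ i) a) \<in> cball (e (n + m)) (r (n + m))" using eq f_iter(2)[OF ab(2), of m] by (simp add: J_def)
    then have "\<theta> (\<theta> ((\<phi> ^^ i) a)) = \<theta> ((\<phi> ^^ i) a)" using theta_id by blast
    then have "\<theta> ((\<phi> ^^ i) a) = (\<phi> ^^ i) a" by (rule injD[OF theta_inj])
    then show False using w aX X_V V_e by (metis IntI empty_iff subsetD)
  qed
qed

section \<open>Surviving poles and the Julia set\<close>

lemma F0_preserved: assumes "s \<in> Ss (Suc N)" shows "f s = F (hs (Suc N)) s"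
proof -
  have g0: "gs (k + Suc N) s = 0" for k
  proof -
    have "s \<in> Ss (Suc (k + Suc N))" using Ss_mono[of "Suc N" "Suc (k + Suc N)"] assms by auto
    then show ?thesis by (rule gs_props(5))
  qed
  have "tl (Suc N) s = 0" unfolding tl_def g0 by simp
  moreover have "s \<notin> As M" for M using Ss_As[of "Suc N" M] assms by auto
  ultimately show ?thesis using f_eq(1)[of s] F0_split[of s "Suc N"] by simp
qed

text \<open>The singular sets \<open>Ds\<close> of different steps are disjoint, so at
  \<open>a\<close> all other terms of the series and its tail are analytic and cannot cancel the
  pole.\<close>

lemma pole_preserved: assumes "is_pole (gs N) a" shows "is_pole f a" "a \<in> Ds N"
proof -
  have op: "open (- S)" if "finite S" for S :: "complex set" using that by (intro open_Compl finite_imp_closed)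
  have an: "gs M analytic_on {a}" if "a \<notin> Ds M" for M
  proof -
    have "finite (Ds M)" "gs M holomorphic_on - Ds M" using gs_props(1)[of M] unfolding fin_mero_def by auto
    then have "gs M analytic_on - Ds M" using op by (simp add: analytic_on_open)
    then show ?thesis by (rule analytic_on_subset) (use that in auto)
  qed
  have npole: "\<not> is_pole q a" if "q analytic_on {a}" for q
    using analytic_at_imp_isCont[OF that] unfolding is_pole_def isCont_def
    by (metis at_neq_bot not_tendsto_and_filterlim_at_infinity)
  show aD: "a \<in> Ds N" using an npole assms by blast
  obtain M0 where M0: "\<And>N. N \<ge> M0 \<Longrightarrow> R N \<ge> cmod a + 1" using R_eventually by blast
  define M where "M = max M0 (Suc N)"
  have "tl M analytic_on ball 0 (cmod a + 1)"
    using tl_holomorphic[of M "cmod a + 1"] M0 by (simp add: analytic_on_open M_def)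
  then have t: "tl M analytic_on {a}" by (rule analytic_on_subset) auto
  have aN: "a \<notin> As N" using aD gs_props(3) by blast
  have "F (hs N) analytic_on - As N"
    using stage_F_holomorphic[OF st] op[OF stage_simps(1)[OF st]] by (simp add: analytic_on_open)
  then have FN: "F (hs N) analytic_on {a}" by (rule analytic_on_subset) (use aN in auto)
  have am: "a \<notin> Ds m" if "m > N" for m
    using gs_props(3)[of m] As_mono[of "Suc N" m] aD that by (auto simp: As_Suc)
  have hsM: "hs (Suc N + k) z = hs N z + gs N z + (\<Sum>m<k. gs (Suc N + m) z)" for k z
    by (induction k) (simp_all add: hs_Suc)
  have MM: "M = Suc N + (M - Suc N)" by (simp add: M_def)
  define q where "q = (\<lambda>z. F (hs N) z + (\<Sum>m<M - Suc N. gs (Suc N + m) z) + tl M z)"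
  have "q analytic_on {a}" unfolding q_def by (intro analytic_on_add analytic_on_sum FN t an am) auto
  then have qc: "q \<midarrow>a\<rightarrow> q a" using analytic_at_imp_isCont isContD by blast
  have "F0 = (\<lambda>z. q z + gs N z)"
  proof (rule ext)
    fix z
    show "F0 z = q z + gs N z" unfolding F0_split[of z M] q_def F_def using hsM[of "M - Suc N" z] MM by simp
  qed
  then have "is_pole F0 a" using tendsto_add_filterlim_at_infinity[OF qc] assms unfolding is_pole_def by metis
  then show "is_pole f a" by (simp add: is_pole_f)
qed

lemma chain_to_pole:
  assumes "n \<le> N" "xx N \<in> frontier (X n)"
  shows "\<exists>t k. cmod (t - ths N (xx N)) < 1 / real (Suc N) \<and> is_pole f ((f ^^ k) t) \<and> (f ^^ k) t \<in> Ds N"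
proof -
  have "\<exists>t k. cmod (t - ths N (xx N)) < 1 / real (Suc N) \<and>
        (\<forall>i<k. (F (hs (Suc N)) ^^ i) t \<in> Ss (Suc N)) \<and> is_pole (gs N) ((F (hs (Suc N)) ^^ k) t)"
    using rel[of N] assms unfolding step_rel_def hs_Suc[symmetric] by blast
  then obtain t k where t: "cmod (t - ths N (xx N)) < 1 / real (Suc N)"
    and k: "\<forall>i<k. (F (hs (Suc N)) ^^ i) t \<in> Ss (Suc N)" "is_pole (gs N) ((F (hs (Suc N)) ^^ k) t)" by blast
  have "(f ^^ i) t = (F (hs (Suc N)) ^^ i) t" if "i \<le> k" for i
    using that
  proof (induction i)
    case (Suc i)
    then show ?case using k(1) F0_preserved[of "(F (hs (Suc N)) ^^ i) t" N] by simp
  qed simp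
  then show ?thesis using t pole_preserved[OF k(2)] by (intro exI[of _ t] exI[of _ k]) simp
qed

text \<open>Each late step \<open>N\<close> with \<open>xx N = x\<close> supplies a point within
  \<open>1 / real (Suc N)\<close> of \<open>ths N x\<close> whose orbit hits a pole. These points
  come arbitrarily close to \<open>\<theta> x\<close>, so no neighbourhood of it has all iterates
  defined. A single visit would leave a positive distance, hence the demand for infinitely
  many.\<close>

lemma Julia_hit:
  assumes x: "x \<in> frontier (X n)" and inf: "infinite {N. xx N = x}"
  shows "\<theta> x \<in> Julia_set f"
proof (rule ccontr)
  assume "\<theta> x \<notin> Julia_set f"
  then obtain U where U: "open U" "\<theta> x \<in> U" "\<forall>w\<in>U. all_iterates_defined f w"
    unfolding Julia_set_def Fatou_set_def by auto
  obtain d where d: "d > 0" "ball (\<theta> x) d \<subseteq> U" using U open_contains_ball by blast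
  have "\<forall>\<^sub>F N in sequentially. dist (ths N x) (\<theta> x) < d / 2" by (rule tendstoD[OF ths_lim]) (use d in simp)
  moreover have "\<forall>\<^sub>F N in sequentially. 1 / real (Suc N) < d / 2"
    by (rule order_tendstoD(2)[OF LIMSEQ_inverse_real_of_nat[unfolded inverse_eq_divide]]) (use d in simp)
  ultimately have "\<forall>\<^sub>F N in sequentially. dist (ths N x) (\<theta> x) < d / 2 \<and> 1 / real (Suc N) < d / 2 \<and> n \<le> N"
    using eventually_ge_at_top[of n] by eventually_elim simp
  then obtain M where M: "\<And>N. N \<ge> M \<Longrightarrow> dist (ths N x) (\<theta> x) < d / 2 \<and> 1 / real (Suc N) < d / 2 \<and> n \<le> N"
    unfolding eventually_sequentially by blast
  obtain N where N: "N \<ge> M" "xx N = x" using inf unfolding infinite_nat_iff_unbounded_le by auto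
  obtain t k where t: "cmod (t - ths N x) < 1 / real (Suc N)" "is_pole f ((f ^^ k) t)"
    using chain_to_pole[of n N] M[OF N(1)] x N(2) by blast
  have "dist t (\<theta> x) \<le> dist t (ths N x) + dist (ths N x) (\<theta> x)" by (rule dist_triangle)
  then have "dist t (\<theta> x) < d" using t(1) M[OF N(1)] by (simp add: dist_norm)
  then have "t \<in> U" using d by (auto simp: dist_commute)
  then have "\<not> is_pole f ((f ^^ k) t)" using U(3) lessI unfolding all_iterates_defined_def iterate_finite_def by blast
  then show False using t(2) by simp
qed

lemma closed_Julia: "closed (Julia_set f)"
proof -
  have "Fatou_set f = \<Union>{U. open U \<and> (\<forall>w\<in>U. all_iterates_defined f w) \<and> normal_family U (range (\<lambda>n. f ^^ n))}"
    unfolding Fatou_set_def by blast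
  then have "open (Fatou_set f)" by (simp add: open_Union)
  then show ?thesis unfolding Julia_set_def by (rule closed_Compl)
qed

lemma theta_frontier: assumes "closed S" shows "frontier (\<theta> ` S) \<subseteq> \<theta> ` frontier S"
proof -
  define \<psi> where "\<psi> = inv \<theta>"
  have "C_infinity \<psi>" using theta_diffeo unfolding smooth_diffeomorphism_def \<psi>_def by blast
  then have cont: "continuous_on UNIV \<psi>" unfolding C_infinity_def by (metis C_k.simps(1))
  have vim: "\<theta> ` A = \<psi> -` A" for A unfolding \<psi>_def using bij_vimage_eq_inv_image[OF bij_imp_bij_inv[OF theta_bij]] theta_bij
    by (simp add: inv_inv_eq)
  have "closed (\<theta> ` S)" unfolding vim using assms cont by (rule closed_vimage)
  moreover have "open (\<theta> ` interior S)" unfolding vim using cont by (intro open_vimage) auto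
  then have "\<theta> ` interior S \<subseteq> interior (\<theta> ` S)" by (intro interior_maximal image_mono interior_subset)
  ultimately show ?thesis unfolding frontier_def using assms by auto
qed

lemma closed_X_Union: "closed (\<Union>n. X n)"
proof -
  have "escaping X" using escaping_XE by (rule escaping_subset) (simp add: XE_def)
  then show ?thesis using closed_Union_escaping[of X UNIV] by (simp add: X_compact compact_imp_closed)
qed

lemma frontier_Union: "frontier (\<Union>n. X n) \<subseteq> (\<Union>n. frontier (X n))"
proof
  fix x assume x: "x \<in> frontier (\<Union>n. X n)"
  then obtain n where n: "x \<in> X n" using closed_X_Union frontier_subset_closed by blast
  have "interior (X n) \<subseteq> interior (\<Union>n. X n)" by (rule interior_mono) blast
  then have "x \<notin> interior (X n)" using x unfolding frontier_def by blast
  then show "x \<in> (\<Union>n. frontier (X n))" using n closure_subset[of "X n"] unfolding frontier_def by blast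
qed

lemma theta_X_cball: "f ` \<theta> ` (\<Union>n. X n) \<subseteq> cball p \<rho>"
  using conjugacy(4) by blast

end

text \<open>The steps are countable and cannot visit every boundary point; a dense set visited
  infinitely often suffices because the Julia set is closed.\<close>

locale bungee_dense = bungee_limit +
  assumes dense: "(\<Union>n. frontier (X n)) \<subseteq> closure {x \<in> (\<Union>n. frontier (X n)). infinite {N. xx N = x}}"
    and nonempty: "(\<Union>n. X n) \<noteq> {}"
begin

lemma theta_frontier_Julia: "\<theta> ` (\<Union>n. frontier (X n)) \<subseteq> Julia_set f"
proof -
  let ?D = "{x \<in> (\<Union>n. frontier (X n)). infinite {N. xx N = x}}"
  have "\<theta> ` (\<Union>n. frontier (X n)) \<subseteq> \<theta> ` closure ?D" using dense by (rule image_mono)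
  also have "\<dots> \<subseteq> closure (\<theta> ` ?D)" using theta_cont by (intro image_closure_subset[OF theta_cont closed_closure closure_subset])
  also have "\<dots> \<subseteq> Julia_set f" using Julia_hit by (intro closure_minimal closed_Julia) blast
  finally show ?thesis .
qed

lemma frontier_theta_Union: "frontier (\<theta> ` (\<Union>n. X n)) \<subseteq> Julia_set f"
  using theta_frontier[OF closed_X_Union] frontier_Union theta_frontier_Julia by blast

lemma wandering: "wandering_compact_set f (\<theta> ` X n)"
  unfolding wandering_compact_set_def
proof (intro conjI allI impI ballI)
  show "compact (\<theta> ` X n)" by (intro compact_continuous_image theta_cont X_compact)
  show "frontier (\<theta> ` X n) \<subseteq> Julia_set f"
    using theta_frontier[OF compact_imp_closed[OF X_compact]] theta_frontier_Julia by blast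
  show "all_iterates_defined f z" if "z \<in> \<theta> ` X n" for z using that all_defined by blast
  show "(f ^^ i) ` \<theta> ` X n \<inter> (f ^^ j) ` \<theta> ` X n = {}" if "i \<noteq> j" for i j
    using orbits_disjoint[of i j n] orbits_disjoint[of j i n] that by (metis Int_commute linorder_neqE_nat)
qed

text \<open>A nonempty compact set in the plane has a boundary point, so by density some boundary
  point is visited infinitely often. Every visit at a late enough step creates a pole in
  \<open>Ds N\<close>, and these sets are disjoint.\<close>

lemma infinitely_many_poles: "infinite {a. is_pole f a}"
proof
  assume fin: "finite {a. is_pole f a}"
  obtain m where m: "X m \<noteq> {}" using nonempty by blast
  have "X m \<noteq> UNIV" using X_compact[of m] not_compact_UNIV by auto
  then have "frontier (X m) \<noteq> {}" using m frontier_eq_empty by blast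
  then obtain x where x: "x \<in> (\<Union>n. frontier (X n))" "infinite {N. xx N = x}"
    using dense closure_empty by (metis (mono_tags, lifting) UNIV_I UN_I empty_Collect_eq empty_subsetI ex_in_conv subset_antisym subset_empty)
  then obtain n where n: "x \<in> frontier (X n)" by blast
  define NS where "NS = {N. xx N = x \<and> n \<le> N}"
  have "infinite NS"
  proof -
    have "{N. xx N = x} \<subseteq> NS \<union> {..<n}" unfolding NS_def by auto
    then show ?thesis using x(2) by (meson finite_Un finite_lessThan finite_subset)
  qed
  have "\<exists>a. is_pole f a \<and> a \<in> Ds N" if "N \<in> NS" for N
    using chain_to_pole[of n N] that n unfolding NS_def by blast
  then obtain a where a: "\<And>N. N \<in> NS \<Longrightarrow> is_pole f (a N) \<and> a N \<in> Ds N" by metis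
  have Dd: "Ds N \<inter> Ds M = {}" if "N < M" for N M
    using gs_props(3)[of M] As_mono[of "Suc N" M] that by (auto simp: As_Suc)
  have "inj_on a NS"
  proof (rule inj_onI)
    fix N M assume "N \<in> NS" "M \<in> NS" "a N = a M"
    then have "Ds N \<inter> Ds M \<noteq> {}" using a by (metis IntI empty_iff)
    then show "N = M" using Dd[of N M] Dd[of M N] by (metis Int_commute linorder_neqE_nat)
  qed
  moreover have "a ` NS \<subseteq> {a. is_pole f a}" using a by blast
  ultimately have "finite NS" using fin finite_subset finite_imageD by blast
  then show False using \<open>infinite NS\<close> by simp
qed

text \<open>A quotient of polynomials has poles only among the finitely many zeros of its
  denominator.\<close>

lemma transcendental: "transcendental_meromorphic f"
  unfolding transcendental_meromorphic_def
proof (intro conjI f_nicely notI)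
  assume "rational_function f"
  then obtain P Q where Q: "Q \<noteq> 0" "\<And>z. poly Q z \<noteq> 0 \<Longrightarrow> f z = poly P z / poly Q z"
    unfolding rational_function_def by blast
  have "finite {z. poly Q z = 0}" using Q(1) by (rule poly_roots_finite)
  then obtain a where a: "is_pole f a" "poly Q a \<noteq> 0"
    using infinitely_many_poles by (metis (mono_tags, lifting) finite_subset mem_Collect_eq subsetI)
  have c: "isCont (\<lambda>z. poly P z / poly Q z) a" using a(2) by (intro continuous_intros) auto
  have "isCont (poly Q) a" by (intro continuous_intros)
  then have "\<forall>\<^sub>F z in at a. poly Q z \<noteq> 0" using a(2) by (auto simp: isCont_def intro: tendsto_imp_eventually_ne)
  then have ev: "\<forall>\<^sub>F z in at a. f z = poly P z / poly Q z" by eventually_elim (rule Q(2))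
  then have "is_pole (\<lambda>z. poly P z / poly Q z) a" using a(1) is_pole_cong[OF ev refl] by simp
  then show False using c unfolding is_pole_def isCont_def
    by (metis at_neq_bot not_tendsto_and_filterlim_at_infinity)
qed

end

text \<open>The conclusion of the theorem as a predicate, so that it can be transferred from a
  replacement of \<phi> back to \<phi> and be obtained separately for empty sets.\<close>

definition realisable :: "(nat \<Rightarrow> complex set) \<Rightarrow> (nat \<Rightarrow> complex set) \<Rightarrow> (complex \<Rightarrow> complex) \<Rightarrow> (nat \<Rightarrow> real) \<Rightarrow> bool" where
  "realisable X C \<phi> \<epsilon> \<longleftrightarrow> (\<exists>(f :: complex \<Rightarrow> complex) (\<theta> :: complex \<Rightarrow> complex) (k :: nat \<Rightarrow> nat).
    transcendental_meromorphic f \<and>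
    smooth_diffeomorphism \<theta> \<and>
    (\<forall>n. k n > 0) \<and>
    (\<forall>n. \<forall>z\<in>X n. iterate_finite f (k n) (\<theta> z) \<and> (f ^^ k n) (\<theta> z) = \<theta> (\<phi> z)) \<and>
    (\<forall>n. \<forall>z\<in>X n. cmod (\<theta> z - z) \<le> \<epsilon> n) \<and>
    frontier (\<theta> ` (\<Union>n. X n)) \<subseteq> Julia_set f \<and>
    (\<forall>z\<in>(\<Union>n. X n). Cauchy_Riemann_at \<theta> z) \<and>
    conformal_on \<theta> (interior (\<Union>n. X n)) \<and>
    (\<forall>c\<in>(\<Union>n. C n). \<theta> c = c) \<and>
    (\<forall>z\<in>\<theta> ` (\<Union>n. X n). \<not> is_pole f z) \<and> bounded (f ` \<theta> ` (\<Union>n. X n)) \<and>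
    \<theta> ` (\<Union>n. X n) \<subseteq> bungee_set f \<and>
    (\<forall>n. wandering_compact_set f (\<theta> ` X n)))"

lemma (in bungee_dense) realised: "realisable X C \<phi> \<epsilon>"
  unfolding realisable_def
proof (intro exI conjI allI ballI)
  show "transcendental_meromorphic f" by (rule transcendental)
  show "smooth_diffeomorphism \<theta>" by (rule theta_diffeo)
  show "0 < (\<lambda>_. 3 :: nat) n" for n :: nat by simp
  show "iterate_finite f 3 (\<theta> z)" "(f ^^ 3) (\<theta> z) = \<theta> (\<phi> z)" if "z \<in> X n" for z n
    using semiconj[OF that] by blast+
  show "cmod (\<theta> z - z) \<le> \<epsilon> n" if "z \<in> X n" for z n using theta_close[OF that] .
  show "frontier (\<theta> ` (\<Union>n. X n)) \<subseteq> Julia_set f" by (rule frontier_theta_Union)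
  show "Cauchy_Riemann_at \<theta> z" if "z \<in> (\<Union>n. X n)" for z using that theta_CR by blast
  show "conformal_on \<theta> (interior (\<Union>n. X n))" by (rule theta_conformal)
  show "\<theta> c = c" if "c \<in> (\<Union>n. C n)" for c using that ql(2) theta_ql by blast
  show "\<not> is_pole f z" if "z \<in> \<theta> ` (\<Union>n. X n)" for z using that conjugacy(1) by blast
  show "bounded (f ` \<theta> ` (\<Union>n. X n))" using theta_X_cball bounded_cball bounded_subset by blast
  show "\<theta> ` (\<Union>n. X n) \<subseteq> bungee_set f" using bungee by blast
  show "wandering_compact_set f (\<theta> ` X n)" for n by (rule wandering)
qed

context bungee_setup begin

lemma stage_0: "stage 0 (\<lambda>z. 0) {p} {} (\<lambda>z. z)"
proof -
  have "p \<in> cball p \<rho>" using rho by simp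
  then have "{p} \<inter> XE m = {}" for m using V_p[of m] X_V[of m] e_p[of m] unfolding XE_def by blast
  moreover have "C_infinity (\<lambda>z. z)" by (simp add: C_infinity_def C_k_id)
  ultimately show ?thesis using rho unfolding stage_def by (auto simp: meromorphic_on_const)
qed

lemma realisable_if_nonempty:
  assumes "(\<Union>n. X n) \<noteq> {}" shows "realisable X C \<phi> \<epsilon>"
proof -
  let ?B = "\<Union>n. frontier (X n)"
  obtain D where D: "countable D" "D \<subseteq> ?B" "?B \<subseteq> closure D" using separable by metis
  obtain m where m: "X m \<noteq> {}" using assms by blast
  have "X m \<noteq> UNIV" using X_compact[of m] not_compact_UNIV by auto
  then have "frontier (X m) \<noteq> {}" using m by (simp add: frontier_eq_empty)
  then have "?B \<noteq> {}" by auto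
  then have "D \<noteq> {}" using D(3) closure_empty by auto
  \<comment> \<open>Through the pairing function every element of \<open>D\<close> is listed
    infinitely often.\<close>
  define xx where "xx N = from_nat_into D (fst (prod_decode N))" for N
  have inf: "infinite {N. xx N = d}" if dD: "d \<in> D" for d
  proof -
    obtain i where i: "from_nat_into D i = d" using from_nat_into_surj[OF D(1) dD] by blast
    have "(\<lambda>j. prod_encode (i, j)) ` UNIV \<subseteq> {N. xx N = d}" using i by (auto simp: xx_def)
    moreover have "infinite (range (\<lambda>j. prod_encode (i, j)))"
      by (intro range_inj_infinite injI) auto
    ultimately show ?thesis using finite_subset by blast
  qed
  have d: "?B \<subseteq> closure {x \<in> ?B. infinite {N. xx N = x}}"
  proof (rule order_trans[OF D(3) closure_mono], rule subsetI)
    fix x assume "x \<in> D"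
    then show "x \<in> {x \<in> ?B. infinite {N. xx N = x}}" using inf subsetD[OF D(2)] by simp
  qed
  \<comment> \<open>The second conjunct pins down the initial state, so that the limits are the sums
    of all increments.\<close>
  define P where "P N s \<longleftrightarrow> (case s of (h, A, S, \<theta>) \<Rightarrow> stage N h A S \<theta> \<and> (N = 0 \<longrightarrow> s = (\<lambda>z. 0, {p}, {}, \<lambda>z. z)))" for N s
  define Q where "Q N s t \<longleftrightarrow> (case s of (h, A, S, \<theta>) \<Rightarrow> case t of (h', A', S', \<theta>') \<Rightarrow>
     (\<exists>g D. h' = (\<lambda>z. h z + g z) \<and> A' = A \<union> D \<and> step_rel N (xx N) h A S \<theta> g D S' \<theta>'))" for N s t
  have "\<exists>s. \<forall>N. P N (s N) \<and> Q N (s N) (s (Suc N))"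
  proof (rule dependent_nat_choice)
    show "\<exists>s. P 0 s" using stage_0 by (auto simp: P_def)
    fix s N assume "P N s"
    obtain h A S \<theta> where s: "s = (h, A, S, \<theta>)" by (cases s)
    have st: "stage N h A S \<theta>" using \<open>P N s\<close> by (simp add: P_def s)
    obtain g D S' \<theta>' where "stage (Suc N) (\<lambda>z. h z + g z) (A \<union> D) S' \<theta>'" "step_rel N (xx N) h A S \<theta> g D S' \<theta>'"
      using stage_step[OF st, of "xx N"] by (elim exE conjE) (rule that; assumption)
    then show "\<exists>t. P (Suc N) t \<and> Q N s t"
      by (intro exI[of _ "(\<lambda>z. h z + g z, A \<union> D, S', \<theta>')"]) (auto simp: P_def Q_def s)
  qed
  then obtain s where s: "\<And>N. P N (s N)" "\<And>N. Q N (s N) (s (Suc N))" by blast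
  define hs where "hs N = fst (s N)" for N
  define As where "As N = fst (snd (s N))" for N
  define Ss where "Ss N = fst (snd (snd (s N)))" for N
  define ths where "ths N = snd (snd (snd (s N)))" for N
  have sN: "s N = (hs N, As N, Ss N, ths N)" for N by (simp add: hs_def As_def Ss_def ths_def)
  have 1: "stage N (hs N) (As N) (Ss N) (ths N)" for N using s(1)[of N] by (simp add: P_def sN)
  have 0: "hs 0 = (\<lambda>z. 0)" "As 0 = {p}" "ths 0 = (\<lambda>z. z)" using s(1)[of 0] by (simp_all add: P_def sN)
  have "\<exists>g D. hs (Suc N) = (\<lambda>z. hs N z + g z) \<and> As (Suc N) = As N \<union> D \<and>
      step_rel N (xx N) (hs N) (As N) (Ss N) (ths N) g D (Ss (Suc N)) (ths (Suc N))" for N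
    using s(2)[of N] by (simp add: Q_def sN)
  then obtain gs Ds where 2: "\<And>N. hs (Suc N) = (\<lambda>z. hs N z + gs N z)" "\<And>N. As (Suc N) = As N \<union> Ds N"
      "\<And>N. step_rel N (xx N) (hs N) (As N) (Ss N) (ths N) (gs N) (Ds N) (Ss (Suc N)) (ths (Suc N))"
    by metis
  interpret bungee_dense X V C \<phi> \<epsilon> p \<rho> e r R ql zl hs gs ths As Ds Ss xx
    by unfold_locales (rule 0 1 2 d assms)+
  show ?thesis by (rule realised)
qed

end

section \<open>Existence\<close>

text \<open>The map \<phi> is exchanged for one without locally constant pieces. As the conclusion
  involves \<phi> only through its values on the \<open>X n\<close>, it carries over to the original
  map.\<close>

lemma realisable_nonempty:
  fixes X C :: "nat \<Rightarrow> complex set"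
  assumes X: "\<And>n. compact (X n)" and disj: "disjoint_family X" and esc: "escaping X"
    and C: "\<And>n. finite (C n)" "\<And>n. C n \<subseteq> X n"
    and U: "open U" "(\<Union>n. X n) \<subseteq> U" "\<phi> holomorphic_on U"
    and nc: "\<And>x. x \<in> (\<Union>n. X n) \<Longrightarrow> x islimpt (\<Union>n. X n) \<Longrightarrow> nonconstant_near \<phi> x"
    and im: "\<And>n. \<phi> ` X n \<subseteq> X (Suc n)" and fr: "\<And>n. \<phi> ` frontier (X n) \<subseteq> frontier (X (Suc n))"
    and eps: "\<And>n. \<epsilon> n > 0" and ne: "(\<Union>n. X n) \<noteq> {}"
  shows "realisable X C \<phi> \<epsilon>"
proof -
  obtain \<psi> U' where psi: "open U'" "(\<Union>n. X n) \<subseteq> U'" "\<psi> holomorphic_on U'" "\<And>z. z \<in> (\<Union>n. X n) \<Longrightarrow> \<psi> z = \<phi> z"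
    "\<And>z. z \<in> U' \<Longrightarrow> \<forall>\<^sub>F y in at z. deriv \<psi> y \<noteq> 0"
    using nowhere_constant_replacement[OF U(3,1,2) nc] by metis
  have eq: "\<psi> z = \<phi> z" if "z \<in> X n" for z n using psi(4) that by blast
  have psi_im: "\<psi> ` X n \<subseteq> X (Suc n)" for n using im[of n] eq by auto
  have "frontier (X n) \<subseteq> X n" for n using X by (simp add: compact_imp_closed frontier_subset_closed)
  then have "\<psi> ` frontier (X n) = \<phi> ` frontier (X n)" for n using eq by (intro image_cong refl) blast
  then have psi_fr: "\<psi> ` frontier (X n) \<subseteq> frontier (X (Suc n))" for n using fr[of n] by simp
  obtain V p \<rho> e r R where g: "\<forall>n. open (V n) \<and> X n \<subseteq> V n \<and> V n \<subseteq> U' \<and> bounded (V n)"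
    "\<forall>m n. m \<noteq> n \<longrightarrow> V m \<inter> V n = {}" "0 < \<rho>" "\<rho> \<le> 1" "\<forall>n. 0 < r n"
    "\<forall>n. V n \<inter> cball p \<rho> = {}" "\<forall>m n. V n \<inter> cball (e m) (r m) = {}" "\<forall>n. cball (e n) (r n) \<inter> cball p \<rho> = {}"
    "\<forall>m n. m \<noteq> n \<longrightarrow> cball (e m) (r m) \<inter> cball (e n) (r n) = {}" "\<forall>n. cmod (e n) \<ge> 2 / \<rho> + 1"
    "\<forall>m n. m \<ge> n \<longrightarrow> V m \<inter> cball 0 (R n) = {} \<and> cball (e m) (r m) \<inter> cball 0 (R n) = {}"
    "filterlim R at_top sequentially"
    using wandering_geometry[OF X disj esc psi(1,2)] by (elim exE conjE) (rule that; assumption)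
  have V: "open (V n)" "X n \<subseteq> V n" "V n \<subseteq> U'" "bounded (V n)" for n using g(1) by simp_all
  have R: "V m \<inter> cball 0 (R n) = {}" "cball (e m) (r m) \<inter> cball 0 (R n) = {}" if "m \<ge> n" for m n using g(11) that by simp_all
  have hol: "\<psi> holomorphic_on V n" for n using psi(3) V(3) by (rule holomorphic_on_subset)
  have iso: "\<forall>\<^sub>F y in at z. deriv \<psi> y \<noteq> 0" if "z \<in> V n" for z n using psi(5) V(3) that by blast
  have iso': "\<forall>\<^sub>F y in at z. deriv \<psi> y \<noteq> 0" if "z \<in> X n" for z n using iso V(2) that by blast
  obtain ql zl where w: "\<And>n. set (ql n) \<subseteq> X n" "\<And>n. C n \<subseteq> set (ql n)" "\<And>n. set (zl n) \<subseteq> X n"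
    "\<And>n. \<exists>N c. open N \<and> X n \<subseteq> N \<and> (\<forall>x\<in>N. wt (ql n) x \<le> c * cmod (deriv \<psi> x))"
    "\<And>n. \<exists>N c. open N \<and> X n \<subseteq> N \<and> (\<forall>x\<in>N. wt (zl n) x \<le> c * (cmod (deriv \<psi> x) * wt (ql n) x))"
    "\<And>n. \<exists>l. ql (Suc n) = map \<psi> (zl n) @ l"
    by (rule weight_sequences[of \<psi> V X C]) (rule hol V X iso' C psi_im that; assumption?)+
  interpret bungee_setup X V C \<psi> \<epsilon> p \<rho> e r R ql zl
    by unfold_locales (rule X V g(2-10)[rule_format] R g(12) hol iso psi_im psi_fr eps w; assumption?)+
  have "realisable X C \<psi> \<epsilon>" by (rule realisable_if_nonempty[OF ne])
  moreover have "(\<forall>n. \<forall>z\<in>X n. iterate_finite f (k n) (\<theta> z) \<and> (f ^^ k n) (\<theta> z) = \<theta> (\<psi> z)) \<longleftrightarrow>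
      (\<forall>n. \<forall>z\<in>X n. iterate_finite f (k n) (\<theta> z) \<and> (f ^^ k n) (\<theta> z) = \<theta> (\<phi> z))" for f \<theta> :: "complex \<Rightarrow> complex" and k
    using eq by metis
  ultimately show ?thesis unfolding realisable_def by simp
qed

text \<open>If all \<open>X n\<close> are empty, the statement still asks for a transcendental
  function, but there are no boundary points to produce poles. The nonempty case, applied to the
  points 0, 1, 2, ... and the translation by 1, supplies one.\<close>

lemma transcendental_meromorphic_exists: "\<exists>f. transcendental_meromorphic f"
proof -
  define X :: "nat \<Rightarrow> complex set" where "X n = {of_nat n}" for n
  have fr: "frontier (X n) = X n" and im: "(\<lambda>z. z + 1) ` X n = X (Suc n)" for n
    by (simp_all add: X_def frontier_def add.commute)
  have "realisable X (\<lambda>_. {}) (\<lambda>z. z + 1) (\<lambda>_. 1)"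
  proof (rule realisable_nonempty[of X "\<lambda>_. {}" UNIV])
    show "compact (X n)" for n by (simp add: X_def)
    show "disjoint_family X" by (simp add: X_def disjoint_family_on_def)
    show "escaping X" unfolding escaping_def
    proof
      fix B
      obtain N :: nat where N: "B + 1 \<le> real N" using real_arch_simple by blast
      show "\<exists>N. \<forall>n\<ge>N. X n \<inter> cball 0 B = {}"
      proof (intro exI allI impI)
        fix n assume "N \<le> n"
        then have "\<not> cmod (of_nat n) \<le> B" using N by simp
        then show "X n \<inter> cball 0 B = {}" unfolding X_def by simp
      qed
    qed
    show "(\<lambda>z. z + 1) holomorphic_on UNIV" by (intro holomorphic_intros)
    show "(\<lambda>z. z + 1) ` X n \<subseteq> X (Suc n)" "(\<lambda>z. z + 1) ` frontier (X n) \<subseteq> frontier (X (Suc n))" for n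
      unfolding fr im by simp_all
    show "(\<Union>n. X n) \<noteq> {}" by (simp add: X_def)
    show "nonconstant_near (\<lambda>z. z + 1) x" for x :: complex
    proof -
      have "\<exists>\<^sub>F z in at x. z \<noteq> x" by (rule eventually_frequently) (simp_all add: eventually_at_filter)
      then have "\<not> (\<forall>\<^sub>F z in nhds x. z = x)" by (simp add: frequently_def eventually_nhds_conv_at)
      then show ?thesis by (simp add: nonconstant_near_def)
    qed
  qed simp_all
  then show ?thesis unfolding realisable_def by (elim exE conjE) (rule exI)
qed

lemma realisable_empty:
  assumes "(\<Union>n. X n) = {}" and "\<And>n. C n \<subseteq> X n" shows "realisable X C \<phi> \<epsilon>"
proof -
  obtain f where f: "transcendental_meromorphic f" using transcendental_meromorphic_exists by blast
  have X: "X n = {}" "C n = {}" for n using assms by blast+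
  have "inv (\<lambda>z. z) = (\<lambda>z::complex. z)" by (rule inv_equality) auto
  then have "smooth_diffeomorphism (\<lambda>z. z)"
    unfolding smooth_diffeomorphism_def C_infinity_def by (simp add: C_k_id bij_iff)
  then show ?thesis unfolding realisable_def
    by (intro exI[of _ f] exI[of _ "\<lambda>z. z"] exI[of _ "\<lambda>_. 1"])
      (simp add: f X conformal_on_def wandering_compact_set_def)
qed

lemma escaping_if_INF_tendsto:
  assumes "(\<lambda>n. INF z\<in>X n. ereal (cmod z)) \<longlonglongrightarrow> \<infinity>" shows "escaping X"
  unfolding escaping_def
proof
  fix B
  obtain N where N: "\<And>n. n \<ge> N \<Longrightarrow> ereal B < (INF z\<in>X n. ereal (cmod z))"
    using assms unfolding tendsto_PInfty eventually_sequentially by blast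
  have "X n \<inter> cball 0 B = {}" if "n \<ge> N" for n
  proof (rule ccontr)
    assume "\<not> ?thesis"
    then obtain z where z: "z \<in> X n" "cmod z \<le> B" by auto
    have "ereal B < ereal (cmod z)" using N[OF that] INF_lower[OF z(1), of "\<lambda>z. ereal (cmod z)"] by (rule less_le_trans)
    then show False using z(2) by simp
  qed
  then show "\<exists>N. \<forall>n\<ge>N. X n \<inter> cball 0 B = {}" by blast
qed

theorem theorem1p2:
  fixes X C :: "nat \<Rightarrow> complex set"
    and \<phi> :: "complex \<Rightarrow> complex"
    and U :: "complex set"
    and \<epsilon> :: "nat \<Rightarrow> real"
  assumes "\<And>n. compact (X n)"
    and "\<And>m n. m \<noteq> n \<Longrightarrow> X m \<inter> X n = {}"
    and "(\<lambda>n. INF z\<in>X n. ereal (cmod z)) \<longlonglongrightarrow> \<infinity>"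
    and "\<And>n. finite (C n)"
    and "\<And>n. C n \<subseteq> X n"
    and "open U"
    and "(\<Union>n. X n) \<subseteq> U"
    and "\<phi> holomorphic_on U"
    and "\<And>x. x \<in> (\<Union>n. X n) \<Longrightarrow> x islimpt (\<Union>n. X n) \<Longrightarrow> nonconstant_near \<phi> x"
    and "\<And>n. n \<ge> 1 \<Longrightarrow> \<phi> ` X (n - 1) \<subseteq> X n"
    and "\<And>n. n \<ge> 1 \<Longrightarrow> \<phi> ` frontier (X (n - 1)) \<subseteq> frontier (X n)"
    and "\<And>n. \<epsilon> n > 0"
  shows "\<exists>(f :: complex \<Rightarrow> complex) (\<theta> :: complex \<Rightarrow> complex) (k :: nat \<Rightarrow> nat).
    transcendental_meromorphic f \<and>
    smooth_diffeomorphism \<theta> \<and>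
    (\<forall>n. k n > 0) \<and>
    (\<forall>n. \<forall>z\<in>X n. iterate_finite f (k n) (\<theta> z) \<and> (f ^^ k n) (\<theta> z) = \<theta> (\<phi> z)) \<and>
    (\<forall>n. \<forall>z\<in>X n. cmod (\<theta> z - z) \<le> \<epsilon> n) \<and>
    frontier (\<theta> ` (\<Union>n. X n)) \<subseteq> Julia_set f \<and>
    (\<forall>z\<in>(\<Union>n. X n). Cauchy_Riemann_at \<theta> z) \<and>
    conformal_on \<theta> (interior (\<Union>n. X n)) \<and>
    (\<forall>c\<in>(\<Union>n. C n). \<theta> c = c) \<and>
    (\<forall>z\<in>\<theta> ` (\<Union>n. X n). \<not> is_pole f z) \<and> bounded (f ` \<theta> ` (\<Union>n. X n)) \<and>
    \<theta> ` (\<Union>n. X n) \<subseteq> bungee_set f \<and>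
    (\<forall>n. wandering_compact_set f (\<theta> ` X n))"
proof -
  have "realisable X C \<phi> \<epsilon>"
  proof (cases "(\<Union>n. X n) = {}")
    case True
    then show ?thesis using assms(5) by (rule realisable_empty)
  next
    case False
    have "disjoint_family X" using assms(2) by (simp add: disjoint_family_on_def)
    moreover have "\<phi> ` X n \<subseteq> X (Suc n)" "\<phi> ` frontier (X n) \<subseteq> frontier (X (Suc n))" for n
      using assms(10)[of "Suc n"] assms(11)[of "Suc n"] by simp_all
    ultimately show ?thesis
      using assms(1) escaping_if_INF_tendsto[OF assms(3)] assms(4-9,12) False by (intro realisable_nonempty)
  qed
  then show ?thesis unfolding realisable_def .
qed

end
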